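(* There is a function $h: \mathbb{R}_{\geq 1} \times \mathbb{Z}_{\geq 0} \to \mathbb{R}_{\geq 1}$ such that for every $C \in \mathbb{R}_{\geq 1}$ and $m \in \mathbb{Z}_{\geq 0}$ the following holds: for any prime power $q$, any $\epsilon = \pm$, any $G = \mathrm{GL}^\epsilon_n(q)$ or $G=\mathrm{SL}^\epsilon_n(q)$ with $n \geq h(C,m)$, any $\chi \in \mathrm{Irr}(G)$, and any $g \in G$ with $|\mathbf{C}_{\mathrm{GL}^\epsilon_n(q)}(g)| \leq q^{Cn}$, one has $|\chi(g)| \leq \chi(1)^{1/2^m}$.
   Context: $\mathrm{GL}^+_n(q)=\mathrm{GL}_n(q)$, $\mathrm{GL}^-_n(q)=\mathrm{GU}_n(q)$, and $\mathrm{SL}^\epsilon_n(q)$ is the determinant-one subgroup; $\mathbf{C}_H(g)$ denotes the centralizer of $g$ in $H$. *)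

theory Defs
  imports "HOL-Algebra.Ring" "HOL-Combinatorics.Permutations" "Jordan_Normal_Form.Matrix"
begin

definition fmats :: "nat ring \<Rightarrow> nat \<Rightarrow> (nat \<Rightarrow> nat \<Rightarrow> nat) set" where
  "fmats R n = {A. (\<forall>i j. A i j \<in> carrier R) \<and> (\<forall>i j. \<not>(i < n \<and> j < n) \<longrightarrow> A i j = \<zero>\<^bsub>R\<^esub>)}"

definition fmat_mul :: "nat ring \<Rightarrow> nat \<Rightarrow> (nat \<Rightarrow> nat \<Rightarrow> nat) \<Rightarrow> (nat \<Rightarrow> nat \<Rightarrow> nat) \<Rightarrow> (nat \<Rightarrow> nat \<Rightarrow> nat)" where
  "fmat_mul R n A B = (\<lambda>i j. if i < n \<and> j < n then (\<Oplus>\<^bsub>R\<^esub>k\<in>{..<n}. A i k \<otimes>\<^bsub>R\<^esub> B k j) else \<zero>\<^bsub>R\<^esub>)"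

definition fmat_one :: "nat ring \<Rightarrow> nat \<Rightarrow> (nat \<Rightarrow> nat \<Rightarrow> nat)" where
  "fmat_one R n = (\<lambda>i j. if i < n \<and> j < n then (if i = j then \<one>\<^bsub>R\<^esub> else \<zero>\<^bsub>R\<^esub>) else \<zero>\<^bsub>R\<^esub>)"

definition fmat_det :: "nat ring \<Rightarrow> nat \<Rightarrow> (nat \<Rightarrow> nat \<Rightarrow> nat) \<Rightarrow> nat" where
  "fmat_det R n A = (\<Oplus>\<^bsub>R\<^esub>\<sigma>\<in>{\<sigma>. \<sigma> permutes {..<n}}.
      (if evenperm \<sigma> then (\<Otimes>\<^bsub>R\<^esub>i\<in>{..<n}. A i (\<sigma> i))
       else \<ominus>\<^bsub>R\<^esub> (\<Otimes>\<^bsub>R\<^esub>i\<in>{..<n}. A i (\<sigma> i))))"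

definition GL_set :: "nat ring \<Rightarrow> nat \<Rightarrow> (nat \<Rightarrow> nat \<Rightarrow> nat) set" where
  "GL_set R n = {A \<in> fmats R n. \<exists>B \<in> fmats R n.
      fmat_mul R n A B = fmat_one R n \<and> fmat_mul R n B A = fmat_one R n}"

text \<open>Conjugate transpose w.r.t. the field automorphism x \<mapsto> x^q (R of order q^2).\<close>
definition conj_tr :: "nat ring \<Rightarrow> nat \<Rightarrow> nat \<Rightarrow> (nat \<Rightarrow> nat \<Rightarrow> nat) \<Rightarrow> (nat \<Rightarrow> nat \<Rightarrow> nat)" where
  "conj_tr R n q A = (\<lambda>i j. if i < n \<and> j < n then A j i [^]\<^bsub>R\<^esub> q else \<zero>\<^bsub>R\<^esub>)"

definition GU_set :: "nat ring \<Rightarrow> nat \<Rightarrow> nat \<Rightarrow> (nat \<Rightarrow> nat \<Rightarrow> nat) set" where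
  "GU_set R n q = {A \<in> GL_set R n. fmat_mul R n (conj_tr R n q A) A = fmat_one R n}"

text \<open>eps = True means GL_n(q) (R of order q), eps = False means GU_n(q) (R of order q^2).\<close>
definition GLeps :: "nat ring \<Rightarrow> nat \<Rightarrow> nat \<Rightarrow> bool \<Rightarrow> (nat \<Rightarrow> nat \<Rightarrow> nat) set" where
  "GLeps R n q eps = (if eps then GL_set R n else GU_set R n q)"

definition SLeps :: "nat ring \<Rightarrow> nat \<Rightarrow> nat \<Rightarrow> bool \<Rightarrow> (nat \<Rightarrow> nat \<Rightarrow> nat) set" where
  "SLeps R n q eps = {A \<in> GLeps R n q eps. fmat_det R n A = \<one>\<^bsub>R\<^esub>}"

definition mat_group :: "nat ring \<Rightarrow> nat \<Rightarrow> (nat \<Rightarrow> nat \<Rightarrow> nat) set \<Rightarrow> (nat \<Rightarrow> nat \<Rightarrow> nat) monoid" where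
  "mat_group R n H = \<lparr>carrier = H, mult = fmat_mul R n, one = fmat_one R n\<rparr>"

definition mtrace :: "complex mat \<Rightarrow> complex" where
  "mtrace A = (\<Sum>i<dim_row A. A $$ (i, i))"

definition is_rep :: "'g monoid \<Rightarrow> nat \<Rightarrow> ('g \<Rightarrow> complex mat) \<Rightarrow> bool" where
  "is_rep G d \<rho> \<longleftrightarrow> (\<forall>g\<in>carrier G. \<rho> g \<in> carrier_mat d d) \<and> \<rho> \<one>\<^bsub>G\<^esub> = 1\<^sub>m d \<and>
     (\<forall>g\<in>carrier G. \<forall>h\<in>carrier G. \<rho> (g \<otimes>\<^bsub>G\<^esub> h) = \<rho> g * \<rho> h)"

definition rep_irreducible :: "'g monoid \<Rightarrow> nat \<Rightarrow> ('g \<Rightarrow> complex mat) \<Rightarrow> bool" where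
  "rep_irreducible G d \<rho> \<longleftrightarrow> d > 0 \<and>
    (\<forall>V. V \<subseteq> carrier_vec d \<and> 0\<^sub>v d \<in> V \<and> (\<forall>u\<in>V. \<forall>w\<in>V. u + w \<in> V) \<and>
         (\<forall>c. \<forall>u\<in>V. c \<cdot>\<^sub>v u \<in> V) \<and> (\<forall>g\<in>carrier G. \<forall>u\<in>V. \<rho> g *\<^sub>v u \<in> V)
       \<longrightarrow> V = {0\<^sub>v d} \<or> V = carrier_vec d)"

definition irr_char :: "'g monoid \<Rightarrow> ('g \<Rightarrow> complex) \<Rightarrow> bool" where
  "irr_char G \<chi> \<longleftrightarrow> (\<exists>d \<rho>. is_rep G d \<rho> \<and> rep_irreducible G d \<rho> \<and>
      (\<forall>g\<in>carrier G. \<chi> g = mtrace (\<rho> g)))"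

end

(*
  GL_n(q) and GU_n(q) are the isometry groups U of the form sum_i s(x_i) y_i over F_q x F_q and over
  F_{q^2}. Let Phi(g) be the number of vectors fixed by g, and let N_j be the group generated by the
  transvections fixing the first j basis vectors.

  If chi(1) is at least q^{c n}, then |chi(g)|^2 <= |C(g)| is enough. Otherwise fix an isotropic u and
  restrict a representation to the transvections with axis u and to the Heisenberg group of root
  elements over them. A character of the Heisenberg group that is nontrivial only modulo its centre
  costs a factor of about q^n in the degree, so after boundedly many descents from N_j to N_{j+4} the
  representation is trivial on all root elements or has a nontrivial central character. In the second
  case its trace is that of a Weil representation: up to a factor it has absolute value sqrt(Phi).
  Either way some positive definite f on some N_j satisfies |f| <= Phi, and its average against the
  conjugate of chi is bounded below by 1/q.

  Let F be induced from f. A multiple of chi splits off F as a positive definite summand, so the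
  moments of |chi| are bounded by those of |F|, which is at most a constant times a power of Phi. By
  Burnside's lemma the moments of Phi count orbits on tuples of vectors, which Witt's theorem bounds
  independently of n. A high moment of chi dominates |chi(g)|^{2k} / |C(g)|, and a nonlinear chi has
  degree at least q^{n-4}; this gives the bound once k is large in terms of C and m.
*)
theory Submission
  imports Defs "HOL-Library.Function_Algebras" "HOL-Library.FuncSet" "HOL-Algebra.Multiplicative_Group" "HOL-Algebra.Sylow" "HOL-Number_Theory.Cong" "Jordan_Normal_Form.Spectral_Radius" "Jordan_Normal_Form.Determinant"
begin

text \<open>No Weil representation is constructed and nothing is decomposed into irreducibles. A
  subrepresentation is a commuting projection, a multiplicity is a ratio of traces, and Frobenius
  reciprocity is a statement about sums of positive definite functions. Only the absolute value of
  the Weil trace is determined, which avoids a distinction between odd and even characteristic. The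
  constant 1/q comes from the multiplicity of the Heisenberg representation: its dimension is
  \<open>q ^ (n - j - 2)\<close>, but counting hyperbolic planes certifies only a degree of
  \<open>q ^ (n - j - 3)\<close> when the rank is odd.

  The obstacle to a uniform treatment of both families is that F_q x F_q has zero divisors: nonzero
  vectors need not be unimodular, so transitivity is argued through idempotents and principal
  ideals. A descent costs four coordinates, two for the plane of u and two to hold the vector that
  labels a character of the Heisenberg group. Comparing N_j with the full isometry group by fixing
  all but five basis vectors costs a factor q^50.\<close>

lemma cmod_sq: "(complex_of_real (cmod z))\<^sup>2 = z * cnj z"
  by (metis complex_norm_square of_real_power)

lemma Cauchy_Schwarz_sum:
  fixes a b :: "'a \<Rightarrow> real"
  shows "(\<Sum>i\<in>I. a i * b i)\<^sup>2 \<le> (\<Sum>i\<in>I. (a i)\<^sup>2) * (\<Sum>i\<in>I. (b i)\<^sup>2)"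
proof -
  have "0 \<le> (\<Sum>i\<in>I. \<Sum>j\<in>I. (a i * b j - a j * b i)\<^sup>2)" by (intro sum_nonneg) simp
  also have "\<dots> = (\<Sum>i\<in>I. \<Sum>j\<in>I. (a i)\<^sup>2 * (b j)\<^sup>2) + (\<Sum>i\<in>I. \<Sum>j\<in>I. (b i)\<^sup>2 * (a j)\<^sup>2)
      - 2 * (\<Sum>i\<in>I. \<Sum>j\<in>I. (a i * b i) * (a j * b j))"
    by (simp add: power2_diff power_mult_distrib sum.distrib sum_subtractf sum_distrib_left mult_ac)
  also have "\<dots> = 2 * ((\<Sum>i\<in>I. (a i)\<^sup>2) * (\<Sum>i\<in>I. (b i)\<^sup>2)) - 2 * (\<Sum>i\<in>I. a i * b i)\<^sup>2"
    by (simp add: sum_product power2_eq_square[of "\<Sum>i\<in>I. a i * b i"] mult.commute[of "\<Sum>i\<in>I. (b i)\<^sup>2"]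
        flip: sum_product)
  finally show ?thesis by simp
qed

section \<open>Finitely supported complex matrices\<close>

text \<open>Matrices indexed by an arbitrary type, so that block matrices and representations of
  different degrees need no dimension bookkeeping. In general this ring has no unit; the role of the
  identity is taken by a projection such as \<open>\<pi> 0\<close>.\<close>

typedef 'i cmx = "{f :: 'i \<Rightarrow> 'i \<Rightarrow> complex. finite {p. f (fst p) (snd p) \<noteq> 0}}"
  morphisms ent Abs_cmx
  by (rule exI[of _ "\<lambda>_ _. 0"]) simp

definition supp :: "'i cmx \<Rightarrow> 'i set" where
  "supp A = {i. \<exists>j. ent A i j \<noteq> 0 \<or> ent A j i \<noteq> 0}"

lemma finite_supp [simp]: "finite (supp A)"
proof -
  let ?S = "{p. ent A (fst p) (snd p) \<noteq> 0}"
  have "finite ?S" using ent[of A] by simp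
  moreover have "supp A \<subseteq> fst ` ?S \<union> snd ` ?S"
  proof
    fix i assume "i \<in> supp A"
    then obtain j where "ent A i j \<noteq> 0 \<or> ent A j i \<noteq> 0" by (auto simp: supp_def)
    then show "i \<in> fst ` ?S \<union> snd ` ?S"
    proof
      assume "ent A i j \<noteq> 0" then have "(i, j) \<in> ?S" by simp
      then show ?thesis by (auto intro!: image_eqI[of _ _ "(i, j)"])
    next
      assume "ent A j i \<noteq> 0" then have "(j, i) \<in> ?S" by simp
      then show ?thesis by (auto intro!: image_eqI[of _ snd "(j, i)"])
    qed
  qed
  ultimately show ?thesis by (simp add: finite_subset)
qed

lemma ent_outside: "i \<notin> supp A \<Longrightarrow> ent A i j = 0" "j \<notin> supp A \<Longrightarrow> ent A i j = 0"
  by (auto simp: supp_def)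

lemma ent_nonzero: "ent A i j \<noteq> 0 \<Longrightarrow> i \<in> supp A" "ent A i j \<noteq> 0 \<Longrightarrow> j \<in> supp A"
  by (auto simp: supp_def)

lemma cmx_eqI: "(\<And>i j. ent A i j = ent B i j) \<Longrightarrow> A = B"
  by (metis ent_inject ext)

lemma ent_Abs:
  assumes "finite S" "\<And>i j. f i j \<noteq> 0 \<Longrightarrow> i \<in> S \<and> j \<in> S"
  shows "ent (Abs_cmx f) = f"
proof (rule Abs_cmx_inverse, simp, rule finite_subset)
  show "{p. f (fst p) (snd p) \<noteq> 0} \<subseteq> S \<times> S" using assms(2) by auto
qed (use assms(1) in simp)

lemma ent_Abs_supp:
  assumes "\<And>i j. f i j \<noteq> 0 \<Longrightarrow> i \<in> supp A \<union> supp B \<and> j \<in> supp A \<union> supp B"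
  shows "ent (Abs_cmx f) = f"
  by (rule ent_Abs[of "supp A \<union> supp B"]) (use assms in auto)

instantiation cmx :: (type) ring
begin

definition "0 = Abs_cmx (\<lambda>_ _. 0)"
definition "A + B = Abs_cmx (\<lambda>i j. ent A i j + ent B i j)"
definition "- A = Abs_cmx (\<lambda>i j. - ent A i j)"
definition "A - B = Abs_cmx (\<lambda>i j. ent A i j - ent B i j)"
definition "A * B = Abs_cmx (\<lambda>i j. \<Sum>k\<in>supp A. ent A i k * ent B k j)"

lemma ent_zero [simp]: "ent 0 i j = 0"
  unfolding zero_cmx_def by (subst ent_Abs[of "{}"]) auto

lemma ent_add [simp]: "ent (A + B) i j = ent A i j + ent B i j"
  unfolding plus_cmx_def by (subst ent_Abs_supp[of _ A B]) (auto simp: supp_def)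

lemma ent_uminus [simp]: "ent (- A) i j = - ent A i j"
  unfolding uminus_cmx_def by (subst ent_Abs_supp[of _ A A]) (auto simp: supp_def)

lemma ent_minus [simp]: "ent (A - B) i j = ent A i j - ent B i j"
  unfolding minus_cmx_def by (subst ent_Abs_supp[of _ A B]) (auto simp: supp_def)

lemma ent_mult0: "ent (A * B) i j = (\<Sum>k\<in>supp A. ent A i k * ent B k j)"
proof -
  have "i \<in> supp A \<union> supp B \<and> j \<in> supp A \<union> supp B"
    if "(\<Sum>k\<in>supp A. ent A i k * ent B k j) \<noteq> 0" for i j
  proof -
    obtain k where "ent A i k * ent B k j \<noteq> 0" using \<open>_ \<noteq> 0\<close> by (meson sum.neutral)
    then show ?thesis by (auto simp: supp_def)
  qed
  then show ?thesis
    unfolding times_cmx_def by (subst ent_Abs_supp[of _ A B]) auto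
qed

lemma ent_mult:
  assumes "finite S" "supp A \<subseteq> S \<or> supp B \<subseteq> S"
  shows "ent (A * B) i j = (\<Sum>k\<in>S. ent A i k * ent B k j)"
proof -
  have "(\<Sum>k\<in>supp A. ent A i k * ent B k j) = (\<Sum>k\<in>S \<union> supp A. ent A i k * ent B k j)"
    by (rule sum.mono_neutral_left) (use assms in \<open>auto simp: ent_outside\<close>)
  also have "\<dots> = (\<Sum>k\<in>S. ent A i k * ent B k j)"
    by (rule sum.mono_neutral_right) (use assms in \<open>auto dest: ent_nonzero\<close>)
  finally show ?thesis by (simp add: ent_mult0)
qed

instance
proof
  fix A B C :: "'a cmx"
  let ?S = "supp A \<union> supp B \<union> supp C"
  have fin: "finite ?S" by simp
  note m = ent_mult[OF fin]
  have mAB: "ent (A * B) i j = (\<Sum>k\<in>?S. ent A i k * ent B k j)" for i j by (rule m) blast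
  have mAX: "ent (A * X) i j = (\<Sum>k\<in>?S. ent A i k * ent X k j)" for X i j by (rule m) blast
  have mBC: "ent (B * C) i j = (\<Sum>k\<in>?S. ent B i k * ent C k j)" for i j by (rule m) blast
  have mXC: "ent (X * C) i j = (\<Sum>k\<in>?S. ent X i k * ent C k j)" for X i j by (rule m) blast
  show "A * B * C = A * (B * C)"
  proof (rule cmx_eqI)
    fix i j
    have "ent (A * B * C) i j = (\<Sum>l\<in>?S. (\<Sum>k\<in>?S. ent A i k * ent B k l) * ent C l j)"
      unfolding mXC mAB ..
    also have "\<dots> = (\<Sum>l\<in>?S. \<Sum>k\<in>?S. ent A i k * (ent B k l * ent C l j))"
      by (simp only: sum_distrib_right mult.assoc)
    also have "\<dots> = (\<Sum>k\<in>?S. \<Sum>l\<in>?S. ent A i k * (ent B k l * ent C l j))"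
      by (rule sum.swap)
    also have "\<dots> = ent (A * (B * C)) i j"
      unfolding mAX mBC by (simp only: sum_distrib_left)
    finally show "ent (A * B * C) i j = ent (A * (B * C)) i j" .
  qed
  show "(A + B) * C = A * C + B * C"
    by (rule cmx_eqI) (simp only: mXC ent_add distrib_right sum.distrib)
  show "A * (B + C) = A * B + A * C"
    by (rule cmx_eqI) (simp only: mAX ent_add distrib_left sum.distrib)
qed (auto intro!: cmx_eqI)

end

definition sc :: "complex \<Rightarrow> 'i cmx \<Rightarrow> 'i cmx" where
  "sc c A = Abs_cmx (\<lambda>i j. c * ent A i j)"

lemma ent_sc [simp]: "ent (sc c A) i j = c * ent A i j"
  unfolding sc_def by (subst ent_Abs_supp[of _ A A]) (auto simp: supp_def)

definition adj :: "'i cmx \<Rightarrow> 'i cmx" where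
  "adj A = Abs_cmx (\<lambda>i j. cnj (ent A j i))"

lemma ent_adj [simp]: "ent (adj A) i j = cnj (ent A j i)"
  unfolding adj_def by (subst ent_Abs_supp[of _ A A]) (auto simp: supp_def)

definition tr :: "'i cmx \<Rightarrow> complex" where
  "tr A = (\<Sum>i\<in>supp A. ent A i i)"

lemma tr_eq: "finite S \<Longrightarrow> supp A \<subseteq> S \<Longrightarrow> tr A = (\<Sum>i\<in>S. ent A i i)"
  unfolding tr_def by (rule sum.mono_neutral_left) (auto simp: ent_outside)

lemma supp_subsets:
  "supp (A + B) \<subseteq> supp A \<union> supp B" "supp (A - B) \<subseteq> supp A \<union> supp B"
  "supp (sc c A) \<subseteq> supp A" "supp (adj A) \<subseteq> supp A"
  by (auto simp: supp_def)

lemma supp_mult: "supp (A * B) \<subseteq> supp A \<union> supp B"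
proof
  fix i assume "i \<in> supp (A * B)"
  then obtain j where "ent (A * B) i j \<noteq> 0 \<or> ent (A * B) j i \<noteq> 0" by (auto simp: supp_def)
  then obtain k where "ent A i k * ent B k j \<noteq> 0 \<or> ent A j k * ent B k i \<noteq> 0"
    unfolding ent_mult0 by (meson sum.neutral)
  then show "i \<in> supp A \<union> supp B" by (auto simp: supp_def)
qed

lemma ent_sum [simp]: "ent (\<Sum>x\<in>X. f x) i j = (\<Sum>x\<in>X. ent (f x) i j)"
  by (induction X rule: infinite_finite_induct) auto

lemma sc_simps [simp]:
  "sc c A * B = sc c (A * B)" "A * sc c B = sc c (A * B)" "sc c (sc d A) = sc (c * d) A"
  "sc 1 A = A" "sc 0 A = 0" "sc c 0 = 0" "adj (sc c A) = sc (cnj c) (adj A)"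
  by (rule cmx_eqI; simp add: ent_mult[of "supp A"] ent_mult[of "supp A" _ A]
      ent_mult[OF _ disjI1[OF supp_subsets(3)]] sum_distrib_left mult.assoc mult.left_commute)+

lemma sc_add: "sc c (A + B) = sc c A + sc c B" "sc (c + d) A = sc c A + sc d A"
  "sc c (A - B) = sc c A - sc c B"
  by (rule cmx_eqI; simp add: algebra_simps)+

lemma sc_sum: "sc c (\<Sum>x\<in>X. f x) = (\<Sum>x\<in>X. sc c (f x))"
  by (rule cmx_eqI) (simp add: sum_distrib_left)

lemma sum_sc: "(\<Sum>x\<in>X. sc (c x) A) = sc (\<Sum>x\<in>X. c x) A"
  by (rule cmx_eqI) (simp add: sum_distrib_right)

lemma sc_eq_0: "sc c A = 0 \<longleftrightarrow> c = 0 \<or> A = 0"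
proof
  assume *: "sc c A = 0"
  have "ent A i j = 0" if "c \<noteq> 0" for i j
    using arg_cong[OF *, of "\<lambda>X. ent X i j"] that by simp
  then show "c = 0 \<or> A = 0" by (metis cmx_eqI ent_zero)
qed auto

lemma adj_simps [simp]:
  "adj (adj A) = A" "adj (A + B) = adj A + adj B" "adj (A - B) = adj A - adj B" "adj 0 = 0"
  by (rule cmx_eqI; simp)+

lemma adj_mult [simp]: "adj (A * B) = adj B * adj A"
  by (rule cmx_eqI) (simp add: ent_mult[of "supp A"] ent_mult[OF _ disjI2[OF supp_subsets(4)]] mult.commute)

lemma adj_sum: "adj (\<Sum>x\<in>X. f x) = (\<Sum>x\<in>X. adj (f x))"
  by (induction X rule: infinite_finite_induct) auto

lemma tr_simps [simp]:
  "tr (A + B) = tr A + tr B" "tr (A - B) = tr A - tr B" "tr (sc c A) = c * tr A"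
  "tr (adj A) = cnj (tr A)"
proof -
  show "tr (A + B) = tr A + tr B"
    by (simp add: tr_eq[of "supp A \<union> supp B"] supp_subsets sum.distrib)
  show "tr (A - B) = tr A - tr B"
    by (simp add: tr_eq[of "supp A \<union> supp B"] supp_subsets sum_subtractf)
  show "tr (sc c A) = c * tr A" "tr (adj A) = cnj (tr A)"
    by (simp_all add: tr_eq[of "supp A"] supp_subsets sum_distrib_left)
qed

lemma tr_0 [simp]: "tr 0 = 0" by (simp add: tr_def)

lemma tr_sum [simp]: "tr (\<Sum>x\<in>X. f x) = (\<Sum>x\<in>X. tr (f x))"
  by (induction X rule: infinite_finite_induct) auto

lemma tr_mult: "finite S \<Longrightarrow> supp A \<subseteq> S \<Longrightarrow> supp B \<subseteq> S \<Longrightarrow>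
    tr (A * B) = (\<Sum>i\<in>S. \<Sum>k\<in>S. ent A i k * ent B k i)"
  by (subst tr_eq[of S]) (use supp_mult[of A B] in \<open>auto simp: ent_mult[of S]\<close>)

lemma tr_commute: "tr (A * B) = tr (B * A)"
proof -
  let ?S = "supp A \<union> supp B"
  have "tr (A * B) = (\<Sum>i\<in>?S. \<Sum>k\<in>?S. ent A i k * ent B k i)" by (rule tr_mult) auto
  also have "\<dots> = (\<Sum>k\<in>?S. \<Sum>i\<in>?S. ent B k i * ent A i k)"
    by (subst sum.swap) (simp add: mult.commute)
  also have "\<dots> = tr (B * A)" by (rule tr_mult[symmetric]) auto
  finally show ?thesis .
qed

text \<open>The squared Hilbert-Schmidt norm. On a projection it equals the trace, hence the rank,
  and in this form dimensions are compared as real numbers.\<close>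

definition nsq :: "'i cmx \<Rightarrow> real" where
  "nsq A = (\<Sum>i\<in>supp A. \<Sum>j\<in>supp A. (cmod (ent A i j))\<^sup>2)"

lemma tr_adj_mult: "tr (adj A * A) = of_real (nsq A)"
proof -
  have "tr (adj A * A) = (\<Sum>i\<in>supp A. \<Sum>k\<in>supp A. cnj (ent A k i) * ent A k i)"
    by (subst tr_mult[of "supp A"]) (auto simp: supp_subsets)
  also have "\<dots> = (\<Sum>k\<in>supp A. \<Sum>i\<in>supp A. cnj (ent A k i) * ent A k i)" by (rule sum.swap)
  also have "\<dots> = of_real (nsq A)"
    unfolding nsq_def of_real_sum
    by (intro sum.cong refl) (simp add: cmod_sq mult.commute)
  finally show ?thesis .
qed

lemma nsq_nonneg: "nsq A \<ge> 0" by (auto simp: nsq_def intro!: sum_nonneg)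

lemma nsq_eq_0: "nsq A = 0 \<Longrightarrow> A = 0"
proof (rule cmx_eqI)
  fix i j assume *: "nsq A = 0"
  have "(\<Sum>j\<in>supp A. (cmod (ent A i j))\<^sup>2) = 0" if "i \<in> supp A" for i
    using * that unfolding nsq_def by (subst (asm) sum_nonneg_eq_0_iff) (auto intro!: sum_nonneg)
  then have "i \<in> supp A \<Longrightarrow> j \<in> supp A \<Longrightarrow> ent A i j = 0"
    by (subst (asm) sum_nonneg_eq_0_iff) auto
  then show "ent A i j = ent 0 i j" using ent_outside by fastforce
qed

definition proj :: "'i cmx \<Rightarrow> bool" where
  "proj P \<longleftrightarrow> adj P = P \<and> P * P = P"

lemma proj_0 [simp]: "proj 0" by (simp add: proj_def)

lemma proj_tr: "proj P \<Longrightarrow> tr P = of_real (nsq P)"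
  using tr_adj_mult[of P] by (simp add: proj_def)

text \<open>A nonzero column \<open>v\<close> of \<open>P\<close> is fixed by \<open>P\<close>, and \<open>|P v|\<^sup>2 \<le> nsq P * |v|\<^sup>2\<close> by Cauchy--Schwarz.\<close>
lemma proj_nsq_ge_1:
  assumes "proj P" "P \<noteq> 0" shows "nsq P \<ge> 1"
proof -
  obtain i j where ij: "ent P i j \<noteq> 0" using assms(2) by (metis cmx_eqI ent_zero)
  let ?S = "supp P" and ?v = "\<lambda>k. ent P k j"
  let ?n = "\<Sum>k\<in>?S. (cmod (?v k))\<^sup>2"
  have Pv: "?v a = (\<Sum>k\<in>?S. ent P a k * ?v k)" for a
    using assms(1) ent_mult0[of P P a j] by (simp add: proj_def)
  have "(cmod (?v a))\<^sup>2 \<le> (\<Sum>k\<in>?S. (cmod (ent P a k))\<^sup>2) * ?n" for a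
  proof -
    have "cmod (?v a) \<le> (\<Sum>k\<in>?S. cmod (ent P a k) * cmod (?v k))"
      by (subst Pv) (rule order_trans[OF norm_sum], simp add: norm_mult)
    then have "(cmod (?v a))\<^sup>2 \<le> (\<Sum>k\<in>?S. cmod (ent P a k) * cmod (?v k))\<^sup>2"
      by (simp add: power_mono)
    also have "\<dots> \<le> (\<Sum>k\<in>?S. (cmod (ent P a k))\<^sup>2) * ?n" by (rule Cauchy_Schwarz_sum)
    finally show ?thesis .
  qed
  then have "?n \<le> (\<Sum>a\<in>?S. (\<Sum>k\<in>?S. (cmod (ent P a k))\<^sup>2) * ?n)" by (rule sum_mono)
  then have "1 * ?n \<le> nsq P * ?n" by (simp add: nsq_def sum_distrib_right)
  moreover have "?n > 0"
    by (rule sum_pos2[of _ i]) (use ij in \<open>auto dest: ent_nonzero\<close>)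
  ultimately show ?thesis by (rule mult_right_le_imp_le)
qed

lemma proj_diff: "proj P \<Longrightarrow> proj Q \<Longrightarrow> P * Q = Q \<Longrightarrow> proj (P - Q)"
  using adj_mult[of P Q] by (simp add: proj_def algebra_simps)

section \<open>Finite groups, unitary representations and Gram functions\<close>

text \<open>Groups are written additively, as the class \<open>group_add\<close> is not commutative.\<close>

definition sgrp :: "'g::group_add set \<Rightarrow> bool" where
  "sgrp H \<longleftrightarrow> finite H \<and> 0 \<in> H \<and> (\<forall>x\<in>H. \<forall>y\<in>H. x + y \<in> H) \<and> (\<forall>x\<in>H. - x \<in> H)"

lemma sgrpD: assumes "sgrp H" shows "finite H" "0 \<in> H" "x \<in> H \<Longrightarrow> y \<in> H \<Longrightarrow> x + y \<in> H"
  "x \<in> H \<Longrightarrow> - x \<in> H" "card H > 0"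
  using assms by (auto simp: sgrp_def card_gt_0_iff)

lemma sgrp_translate:
  assumes "sgrp H" "x \<in> H"
  shows "(\<Sum>h\<in>H. f (x + h)) = (\<Sum>h\<in>H. f h)" "(\<Sum>h\<in>H. f (h + x)) = (\<Sum>h\<in>H. f h)"
    "(\<Sum>h\<in>H. f (- h)) = (\<Sum>h\<in>H. f h)"
proof -
  note D = sgrpD[OF assms(1)]
  show "(\<Sum>h\<in>H. f (x + h)) = (\<Sum>h\<in>H. f h)"
    by (rule sum.reindex_bij_witness[of _ "\<lambda>h. - x + h" "\<lambda>h. x + h"])
      (use D assms(2) in \<open>auto simp: add.assoc[symmetric]\<close>)
  show "(\<Sum>h\<in>H. f (h + x)) = (\<Sum>h\<in>H. f h)"
    by (rule sum.reindex_bij_witness[of _ "\<lambda>h. h - x" "\<lambda>h. h + x"])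
      (use D assms(2) in \<open>auto simp: diff_conv_add_uminus add.assoc simp del: add_uminus_conv_diff\<close>)
  show "(\<Sum>h\<in>H. f (- h)) = (\<Sum>h\<in>H. f h)"
    by (rule sum.reindex_bij_witness[of _ uminus uminus]) (use D in auto)
qed

text \<open>A unitary representation on the range of \<open>\<pi> 0\<close>, which is a projection
  and may differ from an identity matrix. A subrepresentation is then obtained by multiplying with a
  commuting projection, over the same index type.\<close>

definition srep :: "'g::group_add set \<Rightarrow> ('g \<Rightarrow> 'i cmx) \<Rightarrow> bool" where
  "srep H \<pi> \<longleftrightarrow> (\<forall>x\<in>H. \<forall>y\<in>H. \<pi> (x + y) = \<pi> x * \<pi> y) \<and> (\<forall>x\<in>H. \<pi> (- x) = adj (\<pi> x))"

lemma srep_add: "srep H \<pi> \<Longrightarrow> x \<in> H \<Longrightarrow> y \<in> H \<Longrightarrow> \<pi> (x + y) = \<pi> x * \<pi> y"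
  and srep_uminus: "srep H \<pi> \<Longrightarrow> x \<in> H \<Longrightarrow> \<pi> (- x) = adj (\<pi> x)"
  by (auto simp: srep_def)

lemma srep_subset: "srep H \<pi> \<Longrightarrow> K \<subseteq> H \<Longrightarrow> srep K \<pi>"
  by (auto simp: srep_def)

lemma srep_0:
  assumes "srep H \<pi>" "sgrp H"
  shows "proj (\<pi> 0)" "x \<in> H \<Longrightarrow> \<pi> 0 * \<pi> x = \<pi> x" "x \<in> H \<Longrightarrow> \<pi> x * \<pi> 0 = \<pi> x"
  using assms srep_add[OF assms(1), of 0 0] srep_uminus[OF assms(1), of 0]
    srep_add[OF assms(1), of 0 x] srep_add[OF assms(1), of x 0]
  by (auto simp: proj_def sgrp_def)

lemma srep_mult_proj:
  assumes "srep H \<pi>" "proj P" "\<And>h. h \<in> H \<Longrightarrow> \<pi> h * P = P * \<pi> h"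
  shows "srep H (\<lambda>h. \<pi> h * P)"
  unfolding srep_def
proof (intro conjI ballI)
  fix x y assume *: "x \<in> H" "y \<in> H"
  have "\<pi> x * P * (\<pi> y * P) = \<pi> x * (P * \<pi> y) * P" by (simp add: mult.assoc)
  also have "\<dots> = \<pi> x * \<pi> y * (P * P)" using assms(3)[OF *(2)] by (metis mult.assoc)
  finally show "\<pi> (x + y) * P = \<pi> x * P * (\<pi> y * P)"
    using * assms by (simp add: srep_add proj_def)
next
  fix x assume *: "x \<in> H"
  have "adj (\<pi> x * P) = adj (P * \<pi> x)" using assms(3)[OF *] by simp
  then show "\<pi> (- x) * P = adj (\<pi> x * P)"
    using * assms(1,2) by (simp add: srep_uminus proj_def)
qed

text \<open>Positive definite functions, encoded by a Gram factorisation instead of an inequality: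
  sums, products and induction then only require new vectors. The index set consists of naturals so
  that the predicate does not depend on a further type; \<open>gramI\<close> accepts any finite
  index set.\<close>

definition gram :: "'g::group_add set \<Rightarrow> ('g \<Rightarrow> complex) \<Rightarrow> bool" where
  "gram H \<phi> \<longleftrightarrow> (\<exists>(I::nat set) a. finite I \<and>
     (\<forall>x\<in>H. \<forall>y\<in>H. \<phi> (- x + y) = (\<Sum>i\<in>I. cnj (a i x) * a i y)))"

lemma gramI:
  fixes I :: "'i set"
  assumes "finite I" "\<And>x y. x \<in> H \<Longrightarrow> y \<in> H \<Longrightarrow> \<phi> (- x + y) = (\<Sum>i\<in>I. cnj (a i x) * a i y)"
  shows "gram H \<phi>"
proof -
  obtain b where b: "bij_betw b {..<card I} I"
    using assms(1) by (metis atLeast0LessThan ex_bij_betw_nat_finite)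
  show ?thesis unfolding gram_def
    by (rule exI[of _ "{..<card I}"], rule exI[of _ "\<lambda>i. a (b i)"])
      (auto simp: assms(2) sum.reindex_bij_betw[OF b, symmetric])
qed

lemma gramE:
  assumes "gram H \<phi>"
  obtains I :: "nat set" and a where "finite I"
    "\<And>x y. x \<in> H \<Longrightarrow> y \<in> H \<Longrightarrow> \<phi> (- x + y) = (\<Sum>i\<in>I. cnj (a i x) * a i y)"
  using assms unfolding gram_def by blast

lemma gram_subset: "gram H \<phi> \<Longrightarrow> K \<subseteq> H \<Longrightarrow> gram K \<phi>"
  unfolding gram_def by (meson subsetD)

lemma gram_cong:
  assumes "gram H \<phi>" "sgrp H" "\<And>x. x \<in> H \<Longrightarrow> \<phi> x = \<psi> x"
  shows "gram H \<psi>"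
proof -
  obtain I a where I: "finite (I::nat set)"
    "\<And>x y. x \<in> H \<Longrightarrow> y \<in> H \<Longrightarrow> \<phi> (- x + y) = (\<Sum>i\<in>I. cnj (a i x) * a i y)"
    using gramE[OF assms(1)] by blast
  show ?thesis
    by (rule gramI[OF I(1), of H \<psi> a]) (use assms(2,3) I(2) in \<open>metis sgrpD(3,4)\<close>)
qed

lemma gram_mult:
  assumes "gram H \<phi>" "gram H \<psi>" shows "gram H (\<lambda>x. \<phi> x * \<psi> x)"
proof -
  obtain I a where I: "finite (I::nat set)"
    "\<And>x y. x \<in> H \<Longrightarrow> y \<in> H \<Longrightarrow> \<phi> (- x + y) = (\<Sum>i\<in>I. cnj (a i x) * a i y)"
    using gramE[OF assms(1)] by blast
  obtain J b where J: "finite (J::nat set)"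
    "\<And>x y. x \<in> H \<Longrightarrow> y \<in> H \<Longrightarrow> \<psi> (- x + y) = (\<Sum>i\<in>J. cnj (b i x) * b i y)"
    using gramE[OF assms(2)] by blast
  show ?thesis
  proof (rule gramI[of "I \<times> J" H _ "\<lambda>p x. a (fst p) x * b (snd p) x"])
    fix x y assume "x \<in> H" "y \<in> H"
    then show "\<phi> (- x + y) * \<psi> (- x + y) = (\<Sum>p\<in>I \<times> J. cnj (a (fst p) x * b (snd p) x) * (a (fst p) y * b (snd p) y))"
      by (simp add: I(2) J(2) sum_product sum.cartesian_product' mult_ac)
  qed (use I J in auto)
qed

lemma gram_add:
  assumes "gram H \<phi>" "gram H \<psi>" shows "gram H (\<lambda>x. \<phi> x + \<psi> x)"
proof -
  obtain I a where I: "finite (I::nat set)"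
    "\<And>x y. x \<in> H \<Longrightarrow> y \<in> H \<Longrightarrow> \<phi> (- x + y) = (\<Sum>i\<in>I. cnj (a i x) * a i y)"
    using gramE[OF assms(1)] by blast
  obtain J b where J: "finite (J::nat set)"
    "\<And>x y. x \<in> H \<Longrightarrow> y \<in> H \<Longrightarrow> \<psi> (- x + y) = (\<Sum>i\<in>J. cnj (b i x) * b i y)"
    using gramE[OF assms(2)] by blast
  show ?thesis
  proof (rule gramI[of "I <+> J" H _ "case_sum a b"])
    fix x y assume "x \<in> H" "y \<in> H"
    then show "\<phi> (- x + y) + \<psi> (- x + y) = (\<Sum>p\<in>I <+> J. cnj (case_sum a b p x) * case_sum a b p y)"
      by (simp add: I J sum.Plus)
  qed (use I J in auto)
qed

lemma gram_cnj: assumes "gram H \<phi>" shows "gram H (\<lambda>x. cnj (\<phi> x))"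
proof -
  obtain I a where I: "finite (I::nat set)"
    "\<And>x y. x \<in> H \<Longrightarrow> y \<in> H \<Longrightarrow> \<phi> (- x + y) = (\<Sum>i\<in>I. cnj (a i x) * a i y)"
    using gramE[OF assms(1)] by blast
  show ?thesis by (rule gramI[OF I(1), of H _ "\<lambda>i x. cnj (a i x)"]) (simp add: I)
qed

lemma gram_const: "r \<ge> 0 \<Longrightarrow> gram H (\<lambda>x. of_real r)"
  by (rule gramI[of "{()}" _ _ "\<lambda>_ _. of_real (sqrt r)"])
    (auto simp flip: of_real_mult)

lemma gram_scale: "r \<ge> 0 \<Longrightarrow> gram H \<phi> \<Longrightarrow> gram H (\<lambda>x. of_real r * \<phi> x)"
  by (rule gram_mult[OF gram_const])

lemma gram_power: "gram H \<phi> \<Longrightarrow> gram H (\<lambda>x. \<phi> x ^ k)"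
  by (induction k) (use gram_const[of 1 H] in \<open>auto intro: gram_mult\<close>)

text \<open>\<open>tr (adj (\<pi> x) * \<pi> y)\<close> is the Hilbert-Schmidt inner product of two
  matrices, so the Gram vectors are the matrices themselves, flattened over a common finite
  support.\<close>

lemma gram_tr:
  assumes "srep H \<pi>" "sgrp H" shows "gram H (\<lambda>x. tr (\<pi> x))"
proof -
  let ?S = "\<Union>x\<in>H. supp (\<pi> x)"
  have fin: "finite ?S" using sgrpD(1)[OF assms(2)] by auto
  show ?thesis
  proof (rule gramI[of "?S \<times> ?S" H _ "\<lambda>p x. ent (\<pi> x) (snd p) (fst p)"])
    fix x y assume xy: "x \<in> H" "y \<in> H"
    have "tr (\<pi> (- x + y)) = tr (adj (\<pi> x) * \<pi> y)"
      using assms xy sgrpD[OF assms(2)] by (simp add: srep_add srep_uminus)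
    also have "\<dots> = (\<Sum>i\<in>?S. \<Sum>k\<in>?S. ent (adj (\<pi> x)) i k * ent (\<pi> y) k i)"
      by (rule tr_mult[OF fin]) (use xy supp_subsets(4)[of "\<pi> x"] in blast)+
    finally show "tr (\<pi> (- x + y)) = (\<Sum>p\<in>?S \<times> ?S. cnj (ent (\<pi> x) (snd p) (fst p)) * ent (\<pi> y) (snd p) (fst p))"
      by (simp add: sum.cartesian_product')
  qed (use fin in auto)
qed

text \<open>By translation invariance, \<open>card H\<close> times the sum is the sum of
  \<open>\<phi> (- x + y)\<close> over all pairs, that is the squared length of the sum of all Gram
  vectors.\<close>

lemma gram_sum_nonneg:
  assumes "gram H \<phi>" "sgrp H" shows "Re (\<Sum>h\<in>H. \<phi> h) \<ge> 0"
proof -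
  obtain I a where I: "finite (I::nat set)"
    "\<And>x y. x \<in> H \<Longrightarrow> y \<in> H \<Longrightarrow> \<phi> (- x + y) = (\<Sum>i\<in>I. cnj (a i x) * a i y)"
    using gramE[OF assms(1)] by blast
  have "of_nat (card H) * (\<Sum>h\<in>H. \<phi> h) = (\<Sum>x\<in>H. \<Sum>y\<in>H. \<phi> (- x + y))"
    by (simp add: sgrp_translate(1)[OF assms(2) sgrpD(4)[OF assms(2)]])
  also have "\<dots> = (\<Sum>x\<in>H. \<Sum>y\<in>H. \<Sum>i\<in>I. cnj (a i x) * a i y)" by (simp add: I)
  also have "\<dots> = (\<Sum>x\<in>H. \<Sum>i\<in>I. \<Sum>y\<in>H. cnj (a i x) * a i y)"
    by (rule sum.cong[OF refl], rule sum.swap)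
  also have "\<dots> = (\<Sum>i\<in>I. \<Sum>x\<in>H. \<Sum>y\<in>H. cnj (a i x) * a i y)" by (rule sum.swap)
  also have "\<dots> = (\<Sum>i\<in>I. cnj (\<Sum>x\<in>H. a i x) * (\<Sum>x\<in>H. a i x))"
    by (simp add: sum_product)
  also have "\<dots> = of_real (\<Sum>i\<in>I. (cmod (\<Sum>x\<in>H. a i x))\<^sup>2)"
    unfolding of_real_sum by (simp add: cmod_sq mult.commute)
  finally have "of_real (real (card H)) * (\<Sum>h\<in>H. \<phi> h) = of_real (\<Sum>i\<in>I. (cmod (\<Sum>x\<in>H. a i x))\<^sup>2)" by simp
  then have "real (card H) * Re (\<Sum>h\<in>H. \<phi> h) = (\<Sum>i\<in>I. (cmod (\<Sum>x\<in>H. a i x))\<^sup>2)"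
    by (drule_tac arg_cong[where f=Re]) simp
  also have "\<dots> \<ge> 0" by (simp add: sum_nonneg)
  finally show ?thesis using sgrpD(5)[OF assms(2)] by (simp add: zero_le_mult_iff)
qed

text \<open>Domination in the sense of positive definite functions is inherited by powers, by
  telescoping \<open>A ^ Suc k - B ^ Suc k\<close>. The same splitting, applied to
  \<open>A ^ k\<close> and its conjugate, shows that \<open>|A| ^ (2 k) - |B| ^ (2 k)\<close> is
  positive definite. Its sum is therefore nonnegative; a pointwise comparison is not
  claimed.\<close>

lemma gram_moment:
  assumes "sgrp H" "gram H A" "gram H B" "gram H (\<lambda>x. A x - B x)"
  shows "(\<Sum>h\<in>H. cmod (B h) ^ (2 * k)) \<le> (\<Sum>h\<in>H. cmod (A h) ^ (2 * k))"
proof -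
  have pow: "gram H (\<lambda>x. A x ^ k - B x ^ k)" for k
  proof (induction k)
    case 0 show ?case using gram_const[of 0 H] by simp
  next
    case (Suc k)
    have "gram H (\<lambda>x. A x * (A x ^ k - B x ^ k) + (A x - B x) * B x ^ k)"
      by (rule gram_add[OF gram_mult[OF assms(2) Suc] gram_mult[OF assms(4) gram_power[OF assms(3)]]])
    then show ?case by (simp add: algebra_simps)
  qed
  have *: "gram H (\<lambda>x. A x ^ k * cnj (A x ^ k - B x ^ k) + (A x ^ k - B x ^ k) * cnj (B x ^ k))"
    by (rule gram_add[OF gram_mult[OF gram_power[OF assms(2)] gram_cnj[OF pow]]
        gram_mult[OF pow gram_cnj[OF gram_power[OF assms(3)]]]])
  have eq: "(\<lambda>x. A x ^ k * cnj (A x ^ k - B x ^ k) + (A x ^ k - B x ^ k) * cnj (B x ^ k))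
      = (\<lambda>x. of_real (cmod (A x) ^ (2 * k) - cmod (B x) ^ (2 * k)))"
  proof
    fix x
    have "z ^ k * cnj (z ^ k) = of_real (cmod z ^ (2 * k))" for z
      by (simp add: power_mult cmod_sq power_mult_distrib)
    from this[of "A x"] this[of "B x"] 
    show "A x ^ k * cnj (A x ^ k - B x ^ k) + (A x ^ k - B x ^ k) * cnj (B x ^ k)
      = of_real (cmod (A x) ^ (2 * k) - cmod (B x) ^ (2 * k))"
      by (simp add: algebra_simps)
  qed
  from gram_sum_nonneg[OF *[unfolded eq] assms(1)] show ?thesis
    by (simp add: sum_subtractf flip: of_real_sum)
qed


section \<open>The symmetric group of a type\<close>

text \<open>All permutations of a type, written additively to form an instance of
  \<open>group_add\<close>. The isometry groups are finite sets of such permutations, so that one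
  notion of subgroup serves for all of them.\<close>

typedef 'v sym = "{f :: 'v \<Rightarrow> 'v. bij f}"
  morphisms act Abs_sym
  by (rule exI[of _ id]) simp

setup_lifting type_definition_sym

lemma sym_eqI: "(\<And>x. act g x = act h x) \<Longrightarrow> g = h"
  by (metis act_inject ext)

instantiation sym :: (type) group_add
begin
lift_definition zero_sym :: "'a sym" is id by simp
lift_definition plus_sym :: "'a sym \<Rightarrow> 'a sym \<Rightarrow> 'a sym" is "(\<circ>)" by (auto intro: bij_comp)
lift_definition uminus_sym :: "'a sym \<Rightarrow> 'a sym" is "inv_into UNIV" by (rule bij_imp_bij_inv)
definition minus_sym :: "'a sym \<Rightarrow> 'a sym \<Rightarrow> 'a sym" where "minus_sym a b = a + - b"
instance
  by standard (transfer; auto simp: bij_is_inj inv_o_cancel minus_sym_def)+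
end

lemma act_0 [simp]: "act 0 x = x"
  and act_add [simp]: "act (g + h) x = act g (act h x)"
  by (transfer; simp)+

lemma act_uminus_cancel [simp]: "act g (act (- g) x) = x" "act (- g) (act g x) = x"
  by (metis act_add act_0 right_minus left_minus)+

lemma act_diff [simp]: "act (g - h) x = act g (act (- h) x)"
  by (simp only: minus_sym_def act_add)

lemma act_Abs: "bij f \<Longrightarrow> act (Abs_sym f) = f"
  by (simp add: Abs_sym_inverse)

lemma act_inj: "act g x = act g y \<longleftrightarrow> x = y"
  by (metis act_uminus_cancel(2))

section \<open>Hermitian spaces over a finite ring with involution\<close>

definition sm :: "'a::comm_ring_1 \<Rightarrow> (nat \<Rightarrow> 'a) \<Rightarrow> nat \<Rightarrow> 'a" where
  "sm c x = (\<lambda>i. c * x i)"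

lemma sm_apply [simp]: "sm c x i = c * x i" by (simp add: sm_def)

lemma sm_add: "sm c (x + y) = sm c x + sm c y" and sm_add_left: "sm (c + d) x = sm c x + sm d x"
  and sm_sm [simp]: "sm c (sm d x) = sm (c * d) x" and sm_uminus: "sm c (- x) = - sm c x"
  and sm_0 [simp]: "sm 0 x = 0" "sm c 0 = 0" and sm_diff: "sm c (x - y) = sm c x - sm c y"
  and sm_minus_left: "sm (- c) x = - sm c x" and sm_1 [simp]: "sm 1 x = x"
  by (auto simp: fun_eq_iff algebra_simps)

text \<open>
  The ring \<open>A = {x. e * x = x}\<close> with the involution \<open>s\<close> is \<open>F_{q^2}\<close> with \<open>x \<mapsto> x^q\<close> in the unitary
  case and \<open>F_q \<times> F_q\<close> with the coordinate swap in the linear case, where the isometries of the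
  form \<open>\<Sum> s (x i) * y i\<close> are the pairs consisting of a matrix and its inverse transpose. In both
  cases \<open>F_q\<close> is the subring fixed by \<open>s\<close>.
\<close>
locale hring =
  fixes s :: "'a::comm_ring_1 \<Rightarrow> 'a" and e :: 'a and q :: nat and \<alpha> b \<delta> \<delta>i :: 'a
  assumes s_add: "s (x + y) = s x + s y" and s_mult: "s (x * y) = s x * s y"
    and s_s [simp]: "s (s x) = x" and s_e [simp]: "s e = e" and e_e [simp]: "e * e = e"
    and e_nz: "e \<noteq> 0"
    and e_\<alpha>: "e * \<alpha> = \<alpha>" and norm_\<alpha>: "\<alpha> * s \<alpha> = - e"
    and e_b: "e * b = b" and tr_b: "b + s b = e"
    and e_\<delta>: "e * \<delta> = \<delta>" and e_\<delta>i: "e * \<delta>i = \<delta>i" and \<delta>\<delta>i: "\<delta> * \<delta>i = e" and s_\<delta>: "s \<delta> = - \<delta>"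
    and trace_onto: "e * z = z \<Longrightarrow> z \<noteq> 0 \<Longrightarrow> \<exists>c. e * c = c \<and> c * z + s (c * z) = e"
    and dvd_or_idem: "e * d = d \<Longrightarrow> e * y = y \<Longrightarrow>
      (\<exists>c. e * c = c \<and> y = c * d) \<or> (\<exists>p. e * p = p \<and> p * p = p \<and> p * d = 0 \<and> p * y \<noteq> 0)"
    and idem_iso: "e * p = p \<Longrightarrow> p * p = p \<Longrightarrow> p \<noteq> e \<Longrightarrow> p * s p = 0"
    and norm_onto: "e * y = y \<Longrightarrow> s y = y \<Longrightarrow> \<exists>z. e * z = z \<and> z * s z = y"
    and card_A: "card {x. e * x = x} = q\<^sup>2" and q_ge_2: "q \<ge> 2" and card_F: "card {x. e * x = x \<and> s x = x} = q"
begin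

definition A :: "'a set" where "A = {x. e * x = x}"
definition F :: "'a set" where "F = {x. e * x = x \<and> s x = x}"

lemma s_0 [simp]: "s 0 = 0" using s_add[of 0 0] by simp
lemma s_uminus: "s (- x) = - s x" using s_add[of x "- x"] by (simp add: eq_neg_iff_add_eq_0 add.commute)
lemma s_diff: "s (x - y) = s x - s y" using s_add[of x "- y"] by (simp add: s_uminus)
lemma s_sum: "s (\<Sum>i\<in>I. f i) = (\<Sum>i\<in>I. s (f i))"
  by (induction I rule: infinite_finite_induct) (auto simp: s_add)
lemma s_eq_0 [simp]: "s x = 0 \<longleftrightarrow> x = 0" by (metis s_0 s_s)
lemma e_s: "e * x = x \<Longrightarrow> e * s x = s x" by (metis s_mult s_e)

lemma s_\<delta>i: "s \<delta>i = - \<delta>i"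
proof -
  have "- \<delta> * s \<delta>i = e" using \<delta>\<delta>i s_mult[of \<delta> \<delta>i] s_\<delta> by simp
  then have "\<delta>i * (- \<delta> * s \<delta>i) = \<delta>i" using e_\<delta>i by (simp add: mult.commute)
  then have "- ((\<delta> * \<delta>i) * s \<delta>i) = \<delta>i" by (simp add: mult_ac)
  then have "- s \<delta>i = \<delta>i" using e_s[OF e_\<delta>i] by (simp add: \<delta>\<delta>i)
  then show ?thesis by (simp add: minus_equation_iff)
qed

lemma card_A': "card A = q\<^sup>2" and card_F': "card F = q"
  using card_A card_F by (simp_all add: A_def F_def)

lemma in_A: "x \<in> A \<longleftrightarrow> e * x = x" by (simp add: A_def)
lemma in_F: "x \<in> F \<longleftrightarrow> e * x = x \<and> s x = x" by (simp add: F_def)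

lemma e_simps [simp]: "e * \<alpha> = \<alpha>" "e * b = b" "e * \<delta> = \<delta>" "e * \<delta>i = \<delta>i" "\<delta> * \<delta>i = e" "s \<delta> = - \<delta>"
  "s \<delta>i = - \<delta>i" "e * s \<alpha> = s \<alpha>" "e * s b = s b"
  using e_\<alpha> e_b e_\<delta> e_\<delta>i \<delta>\<delta>i s_\<delta> s_\<delta>i e_s by auto

lemma finite_A [simp]: "finite A" "finite F"
  using card_A' card_F' q_ge_2 by (auto intro!: card_ge_0_finite)

end


locale hgeom = hring s e q \<alpha> b \<delta> \<delta>i
  for s :: "'a::comm_ring_1 \<Rightarrow> 'a" and e q \<alpha> b \<delta> \<delta>i +
  fixes n :: nat
begin

definition ip :: "(nat \<Rightarrow> 'a) \<Rightarrow> (nat \<Rightarrow> 'a) \<Rightarrow> 'a" where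
  "ip x y = (\<Sum>i<n. s (x i) * y i)"

definition V :: "nat \<Rightarrow> nat \<Rightarrow> (nat \<Rightarrow> 'a) set" where
  "V j l = {x. \<forall>i. e * x i = x i \<and> (\<not> (j \<le> i \<and> i < l) \<longrightarrow> x i = 0)}"

definition bv :: "nat \<Rightarrow> nat \<Rightarrow> 'a" where "bv i = (\<lambda>k. if k = i then e else 0)"

lemma ip_simps [simp]:
  "ip x (y + z) = ip x y + ip x z" "ip (x + y) z = ip x z + ip y z"
  "ip x (y - z) = ip x y - ip x z" "ip (x - y) z = ip x z - ip y z"
  "ip x (- y) = - ip x y" "ip (- x) y = - ip x y"
  "ip x (sm c y) = c * ip x y" "ip (sm c x) y = s c * ip x y" "ip x 0 = 0" "ip 0 x = 0"
  by (simp_all add: ip_def algebra_simps s_add s_diff s_uminus s_mult sum.distrib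
      sum_subtractf sum_negf sum_distrib_left)

lemma ip_sym: "ip y x = s (ip x y)"
  by (simp add: ip_def s_sum s_mult mult.commute)

lemma ip_0_sym: "ip x y = 0 \<Longrightarrow> ip y x = 0" by (subst ip_sym) simp

lemma V_zero [simp]: "0 \<in> V j l" by (simp add: V_def)
lemma V_add: "x \<in> V j l \<Longrightarrow> y \<in> V j l \<Longrightarrow> x + y \<in> V j l" by (auto simp: V_def algebra_simps)
lemma V_uminus: "x \<in> V j l \<Longrightarrow> - x \<in> V j l" by (auto simp: V_def)
lemma V_diff: "x \<in> V j l \<Longrightarrow> y \<in> V j l \<Longrightarrow> x - y \<in> V j l" by (auto simp: V_def algebra_simps)
lemma V_sm: "x \<in> V j l \<Longrightarrow> sm c x \<in> V j l" by (auto simp: V_def mult.left_commute)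
lemma V_mono: "x \<in> V j l \<Longrightarrow> j' \<le> j \<Longrightarrow> l \<le> l' \<Longrightarrow> x \<in> V j' l'" unfolding V_def by force
lemma V_e: "x \<in> V j l \<Longrightarrow> e * x i = x i" by (simp add: V_def)
lemma V_out: "x \<in> V j l \<Longrightarrow> i < j \<or> l \<le> i \<Longrightarrow> x i = 0" by (auto simp: V_def)
lemma V_bv: "j \<le> i \<Longrightarrow> i < l \<Longrightarrow> bv i \<in> V j l" by (auto simp: V_def bv_def)
lemma bv_apply: "bv i k = (if k = i then e else 0)" by (simp add: bv_def)

lemmas V_intros = V_add V_diff V_uminus V_sm V_bv

lemma sm_e: "x \<in> V j l \<Longrightarrow> sm e x = x" by (simp add: fun_eq_iff V_e)

lemma ip_e: "x \<in> V j l \<Longrightarrow> e * ip x y = ip x y" "x \<in> V j l \<Longrightarrow> e * ip y x = ip y x"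
proof -
  assume x: "x \<in> V j l"
  then have "ip (sm e x) y = ip x y" "ip y (sm e x) = ip y x" by (simp_all only: sm_e)
  then show "e * ip x y = ip x y" "e * ip y x = ip y x" by simp_all
qed

lemma ip_bv: "i < n \<Longrightarrow> ip (bv i) x = e * x i" "i < n \<Longrightarrow> ip x (bv i) = s (x i) * e"
proof -
  assume i: "i < n"
  have "ip (bv i) x = (\<Sum>k<n. if k = i then e * x i else 0)"
    unfolding ip_def by (rule sum.cong) (auto simp: bv_def)
  then show "ip (bv i) x = e * x i" using i by simp
  have "ip x (bv i) = (\<Sum>k<n. if k = i then s (x i) * e else 0)"
    unfolding ip_def by (rule sum.cong) (auto simp: bv_def)
  then show "ip x (bv i) = s (x i) * e" using i by simp
qed

lemma ip_disjoint:
  assumes "x \<in> V j l" "y \<in> V j' l'" "l \<le> j' \<or> l' \<le> j" shows "ip x y = 0"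
proof -
  have "s (x i) * y i = 0" for i
    using V_out[OF assms(1), of i] V_out[OF assms(2), of i] assms(3) by (cases "x i = 0") force+
  then show ?thesis by (simp add: ip_def)
qed

lemma V_induct [consumes 1, case_names zero add bv]:
  assumes "x \<in> V j l" "P 0" "\<And>x y. P x \<Longrightarrow> P y \<Longrightarrow> P (x + y)"
    "\<And>c i. e * c = c \<Longrightarrow> j \<le> i \<Longrightarrow> i < l \<Longrightarrow> P (sm c (bv i))"
  shows "P x"
  using assms(1,4)
proof (induction l arbitrary: x)
  case 0 then have "x = 0" by (auto simp: V_def fun_eq_iff)
  with assms(2) show ?case by metis
next
  case (Suc l)
  show ?case
  proof (cases "j \<le> l")
    case True
    define y where "y = x - sm (x l) (bv l)"
    have "y i = (if i = l then 0 else x i)" for i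
      using V_e[OF Suc.prems(1), of l] by (simp add: y_def bv_def mult.commute)
    then have "y \<in> V j l" using Suc.prems(1) by (auto simp: V_def)
    then have "P y" by (rule Suc.IH) (rule Suc.prems(2), auto)
    moreover have "P (sm (x l) (bv l))" by (rule Suc.prems(2)) (use V_e[OF Suc.prems(1)] True in auto)
    ultimately have "P (y + sm (x l) (bv l))" by (rule assms(3))
    moreover have "y + sm (x l) (bv l) = x" by (simp add: y_def)
    ultimately show ?thesis by metis
  next
    case False
    then have "x = 0" using Suc.prems(1) by (auto simp: V_def fun_eq_iff)
    with assms(2) show ?thesis by metis
  qed
qed

lemma card_V: assumes "j \<le> l" shows "finite (V j l)" "card (V j l) = q ^ (2 * (l - j))"
proof -
  have bij: "bij_betw (\<lambda>x. restrict x {j..<l}) (V j l) ({j..<l} \<rightarrow>\<^sub>E A)"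
  proof (rule bij_betw_byWitness[where f' = "\<lambda>f i. if j \<le> i \<and> i < l then f i else 0"])
    show "(\<lambda>x. restrict x {j..<l}) ` V j l \<subseteq> {j..<l} \<rightarrow>\<^sub>E A" by (auto simp: V_def in_A)
    show "(\<lambda>f i. if j \<le> i \<and> i < l then f i else 0) ` ({j..<l} \<rightarrow>\<^sub>E A) \<subseteq> V j l"
      by (auto simp: V_def in_A PiE_def Pi_def)
    show "\<forall>f\<in>{j..<l} \<rightarrow>\<^sub>E A. restrict (\<lambda>i. if j \<le> i \<and> i < l then f i else 0) {j..<l} = f"
      by (auto simp: fun_eq_iff PiE_def extensional_def)
  qed (auto simp: V_def fun_eq_iff)
  have "finite ({j..<l} \<rightarrow>\<^sub>E A)" by (rule finite_PiE) auto
  then show "finite (V j l)" using bij_betw_finite[OF bij] by simp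
  show "card (V j l) = q ^ (2 * (l - j))"
    using bij_betw_same_card[OF bij] by (simp add: card_PiE card_A' power_mult)
qed

subsection \<open>Isometries and root elements\<close>

text \<open>The elements are permutations of all functions \<open>nat \<Rightarrow> 'a\<close>,
  while the geometry lives on \<open>V 0 n\<close>. The clauses on \<open>act g x - x\<close> and on
  vectors killed by \<open>e\<close> make the action trivial outside that module, so an element is
  determined by the images of the first \<open>n\<close> basis vectors.\<close>

definition U :: "nat \<Rightarrow> (nat \<Rightarrow> 'a) sym set" where
  "U j = {g. (\<forall>x y. act g (x + y) = act g x + act g y) \<and> (\<forall>c x. act g (sm c x) = sm c (act g x))
     \<and> (\<forall>x y. ip (act g x) (act g y) = ip x y) \<and> (\<forall>x. act g x - x \<in> V 0 n)
     \<and> (\<forall>x. (\<forall>i<n. e * x i = 0) \<longrightarrow> act g x = x) \<and> (\<forall>i<j. act g (bv i) = bv i)}"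

lemma UD:
  assumes "g \<in> U j"
  shows "act g (x + y) = act g x + act g y" "act g (sm c x) = sm c (act g x)"
    "ip (act g x) (act g y) = ip x y" "act g x - x \<in> V 0 n" "(\<forall>i<n. e * x i = 0) \<Longrightarrow> act g x = x"
    "i < j \<Longrightarrow> act g (bv i) = bv i"
  using assms by (auto simp: U_def)

lemma U_lin:
  assumes "g \<in> U j"
  shows "act g 0 = 0" "act g (- x) = - act g x" "act g (x - y) = act g x - act g y"
proof -
  show "act g 0 = 0" using UD(1)[OF assms, of 0 0] by simp
  show *: "act g (- x) = - act g x" for x using UD(2)[OF assms, of "- 1" x] by (simp add: sm_minus_left)
  show "act g (x - y) = act g x - act g y" using UD(1)[OF assms, of x "- y"] * by simp
qed

lemma U_mono: "j \<le> j' \<Longrightarrow> U j' \<subseteq> U j" by (auto simp: U_def)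

lemma U_zero: "0 \<in> U j" by (simp add: U_def)

lemma U_add: assumes "g \<in> U j" "h \<in> U j" shows "g + h \<in> U j"
proof -
  have "act g (act h x) - x \<in> V 0 n" for x
    using V_add[OF UD(4)[OF assms(1), of "act h x"] UD(4)[OF assms(2), of x]] by simp
  then show ?thesis
    unfolding U_def using UD[OF assms(1)] UD[OF assms(2)] by (simp add: U_def)
qed

lemma U_uminus: assumes "g \<in> U j" shows "- g \<in> U j"
proof -
  have inv: "act (- g) y = x \<longleftrightarrow> y = act g x" for x y by auto
  have 1: "act (- g) (x + y) = act (- g) x + act (- g) y" for x y
    unfolding inv by (simp add: UD(1)[OF assms])
  have 2: "act (- g) (sm c x) = sm c (act (- g) x)" for c x
    unfolding inv by (simp add: UD(2)[OF assms])
  have 3: "ip (act (- g) x) (act (- g) y) = ip x y" for x y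
    using UD(3)[OF assms, of "act (- g) x" "act (- g) y"] by simp
  have 4: "act (- g) x - x \<in> V 0 n" for x
    using V_uminus[OF UD(4)[OF assms, of "act (- g) x"]] by simp
  have 5: "act (- g) x = x" if "act g x = x" for x using that by (metis act_uminus_cancel(2))
  show ?thesis unfolding U_def using 1 2 3 4 5 UD(5,6)[OF assms] by blast
qed

lemma U_V: assumes "g \<in> U 0" "x \<in> V 0 n" shows "act g x \<in> V 0 n"
  using V_add[OF UD(4)[OF assms(1), of x] assms(2)] by simp

lemma U_Vj: assumes "g \<in> U j" "x \<in> V j n" shows "act g x \<in> V j n"
proof -
  have V: "act g x \<in> V 0 n" using U_V assms U_mono[of 0 j] V_mono[of x j n 0 n] by auto
  have "act g x i = 0" if "i < j" for i
  proof (cases "i < n")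
    case True
    have "ip (bv i) (act g x) = ip (bv i) x"
      using UD(3)[OF assms(1), of "bv i" x] UD(6)[OF assms(1) that] by simp
    then show ?thesis using True V_e[OF V] V_e[OF assms(2)] V_out[OF assms(2), of i] that by (simp add: ip_bv)
  qed (use V_out[OF V] in auto)
  then show ?thesis using V by (auto simp: V_def)
qed

lemma U_fix: assumes "g \<in> U l" "x \<in> V 0 l" shows "act g x = x"
  using assms(2)
proof (induction rule: V_induct)
  case zero show ?case by (rule U_lin(1)[OF assms(1)])
next
  case (add x y)
  then have "act g (x + y) = x + y" by (simp add: UD[OF assms(1)])
  then show ?case .
next
  case (bv c i)
  then have "act g (sm c (bv i)) = sm c (bv i)" by (simp add: UD(2,6)[OF assms(1)])
  then show ?case .
qed

lemma U_eqI:
  assumes "g \<in> U 0" "h \<in> U 0" "\<And>i. i < n \<Longrightarrow> act g (bv i) = act h (bv i)" shows "g = h"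
proof (rule sym_eqI)
  fix x
  define y where "y = (\<lambda>i. if i < n then e * x i else 0)"
  have y: "y \<in> V 0 n" by (auto simp: y_def V_def mult.assoc[symmetric])
  have "act g y = act h y" using y
  proof (induction rule: V_induct)
    case zero show ?case by (rule trans[OF U_lin(1)[OF assms(1)] U_lin(1)[OF assms(2), symmetric]])
  next
    case (add x y)
    then have "act g (x + y) = act h (x + y)" by (simp add: UD(1)[OF assms(1)] UD(1)[OF assms(2)])
    then show ?case .
  next
    case (bv c i)
    then have "act g (sm c (bv i)) = act h (sm c (bv i))"
      by (simp add: UD(2)[OF assms(1)] UD(2)[OF assms(2)] assms(3))
    then show ?case .
  qed
  moreover have "\<forall>i<n. e * (x - y) i = 0"
    by (auto simp: y_def algebra_simps mult.assoc[symmetric])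
  then have "act g (x - y) = x - y" "act h (x - y) = x - y" 
    using UD(5)[OF assms(1)] UD(5)[OF assms(2)] by auto
  ultimately have "act g (x - y + y) = act h (x - y + y)"
    by (simp only: UD(1)[OF assms(1)] UD(1)[OF assms(2)])
  then show "act g x = act h x" by simp
qed

text \<open>An element is determined by the images of the remaining \<open>n - l\<close> basis
  vectors, and each of these images lies in \<open>V l n\<close>.\<close>

lemma card_U:
  assumes "l \<le> n" shows "finite (U l)" "card (U l) \<le> q ^ (2 * (n - l)\<^sup>2)"
proof -
  let ?r = "\<lambda>g. restrict (\<lambda>i. act g (bv i)) {l..<n}"
  have inj: "inj_on ?r (U l)"
  proof (rule inj_onI)
    fix g h assume g: "g \<in> U l" and h: "h \<in> U l" and eq: "?r g = ?r h"
    have "act g (bv i) = act h (bv i)" if "i < n" for i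
      using UD(6)[OF g] UD(6)[OF h] fun_cong[OF eq, of i] that by (cases "i < l") auto
    then show "g = h" using U_eqI g h U_mono[of 0 l] by auto
  qed
  have sub: "?r ` U l \<subseteq> {l..<n} \<rightarrow>\<^sub>E V l n" using U_Vj V_bv by auto
  have fin: "finite ({l..<n} \<rightarrow>\<^sub>E V l n)" using card_V(1)[OF assms] by (intro finite_PiE) auto
  show "finite (U l)" using inj sub fin by (metis finite_imageD finite_subset)
  have "card (U l) = card (?r ` U l)" by (simp add: card_image inj)
  also have "\<dots> \<le> card ({l..<n} \<rightarrow>\<^sub>E V l n)" by (rule card_mono[OF fin sub])
  also have "\<dots> = (q ^ (2 * (n - l))) ^ (n - l)" by (simp add: card_PiE card_V(2)[OF assms])
  finally show "card (U l) \<le> q ^ (2 * (n - l)\<^sup>2)" by (simp add: power_mult power2_eq_square)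
qed

text \<open>Siegel (Eichler) transformations. For a fixed isotropic \<open>u\<close> the admissible
  ones multiply by the Heisenberg law \<open>(w, a) (w', a') = (w + w', a + a' - ip w w')\<close>;
  those with \<open>w = 0\<close> are the transvections with axis \<open>u\<close>.\<close>

definition E :: "(nat \<Rightarrow> 'a) \<Rightarrow> (nat \<Rightarrow> 'a) \<Rightarrow> 'a \<Rightarrow> (nat \<Rightarrow> 'a) \<Rightarrow> nat \<Rightarrow> 'a" where
  "E u w a x = x + sm (ip u x) w - sm (ip w x) u + sm (a * ip u x) u"

definition adm :: "(nat \<Rightarrow> 'a) \<Rightarrow> (nat \<Rightarrow> 'a) \<Rightarrow> 'a \<Rightarrow> bool" where
  "adm u w a \<longleftrightarrow> ip u u = 0 \<and> ip u w = 0 \<and> a + s a = - ip w w"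

definition Eg :: "(nat \<Rightarrow> 'a) \<Rightarrow> (nat \<Rightarrow> 'a) \<Rightarrow> 'a \<Rightarrow> (nat \<Rightarrow> 'a) sym" where
  "Eg u w a = Abs_sym (E u w a)"

lemma E_comp:
  assumes "ip u u = 0" "ip u w = 0" "ip u w' = 0"
  shows "E u w a (E u w' a' x) = E u (w + w') (a + a' - ip w w') x"
  using assms ip_0_sym[OF assms(2)] ip_0_sym[OF assms(3)]
  by (simp add: E_def fun_eq_iff algebra_simps)

lemma bij_E: assumes "adm u w a" shows "bij (E u w a)"
proof -
  have a: "ip u u = 0" "ip u w = 0" "ip u (- w) = 0" "a + s a = - ip w w"
    using assms by (auto simp: adm_def)
  \<comment> \<open>The inverse has the parameters \<open>- w\<close> and \<open>s a\<close>: in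
    both products the third parameter is \<open>a + s a + ip w w = 0\<close>.\<close>
  have "a + s a - ip w (- w) = 0" "s a + a - ip (- w) w = 0" using a(4) by (simp_all add: add.commute)
  then have "E u w a (E u (- w) (s a) x) = x" "E u (- w) (s a) (E u w a x) = x" for x
    using E_comp[OF a(1-3), of a "s a"] E_comp[OF a(1,3,2), of "s a" a] by (simp_all add: E_def)
  then show ?thesis by (intro bij_betw_byWitness[where f' = "E u (- w) (s a)"]) auto
qed

lemma act_Eg: "adm u w a \<Longrightarrow> act (Eg u w a) x = x + sm (ip u x) w - sm (ip w x) u + sm (a * ip u x) u"
  by (simp add: Eg_def act_Abs[OF bij_E] E_def)

lemma Eg_add:
  assumes "adm u w a" "adm u w' a'"
  shows "Eg u w a + Eg u w' a' = Eg u (w + w') (a + a' - ip w w')" "adm u (w + w') (a + a' - ip w w')"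
proof -
  have *: "ip u u = 0" "ip u w = 0" "ip u w' = 0" using assms by (auto simp: adm_def)
  have "a + a' - ip w w' + s (a + a' - ip w w') = (a + s a) + (a' + s a') - ip w w' - ip w' w"
    using ip_sym[of w' w] by (simp add: s_add s_diff algebra_simps)
  also have "\<dots> = - ip (w + w') (w + w')" using assms by (simp add: adm_def algebra_simps)
  finally show adm: "adm u (w + w') (a + a' - ip w w')" using * by (simp add: adm_def)
  show "Eg u w a + Eg u w' a' = Eg u (w + w') (a + a' - ip w w')"
    by (rule sym_eqI) (use E_comp[OF *, of a a'] in \<open>simp add: Eg_def act_Abs bij_E adm assms\<close>)
qed

lemma Eg_zero: "ip u u = 0 \<Longrightarrow> Eg u 0 0 = 0"
  by (rule sym_eqI) (simp add: act_Eg adm_def)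

lemma Eg_U:
  assumes "adm u w a" "u \<in> V j n" "w \<in> V j n" shows "Eg u w a \<in> U j"
proof -
  have a: "ip u u = 0" "ip u w = 0" "ip w w = - (a + s a)" "ip w u = 0"
    using assms(1) ip_0_sym by (auto simp: adm_def)
  have V: "u \<in> V 0 n" "w \<in> V 0 n" using assms V_mono by blast+
  note [simp] = act_Eg[OF assms(1)]
  let ?g = "Eg u w a"
  have 3: "ip (act ?g x) (act ?g y) = ip x y" for x y
  proof -
    have "ip (act ?g x) (act ?g y) = ip x y + ip u y * s (ip u x) * (a + s a + ip w w)"
      using a(1,2,4) by (simp add: ip_sym[of x u] ip_sym[of x w] s_mult algebra_simps)
    then show ?thesis using a(3) by simp
  qed
  have 4: "act ?g x - x \<in> V 0 n" for x
  proof -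
    have "act ?g x - x = sm (ip u x) w - sm (ip w x) u + sm (a * ip u x) u" by simp
    also have "\<dots> \<in> V 0 n" by (intro V_intros V)
    finally show ?thesis .
  qed
  have zero: "ip v x = 0" if "\<forall>i<n. e * x i = 0" "v \<in> V 0 n" for v x
  proof -
    have "s (v i) * x i = 0" if "i < n" for i
    proof -
      have "s (v i) * x i = (e * s (v i)) * x i" using e_s[OF V_e[OF \<open>v \<in> V 0 n\<close>, of i]] by simp
      also have "\<dots> = s (v i) * (e * x i)" by (simp only: mult_ac)
      finally show ?thesis using \<open>\<forall>i<n. e * x i = 0\<close> that by simp
    qed
    then show ?thesis by (simp add: ip_def)
  qed
  have 6: "act ?g (bv i) = bv i" if "i < j" for i
  proof -
    have "ip u (bv i) = 0" "ip w (bv i) = 0"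
      using ip_disjoint[OF assms(2) V_bv[of i i "Suc i"]] ip_disjoint[OF assms(3) V_bv[of i i "Suc i"]] that by auto
    then show ?thesis by simp
  qed
  have 1: "act ?g (x + y) = act ?g x + act ?g y" "act ?g (sm c x) = sm c (act ?g x)" for x y c
    by (simp_all add: fun_eq_iff algebra_simps)
  have 5: "act ?g x = x" if "\<forall>i<n. e * x i = 0" for x
    by (simp add: zero[OF that V(1)] zero[OF that V(2)])
  show ?thesis unfolding U_def using 1 3 4 5 6 by blast
qed

lemma conj_Eg:
  assumes "g \<in> U j" "adm u w a"
  shows "adm (act g u) (act g w) a" "g + Eg u w a - g = Eg (act g u) (act g w) a"
proof -
  note U = UD[OF assms(1)] U_lin[OF assms(1)]
  show adm: "adm (act g u) (act g w) a" using assms(2) by (simp add: adm_def U)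
  have ipg: "ip v (act (- g) x) = ip (act g v) x" for v x
    using UD(3)[OF assms(1), of v "act (- g) x"] by simp
  show "g + Eg u w a - g = Eg (act g u) (act g w) a"
    by (rule sym_eqI) (simp add: act_Eg[OF adm] act_Eg[OF assms(2)] U ipg)
qed

end


context hgeom
begin

subsection \<open>The groups generated by transvections\<close>

definition tv :: "(nat \<Rightarrow> 'a) \<Rightarrow> 'a \<Rightarrow> (nat \<Rightarrow> 'a) sym" where
  "tv z a = Eg z 0 a"

text \<open>Generators are multiplied on the left only. Since the inverse of a transvection is a
  transvection, this already yields the generated group, and inductions treat one transvection at a
  time.\<close>

inductive_set N :: "nat \<Rightarrow> (nat \<Rightarrow> 'a) sym set" for j where
  N_zero: "0 \<in> N j"
| N_step: "z \<in> V j n \<Longrightarrow> ip z z = 0 \<Longrightarrow> e * a = a \<Longrightarrow> s a = - a \<Longrightarrow> g \<in> N j \<Longrightarrow> tv z a + g \<in> N j"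

lemma adm_tv: "ip z z = 0 \<Longrightarrow> s a = - a \<Longrightarrow> adm z 0 a" by (simp add: adm_def)

lemma act_tv: "ip z z = 0 \<Longrightarrow> s a = - a \<Longrightarrow> act (tv z a) x = x + sm (a * ip z x) z"
  by (simp add: tv_def act_Eg[OF adm_tv])

lemma tv_add: "ip z z = 0 \<Longrightarrow> s a = - a \<Longrightarrow> s a' = - a' \<Longrightarrow> tv z a + tv z a' = tv z (a + a')"
  unfolding tv_def by (subst Eg_add) (auto simp: adm_tv)

lemma tv_0: "ip z z = 0 \<Longrightarrow> tv z 0 = 0" by (simp add: tv_def Eg_zero)

lemma tv_uminus: "ip z z = 0 \<Longrightarrow> s a = - a \<Longrightarrow> - tv z a = tv z (- a)"
  using tv_add[of z a "- a"] tv_0[of z] by (simp add: s_uminus minus_unique)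

lemma tv_U: "z \<in> V j n \<Longrightarrow> ip z z = 0 \<Longrightarrow> s a = - a \<Longrightarrow> tv z a \<in> U j"
  unfolding tv_def by (rule Eg_U) (auto simp: adm_tv)

lemma conj_tv:
  assumes "g \<in> U j" "ip z z = 0" "s a = - a"
  shows "g + tv z a - g = tv (act g z) a" "ip (act g z) (act g z) = 0"
  using conj_Eg[OF assms(1) adm_tv[OF assms(2,3)]] U_lin(1)[OF assms(1)]
  by (auto simp: tv_def adm_def)

lemma N_tv: "z \<in> V j n \<Longrightarrow> ip z z = 0 \<Longrightarrow> e * a = a \<Longrightarrow> s a = - a \<Longrightarrow> tv z a \<in> N j"
  using N_step[OF _ _ _ _ N_zero] by fastforce

lemma N_add: "g \<in> N j \<Longrightarrow> h \<in> N j \<Longrightarrow> g + h \<in> N j"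
  by (induction rule: N.induct) (auto simp: add.assoc intro: N_step)

lemma N_uminus: "g \<in> N j \<Longrightarrow> - g \<in> N j"
proof (induction rule: N.induct)
  case N_zero show ?case by (simp add: N.N_zero)
next
  case (N_step z a g)
  then have "- tv z a \<in> N j" by (simp add: tv_uminus N_tv s_uminus)
  then have "- g + - tv z a \<in> N j" using N_step(6) by (intro N_add)
  then show ?case by (simp only: minus_add)
qed

lemma N_U: "g \<in> N j \<Longrightarrow> g \<in> U j"
  by (induction rule: N.induct) (auto intro: U_zero U_add tv_U)

lemma N_U0: "g \<in> N j \<Longrightarrow> g \<in> U 0" using N_U U_mono[of 0 j] by auto

lemma N_mono: assumes "j \<le> j'" shows "N j' \<subseteq> N j"
proof
  fix g assume "g \<in> N j'"
  then show "g \<in> N j"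
    by (induction rule: N.induct) (use assms V_mono in \<open>blast intro: N.intros\<close>)+
qed

lemma sgrp_N: "sgrp (N j)"
proof -
  have "N j \<subseteq> U 0" using N_U0 by auto
  then have "finite (N j)" using card_U(1)[of 0] finite_subset by auto
  then show ?thesis unfolding sgrp_def using N_zero N_add N_uminus by blast
qed

lemma N_conj: assumes "g \<in> U j" "h \<in> N j" shows "g + h - g \<in> N j"
  using assms(2)
proof (induction rule: N.induct)
  case N_zero show ?case by (simp add: N.N_zero)
next
  case (N_step z a h)
  have "g + (tv z a + h) - g = (g + tv z a - g) + (g + h - g)"
    by (simp add: diff_conv_add_uminus add.assoc del: add_uminus_conv_diff)
  moreover have "g + tv z a - g \<in> N j"
    using conj_tv[OF assms(1) N_step(2,4)] N_tv U_Vj[OF assms(1) N_step(1)] N_step by simp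
  ultimately show ?case using N_step N_add by simp
qed

text \<open>Expand the transvection with axis \<open>u + \<delta>i w\<close>.\<close>
lemma cross_N:
  assumes "u \<in> V j n" "w \<in> V j n" "ip u u = 0" "ip w w = 0" "ip u w = 0"
  shows "Eg u w 0 \<in> N j"
proof -
  have wu: "ip w u = 0" using assms(5) by (rule ip_0_sym)
  let ?z = "u + sm \<delta>i w"
  have z: "?z \<in> V j n" "ip ?z ?z = 0" using assms wu by (auto intro: V_intros)
  have "Eg u w 0 = tv ?z \<delta> + (tv u (- \<delta>) + tv w \<delta>i)"
  proof (rule sym_eqI)
    fix x
    let ?p = "ip u x" and ?r = "ip w x"
    let ?y = "x + sm (\<delta>i * ?r) w - sm (\<delta> * ?p) u"
    have y: "act (tv u (- \<delta>) + tv w \<delta>i) x = ?y"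
      using assms wu by (simp add: act_tv s_uminus sm_minus_left)
    have "ip ?z ?y = ?p - \<delta>i * ?r" using assms wu by simp
    then have "act (tv ?z \<delta> + (tv u (- \<delta>) + tv w \<delta>i)) x = ?y + sm (\<delta> * (?p - \<delta>i * ?r)) ?z"
      using y z by (simp add: act_tv)
    also have "\<dots> = x + sm ?p w - sm ?r u"
    proof
      fix k
      have "\<delta>i * ?r * w k - \<delta> * ?p * u k + \<delta> * (?p - \<delta>i * ?r) * (u k + \<delta>i * w k)
        = ((\<delta> * \<delta>i) * ?p) * w k - ((\<delta> * \<delta>i) * ?r) * u k + (\<delta>i - (\<delta> * \<delta>i) * \<delta>i) * ?r * w k"
        by (simp only: algebra_simps)
      also have "\<dots> = ?p * w k - ?r * u k"
        using ip_e(1)[OF assms(1), of x] ip_e(1)[OF assms(2), of x] by simp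
      finally show "(?y + sm (\<delta> * (?p - \<delta>i * ?r)) ?z) k = (x + sm ?p w - sm ?r u) k"
        by (simp add: algebra_simps)
    qed
    finally show "act (Eg u w 0) x = act (tv ?z \<delta> + (tv u (- \<delta>) + tv w \<delta>i)) x"
      using assms by (simp add: act_Eg adm_def)
  qed
  also have "\<dots> \<in> N j"
    using assms z by (auto intro!: N_add N_tv simp: s_uminus)
  finally show ?thesis .
qed

text \<open>Together with \<open>isv'\<close> a hyperbolic pair in the plane of two coordinates. The
  first vector is isotropic because \<alpha> has norm \<open>- e\<close>; the element
  \<open>b\<close> of trace \<open>e\<close> corrects the second so that it is isotropic as well and
  pairs to \<open>e\<close> with the first.\<close>

definition isv :: "nat \<Rightarrow> nat \<Rightarrow> nat \<Rightarrow> 'a" where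
  "isv i k = bv i + sm \<alpha> (bv k)"
definition isv' :: "nat \<Rightarrow> nat \<Rightarrow> nat \<Rightarrow> 'a" where
  "isv' i k = sm b (bv i) - sm (s b * \<alpha>) (bv k)"

lemma norm_\<alpha>': "s \<alpha> * \<alpha> = - e" using norm_\<alpha> by (simp add: mult.commute)

lemma ip_bv_bv: "i < n \<Longrightarrow> k < n \<Longrightarrow> ip (bv i) (bv k) = (if i = k then e else 0)"
  by (simp add: ip_bv bv_apply)

lemma isv_ip:
  assumes "i < n" "k < n" "i \<noteq> k"
  shows "ip (isv i k) (isv i k) = 0" "ip (isv' i k) (isv' i k) = 0"
    "ip (isv' i k) (isv i k) = e" "ip (isv i k) (isv' i k) = e"
    "bv i = sm (s b) (isv i k) + isv' i k"
proof -
  note [simp] = ip_bv_bv assms assms(3)[symmetric]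
  show "ip (isv i k) (isv i k) = 0" using norm_\<alpha> by (simp add: isv_def mult.assoc[symmetric])
  have "ip (isv' i k) (isv' i k) = (b * s b) * e + (s b * b) * ((\<alpha> * s \<alpha>) * e)"
    by (simp add: isv'_def s_mult algebra_simps)
  then show "ip (isv' i k) (isv' i k) = 0" by (simp add: norm_\<alpha> algebra_simps)
  have "ip (isv' i k) (isv i k) = e * s b - b * ((s \<alpha> * \<alpha>) * e)"
    by (simp add: isv'_def isv_def s_mult algebra_simps)
  also have "\<dots> = e" unfolding norm_\<alpha>' using tr_b by (simp add: mult.commute[of b e] add.commute)
  finally show *: "ip (isv' i k) (isv i k) = e" .
  show "ip (isv i k) (isv' i k) = e" by (subst ip_sym) (simp add: *)
  have "sm (s b) (bv i) + sm b (bv i) = bv i"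
    using tr_b by (simp add: sm_add_left[symmetric] add.commute sm_e[OF V_bv[of 0 i n]])
  then show "bv i = sm (s b) (isv i k) + isv' i k"
    by (simp add: isv_def isv'_def sm_add algebra_simps)
qed

lemma isv_V: "j \<le> i \<Longrightarrow> i < l \<Longrightarrow> j \<le> k \<Longrightarrow> k < l \<Longrightarrow> isv i k \<in> V j l \<and> isv' i k \<in> V j l"
  by (simp add: isv_def isv'_def V_intros)

text \<open>The hyperbolic pair in the first two coordinates of \<open>V j n\<close>.\<close>
abbreviation u0 where "u0 j \<equiv> isv j (Suc j)"
abbreviation u1 where "u1 j \<equiv> isv' j (Suc j)"

lemma isv_decomp:
  assumes "x \<in> V j (j + 2)" "j + 2 \<le> n"
  shows "x = sm (ip (u1 j) x) (u0 j) + sm (ip (u0 j) x) (u1 j)"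
proof -
  have j: "j < n" "Suc j < n" using assms(2) by auto
  let ?f = "\<lambda>x. sm (ip (u1 j) x) (u0 j) + sm (ip (u0 j) x) (u1 j)"
  have 1: "?f (bv j) = bv j"
  proof -
    have "ip (u1 j) (bv j) = s b" "ip (u0 j) (bv j) = e" using j by (simp_all add: isv_def isv'_def ip_bv_bv mult.commute)
    then show ?thesis using isv_ip(5)[OF j] sm_e[OF conjunct2[OF isv_V[of j j "j+2" "Suc j"]]] by simp
  qed
  have 2: "?f (bv (Suc j)) = bv (Suc j)"
  proof -
    have "ip (u1 j) (bv (Suc j)) = - (b * s \<alpha>)" "ip (u0 j) (bv (Suc j)) = s \<alpha>"
      using j by (simp_all add: isv_def isv'_def ip_bv_bv s_mult mult_ac)
    then have "?f (bv (Suc j)) = sm (- (b * s \<alpha>)) (u0 j) + sm (s \<alpha>) (u1 j)" by simp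
    also have "\<dots> = sm (- (s \<alpha> * \<alpha>) * b - (s \<alpha> * \<alpha>) * s b) (bv (Suc j))"
      by (simp add: isv_def isv'_def fun_eq_iff algebra_simps)
    also have "- (s \<alpha> * \<alpha>) * b - (s \<alpha> * \<alpha>) * s b = e" using tr_b by (simp add: norm_\<alpha>')
    also have "sm e (bv (Suc j)) = bv (Suc j)" using sm_e[OF V_bv[of 0 "Suc j" n]] j by simp
    finally show ?thesis .
  qed
  from assms(1) show ?thesis
  proof (induction rule: V_induct)
    case zero have "(0::nat \<Rightarrow> 'a) = ?f 0" by simp then show ?case .
  next
    case (add x y)
    have "?f (x + y) = ?f x + ?f y" by (simp add: sm_add_left algebra_simps)
    then have "?f (x + y) = x + y" using add[symmetric] by simp
    then have "x + y = ?f (x + y)" by (rule sym)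
    then show ?case .
  next
    case (bv c i)
    then have "i = j \<or> i = Suc j" by auto
    moreover have "?f (sm c (bv i)) = sm c (?f (bv i))" by (simp add: sm_add)
    moreover have "?f (bv i) = bv i" using \<open>i = j \<or> i = Suc j\<close> 1 2 by (elim disjE) (simp_all only:)
    ultimately have "?f (sm c (bv i)) = sm c (bv i)" by (simp only:)
    then have "sm c (bv i) = ?f (sm c (bv i))" by (rule sym)
    then show ?case .
  qed
qed

lemma Eg_tv: 
  assumes "adm u w a" "s a' = - a'"
  shows "Eg u w a + tv u a' = Eg u w (a + a')" "adm u w (a + a')"
  using Eg_add[OF assms(1) adm_tv[OF _ assms(2)]] assms(1) by (auto simp: tv_def adm_def)

text \<open>For given \<open>w\<close> the admissible third parameters form a coset of the skew
  elements; an element \<open>b\<close> of trace \<open>e\<close> singles out one of them without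
  dividing by 2.\<close>

lemma adm_b: "ip u u = 0 \<Longrightarrow> ip u w = 0 \<Longrightarrow> w \<in> V j l \<Longrightarrow> adm u w (- (b * ip w w))"
proof -
  assume a: "ip u u = 0" "ip u w = 0" "w \<in> V j l"
  have "s (ip w w) = ip w w" by (metis ip_sym)
  then have "- (b * ip w w) + s (- (b * ip w w)) = - ((b + s b) * ip w w)"
    by (simp add: s_uminus s_mult algebra_simps)
  then show ?thesis using a ip_e(1)[OF a(3)] by (simp add: adm_def tr_b)
qed

text \<open>Isotropic \<open>w\<close> are covered by \<open>cross_N\<close>, and every multiple of
  a basis vector is a sum of two isotropic vectors taken from a hyperbolic pair; two coordinates
  beyond \<open>l\<close> guarantee a partner coordinate for it. Changing the third parameter for
  the same \<open>w\<close> multiplies by a transvection with axis \<open>u\<close>.\<close>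

lemma Eg_N:
  assumes u: "u \<in> V j l" "ip u u = 0" and w: "w \<in> V l n" and l: "j \<le> l" "l + 2 \<le> n"
    and "adm u w a" "e * a = a"
  shows "Eg u w a \<in> N j"
proof -
  have uw: "ip u x = 0" if "x \<in> V l n" for x using ip_disjoint[OF u(1) that] by simp
  have uj: "u \<in> V j n" using V_mono[OF u(1)] l by auto
  define P where "P x \<longleftrightarrow> x \<in> V l n \<and> (\<exists>a. adm u x a \<and> e * a = a \<and> Eg u x a \<in> N j)" for x
  have P_all: "Eg u x a \<in> N j" if "P x" "adm u x a" "e * a = a" for x a
  proof -
    obtain a0 where a0: "adm u x a0" "e * a0 = a0" "Eg u x a0 \<in> N j" using \<open>P x\<close> unfolding P_def by blast
    have sk: "s (a - a0) = - (a - a0)"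
    proof -
      have "a + s a = a0 + s a0" using a0(1) that(2) by (simp add: adm_def)
      then show ?thesis by (simp add: s_diff algebra_simps)
    qed
    have "tv u (a - a0) \<in> N j" by (rule N_tv[OF uj u(2) _ sk]) (simp add: right_diff_distrib a0 that)
    then have "Eg u x a0 + tv u (a - a0) \<in> N j" using N_add a0(3) by blast
    then show ?thesis using Eg_tv(1)[OF a0(1) sk] by simp
  qed
  have P_add: "P (x + y)" if "P x" "P y" for x y
  proof -
    obtain a a' where a: "adm u x a" "e * a = a" "Eg u x a \<in> N j" "adm u y a'" "e * a' = a'" "Eg u y a' \<in> N j"
      and V: "x \<in> V l n" "y \<in> V l n" using \<open>P x\<close> \<open>P y\<close> unfolding P_def by blast
    have "e * (a + a' - ip x y) = a + a' - ip x y" using a ip_e(1)[OF V(1)] by (simp add: algebra_simps)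
    then show ?thesis
      unfolding P_def using Eg_add[OF a(1,4)] N_add[OF a(3,6)] V_add[OF V] by auto
  qed
  have P_iso: "P x" if "x \<in> V l n" "ip x x = 0" for x
    unfolding P_def
    using cross_N[OF uj V_mono[OF that(1)] u(2) that(2) uw[OF that(1)]] that l(1) uw[OF that(1)] u(2)
    by (auto intro!: exI[of _ 0] simp: adm_def)
  have "P w" using w
  proof (induction rule: V_induct)
    case zero have "P 0" by (rule P_iso) auto
    then show ?case .
  next
    case (add x y) then show ?case by (rule P_add)
  next
    case (bv c i)
    obtain k where k: "l \<le> k" "k < n" "k \<noteq> i"
      using that[of l] that[of "Suc l"] l(2) by (cases "i = l") auto
    have "P (sm (c * s b) (isv i k))" "P (sm c (isv' i k))"
      using isv_ip[of i k] isv_V[of l i n k] k bv by (auto intro!: P_iso V_sm)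
    then have "P (sm (c * s b) (isv i k) + sm c (isv' i k))" by (rule P_add)
    moreover have "sm (c * s b) (isv i k) + sm c (isv' i k) = sm c (bv i)"
      using isv_ip(5)[of i k] k bv by (simp add: sm_add)
    ultimately show ?case by metis
  qed
  then show ?thesis using P_all assms by blast
qed

end


context hgeom
begin

subsection \<open>Transitivity\<close>

definition idem :: "'a \<Rightarrow> bool" where "idem p \<longleftrightarrow> e * p = p \<and> p * p = p"

text \<open>The principal ideal of \<open>A\<close> generated by \<open>d\<close>. Its cardinality
  measures how close \<open>d\<close> is to being a unit and is the quantity to be
  maximised.\<close>

definition idl :: "'a \<Rightarrow> 'a set" where "idl d = (\<lambda>c. c * d) ` A"

lemma finite_idl [simp]: "finite (idl d)" by (simp add: idl_def)

lemma u0_facts: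
  assumes "j + 2 \<le> n"
  shows "u0 j \<in> V j (j + 2)" "u1 j \<in> V j (j + 2)" "u0 j \<in> V j n" "u1 j \<in> V j n"
    "ip (u0 j) (u0 j) = 0" "ip (u1 j) (u1 j) = 0" "ip (u1 j) (u0 j) = e" "ip (u0 j) (u1 j) = e"
    "bv j = sm (s b) (u0 j) + u1 j"
  using isv_V[of j j "j+2" "Suc j"] isv_V[of j j n "Suc j"] isv_ip[of j "Suc j"] assms by auto

text \<open>The idempotent \<open>p\<close> marks a component of \<open>A\<close> in which the
  pairing with \<open>u0 j\<close> vanishes although \<open>y\<close> has a nonzero coordinate
  there. A root element along an isotropic \<open>v\<close> with
  \<open>p * ip v y \<noteq> 0\<close> adds \<open>p * ip v y\<close> to the pairing. The old value
  is \<open>e - p\<close> times the new one, so the ideal strictly grows.\<close>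

lemma enlarge:
  assumes n: "j + 5 \<le> n" and y: "y \<in> V j n" and p: "idem p" "p * ip (u0 j) y = 0"
    and i: "j + 2 \<le> i" "p * y i \<noteq> 0"
  shows "\<exists>g\<in>N j. card (idl (ip (u0 j) (act g y))) > card (idl (ip (u0 j) y))"
proof -
  have jn: "j + 2 \<le> n" using n by simp
  note u = u0_facts[OF jn]
  have i_n: "i < n" using i(2) V_out[OF y, of i] by (cases "i < n") auto
  \<comment> \<open>\<open>k\<close> completes \<open>i\<close> to a plane carrying
    \<open>v\<close>, and \<open>m\<close> gives room for a vector \<open>w\<close> orthogonal to
    \<open>v\<close>. Three coordinates beyond the first plane are required, whence
    \<open>j + 5 \<le> n\<close>.\<close>
  obtain k m where km: "j + 2 \<le> k" "k < n" "j + 2 \<le> m" "m < n" "k \<noteq> i" "m \<noteq> i" "k \<noteq> m"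
  proof -
    consider "i = j + 2" | "i = j + 3" | "i > j + 3" using i by linarith
    then show ?thesis
    proof cases
      case 1 show ?thesis by (rule that[of "j+3" "j+4"]) (use 1 n in auto)
    next
      case 2 show ?thesis by (rule that[of "j+2" "j+4"]) (use 2 n in auto)
    next
      case 3 show ?thesis by (rule that[of "j+2" "j+3"]) (use 3 n in auto)
    qed
  qed
  let ?d = "ip (u0 j) y"
  obtain v where v: "v \<in> V (j + 2) n" "ip v v = 0" "p * ip v y \<noteq> 0" "\<forall>x. v x \<noteq> 0 \<longrightarrow> x = i \<or> x = k"
  proof -
    have out: "\<forall>x. sm (s b) (isv i k) x \<noteq> 0 \<longrightarrow> x = i \<or> x = k" "\<forall>x. isv' i k x \<noteq> 0 \<longrightarrow> x = i \<or> x = k"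
      by (auto simp: isv_def isv'_def bv_apply)
    have "bv i = sm (s b) (isv i k) + isv' i k" using isv_ip(5)[of i k] i_n km by auto
    then have "ip (bv i) y = ip (sm (s b) (isv i k)) y + ip (isv' i k) y" by (metis ip_simps(2))
    then have "p * ip (sm (s b) (isv i k)) y + p * ip (isv' i k) y \<noteq> 0"
      using i(2) ip_bv(1)[OF i_n] V_e[OF y] by (simp add: distrib_left[symmetric])
    then have "p * ip (sm (s b) (isv i k)) y \<noteq> 0 \<or> p * ip (isv' i k) y \<noteq> 0" by auto
    then show ?thesis
    proof
      assume 1: "p * ip (sm (s b) (isv i k)) y \<noteq> 0"
      have 2: "sm (s b) (isv i k) \<in> V (j + 2) n" "ip (sm (s b) (isv i k)) (sm (s b) (isv i k)) = 0"
        using isv_V[of "j+2" i n k] isv_ip(1)[of i k] i i_n km by (simp_all add: V_sm)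
      show ?thesis by (rule that[OF 2 1 out(1)])
    next
      assume "p * ip (isv' i k) y \<noteq> 0"
      then show ?thesis
        using that[OF _ _ _ out(2)] isv_V[of "j+2" i n k] isv_ip(2)[of i k] i i_n km by simp
    qed
  qed
  define w where "w = isv j m"
  have w: "w \<in> V j n" "ip w w = 0"
    using isv_V[of j j n m] isv_ip(1)[of j m] km n by (auto simp: w_def)
  have uw: "ip (u0 j) w = e"
    using n km by (simp add: w_def isv_def ip_bv_bv)
  have "v j = 0" "v m = 0" using v(1,4) V_out[OF v(1), of j] km by auto
  then have vw: "ip v w = 0"
    using n km by (simp add: w_def isv_def ip_bv)
  have uv: "ip (u0 j) v = 0" by (rule ip_disjoint[OF u(1) v(1)]) simp
  have vj: "v \<in> V j n" using V_mono[OF v(1)] by simp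
  have pv: "ip v (sm p w) = 0" "ip (sm p w) (sm p w) = 0" using vw w by auto
  define g where "g = Eg v (sm p w) 0"
  have g: "g \<in> N j" unfolding g_def by (rule cross_N[OF vj V_sm[OF w(1)] v(2) pv(2,1)])
  have adm: "adm v (sm p w) 0" using pv v(2) by (simp add: adm_def)
  define d' where "d' = ip (u0 j) (act g y)"
  have pp: "p * p = p" "e * p = p" using p(1) by (auto simp: idem_def)
  have "d' = ?d + ip v y * (e * p)"
    using uw uv by (simp add: d'_def g_def act_Eg[OF adm] mult_ac)
  then have d': "d' = ?d + p * ip v y" using pp by (simp add: mult.commute)
  have pd': "p * d' = p * ip v y" using p(2) pp by (simp add: d' distrib_left mult.assoc[symmetric])
  have d: "?d = (e - p) * d'"
  proof -
    have "(e - p) * d' = (e * ?d - p * ?d) + (e * p - p * p) * ip v y"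
      unfolding d' by (simp only: algebra_simps)
    then show ?thesis using p(2) pp ip_e(2)[OF y, of "u0 j"] by simp
  qed
  have "idl ?d \<subseteq> idl d'"
  proof
    fix x assume "x \<in> idl ?d"
    then obtain c where "c \<in> A" "x = c * ?d" by (auto simp: idl_def)
    then have "x = (c * (e - p)) * d'" using d by (simp add: mult.assoc)
    moreover have "c * (e - p) \<in> A" using \<open>c \<in> A\<close> by (simp add: in_A mult.assoc[symmetric])
    ultimately show "x \<in> idl d'" unfolding idl_def by (rule image_eqI)
  qed
  moreover have "p * d' \<in> idl d'" using pp by (auto simp: idl_def in_A)
  moreover have "p * d' \<notin> idl ?d"
  proof
    assume "p * d' \<in> idl ?d"
    then obtain c where "p * d' = c * ?d" by (auto simp: idl_def)
    then have "p * (p * d') = c * (p * ?d)" by (simp add: mult.left_commute)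
    then show False using p(2) pd' v(3) pp by (simp add: mult.assoc[symmetric])
  qed
  ultimately have "idl ?d \<subset> idl d'" by blast
  then show ?thesis using g by (intro bexI[of _ g]) (auto simp: d'_def intro: psubset_card_mono)
qed

lemma act_N: "g \<in> N j \<Longrightarrow> x \<in> V j n \<Longrightarrow> act g x \<in> V j n"
  using U_Vj N_U by blast

text \<open>Choose \<open>g\<close> with the largest possible ideal generated by \<open>ip (u0 j) (act g x)\<close>.\<close>
lemma move_max:
  assumes n: "j + 5 \<le> n" and x: "x \<in> V j n"
  shows "\<exists>g\<in>N j. act g x \<in> V j (j + 2) \<and>
    (\<forall>p. idem p \<and> p * ip (u0 j) (act g x) = 0 \<longrightarrow> sm p (act g x) = 0)"
proof -
  have jn: "j + 2 \<le> n" using n by simp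
  note u = u0_facts[OF jn]
  let ?m = "\<lambda>g. card (idl (ip (u0 j) (act g x)))"
  have "\<forall>g. g \<in> N j \<longrightarrow> ?m g < Suc (card A)"
    by (auto simp: idl_def less_Suc_eq_le intro: card_image_le)
  then obtain g0 where g0: "g0 \<in> N j" and max: "\<And>g. g \<in> N j \<Longrightarrow> ?m g \<le> ?m g0"
    using ex_has_greatest_nat[of "\<lambda>g. g \<in> N j" 0 ?m "Suc (card A)"] N.N_zero by auto
  define y where "y = act g0 x"
  define d where "d = ip (u0 j) y"
  have y: "y \<in> V j n" unfolding y_def by (rule act_N[OF g0 x])
  have max': "card (idl (ip (u0 j) (act g y))) \<le> card (idl d)" if "g \<in> N j" for g
    using max[OF N_add[OF that g0]] by (simp add: y_def d_def)
  have "\<exists>c. e * c = c \<and> y i = c * d" if "j + 2 \<le> i" for i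
  proof -
    have "\<not> (e * p = p \<and> p * p = p \<and> p * d = 0 \<and> p * y i \<noteq> 0)" for p
      using enlarge[OF n y, of p i] max' that by (fastforce simp: idem_def d_def)
    then show ?thesis using dvd_or_idem[of d "y i"] ip_e(2)[OF y] V_e[OF y] unfolding d_def by blast
  qed
  then obtain c where c: "\<And>i. j + 2 \<le> i \<Longrightarrow> e * c i = c i \<and> y i = c i * d" by metis
  \<comment> \<open>In every coordinate beyond the first plane \<open>y i\<close> is a multiple of
    \<open>d\<close>, so a single root element with axis \<open>u0 j\<close> clears all of
    them.\<close>
  define w where "w = (\<lambda>i. if j + 2 \<le> i \<and> i < n then - c i else 0)"
  have w: "w \<in> V (j + 2) n" using c by (auto simp: w_def V_def)
  have uw: "ip (u0 j) w = 0" by (rule ip_disjoint[OF u(1) w]) simp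
  define g1 where "g1 = Eg (u0 j) w (- (b * ip w w))"
  have adm: "adm (u0 j) w (- (b * ip w w))" by (rule adm_b[OF u(5) uw w])
  have g1: "g1 \<in> N j"
    unfolding g1_def by (rule Eg_N[OF u(1,5) w _ _ adm]) (use n in \<open>simp_all add: mult.assoc[symmetric]\<close>)
  define z where "z = act g1 y"
  have zd: "ip (u0 j) z = d" by (simp add: z_def g1_def act_Eg[OF adm] uw u(5) d_def)
  have z: "z \<in> V j n" unfolding z_def by (rule act_N[OF g1 y])
  have "z i = 0" if "j + 2 \<le> i" for i
  proof (cases "i < n")
    case True
    have "z i = y i + d * w i" using V_out[OF u(1), of i] that
      by (simp add: z_def g1_def act_Eg[OF adm] d_def)
    then show ?thesis using c[OF that] that True by (simp add: w_def mult.commute)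
  qed (use V_out[OF z] in auto)
  then have z2: "z \<in> V j (j + 2)" using z by (auto simp: V_def)
  have maxz: "card (idl (ip (u0 j) (act g z))) \<le> card (idl d)" if "g \<in> N j" for g
    using max'[OF N_add[OF that g1]] by (simp add: z_def)
  \<comment> \<open>If \<open>p\<close> killed \<open>d\<close> but not \<open>z\<close>, it would
    not kill the other coefficient \<open>X\<close>. A root element with axis \<open>u1 j\<close>
    keeps the pairing \<open>d\<close> and copies \<open>X\<close> into a coordinate beyond the
    plane, where \<open>enlarge\<close> contradicts maximality.\<close>
  have "sm p z = 0" if p: "idem p" "p * d = 0" for p
  proof (rule ccontr)
    assume nz: "sm p z \<noteq> 0"
    define X where "X = ip (u1 j) z"
    have zX: "z = sm X (u0 j) + sm d (u1 j)" unfolding X_def by (rule isv_decomp[OF z2 jn, unfolded zd])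
    have pX: "p * X \<noteq> 0"
    proof
      assume "p * X = 0"
      then have "sm p z = 0" by (subst zX) (simp add: sm_add p)
      then show False using nz by simp
    qed
    define ww where "ww = isv (j + 2) (j + 3)"
    have w': "ww \<in> V (j + 2) n" "ip ww ww = 0" "ww (j + 2) = e"
      using isv_V[of "j+2" "j+2" n "j+3"] isv_ip(1)[of "j+2" "j+3"] n by (auto simp: ww_def isv_def bv_apply)
    have u1w: "ip (u1 j) ww = 0" "ip (u0 j) ww = 0"
      by (rule ip_disjoint[OF u(2) w'(1)], simp, rule ip_disjoint[OF u(1) w'(1)], simp)
    have wz: "ip ww z = 0" by (rule ip_disjoint[OF w'(1) z2]) simp
    define g where "g = Eg (u1 j) ww 0"
    have g: "g \<in> N j"
      unfolding g_def by (rule cross_N[OF u(4) V_mono[OF w'(1)] u(6) w'(2) u1w(1)]) auto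
    have adm: "adm (u1 j) ww 0" using u w' u1w by (simp add: adm_def)
    have gz: "act g z = z + sm X ww" using wz u(6) by (simp add: g_def act_Eg[OF adm] X_def)
    have "p * ip (u0 j) (act g z) = 0" using gz u1w zd p by simp
    moreover have "p * act g z (j + 2) \<noteq> 0"
      using gz w' pX V_out[OF z2, of "j + 2"] ip_e(1)[OF u(4), of z]
      by (simp add: X_def mult.commute[of _ e])
    ultimately obtain h where h: "h \<in> N j" "card (idl (ip (u0 j) (act h (act g z)))) > card (idl (ip (u0 j) (act g z)))"
      using enlarge[OF n act_N[OF g z] p(1)] by blast
    moreover have "ip (u0 j) (act g z) = d" using gz u1w zd by simp
    ultimately show False using maxz[OF N_add[OF h(1) g]] by simp
  qed
  then show ?thesis using z2 zd N_add[OF g1 g0] by (intro bexI[of _ "g1 + g0"]) (auto simp: z_def y_def)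
qed

lemma move2:
  assumes "j + 5 \<le> n" "x \<in> V j n" shows "\<exists>g\<in>N j. act g x \<in> V j (j + 2)"
  using move_max[OF assms] by blast

text \<open>An auxiliary hyperbolic pair \<open>v0\<close>, \<open>v1\<close> in the next plane
  transports the correction. Since the pairing \<open>d\<close> is a unit, a root element with axis
  \<open>u0 j\<close> can add exactly \<open>v0\<close> to \<open>y\<close>; one with axis
  \<open>v1\<close> then detects this \<open>v0\<close> and adds \<open>e - d\<close> to the
  pairing.\<close>

lemma move_unit:
  assumes n: "j + 5 \<le> n" and y: "y \<in> V j (j + 2)" and c: "e * c = c" "c * ip (u0 j) y = e"
  shows "\<exists>g\<in>N j. act g y \<in> V j n \<and> ip (u0 j) (act g y) = e"
proof -
  have jn: "j + 2 \<le> n" using n by simp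
  note u = u0_facts[OF jn]
  define v0 where "v0 = isv (j + 2) (j + 3)"
  define v1 where "v1 = isv' (j + 2) (j + 3)"
  have v: "v0 \<in> V (j + 2) n" "v1 \<in> V (j + 2) n" "ip v0 v0 = 0" "ip v1 v1 = 0" "ip v1 v0 = e"
    using isv_V[of "j+2" "j+2" n "j+3"] isv_ip[of "j+2" "j+3"] n by (simp_all add: v0_def v1_def)
  have vj: "v0 \<in> V j n" "v1 \<in> V j n" using v V_mono by auto
  have uv: "ip (u0 j) v0 = 0" "ip (u0 j) v1 = 0" "ip (u1 j) v1 = 0" "ip v1 (u1 j) = 0" "ip v1 y = 0" "ip v0 y = 0"
    using ip_disjoint[OF u(1) v(1)] ip_disjoint[OF u(1) v(2)] ip_disjoint[OF u(2) v(2)]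
      ip_disjoint[OF v(2) u(2)] ip_disjoint[OF v(2) y] ip_disjoint[OF v(1) y] by simp_all
  define d where "d = ip (u0 j) y"
  have yj: "y \<in> V j n" using V_mono[OF y] jn by simp
  define g1 where "g1 = Eg (u0 j) (sm c v0) 0"
  have g1: "g1 \<in> N j"
    unfolding g1_def by (rule cross_N[OF u(3) V_sm[OF vj(1)] u(5)]) (simp_all add: v(3) uv(1))
  have adm1: "adm (u0 j) (sm c v0) 0" by (simp add: adm_def u(5) uv(1) v(3))
  have dc: "d * c = e" using c(2) by (simp add: d_def mult.commute)
  have "act g1 y = y + sm (d * c) v0" using uv by (simp add: g1_def act_Eg[OF adm1] d_def)
  then have y1: "act g1 y = y + v0" unfolding dc sm_e[OF v(1)] .
  define g2 where "g2 = Eg v1 (sm (e - d) (u1 j)) 0"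
  have g2: "g2 \<in> N j"
    unfolding g2_def by (rule cross_N[OF vj(2) V_sm[OF u(4)] v(4)]) (simp_all add: u(6) uv(4))
  have adm2: "adm v1 (sm (e - d) (u1 j)) 0" by (simp add: adm_def u(6) uv(4) v(4))
  have ed: "e * d = d" unfolding d_def by (rule ip_e(1)[OF u(1)])
  have h: "e * (e - d) * e = e - d" using ed by (simp add: right_diff_distrib left_diff_distrib mult.commute[of d e])
  have "ip (u0 j) (act g2 (y + v0)) = d + e * (e - d) * e"
    by (simp add: g2_def act_Eg[OF adm2] d_def[symmetric] uv v(5) u(8))
  then have "ip (u0 j) (act (g2 + g1) y) = e" unfolding act_add y1 h by (simp only: add_diff_cancel_left' diff_add_cancel add_diff_eq)
  then show ?thesis using N_add[OF g2 g1] act_N[OF N_add[OF g2 g1] yj] by blast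
qed

text \<open>With pairing \<open>e\<close> the coordinates beyond the plane are cleared by one root
  element. The result is \<open>Y u0 + u1\<close>, where the norm prescribes the trace of
  \<open>Y\<close>; hence \<open>X - Y\<close> is skew and a transvection with axis
  \<open>u0 j\<close> adjusts the coefficient.\<close>

lemma move_normal:
  assumes n: "j + 5 \<le> n" and y: "y \<in> V j n" and c: "ip (u0 j) y = e"
    and X: "e * X = X" "X + s X = ip y y"
  shows "\<exists>g\<in>N j. act g y = sm X (u0 j) + u1 j"
proof -
  have jn: "j + 2 \<le> n" using n by simp
  note u = u0_facts[OF jn]
  define w where "w = (\<lambda>i. if j + 2 \<le> i then - y i else 0)"
  have w: "w \<in> V (j + 2) n" using V_e[OF y] V_out[OF y] by (auto simp: w_def V_def)
  have uw: "ip (u0 j) w = 0" by (rule ip_disjoint[OF u(1) w]) simp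
  define g1 where "g1 = Eg (u0 j) w (- (b * ip w w))"
  have adm: "adm (u0 j) w (- (b * ip w w))" by (rule adm_b[OF u(5) uw w])
  have g1: "g1 \<in> N j"
    unfolding g1_def by (rule Eg_N[OF u(1,5) w _ _ adm]) (use n in \<open>simp_all add: mult.assoc[symmetric]\<close>)
  define z where "z = act g1 y"
  have zd: "ip (u0 j) z = e" by (simp add: z_def g1_def act_Eg[OF adm] uw u(5) c)
  have z: "z \<in> V j n" unfolding z_def by (rule act_N[OF g1 y])
  have "z i = 0" if "j + 2 \<le> i" for i
  proof -
    have "z i = y i + e * w i" using V_out[OF u(1), of i] that
      by (simp add: z_def g1_def act_Eg[OF adm] c)
    then show ?thesis using V_e[OF y, of i] that by (simp add: w_def)
  qed
  then have z2: "z \<in> V j (j + 2)" using z by (auto simp: V_def)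
  define Y where "Y = ip (u1 j) z"
  have eY: "e * Y = Y" unfolding Y_def by (rule ip_e(1)[OF u(4)])
  have zY: "z = sm Y (u0 j) + u1 j" unfolding Y_def by (rule isv_decomp[OF z2 jn, unfolded zd sm_e[OF u(2)]])
  have "ip z z = Y * e + s Y * e" by (subst (1 2) zY) (simp add: u add.commute)
  moreover have "ip z z = ip y y" using UD(3)[OF N_U[OF g1]] by (simp add: z_def)
  ultimately have "X + s X = Y + s Y" using X e_s[OF eY] eY by (simp add: mult.commute)
  then have sk: "s (X - Y) = - (X - Y)" by (simp add: s_diff algebra_simps)
  have g2: "tv (u0 j) (X - Y) \<in> N j" by (rule N_tv[OF u(3,5) _ sk]) (simp add: right_diff_distrib X eY)
  have XY: "(X - Y) * e = X - Y" using X eY by (simp add: right_diff_distrib mult.commute[of _ e])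
  have "act (tv (u0 j) (X - Y)) z = z + sm ((X - Y) * e) (u0 j)" by (simp add: act_tv[OF u(5) sk] zd)
  then have "act (tv (u0 j) (X - Y)) z = (sm Y (u0 j) + u1 j) + sm (X - Y) (u0 j)"
    unfolding XY using zY by (simp only:)
  then have "act (tv (u0 j) (X - Y)) z = sm X (u0 j) + u1 j"
    by (simp add: sm_add_left[symmetric] add_ac) (simp add: fun_eq_iff algebra_simps)?
  then show ?thesis using N_add[OF g2 g1] by (intro bexI[of _ "tv (u0 j) (X - Y) + g1"]) (simp_all add: z_def)
qed

text \<open>Over a field this means nonzero; over F_q x F_q it means that both components of the
  vector are nonzero.\<close>

definition prim :: "(nat \<Rightarrow> 'a) \<Rightarrow> bool" where
  "prim x \<longleftrightarrow> (\<forall>p. idem p \<and> sm p x = 0 \<longrightarrow> p = 0)"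

text \<open>An idempotent killing the pairing produced by \<open>move_max\<close> kills the vector
  itself, so for a primitive vector this pairing is a unit. The normal form depends only on the
  norm, once \<open>X\<close> is chosen with that trace; this is the transitivity behind the
  Witt-type statements below.\<close>

lemma move_prim:
  assumes n: "j + 5 \<le> n" and x: "x \<in> V j n" "prim x" and X: "e * X = X" "X + s X = ip x x"
  shows "\<exists>g\<in>N j. act g x = sm X (u0 j) + u1 j"
proof -
  obtain g where g: "g \<in> N j" "act g x \<in> V j (j + 2)"
    "\<And>p. idem p \<Longrightarrow> p * ip (u0 j) (act g x) = 0 \<Longrightarrow> sm p (act g x) = 0"
    using move_max[OF n x(1)] by blast
  let ?d = "ip (u0 j) (act g x)"
  note gU = N_U[OF g(1)]
  have "\<not> (e * p = p \<and> p * p = p \<and> p * ?d = 0 \<and> p * e \<noteq> 0)" for p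
  proof
    assume p: "e * p = p \<and> p * p = p \<and> p * ?d = 0 \<and> p * e \<noteq> 0"
    then have "sm p (act g x) = 0" using g(3) by (simp add: idem_def)
    then have "act g (sm p x) = act g 0" using UD(2)[OF gU] U_lin(1)[OF gU] by simp
    then have "sm p x = 0" by (simp only: act_inj)
    then have "p = 0" using x(2) p by (auto simp: prim_def idem_def)
    then show False using p by simp
  qed
  then obtain c where c: "e * c = c" "c * ?d = e"
    using dvd_or_idem[of ?d e] ip_e(2)[OF g(2)] by (metis e_e)
  obtain h where h: "h \<in> N j" "act h (act g x) \<in> V j n" "ip (u0 j) (act h (act g x)) = e"
    using move_unit[OF n g(2) c] by blast
  have "ip (act h (act g x)) (act h (act g x)) = ip x x"
    by (simp add: UD(3)[OF gU] UD(3)[OF N_U[OF h(1)]])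
  then obtain k where "k \<in> N j" "act k (act h (act g x)) = sm X (u0 j) + u1 j"
    using move_normal[OF n h(2,3) X(1)] X(2) by auto
  then show ?thesis using N_add[OF _ N_add[OF h(1) g(1)]] by (intro bexI[of _ "k + (h + g)"]) auto
qed

text \<open>The complementary idempotent \<open>r = e - p\<close> satisfies
  \<open>r * s r = 0\<close> and \<open>r z = z\<close>. The transvection contains \<open>z\<close>
  once directly and once conjugated inside \<open>ip\<close>, hence the factor
  \<open>r * s r\<close>. Over a field only \<open>z = 0\<close> is affected; over F_q x F_q these
  are the vectors with a vanishing component.\<close>

lemma tv_trivial_or_prim:
  assumes z: "z \<in> V j n" "ip z z = 0" and np: "\<not> prim z" "s a = - a"
  shows "tv z a = 0"
proof -
  obtain p where p: "idem p" "sm p z = 0" "p \<noteq> 0" using np by (auto simp: prim_def)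
  have pp: "e * p = p" "p * p = p" using p(1) by (auto simp: idem_def)
  let ?r = "e - p"
  have r: "?r * s ?r = 0"
    by (rule idem_iso) (use pp p(3) in \<open>auto simp: algebra_simps\<close>)
  have "sm ?r z = sm e z - sm p z" by (simp add: fun_eq_iff left_diff_distrib)
  then have zr: "sm ?r z = z" using sm_e[OF z(1)] p(2) by simp
  show ?thesis
  proof (rule sym_eqI)
    fix x
    have "sm (a * ip z x) z = sm (a * ip (sm ?r z) x) (sm ?r z)" by (simp only: zr)
    also have "\<dots> = sm ((?r * s ?r) * (a * ip z x)) z" by (simp add: fun_eq_iff mult_ac del: s_e)
    finally have "sm (a * ip z x) z = 0" by (simp add: r)
    then show "act (tv z a) x = act 0 x" using act_tv[OF z(2) np(2)] by simp
  qed
qed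

lemma move_isotropic:
  assumes "j + 5 \<le> n" "z \<in> V j n" "ip z z = 0" "prim z"
  shows "\<exists>g\<in>N j. act g z = u1 j"
  using move_prim[OF assms(1,2,4), of 0] assms(3) by simp

lemma move_norm_1:
  assumes n: "j + 5 \<le> n" and x: "x \<in> V j n" "ip x x = e"
  shows "\<exists>g\<in>N j. act g x = bv j"
proof -
  have "prim x" unfolding prim_def
  proof (intro allI impI, elim conjE)
    fix p assume p: "idem p" "sm p x = 0"
    then have "p * ip x x = 0" by (metis ip_simps(7,9))
    then show "p = 0" using p x(2) by (simp add: idem_def mult.commute)
  qed
  then show ?thesis
    using move_prim[OF n x(1), of "s b"] x(2) tr_b u0_facts(9)[of j] n by (simp add: add.commute)
qed

text \<open>After \<open>x\<close> has been moved into the plane it pairs to some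
  \<open>d \<noteq> 0\<close> with one of the two isotropic basis vectors. Root elements along that
  vector write \<open>d * c * t i\<close> into the free coordinates, and the trace recovers every
  \<open>t i\<close> in \<open>F\<close> because \<open>c * d\<close> has trace \<open>e\<close>.
  The argument also covers a zero divisor \<open>d\<close>.\<close>

lemma orbit_card:
  assumes n: "j + 5 \<le> n" and x: "x \<in> V j n" "x \<noteq> 0"
  shows "card ((\<lambda>g. act g x) ` N j) \<ge> q ^ (n - j - 2)"
proof -
  have jn: "j + 2 \<le> n" using n by simp
  note u = u0_facts[OF jn]
  obtain g where g: "g \<in> N j" "act g x \<in> V j (j + 2)" using move2[OF n x(1)] by blast
  define y where "y = act g x"
  have y: "y \<in> V j (j + 2)" using g by (simp add: y_def)
  have "y \<noteq> 0" using x(2) act_inj[of g x 0] U_lin(1)[OF N_U[OF g(1)]] by (simp add: y_def)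
  then have "ip (u0 j) y \<noteq> 0 \<or> ip (u1 j) y \<noteq> 0" using isv_decomp[OF y jn] by (metis add_0 sm_0(1))
  then obtain v where v: "v \<in> V j (j + 2)" "ip v v = 0" "ip v y \<noteq> 0" using u by blast
  define d where "d = ip v y"
  obtain c where c: "e * c = c" "c * d + s (c * d) = e"
    using trace_onto[of d] v(3) ip_e(1)[OF v(1)] by (auto simp: d_def)
  define w where "w t = (\<lambda>i. if j + 2 \<le> i \<and> i < n then c * t i else 0)" for t
  define g' where "g' t = Eg v (w t) (- (b * ip (w t) (w t)))" for t
  let ?T = "{j+2..<n} \<rightarrow>\<^sub>E F"
  have w: "w t \<in> V (j + 2) n" for t using c(1) by (auto simp: w_def V_def mult.assoc[symmetric])
  have adm: "adm v (w t) (- (b * ip (w t) (w t)))" for t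
    by (rule adm_b[OF v(2) _ w]) (rule ip_disjoint[OF v(1) w], simp)
  have gN: "g' t \<in> N j" for t
    unfolding g'_def by (rule Eg_N[OF v(1,2) w _ _ adm]) (use n in \<open>simp_all add: mult.assoc[symmetric]\<close>)
  have ent: "act (g' t) y i = d * (c * t i)" if "i \<in> {j+2..<n}" for t i
  proof -
    have "w t i = c * t i" using that by (simp add: w_def)
    then show ?thesis
      using that V_out[OF v(1), of i] V_out[OF y, of i] by (simp add: g'_def act_Eg[OF adm] d_def)
  qed
  have inj: "inj_on (\<lambda>t. act (g' t) y) ?T"
  proof (rule inj_onI)
    fix t t' assume t: "t \<in> ?T" "t' \<in> ?T" and eq: "act (g' t) y = act (g' t') y"
    have rec: "d * (c * f) + s (d * (c * f)) = f" if "f \<in> F" for f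
    proof -
      have "d * (c * f) + s (d * (c * f)) = (c * d + s (c * d)) * f"
        using that by (simp add: in_F s_mult algebra_simps)
      then show ?thesis using c(2) that by (simp add: in_F)
    qed
    have "t i = t' i" if i: "i \<in> {j+2..<n}" for i
      using ent[OF i, of t] ent[OF i, of t'] eq rec[of "t i"] rec[of "t' i"] PiE_mem[OF t(1) i] PiE_mem[OF t(2) i]
      by metis
    then show "t = t'" using t by (auto intro: PiE_ext)
  qed
  have "(\<lambda>t. act (g' t) y) ` ?T \<subseteq> (\<lambda>g. act g x) ` N j"
  proof
    fix z assume "z \<in> (\<lambda>t. act (g' t) y) ` ?T"
    then obtain t where "z = act (g' t + g) x" by (auto simp: y_def)
    then show "z \<in> (\<lambda>g. act g x) ` N j" using N_add[OF gN[of t] g(1)] by blast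
  qed
  then have "card ((\<lambda>t. act (g' t) y) ` ?T) \<le> card ((\<lambda>g. act g x) ` N j)"
    by (intro card_mono) (simp add: sgrpD(1)[OF sgrp_N])
  then show ?thesis unfolding card_image[OF inj] by (simp add: card_PiE card_F')
qed

text \<open>Once \<open>m\<close> vectors have been moved to the basis vectors, the image of the
  next one is orthogonal to these, so the element moving it can be taken in \<open>N m\<close>,
  which fixes them.\<close>

lemma witt:
  assumes "m + 5 \<le> n" "\<And>r. r < m \<Longrightarrow> x r \<in> V 0 n"
    "\<And>r t. r < m \<Longrightarrow> t < m \<Longrightarrow> ip (x r) (x t) = (if r = t then e else 0)"
  shows "\<exists>p\<in>N 0. \<forall>r<m. act p (x r) = bv r"
  using assms
proof (induction m)
  case 0 show ?case using N.N_zero by blast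
next
  case (Suc m)
  then obtain p where p: "p \<in> N 0" "\<forall>r<m. act p (x r) = bv r" by fastforce
  note pU = N_U[OF p(1)]
  let ?y = "act p (x m)"
  have y: "?y \<in> V 0 n" using act_N[OF p(1)] Suc.prems(2) by simp
  have "?y r = 0" if "r < m" for r
  proof -
    have "ip (bv r) ?y = ip (act p (x r)) ?y" using p(2) that by simp
    also have "\<dots> = 0" using Suc.prems(3)[of r m] that by (simp add: UD(3)[OF pU])
    finally show ?thesis using ip_bv(1)[of r ?y] V_e[OF y] that Suc.prems(1) by simp
  qed
  then have ym: "?y \<in> V m n" using y by (auto simp: V_def)
  moreover have "ip ?y ?y = e" using Suc.prems(3)[of m m] by (simp add: UD(3)[OF pU])
  ultimately obtain g where g: "g \<in> N m" "act g ?y = bv m" using move_norm_1[of m ?y] Suc.prems(1) by auto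
  have "act (g + p) (x r) = bv r" if "r < Suc m" for r
    using that p(2) g(2) UD(6)[OF N_U[OF g(1)]] by (cases "r = m") auto
  then show ?case using N_add[OF _ p(1)] N_mono[of 0 m] g(1) by (intro bexI[of _ "g + p"]) auto
qed

end


section \<open>Characters and spectral projections of finite abelian groups\<close>

lemma char_sum_zero:
  fixes f :: "'b::group_add \<Rightarrow> complex"
  assumes "sgrp X" "\<And>x y. x \<in> X \<Longrightarrow> y \<in> X \<Longrightarrow> f (x + y) = f x * f y" "x0 \<in> X" "f x0 \<noteq> 1"
  shows "(\<Sum>x\<in>X. f x) = 0"
proof -
  have "(\<Sum>x\<in>X. f x) = (\<Sum>x\<in>X. f (x0 + x))" by (simp only: sgrp_translate(1)[OF assms(1,3)])
  also have "\<dots> = f x0 * (\<Sum>x\<in>X. f x)" using assms by (simp add: sum_distrib_left)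
  finally have "(1 - f x0) * (\<Sum>x\<in>X. f x) = 0" by (simp add: algebra_simps)
  then show ?thesis using assms(4) by simp
qed

text \<open>
  Let \<open>M\<close> be a maximal proper subgroup of \<open>X\<close> and \<open>t\<close> an element outside it. Then \<open>X\<close> is generated
  by \<open>M\<close> and \<open>t\<close>, and \<open>m + k t \<mapsto> exp (2 \<pi> i k / p)\<close> is well defined, where \<open>p\<close> is the order
  of \<open>t\<close> modulo \<open>M\<close>.
\<close>
lemma nontrivial_char:
  fixes X :: "'a::comm_ring_1 set"
  assumes X: "sgrp X" and ne: "x1 \<in> X" "x1 \<noteq> 0"
  shows "\<exists>f. (\<forall>x\<in>X. \<forall>y\<in>X. f (x + y) = f x * f y) \<and> (\<forall>x\<in>X. cmod (f x) = 1) \<and> (\<exists>x\<in>X. f x \<noteq> (1::complex))"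
proof -
  have of_int_in: "of_int k * y \<in> Y" if "sgrp Y" "y \<in> Y" for Y and y :: 'a and k
  proof (induction k rule: int_induct[where k = 0])
    case base show ?case using sgrpD(2)[OF that(1)] by simp
  next
    case (step1 i)
    have "of_int (i + 1) * y = of_int i * y + y" by (simp add: algebra_simps)
    then show ?case using sgrpD(3)[OF that(1) step1(2) that(2)] by simp
  next
    case (step2 i)
    have "of_int (i - 1) * y = of_int i * y + - y" by (simp add: algebra_simps)
    then show ?case using sgrpD(3)[OF that(1) step2(2) sgrpD(4)[OF that]] by simp
  qed
  let ?C = "{M. sgrp M \<and> M \<subset> X}"
  have "finite ?C" by (rule finite_subset[of _ "Pow X"]) (use sgrpD(1)[OF X] in auto)
  moreover have "{0} \<in> ?C" using ne sgrpD(2)[OF X] by (auto simp: sgrp_def)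
  ultimately have "\<exists>M\<in>?C. \<forall>M'\<in>?C. M \<le> M' \<longrightarrow> M = M'" by (intro finite_has_maximal) auto
  then obtain M where M: "M \<in> ?C" "\<forall>M'\<in>?C. M \<subseteq> M' \<longrightarrow> M = M'" by (elim bexE)
  then have sM: "sgrp M" and MX: "M \<subset> X" by auto
  note D = sgrpD[OF sM]
  obtain t where t: "t \<in> X" "t \<notin> M" using MX by blast
  let ?M' = "{m + of_int k * t | m k. m \<in> M}"
  have sub: "?M' \<subseteq> X" using MX of_int_in[OF X t(1)] sgrpD(3)[OF X] by auto
  have "sgrp ?M'"
    unfolding sgrp_def
  proof (intro conjI ballI)
    show "finite ?M'" using sub sgrpD(1)[OF X] finite_subset by blast
    show "0 \<in> ?M'" using D(2) by (intro CollectI exI[of _ 0]) simp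
  next
    fix x y assume "x \<in> ?M'" "y \<in> ?M'"
    then obtain m k m' k' where "x = m + of_int k * t" "y = m' + of_int k' * t" "m \<in> M" "m' \<in> M" by auto
    then show "x + y \<in> ?M'"
      by (intro CollectI exI[of _ "m + m'"] exI[of _ "k + k'"]) (simp add: D(3) algebra_simps)
  next
    fix x assume "x \<in> ?M'"
    then obtain m k where "x = m + of_int k * t" "m \<in> M" by auto
    then show "- x \<in> ?M'"
      by (intro CollectI exI[of _ "- m"] exI[of _ "- k"]) (simp add: D(4) algebra_simps)
  qed
  moreover have "M \<subseteq> ?M'"
  proof
    fix x assume "x \<in> M" then show "x \<in> ?M'" by (intro CollectI exI[of _ x] exI[of _ 0]) simp
  qed
  moreover have "t \<in> ?M'" using D(2) by (intro CollectI exI[of _ 0] exI[of _ 1]) simp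
  ultimately have M'X: "?M' = X"
  proof -
    assume 1: "sgrp ?M'" "M \<subseteq> ?M'" "t \<in> ?M'"
    show ?thesis
    proof (rule ccontr)
      assume "?M' \<noteq> X"
      then have "?M' \<in> ?C" using 1(1) sub by blast
      then have "M = ?M'" using M(2) 1(2) by blast
      then show False using 1(3) t(2) by blast
    qed
  qed
  let ?S = "\<lambda>k::int. of_int k * t \<in> M"
  have "\<not> inj_on (\<lambda>k::nat. of_nat k * t) UNIV"
  proof
    assume "inj_on (\<lambda>k::nat. of_nat k * t) UNIV"
    moreover have "range (\<lambda>k::nat. of_nat k * t) \<subseteq> X"
      using of_int_in[OF X t(1), of "int _"] by auto
    ultimately show False using sgrpD(1)[OF X] by (meson finite_imageD finite_subset infinite_UNIV_nat)
  qed
  then obtain a b :: nat where ab: "of_nat a * t = of_nat b * t" "a \<noteq> b" by (auto simp: inj_on_def)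
  have "\<exists>k::nat. k > 0 \<and> ?S (int k)"
  proof (rule exI[of _ "nat \<bar>int a - int b\<bar>"])
    have "of_int (int a - int b) * t = 0" using ab by (simp add: algebra_simps)
    then have "of_int \<bar>int a - int b\<bar> * t = 0" by (simp add: abs_if algebra_simps)
    then show "nat \<bar>int a - int b\<bar> > 0 \<and> ?S (int (nat \<bar>int a - int b\<bar>))" using ab D(2) by auto
  qed
  define p where "p = (LEAST k::nat. k > 0 \<and> ?S (int k))"
  have p: "p > 0" "?S (int p)" and p_least: "\<And>k. 0 < k \<Longrightarrow> ?S (int k) \<Longrightarrow> p \<le> k"
    using LeastI_ex[OF \<open>\<exists>k. _ k\<close>] Least_le[of "\<lambda>k. k > 0 \<and> ?S (int k)"] unfolding p_def by auto
  have p_dvd: "int p dvd k" if "?S k" for k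
  proof -
    have "of_int (k mod int p) * t = of_int k * t + - (of_int (k div int p) * (of_int (int p) * t))"
      by (simp add: minus_div_mult_eq_mod[symmetric] algebra_simps)
    then have "?S (k mod int p)" using D(3)[OF that D(4)[OF of_int_in[OF sM p(2)]]] by simp
    moreover have "k mod int p \<ge> 0" "k mod int p < int p" using p(1) by auto
    ultimately have "k mod int p = 0"
      using p_least[of "nat (k mod int p)"] by (cases "k mod int p = 0") auto
    then show ?thesis by auto
  qed
  define c where "c k = cis (2 * pi * (real_of_int k / real p))" for k
  have c_add: "c (k + l) = c k * c l" for k l by (simp add: c_def cis_mult algebra_simps add_divide_distrib)
  have c_dvd: "c k = 1" if "int p dvd k" for k
  proof -
    obtain m where "k = int p * m" using \<open>int p dvd k\<close> by auto
    then show ?thesis using p(1) by (simp add: c_def cis_multiple_2pi)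
  qed
  define r where "r x = (SOME k. x + - (of_int k * t) \<in> M)" for x
  have r: "x + - (of_int (r x) * t) \<in> M" if x: "x \<in> X" for x
  proof -
    obtain m k where "x = m + of_int k * t" "m \<in> M" using x M'X by auto
    then have "\<exists>k. x + - (of_int k * t) \<in> M" by (intro exI[of _ k]) simp
    then show ?thesis unfolding r_def by (rule someI_ex)
  qed
  have cr: "c (r x) = c k" if "x \<in> X" "x + - (of_int k * t) \<in> M" for x k
  proof -
    have "of_int (r x - k) * t = (x + - (of_int k * t)) + - (x + - (of_int (r x) * t))"
      by (simp add: algebra_simps)
    then have "?S (r x - k)" using D(3)[OF that(2) D(4)[OF r[OF that(1)]]] by simp
    then have "c (k + (r x - k)) = c k * 1" unfolding c_add using c_dvd p_dvd by metis
    then show ?thesis by simp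
  qed
  show ?thesis
  proof (intro exI[of _ "\<lambda>x. c (r x)"] conjI ballI)
    fix x y assume xy: "x \<in> X" "y \<in> X"
    have eq: "(x + y) + - (of_int (r x + r y) * t) = (x + - (of_int (r x) * t)) + (y + - (of_int (r y) * t))"
      by (simp add: algebra_simps)
    have "c (r (x + y)) = c (r x + r y)"
      by (rule cr[OF sgrpD(3)[OF X xy]], unfold eq, rule D(3)[OF r[OF xy(1)] r[OF xy(2)]])
    then show "c (r (x + y)) = c (r x) * c (r y)" by (simp add: c_add)
  next
    fix x show "cmod (c (r x)) = 1" by (simp add: c_def)
  next
    have "c (r t) = c 1" by (rule cr[OF t(1)]) (simp add: D(2))
    moreover have "c 1 \<noteq> 1"
    proof
      assume "c 1 = 1"
      then have "cos (2 * pi / real p) = 1" by (simp add: c_def complex_eq_iff)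
      then obtain m :: int where "2 * pi / real p = real_of_int m * 2 * pi" using cos_one_2pi_int by auto
      then have "1 = real_of_int m * real p" using p(1) by (simp add: field_simps)
      then have "1 = m * int p" by (metis of_int_1 of_int_eq_iff of_int_mult of_int_of_nat_eq)
      then have "int p dvd 1" using dvdI[of 1 "int p" m] by (simp add: mult.commute)
      then have "p = 1" by simp
      then show False using p(2) t(2) by simp
    qed
    ultimately show "\<exists>x\<in>X. c (r x) \<noteq> 1" using t(1) by metis
  qed
qed

text \<open>For a unitary character \<open>f\<close> this is the orthogonal projection to the
  vectors on which \<open>X\<close> acts through \<open>f\<close>.\<close>

definition spr :: "'b::group_add set \<Rightarrow> ('b \<Rightarrow> 'i cmx) \<Rightarrow> ('b \<Rightarrow> complex) \<Rightarrow> 'i cmx" where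
  "spr X \<rho> f = sc (1 / of_nat (card X)) (\<Sum>x\<in>X. sc (cnj (f x)) (\<rho> x))"

locale spectral =
  fixes X :: "'b::group_add set" and \<rho> :: "'b \<Rightarrow> 'i cmx" and f :: "'b \<Rightarrow> complex"
  assumes X: "sgrp X" and rep: "srep X \<rho>"
    and f_add: "\<And>x y. x \<in> X \<Longrightarrow> y \<in> X \<Longrightarrow> f (x + y) = f x * f y" and f_norm: "\<And>x. x \<in> X \<Longrightarrow> cmod (f x) = 1"
begin

lemma f_cnj: "x \<in> X \<Longrightarrow> f x * cnj (f x) = 1"
  using f_norm[of x] by (simp add: cmod_sq[symmetric])

lemma f_uminus: assumes "x \<in> X" shows "f (- x) = cnj (f x)"
proof -
  have 0: "f 0 = 1" using f_add[of 0 0] f_norm[of 0] sgrpD(2)[OF X] by (metis add_0 mult_cancel_right2 norm_zero zero_neq_one)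
  have "cnj (f x) = cnj (f x) * (f x * f (- x))" using f_add[OF assms sgrpD(4)[OF X assms]] 0 by simp
  also have "\<dots> = f (- x)" using f_cnj[OF assms] by (simp add: mult.commute mult.left_commute)
  finally show ?thesis ..
qed

lemma spr_left: assumes x: "x \<in> X" shows "\<rho> x * spr X \<rho> f = sc (f x) (spr X \<rho> f)"
proof -
  have "\<rho> x * (\<Sum>y\<in>X. sc (cnj (f y)) (\<rho> y)) = (\<Sum>y\<in>X. sc (cnj (f y)) (\<rho> (x + y)))"
    unfolding sum_distrib_left using x by (intro sum.cong refl) (simp add: srep_add[OF rep])
  also have "\<dots> = (\<Sum>y\<in>X. sc (f x * cnj (f (x + y))) (\<rho> (x + y)))"
    using f_cnj[OF x] x by (intro sum.cong refl) (simp add: f_add mult.assoc[symmetric])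
  also have "\<dots> = (\<Sum>y\<in>X. sc (f x * cnj (f y)) (\<rho> y))"
    by (rule sgrp_translate(1)[OF X x])
  finally have "\<rho> x * (\<Sum>y\<in>X. sc (cnj (f y)) (\<rho> y)) = sc (f x) (\<Sum>y\<in>X. sc (cnj (f y)) (\<rho> y))"
    by (simp add: sc_sum)
  then show ?thesis by (simp add: spr_def mult.commute)
qed

lemma adj_spr: "adj (spr X \<rho> f) = spr X \<rho> f"
proof -
  have "(\<Sum>x\<in>X. sc (f x) (\<rho> (- x))) = (\<Sum>x\<in>X. sc (cnj (f (- x))) (\<rho> (- x)))"
    by (intro sum.cong refl) (simp add: f_uminus)
  also have "\<dots> = (\<Sum>x\<in>X. sc (cnj (f x)) (\<rho> x))"
    by (rule sgrp_translate(3)[OF X sgrpD(2)[OF X]])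
  finally have "(\<Sum>x\<in>X. sc (f x) (adj (\<rho> x))) = (\<Sum>x\<in>X. sc (cnj (f x)) (\<rho> x))"
    by (simp add: srep_uminus[OF rep])
  then show ?thesis by (simp add: spr_def adj_sum)
qed

lemma spr_right: assumes x: "x \<in> X" shows "spr X \<rho> f * \<rho> x = sc (f x) (spr X \<rho> f)"
proof -
  have "adj (\<rho> (- x) * spr X \<rho> f) = sc (f x) (spr X \<rho> f)"
    using spr_left[OF sgrpD(4)[OF X x]] adj_spr by (simp add: f_uminus[OF x])
  then show ?thesis using adj_spr by (simp add: srep_uminus[OF rep x])
qed

lemma proj_spr: "proj (spr X \<rho> f)"
proof -
  have "spr X \<rho> f * spr X \<rho> f = sc (1 / of_nat (card X)) (\<Sum>x\<in>X. sc (cnj (f x) * f x) (spr X \<rho> f))"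
    by (subst (1) spr_def) (simp add: sum_distrib_right spr_left)
  also have "\<dots> = sc (1 / of_nat (card X)) (\<Sum>x\<in>X. sc 1 (spr X \<rho> f))"
    using f_cnj by (simp add: mult.commute)
  also have "\<dots> = spr X \<rho> f" using sgrpD(5)[OF X] unfolding sum_sc by simp
  finally show ?thesis using adj_spr by (simp add: proj_def)
qed

lemma spr_commute:
  assumes "\<And>x. x \<in> X \<Longrightarrow> M * \<rho> x = \<rho> x * M" shows "M * spr X \<rho> f = spr X \<rho> f * M"
  using assms by (simp add: spr_def sum_distrib_left sum_distrib_right)

lemma spr_0: "\<rho> 0 * spr X \<rho> f = spr X \<rho> f" "spr X \<rho> f * \<rho> 0 = spr X \<rho> f"
  using srep_0[OF rep X] by (simp_all add: spr_def sum_distrib_left sum_distrib_right)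

end

text \<open>Fourier inversion at the identity. The dual group enters only as an index set
  \<open>Y\<close> of the right size that satisfies the orthogonality relation.\<close>

lemma spr_complete:
  assumes X: "sgrp X" and Y: "finite Y" "card Y = card X"
    and f: "\<And>x. x \<in> X \<Longrightarrow> x \<noteq> 0 \<Longrightarrow> (\<Sum>y\<in>Y. f y x) = 0" "\<And>y. y \<in> Y \<Longrightarrow> f y 0 = 1"
  shows "(\<Sum>y\<in>Y. spr X \<rho> (f y)) = \<rho> 0"
proof -
  have "(\<Sum>y\<in>Y. \<Sum>x\<in>X. sc (cnj (f y x)) (\<rho> x)) = (\<Sum>x\<in>X. \<Sum>y\<in>Y. sc (cnj (f y x)) (\<rho> x))"
    by (rule sum.swap)
  also have "\<dots> = (\<Sum>x\<in>X. sc (cnj (\<Sum>y\<in>Y. f y x)) (\<rho> x))" by (simp add: sum_sc)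
  also have "\<dots> = (\<Sum>x\<in>X. if x = 0 then sc (of_nat (card X)) (\<rho> 0) else 0)"
    using f Y by (intro sum.cong refl) (auto simp del: cnj_sum simp flip: cnj_sum)
  also have "\<dots> = sc (of_nat (card X)) (\<rho> 0)" using sgrpD(1,2)[OF X] by simp
  finally show ?thesis using sgrpD(5)[OF X] by (simp add: spr_def sc_sum[symmetric])
qed


section \<open>Unitary representations of the groups generated by transvections\<close>

lemma conj_to_commute:
  assumes "srep H \<pi>" "sgrp H" "g \<in> H" "P * \<pi> 0 = P" "\<pi> g * P * \<pi> (- g) = P"
  shows "\<pi> g * P = P * \<pi> g"
proof -
  have "P * \<pi> g = \<pi> g * P * (\<pi> (- g) * \<pi> g)" by (subst (1) assms(5)[symmetric]) (simp add: mult.assoc)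
  also have "\<pi> (- g) * \<pi> g = \<pi> 0" using srep_add[OF assms(1) sgrpD(4)[OF assms(2,3)] assms(3)] by simp
  finally show ?thesis using assms(4) by (simp add: mult.assoc)
qed

lemma tr_conj:
  assumes "srep H \<pi>" "sgrp H" "g \<in> H" "\<pi> 0 * P = P" shows "tr (\<pi> g * P * \<pi> (- g)) = tr P"
proof -
  have "tr (\<pi> g * P * \<pi> (- g)) = tr (\<pi> (- g) * \<pi> g * P)" by (subst tr_commute) (simp add: mult.assoc)
  also have "\<pi> (- g) * \<pi> g = \<pi> 0" using srep_add[OF assms(1) sgrpD(4)[OF assms(2,3)] assms(3)] by simp
  finally show ?thesis using assms(4) by simp
qed

lemma conj_add_srep:
  assumes "srep H \<pi>" "sgrp H" "g \<in> H" "h \<in> H" shows "\<pi> g * \<pi> h * \<pi> (- g) = \<pi> (g + h - g)"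
  using srep_add[OF assms(1)] assms(3,4) sgrpD(3,4)[OF assms(2)]
  by (simp add: diff_conv_add_uminus del: add_uminus_conv_diff)

text \<open>One nontrivial additive character of \<open>F\<close> is fixed. The maps
  \<open>t \<mapsto> \<kappa> (s0 * t)\<close> supply the others, and characters of \<open>A\<close>
  and of the modules \<open>V j l\<close> arise by composing with the trace.\<close>

locale hchar = hgeom s e q \<alpha> b \<delta> \<delta>i n
  for s :: "'a::comm_ring_1 \<Rightarrow> 'a" and e q \<alpha> b \<delta> \<delta>i n +
  fixes \<kappa> :: "'a \<Rightarrow> complex"
  assumes \<kappa>_add: "x \<in> F \<Longrightarrow> y \<in> F \<Longrightarrow> \<kappa> (x + y) = \<kappa> x * \<kappa> y"
    and \<kappa>_norm: "x \<in> F \<Longrightarrow> cmod (\<kappa> x) = 1" and \<kappa>_nontriv: "\<exists>x\<in>F. \<kappa> x \<noteq> 1"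

lemma (in hring) F_add: "x \<in> F \<Longrightarrow> y \<in> F \<Longrightarrow> x + y \<in> F" and F_uminus: "x \<in> F \<Longrightarrow> - x \<in> F"
  and F_0 [simp]: "0 \<in> F" and F_mult: "x \<in> F \<Longrightarrow> y \<in> F \<Longrightarrow> x * y \<in> F"
  by (auto simp: in_F s_add s_uminus s_mult distrib_left mult.assoc[symmetric])

lemma (in hring) sgrp_F: "sgrp F" and sgrp_A: "sgrp A"
  by (auto simp: sgrp_def F_add F_uminus) (auto simp: in_A distrib_left)

lemma (in hring) F_inverse:
  assumes "y \<in> F" "y \<noteq> 0" shows "\<exists>c\<in>F. c * y = e"
proof -
  obtain c where c: "e * c = c" "c * y + s (c * y) = e" using trace_onto[of y] assms by (auto simp: in_F)
  then have "(c + s c) * y = e" "c + s c \<in> F"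
    using assms e_s[OF c(1)] by (simp_all add: in_F s_mult s_add algebra_simps)
  then show ?thesis by blast
qed

lemma (in hring) trace_F: "e * z = z \<Longrightarrow> z + s z \<in> F"
  by (simp add: in_F s_add e_s distrib_left add.commute)

lemma (in hgeom) sgrp_V: "j \<le> l \<Longrightarrow> sgrp (V j l)"
  by (simp add: sgrp_def card_V(1) V_add V_uminus)

context hgeom
begin

lemma skew_F: "t \<in> F \<Longrightarrow> s (\<delta> * t) = - (\<delta> * t) \<and> e * (\<delta> * t) = \<delta> * t"
  by (simp add: in_F s_mult mult.assoc[symmetric])

lemma skew_to_F: "e * a = a \<Longrightarrow> s a = - a \<Longrightarrow> \<delta>i * a \<in> F \<and> \<delta> * (\<delta>i * a) = a"
  by (simp add: in_F s_mult mult.assoc[symmetric])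

text \<open>A section of the Heisenberg group over its quotient by the transvections with axis
  \<open>u\<close>. It is not a homomorphism; its cocycle is \<theta>, which takes skew
  values.\<close>

definition sig :: "(nat \<Rightarrow> 'a) \<Rightarrow> (nat \<Rightarrow> 'a) \<Rightarrow> (nat \<Rightarrow> 'a) sym" where
  "sig u w = Eg u w (- (b * ip w w))"

definition \<theta> :: "(nat \<Rightarrow> 'a) \<Rightarrow> (nat \<Rightarrow> 'a) \<Rightarrow> 'a" where
  "\<theta> w w' = b * ip w' w - s b * ip w w'"

lemma \<theta>_skew: "s (\<theta> w w') = - \<theta> w w'"
  using ip_sym[of w w'] ip_sym[of w' w] by (simp add: \<theta>_def s_diff s_mult)

lemma e_\<theta>: "e * \<theta> w w' = \<theta> w w'" by (simp add: \<theta>_def right_diff_distrib mult.assoc[symmetric])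

lemma e_bip: "e * (b * x) = b * x" by (simp add: mult.assoc[symmetric])

end

context hchar
begin

lemma \<kappa>_0 [simp]: "\<kappa> 0 = 1"
  using \<kappa>_add[of 0 0] \<kappa>_norm[of 0] by (metis F_0 add_0 mult_cancel_right2 norm_zero zero_neq_one)

lemma \<kappa>_trace_nontriv:
  assumes "e * z = z" "z \<noteq> 0" shows "\<exists>c. e * c = c \<and> \<kappa> (c * z + s (c * z)) \<noteq> 1"
proof -
  obtain c where c: "e * c = c" "c * z + s (c * z) = e" using trace_onto assms by blast
  obtain t where t: "t \<in> F" "\<kappa> t \<noteq> 1" using \<kappa>_nontriv by blast
  have "(t * c) * z + s ((t * c) * z) = t * (c * z + s (c * z))" using t(1) by (simp add: in_F s_mult algebra_simps)
  also have "\<dots> = t" using c t(1) by (simp add: in_F mult.commute)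
  finally show ?thesis using c(1) t(2) by (intro exI[of _ "t * c"]) (simp add: mult.left_commute[of e])
qed

text \<open>The factor \<delta> turns elements of \<open>F\<close> into skew ones, so this is the
  projection to the character \<open>\<kappa> (s0 * t)\<close> of the group of transvections with
  axis \<open>z\<close>. The value \<open>s0 = 0\<close> gives the vectors fixed by all of
  them.\<close>

definition Ps :: "((nat \<Rightarrow> 'a) sym \<Rightarrow> 'i cmx) \<Rightarrow> (nat \<Rightarrow> 'a) \<Rightarrow> 'a \<Rightarrow> 'i cmx" where
  "Ps \<pi> z s0 = spr F (\<lambda>t. \<pi> (tv z (\<delta> * t))) (\<lambda>t. \<kappa> (s0 * t))"

abbreviation PZ where "PZ \<pi> z \<equiv> Ps \<pi> z 0"

text \<open>The vectors on which the Heisenberg group of \<open>u\<close> acts through a character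
  trivial on the transvections with axis \<open>u\<close>; such characters are labelled by
  \<open>x\<close> through the trace form.\<close>

definition Px :: "nat \<Rightarrow> ((nat \<Rightarrow> 'a) sym \<Rightarrow> 'i cmx) \<Rightarrow> (nat \<Rightarrow> 'a) \<Rightarrow> (nat \<Rightarrow> 'a) \<Rightarrow> 'i cmx" where
  "Px l \<pi> u x = spr (V l n) (\<lambda>w. \<pi> (sig u w) * PZ \<pi> u) (\<lambda>w. \<kappa> (ip x w + s (ip x w)))"

end

section \<open>Spectral projections for the Heisenberg group of an isotropic vector\<close>

locale hrep = hchar s e q \<alpha> b \<delta> \<delta>i n \<kappa>
  for s :: "'a::comm_ring_1 \<Rightarrow> 'a" and e q \<alpha> b \<delta> \<delta>i n \<kappa> +
  fixes j :: nat and \<pi> :: "(nat \<Rightarrow> 'a) sym \<Rightarrow> 'i cmx"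
  assumes rep: "srep (N j) \<pi>" and jn: "j + 7 \<le> n"
begin

lemma tv_F_N: "z \<in> V j n \<Longrightarrow> ip z z = 0 \<Longrightarrow> t \<in> F \<Longrightarrow> tv z (\<delta> * t) \<in> N j"
  using N_tv skew_F by blast

lemma spec_Z:
  assumes "z \<in> V j n" "ip z z = 0" "s0 \<in> F"
  shows "spectral F (\<lambda>t. \<pi> (tv z (\<delta> * t))) (\<lambda>t. \<kappa> (s0 * t))"
proof
  show "sgrp F" by (rule sgrp_F)
  have "tv z (\<delta> * (t + t')) = tv z (\<delta> * t) + tv z (\<delta> * t')" if "t \<in> F" "t' \<in> F" for t t'
    using tv_add[OF assms(2)] skew_F that by (simp add: distrib_left)
  moreover have "tv z (\<delta> * - t) = - tv z (\<delta> * t)" if "t \<in> F" for t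
    using tv_uminus[OF assms(2)] skew_F that by simp
  ultimately show "srep F (\<lambda>t. \<pi> (tv z (\<delta> * t)))"
    unfolding srep_def using rep tv_F_N[OF assms(1,2)] by (simp add: srep_add srep_uminus)
qed (use assms(3) in \<open>simp_all add: distrib_left \<kappa>_add \<kappa>_norm F_mult\<close>)

lemma Ps_left:
  assumes "z \<in> V j n" "ip z z = 0" "s0 \<in> F" "t \<in> F"
  shows "\<pi> (tv z (\<delta> * t)) * Ps \<pi> z s0 = sc (\<kappa> (s0 * t)) (Ps \<pi> z s0)"
    "Ps \<pi> z s0 * \<pi> (tv z (\<delta> * t)) = sc (\<kappa> (s0 * t)) (Ps \<pi> z s0)"
  using spectral.spr_left[OF spec_Z[OF assms(1-3)] assms(4)] spectral.spr_right[OF spec_Z[OF assms(1-3)] assms(4)]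
  by (simp_all add: Ps_def)

lemma Ps_proj: "z \<in> V j n \<Longrightarrow> ip z z = 0 \<Longrightarrow> s0 \<in> F \<Longrightarrow> proj (Ps \<pi> z s0)"
  unfolding Ps_def by (rule spectral.proj_spr[OF spec_Z])

lemma Ps_0:
  assumes "z \<in> V j n" "ip z z = 0" "s0 \<in> F"
  shows "\<pi> 0 * Ps \<pi> z s0 = Ps \<pi> z s0" "Ps \<pi> z s0 * \<pi> 0 = Ps \<pi> z s0"
  using spectral.spr_0[OF spec_Z[OF assms]] tv_0[OF assms(2)] by (simp_all add: Ps_def)

lemma PZ_left:
  assumes "z \<in> V j n" "ip z z = 0" "e * a = a" "s a = - a"
  shows "\<pi> (tv z a) * PZ \<pi> z = PZ \<pi> z" "PZ \<pi> z * \<pi> (tv z a) = PZ \<pi> z"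
  using Ps_left[OF assms(1,2) F_0, of "\<delta>i * a"] skew_to_F[OF assms(3,4)] by simp_all

lemma Ps_conj:
  assumes z: "z \<in> V j n" "ip z z = 0" and g: "g \<in> N j"
  shows "\<pi> g * Ps \<pi> z s0 * \<pi> (- g) = Ps \<pi> (act g z) s0"
proof -
  have "\<pi> g * \<pi> (tv z (\<delta> * t)) * \<pi> (- g) = \<pi> (tv (act g z) (\<delta> * t))" if "t \<in> F" for t
    using conj_add_srep[OF rep sgrp_N g tv_F_N[OF z that]] conj_tv(1)[OF N_U[OF g] z(2)] skew_F[OF that] by simp
  then show ?thesis by (simp add: Ps_def spr_def sum_distrib_left sum_distrib_right)
qed

lemma Ps_commute:
  assumes z: "z \<in> V j n" "ip z z = 0" and g: "g \<in> N j" "act g z = z" and s0: "s0 \<in> F"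
  shows "\<pi> g * Ps \<pi> z s0 = Ps \<pi> z s0 * \<pi> g"
  by (rule conj_to_commute[OF rep sgrp_N g(1) Ps_0(2)[OF z s0]]) (simp add: Ps_conj[OF z g(1)] g(2))

lemma Ps_complete:
  assumes "z \<in> V j n" "ip z z = 0" shows "(\<Sum>s0\<in>F. Ps \<pi> z s0) = \<pi> 0"
proof -
  have "(\<Sum>y\<in>F. \<kappa> (y * t)) = 0" if t: "t \<in> F" "t \<noteq> 0" for t
  proof -
    obtain c where c: "c \<in> F" "c * t = e" using F_inverse[OF t] by blast
    obtain t0 where t0: "t0 \<in> F" "\<kappa> t0 \<noteq> 1" using \<kappa>_nontriv by blast
    have "t0 * c * t = t0" using c(2) t0(1) by (simp add: in_F mult.assoc mult.commute[of t0 e])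
    then show ?thesis
      by (intro char_sum_zero[OF sgrp_F, of _ "t0 * c"]) (use t t0 c in \<open>simp_all add: distrib_right \<kappa>_add F_mult\<close>)
  qed
  then have "(\<Sum>s0\<in>F. Ps \<pi> z s0) = \<pi> (tv z (\<delta> * 0))"
    unfolding Ps_def by (intro spr_complete[OF sgrp_F]) auto
  then show ?thesis using tv_0[OF assms(2)] by simp
qed

abbreviation u where "u \<equiv> u0 j"

lemma u_facts: "u \<in> V j (j + 2)" "u \<in> V j n" "ip u u = 0" "u1 j \<in> V j (j + 2)" "u1 j \<in> V j n"
  "ip (u1 j) (u1 j) = 0" "ip (u1 j) u = e" "ip u (u1 j) = e"
  using u0_facts[of j] jn by auto

lemma u_perp: "w \<in> V (j + 2) n \<Longrightarrow> ip u w = 0 \<and> ip w u = 0"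
  using ip_disjoint[OF u_facts(1)] ip_disjoint[OF _ u_facts(1)] by simp

lemma sig_adm: "w \<in> V (j + 2) n \<Longrightarrow> adm u w (- (b * ip w w))"
  using adm_b[OF u_facts(3)] u_perp by blast

lemma sig_N: "w \<in> V (j + 2) n \<Longrightarrow> sig u w \<in> N j"
  unfolding sig_def by (rule Eg_N[OF u_facts(1,3) _ _ _ sig_adm]) (use jn e_bip in auto)

lemma sig_add:
  assumes "w \<in> V (j + 2) n" "w' \<in> V (j + 2) n"
  shows "sig u w + sig u w' = sig u (w + w') + tv u (\<theta> w w')"
proof -
  have "b * ip w w' + s b * ip w w' = ip w w'"
    using ip_e(1)[OF assms(1)] by (simp add: distrib_right[symmetric] tr_b)
  then have "- (b * ip w w) + - (b * ip w' w') - ip w w' = - (b * ip (w + w') (w + w')) + \<theta> w w'"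
    by (simp add: \<theta>_def algebra_simps)
  then show ?thesis
    using Eg_add(1)[OF sig_adm[OF assms(1)] sig_adm[OF assms(2)]]
      Eg_tv(1)[OF sig_adm[OF V_add[OF assms]] \<theta>_skew] by (simp add: sig_def)
qed

lemma sig_0: "sig u 0 = 0" by (simp add: sig_def Eg_zero u_facts)

lemma fix_u: "h \<in> N (j + 2) \<Longrightarrow> act h u = u"
  by (rule U_fix[OF N_U V_mono[OF u_facts(1)]]) auto

lemma sig_conj:
  assumes "h \<in> N (j + 2)" "w \<in> V (j + 2) n"
  shows "h + sig u w - h = sig u (act h w)"
  using conj_Eg(2)[OF N_U[OF assms(1)] sig_adm[OF assms(2)]] UD(3)[OF N_U[OF assms(1)]]
  by (simp add: sig_def fix_u[OF assms(1)])

lemma Nj2: "h \<in> N (j + 2) \<Longrightarrow> h \<in> N j" using N_mono[of j "j+2"] by auto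

lemma tv_\<theta>_N: "tv u (\<theta> w w') \<in> N j" by (rule N_tv[OF u_facts(2,3) e_\<theta> \<theta>_skew])

lemma sig_PZ: "w \<in> V (j + 2) n \<Longrightarrow> \<pi> (sig u w) * PZ \<pi> u = PZ \<pi> u * \<pi> (sig u w)"
  by (rule Ps_commute[OF u_facts(2,3) sig_N]) (use u_facts(3) u_perp in \<open>auto simp: sig_def act_Eg[OF sig_adm]\<close>)

lemma PZ2: "PZ \<pi> u * PZ \<pi> u = PZ \<pi> u" "adj (PZ \<pi> u) = PZ \<pi> u"
  using Ps_proj[OF u_facts(2,3) F_0] by (auto simp: proj_def)

text \<open>On the range of \<open>PZ \<pi> u\<close> the transvections with axis \<open>u\<close>
  act trivially, so the cocycle disappears and \<open>sig\<close> yields a representation of the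
  additive group \<open>V (j + 2) n\<close>.\<close>

lemma spec_W:
  assumes "x \<in> V (j + 2) n"
  shows "spectral (V (j + 2) n) (\<lambda>w. \<pi> (sig u w) * PZ \<pi> u) (\<lambda>w. \<kappa> (ip x w + s (ip x w)))"
proof
  show "sgrp (V (j + 2) n)" using jn by (intro sgrp_V) simp
  have add: "\<pi> (sig u (w + w')) * PZ \<pi> u = \<pi> (sig u w) * PZ \<pi> u * (\<pi> (sig u w') * PZ \<pi> u)"
    if w: "w \<in> V (j + 2) n" "w' \<in> V (j + 2) n" for w w'
  proof -
    have "\<pi> (sig u w) * PZ \<pi> u * (\<pi> (sig u w') * PZ \<pi> u) = \<pi> (sig u w) * (PZ \<pi> u * \<pi> (sig u w')) * PZ \<pi> u"
      by (simp only: mult.assoc)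
    also have "\<dots> = \<pi> (sig u w) * \<pi> (sig u w') * (PZ \<pi> u * PZ \<pi> u)"
      by (simp only: sig_PZ[OF w(2), symmetric] mult.assoc)
    also have "\<dots> = \<pi> (sig u (w + w') + tv u (\<theta> w w')) * PZ \<pi> u"
      using srep_add[OF rep sig_N[OF w(1)] sig_N[OF w(2)]] sig_add[OF w] by (simp add: PZ2)
    also have "\<dots> = \<pi> (sig u (w + w')) * (\<pi> (tv u (\<theta> w w')) * PZ \<pi> u)"
      using srep_add[OF rep sig_N[OF V_add[OF w]] tv_\<theta>_N] by (simp add: mult.assoc)
    finally show ?thesis using PZ_left(1)[OF u_facts(2,3) e_\<theta> \<theta>_skew] by simp
  qed
  have "\<pi> (sig u (- w)) * PZ \<pi> u = adj (\<pi> (sig u w) * PZ \<pi> u)" if w: "w \<in> V (j + 2) n" for w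
  proof -
    have "sig u w + sig u (- w) = tv u (\<theta> w (- w))" using sig_add[OF w V_uminus[OF w]] by (simp add: sig_0)
    then have "sig u (- w) = - sig u w + tv u (\<theta> w (- w))" by (metis minus_add_cancel)
    then have "\<pi> (sig u (- w)) * PZ \<pi> u = \<pi> (- sig u w) * (\<pi> (tv u (\<theta> w (- w))) * PZ \<pi> u)"
      using srep_add[OF rep N_uminus[OF sig_N[OF w]] tv_\<theta>_N] by (simp add: mult.assoc)
    also have "\<dots> = adj (\<pi> (sig u w)) * PZ \<pi> u"
      using PZ_left(1)[OF u_facts(2,3) e_\<theta> \<theta>_skew] srep_uminus[OF rep sig_N[OF w]] by simp
    also have "\<dots> = adj (PZ \<pi> u * \<pi> (sig u w))" by (simp add: PZ2)
    finally show ?thesis by (simp add: sig_PZ[OF w])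
  qed
  then show "srep (V (j + 2) n) (\<lambda>w. \<pi> (sig u w) * PZ \<pi> u)" unfolding srep_def using add by blast
  fix w w' assume w: "w \<in> V (j + 2) n" "w' \<in> V (j + 2) n"
  have F: "ip x w + s (ip x w) \<in> F" "ip x w' + s (ip x w') \<in> F" using ip_e(1)[OF assms] by (auto intro: trace_F)
  have "ip x (w + w') + s (ip x (w + w')) = (ip x w + s (ip x w)) + (ip x w' + s (ip x w'))"
    by (simp add: s_add)
  then show "\<kappa> (ip x (w + w') + s (ip x (w + w'))) = \<kappa> (ip x w + s (ip x w)) * \<kappa> (ip x w' + s (ip x w'))"
    by (simp only: \<kappa>_add[OF F])
next
  fix w show "cmod (\<kappa> (ip x w + s (ip x w))) = 1" by (rule \<kappa>_norm[OF trace_F[OF ip_e(1)[OF assms]]])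
qed

abbreviation PX where "PX \<equiv> Px (j + 2) \<pi> u"

lemma Px_proj: "x \<in> V (j + 2) n \<Longrightarrow> proj (PX x)"
  unfolding Px_def by (rule spectral.proj_spr[OF spec_W])

lemma Px_0: assumes "x \<in> V (j + 2) n" shows "\<pi> 0 * PX x = PX x" "PX x * \<pi> 0 = PX x" "PX x * PZ \<pi> u = PX x"
proof -
  have "PX x = \<pi> 0 * PZ \<pi> u * PX x" "PX x = PX x * (\<pi> 0 * PZ \<pi> u)"
    using spectral.spr_0[OF spec_W[OF assms]] by (simp_all add: Px_def sig_0)
  then have *: "PX x = PZ \<pi> u * PX x" "PX x = PX x * PZ \<pi> u" using Ps_0[OF u_facts(2,3) F_0] by simp_all
  show "PX x * PZ \<pi> u = PX x" using *(2) by (rule sym)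
  show "\<pi> 0 * PX x = PX x" by (subst (1 2) *(1)) (simp add: mult.assoc[symmetric] Ps_0[OF u_facts(2,3) F_0])
  show "PX x * \<pi> 0 = PX x" by (subst (1 2) *(2)) (simp add: mult.assoc Ps_0[OF u_facts(2,3) F_0])
qed

lemma Px_complete: "(\<Sum>x\<in>V (j + 2) n. PX x) = PZ \<pi> u"
proof -
  have "(\<Sum>x\<in>V (j + 2) n. \<kappa> (ip x w + s (ip x w))) = 0" if w: "w \<in> V (j + 2) n" "w \<noteq> 0" for w
  proof -
    obtain i where i: "w i \<noteq> 0" using w(2) by (auto simp: fun_eq_iff)
    then have ij: "j + 2 \<le> i" "i < n" using V_out[OF w(1), of i] by force+
    obtain c where c: "e * c = c" "\<kappa> (c * w i + s (c * w i)) \<noteq> 1" using \<kappa>_trace_nontriv V_e[OF w(1)] i by blast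
    let ?x = "sm (s c) (bv i)"
    have "ip ?x w = c * w i" using ip_bv(1)[OF ij(2), of w] V_e[OF w(1)] by simp
    then have "\<kappa> (ip ?x w + s (ip ?x w)) \<noteq> 1" using c(2) by simp
    moreover have "?x \<in> V (j + 2) n" using ij by (intro V_sm V_bv)
    moreover have "\<kappa> (ip (x + y) w + s (ip (x + y) w)) = \<kappa> (ip x w + s (ip x w)) * \<kappa> (ip y w + s (ip y w))" for x y
    proof -
      have "ip x w + s (ip x w) \<in> F" "ip y w + s (ip y w) \<in> F" using ip_e(2)[OF w(1)] by (auto intro: trace_F)
      from \<kappa>_add[OF this] show ?thesis by (simp add: s_add algebra_simps)
    qed
    ultimately show ?thesis
      using char_sum_zero[of "V (j + 2) n" "\<lambda>x. \<kappa> (ip x w + s (ip x w))" ?x] sgrp_V[of "j+2" n] jn by auto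
  qed
  then have "(\<Sum>x\<in>V (j + 2) n. PX x) = \<pi> (sig u 0) * PZ \<pi> u"
    unfolding Px_def using jn card_V(1)[of "j+2" n] sgrp_V[of "j+2" n] by (intro spr_complete) auto
  then show ?thesis using Ps_0[OF u_facts(2,3) F_0] by (simp add: sig_0)
qed

lemma Px_conj:
  assumes h: "h \<in> N (j + 2)" and x: "x \<in> V (j + 2) n"
  shows "\<pi> h * PX x * \<pi> (- h) = PX (act h x)"
proof -
  let ?V = "V (j + 2) n"
  have hj: "h \<in> N j" by (rule Nj2[OF h])
  note hU = N_U[OF h]
  have 1: "\<pi> h * (\<pi> (sig u w) * PZ \<pi> u) * \<pi> (- h) = \<pi> (sig u (act h w)) * PZ \<pi> u" if w: "w \<in> ?V" for w
  proof -
    have "\<pi> h * (\<pi> (sig u w) * PZ \<pi> u) * \<pi> (- h) = \<pi> h * \<pi> (sig u w) * (\<pi> (- h) * PZ \<pi> u)"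
      using Ps_commute[OF u_facts(2,3) N_uminus[OF hj] _ F_0] fix_u[OF N_uminus[OF h]] by (simp add: mult.assoc)
    also have "\<dots> = \<pi> (sig u (act h w)) * PZ \<pi> u"
      using conj_add_srep[OF rep sgrp_N hj sig_N[OF w]] sig_conj[OF h w] by (simp add: mult.assoc[symmetric])
    finally show ?thesis .
  qed
  let ?f = "\<lambda>x w. sc (cnj (\<kappa> (ip x w + s (ip x w)))) (\<pi> (sig u w) * PZ \<pi> u)"
  have "\<pi> h * (\<Sum>w\<in>?V. ?f x w) * \<pi> (- h) = (\<Sum>w\<in>?V. ?f (act h x) (act h w))"
    unfolding sum_distrib_left sum_distrib_right
    using 1 by (intro sum.cong refl) (simp add: UD(3)[OF hU])
  also have "\<dots> = (\<Sum>w\<in>?V. ?f (act h x) w)"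
    by (rule sum.reindex_bij_witness[of _ "act (- h)" "act h"])
      (use U_Vj[OF hU] U_Vj[OF N_U[OF N_uminus[OF h]]] in auto)
  finally show ?thesis by (simp add: Px_def spr_def)
qed

text \<open>Conjugation by \<open>N (j + 2)\<close> permutes the projections \<open>PX z\<close>
  along the orbits of their labels, so the traces over an orbit are equal, while all of them add up
  to at most that of \<open>\<pi> 0\<close>. A label moved into the coordinates \<open>j + 2\<close>
  and \<open>j + 3\<close> is fixed by \<open>N (j + 4)\<close>, which therefore commutes with its
  projection. The bound on the degree is the bound of \<open>orbit_card\<close> for the
  label.\<close>

lemma Px_bound:
  assumes x: "x \<in> V (j + 2) n" "x \<noteq> 0" "PX x \<noteq> 0"
  shows "\<exists>P. proj P \<and> P \<noteq> 0 \<and> \<pi> 0 * P = P \<and> P * \<pi> 0 = P \<and> (\<forall>h\<in>N (j + 4). \<pi> h * P = P * \<pi> h)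
    \<and> nsq P * real q ^ (n - j - 4) \<le> nsq (\<pi> 0)"
proof -
  let ?V = "V (j + 2) n"
  \<comment> \<open>Transitivity is applied with \<open>j + 2\<close> in place of \<open>j\<close>,
    which is the reason for \<open>j + 7 \<le> n\<close>.\<close>
  obtain g where g: "g \<in> N (j + 2)" "act g x \<in> V (j + 2) (j + 4)"
    using move2[of "j + 2" x] x jn by (auto simp: numeral_eq_Suc)
  define y where "y = act g x"
  have y: "y \<in> ?V" unfolding y_def by (rule act_N[OF g(1) x(1)])
  have "y \<noteq> 0" using x(2) act_inj[of g x 0] U_lin(1)[OF N_U[OF g(1)]] by (simp add: y_def)
  have trace: "nsq (PX (act h x)) = nsq (PX x)" if "h \<in> N (j + 2)" "x \<in> ?V" for h x
  proof -
    have "tr (PX (act h x)) = tr (PX x)"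
      unfolding Px_conj[OF that, symmetric] by (rule tr_conj[OF rep sgrp_N Nj2[OF that(1)] Px_0(1)[OF that(2)]])
    then show ?thesis using proj_tr[OF Px_proj[OF that(2)]] proj_tr[OF Px_proj[OF act_N[OF that]]] by simp
  qed
  have nz: "PX y \<noteq> 0"
  proof
    assume "PX y = 0"
    then have "nsq (PX x) = 0" using trace[OF g(1) x(1)] by (simp add: y_def nsq_def)
    then show False using x(3) nsq_eq_0 by blast
  qed
  have comm: "\<pi> h * PX y = PX y * \<pi> h" if h: "h \<in> N (j + 4)" for h
  proof -
    have "h \<in> N (j + 2)" using h N_mono[of "j+2" "j+4"] by auto
    moreover have "act h y = y" unfolding y_def by (rule U_fix[OF N_U[OF h] V_mono[OF g(2)]]) auto
    ultimately show ?thesis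
      using conj_to_commute[OF rep sgrp_N Nj2 Px_0(2)[OF y]] Px_conj[OF _ y] by auto
  qed
  let ?O = "(\<lambda>h. act h y) ` N (j + 2)"
  have "real (card ?O) * nsq (PX y) = (\<Sum>z\<in>?O. nsq (PX y))" by simp
  also have "\<dots> = (\<Sum>z\<in>?O. nsq (PX z))" by (rule sum.cong) (use trace[OF _ y] in auto)
  also have "\<dots> \<le> (\<Sum>z\<in>?V. nsq (PX z))"
    using act_N y card_V(1)[of "j+2" n] jn nsq_nonneg by (intro sum_mono2) auto
  also have "\<dots> = nsq (PZ \<pi> u)"
  proof -
    have "tr (\<Sum>z\<in>?V. PX z) = (\<Sum>z\<in>?V. of_real (nsq (PX z)))" using proj_tr[OF Px_proj] by simp
    then show ?thesis
      unfolding Px_complete using proj_tr[OF Ps_proj[OF u_facts(2,3) F_0]] by (simp flip: of_real_sum)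
  qed
  also have "\<dots> \<le> nsq (\<pi> 0)"
  proof -
    have *: "proj (\<pi> 0 - PZ \<pi> u)"
      by (rule proj_diff[OF srep_0(1)[OF rep sgrp_N] Ps_proj[OF u_facts(2,3) F_0] Ps_0(1)[OF u_facts(2,3) F_0]])
    have "complex_of_real (nsq (\<pi> 0 - PZ \<pi> u)) = of_real (nsq (\<pi> 0) - nsq (PZ \<pi> u))"
      using proj_tr[OF *] proj_tr[OF srep_0(1)[OF rep sgrp_N]] proj_tr[OF Ps_proj[OF u_facts(2,3) F_0]] by simp
    then have "nsq (\<pi> 0 - PZ \<pi> u) = nsq (\<pi> 0) - nsq (PZ \<pi> u)" by (simp only: of_real_eq_iff)
    then show ?thesis using nsq_nonneg[of "\<pi> 0 - PZ \<pi> u"] by simp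
  qed
  finally have 1: "real (card ?O) * nsq (PX y) \<le> nsq (\<pi> 0)" .
  have "q ^ (n - j - 4) \<le> card ?O" using orbit_card[of "j+2" y] y \<open>y \<noteq> 0\<close> jn by (simp add: numeral_eq_Suc)
  then have "real q ^ (n - j - 4) * nsq (PX y) \<le> real (card ?O) * nsq (PX y)"
    by (intro mult_right_mono nsq_nonneg) (metis of_nat_le_iff of_nat_power)
  with 1 have "nsq (PX y) * real q ^ (n - j - 4) \<le> nsq (\<pi> 0)" by (simp add: mult.commute)
  then show ?thesis using Px_proj[OF y] nz Px_0[OF y] comm by blast
qed

text \<open>If no nontrivial label occurs, completeness leaves only \<open>PX 0\<close>, so every
  vector fixed by the transvections with axis \<open>u\<close> is fixed by the whole Heisenberg
  group.\<close>

lemma stop_Eg: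
  assumes stop: "\<And>x. x \<in> V (j + 2) n \<Longrightarrow> x \<noteq> 0 \<Longrightarrow> PX x = 0"
    and w: "w \<in> V (j + 2) n" "adm u w a" "e * a = a"
  shows "\<pi> (Eg u w a) * PZ \<pi> u = PZ \<pi> u"
proof -
  have "PZ \<pi> u = (\<Sum>x\<in>V (j + 2) n. if x = 0 then PX 0 else 0)"
    unfolding Px_complete[symmetric] using stop by (intro sum.cong) auto
  also have "\<dots> = PX 0" using card_V(1)[of "j+2" n] jn by simp
  finally have eq: "PZ \<pi> u = PX 0" .
  have 1: "\<pi> (sig u w) * PZ \<pi> u = PZ \<pi> u"
  proof -
    have "\<pi> (sig u w) * PZ \<pi> u * PX 0 = PX 0"
      using spectral.spr_left[OF spec_W[OF V_zero] w(1)] by (simp add: Px_def)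
    then show ?thesis using eq PZ2 by (simp add: mult.assoc)
  qed
  have sk: "s (a + b * ip w w) = - (a + b * ip w w)" "e * (a + b * ip w w) = a + b * ip w w"
  proof -
    have "a + s a + (b + s b) * ip w w = 0" using w(2) ip_e(1)[OF w(1)] by (simp add: adm_def tr_b)
    moreover have "s (ip w w) = ip w w" by (metis ip_sym)
    ultimately show "s (a + b * ip w w) = - (a + b * ip w w)"
      by (simp add: s_add s_mult eq_neg_iff_add_eq_0 algebra_simps)
    show "e * (a + b * ip w w) = a + b * ip w w" using w(3) e_bip by (simp add: distrib_left)
  qed
  have "Eg u w a = sig u w + tv u (a + b * ip w w)"
    using Eg_tv(1)[OF sig_adm[OF w(1)] sk(1)] by (simp add: sig_def)
  then show ?thesis
    using srep_add[OF rep sig_N[OF w(1)] N_tv[OF u_facts(2,3) sk(2,1)]] PZ_left(1)[OF u_facts(2,3) sk(2,1)] 1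
    by (simp add: mult.assoc)
qed

lemma u_prim: "prim u"
  unfolding prim_def
proof (intro allI impI, elim conjE)
  fix p assume p: "idem p" "sm p u = 0"
  have "p * u j = 0" using fun_cong[OF p(2), of j] by simp
  then show "p = 0" using p(1) by (simp add: isv_def bv_apply idem_def mult.commute)
qed

text \<open>All primitive isotropic vectors are conjugate to \<open>u\<close> under
  \<open>N j\<close>, and a transvection with any other isotropic axis is the identity.\<close>

lemma trivial_case:
  assumes "PZ \<pi> u = \<pi> 0" "g \<in> N j" shows "\<pi> g = \<pi> 0"
  using assms(2)
proof (induction rule: N.induct)
  case (N_step z a g)
  have j5: "j + 5 \<le> n" using jn by simp
  have "\<pi> (tv z a) = \<pi> 0"
  proof (cases "prim z")
    case False
    then show ?thesis using tv_trivial_or_prim N_step by simp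
  next
    case True
    obtain h where h: "h \<in> N j" "act h z = u1 j" using move_isotropic[OF j5 N_step(1,2) True] by blast
    obtain k where k: "k \<in> N j" "act k u = u1 j" using move_isotropic[OF j5 u_facts(2,3) u_prim] by blast
    define m where "m = - h + k"
    have m: "m \<in> N j" unfolding m_def by (intro N_add N_uminus h k)
    have "act m u = z" using h(2) k(2) by (simp add: m_def) (metis act_uminus_cancel(2))
    then have "tv z a = m + tv u a - m" using conj_tv(1)[OF N_U[OF m] u_facts(3) N_step(4)] by simp
    moreover have tva: "tv u a \<in> N j" by (rule N_tv[OF u_facts(2,3) N_step(3,4)])
    moreover have "\<pi> (tv u a) = \<pi> 0"
      using PZ_left(1)[OF u_facts(2,3) N_step(3,4)] assms(1) srep_0(3)[OF rep sgrp_N tva] by simp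
    ultimately have "\<pi> (tv z a) = \<pi> m * \<pi> 0 * \<pi> (- m)" using conj_add_srep[OF rep sgrp_N m tva] by simp
    also have "\<dots> = \<pi> 0" using srep_0(3)[OF rep sgrp_N m] srep_add[OF rep m N_uminus[OF m]] by simp
    finally show ?thesis .
  qed
  moreover have "tv z a \<in> N j" using N_tv N_step by blast
  ultimately have "\<pi> (tv z a + g) = \<pi> 0 * \<pi> 0" using srep_add[OF rep _ N_step(5)] N_step(6) by simp
  then show ?case using srep_0(1)[OF rep sgrp_N] by (simp add: proj_def)
qed simp

end


inductive_set cspan :: "'i cmx set \<Rightarrow> 'i cmx set" for B where
  cspan_base: "x \<in> B \<Longrightarrow> x \<in> cspan B"
| cspan_0: "0 \<in> cspan B"
| cspan_add: "x \<in> cspan B \<Longrightarrow> y \<in> cspan B \<Longrightarrow> x + y \<in> cspan B"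
| cspan_sc: "x \<in> cspan B \<Longrightarrow> sc c x \<in> cspan B"

lemma cspan_mult:
  assumes "\<And>x y. x \<in> B \<Longrightarrow> y \<in> B \<Longrightarrow> x * y \<in> cspan B" "x \<in> cspan B" "y \<in> cspan B"
  shows "x * y \<in> cspan B"
  using assms(2)
proof (induction rule: cspan.induct)
  case (cspan_base x)
  from assms(3) show ?case
    by (induction rule: cspan.induct) (auto simp: distrib_left intro: cspan.intros assms(1) cspan_base)
qed (auto simp: distrib_right intro: cspan.intros)

lemma cspan_sum: "(\<And>i. i \<in> I \<Longrightarrow> f i \<in> cspan B) \<Longrightarrow> (\<Sum>i\<in>I. f i) \<in> cspan B"
  by (induction I rule: infinite_finite_induct) (auto intro: cspan_0 cspan_add)

subsection \<open>Nontrivial central characters: the Heisenberg algebra\<close>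

locale heis = hrep s e q \<alpha> b \<delta> \<delta>i n \<kappa> j \<pi>
  for s :: "'a::comm_ring_1 \<Rightarrow> 'a" and e q \<alpha> b \<delta> \<delta>i n \<kappa> j and \<pi> :: "(nat \<Rightarrow> 'a) sym \<Rightarrow> 'i cmx" +
  fixes s0 :: 'a
  assumes s0: "s0 \<in> F" "s0 \<noteq> 0"
begin

declare add_2_eq_Suc' [simp del]

abbreviation "W \<equiv> V (j + 2) n"
abbreviation "P0 \<equiv> Ps \<pi> u s0"

text \<open>The Heisenberg operators on the range of \<open>P0\<close>. They form a projective
  representation of the additive group \<open>W\<close> whose multiplier is the central character
  evaluated on the cocycle \<theta>.\<close>

definition T :: "(nat \<Rightarrow> 'a) \<Rightarrow> 'i cmx" where "T w = \<pi> (sig u w) * P0"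


lemma P0_facts: "P0 * P0 = P0" "adj P0 = P0" "\<pi> 0 * P0 = P0" "P0 * \<pi> 0 = P0" "proj P0"
  using Ps_proj[OF u_facts(2,3) s0(1)] Ps_0[OF u_facts(2,3) s0(1)] by (auto simp: proj_def)

lemma P0_P0: "P0 * (P0 * X) = P0 * X" using P0_facts(1) by (simp add: mult.assoc[symmetric])

lemma tvP: assumes "e * a = a" "s a = - a"
  shows "\<pi> (tv u a) * P0 = sc (\<kappa> (s0 * (\<delta>i * a))) P0"
  using Ps_left(1)[OF u_facts(2,3) s0(1), of "\<delta>i * a"] skew_to_F[OF assms] by simp

lemma act_sig_u: "w \<in> W \<Longrightarrow> act (sig u w) u = u"
  using u_facts(3) u_perp[of w] by (simp add: sig_def act_Eg[OF sig_adm])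

lemma sig_P0: "w \<in> W \<Longrightarrow> \<pi> (sig u w) * P0 = P0 * \<pi> (sig u w)"
  by (rule Ps_commute[OF u_facts(2,3) sig_N act_sig_u s0(1)])

lemma sig_P0': "w \<in> W \<Longrightarrow> \<pi> (- sig u w) * P0 = P0 * \<pi> (- sig u w)"
  by (rule Ps_commute[OF u_facts(2,3) N_uminus[OF sig_N] _ s0(1)]) (metis act_sig_u act_uminus_cancel(2))+

lemma \<pi>_inv: "g \<in> N j \<Longrightarrow> \<pi> (- g) * \<pi> g = \<pi> 0" "g \<in> N j \<Longrightarrow> \<pi> g * \<pi> (- g) = \<pi> 0"
  using srep_add[OF rep, of "- g" g] srep_add[OF rep, of g "- g"] N_uminus by auto

text \<open>Formulated for any \<open>P\<close> below \<open>P0\<close>, as it is also applied to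
  the smaller projections obtained by fixing isotropic lines.\<close>

lemma sig_mult_gen:
  assumes w: "w \<in> W" "w' \<in> W" and P: "P0 * P = P"
  shows "\<pi> (sig u w) * (\<pi> (sig u w') * P) = sc (\<kappa> (s0 * (\<delta>i * \<theta> w w'))) (\<pi> (sig u (w + w')) * P)"
proof -
  have tvN: "tv u (\<theta> w w') \<in> N j" by (rule N_tv[OF u_facts(2,3) e_\<theta> \<theta>_skew])
  have "\<pi> (sig u w) * (\<pi> (sig u w') * P) = \<pi> (sig u w + sig u w') * P"
    using srep_add[OF rep sig_N[OF w(1)] sig_N[OF w(2)]] by (simp add: mult.assoc)
  also have "\<dots> = \<pi> (sig u (w + w')) * (\<pi> (tv u (\<theta> w w')) * P0 * P)"
    unfolding sig_add[OF w] using srep_add[OF rep sig_N[OF V_add[OF w]] tvN] P by (simp add: mult.assoc)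
  also have "\<dots> = sc (\<kappa> (s0 * (\<delta>i * \<theta> w w'))) (\<pi> (sig u (w + w')) * P)"
    by (simp only: tvP[OF e_\<theta> \<theta>_skew] sc_simps P)
  finally show ?thesis .
qed

lemma T_mult:
  assumes w: "w \<in> W" "w' \<in> W"
  shows "T w * T w' = sc (\<kappa> (s0 * (\<delta>i * \<theta> w w'))) (T (w + w'))"
proof -
  have "T w * T w' = \<pi> (sig u w) * (P0 * \<pi> (sig u w')) * P0" by (simp only: T_def mult.assoc)
  also have "\<dots> = \<pi> (sig u w) * (\<pi> (sig u w') * (P0 * P0))"
    by (simp only: sig_P0[OF w(2), symmetric] mult.assoc)
  finally have "T w * T w' = \<pi> (sig u w) * (\<pi> (sig u w') * P0)" by (simp only: P0_facts(1))
  then show ?thesis using sig_mult_gen[OF w P0_facts(1)] by (simp add: T_def)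
qed

lemma T_0: "T 0 = P0" by (simp add: T_def sig_0 P0_facts)

lemma P0_T: "w \<in> W \<Longrightarrow> P0 * T w = T w" "w \<in> W \<Longrightarrow> T w * P0 = T w"
  using sig_P0[of w] P0_facts(1) by (simp_all add: T_def mult.assoc P0_P0)

lemma adj_T: assumes "w \<in> W" shows "adj (T w) = \<pi> (- sig u w) * P0"
  using srep_uminus[OF rep sig_N[OF assms]] sig_P0'[OF assms] P0_facts(2) by (simp add: T_def)

lemma T_unit: assumes w: "w \<in> W" shows "adj (T w) * T w = P0" "T w * adj (T w) = P0"
proof -
  have "adj (T w) * T w = \<pi> (- sig u w) * (P0 * \<pi> (sig u w)) * P0" by (simp only: adj_T[OF w]) (simp only: T_def mult.assoc)
  also have "\<dots> = (\<pi> (- sig u w) * \<pi> (sig u w)) * (P0 * P0)" by (simp only: sig_P0[OF w, symmetric] mult.assoc)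
  finally show "adj (T w) * T w = P0" using \<pi>_inv[OF sig_N[OF w]] P0_facts by simp
  have "T w * adj (T w) = \<pi> (sig u w) * (P0 * \<pi> (- sig u w)) * P0" by (simp only: adj_T[OF w]) (simp only: T_def mult.assoc)
  also have "\<dots> = (\<pi> (sig u w) * \<pi> (- sig u w)) * (P0 * P0)" by (simp only: sig_P0'[OF w, symmetric] mult.assoc)
  finally show "T w * adj (T w) = P0" using \<pi>_inv[OF sig_N[OF w]] P0_facts by simp
qed

lemma \<delta>\<theta>_F: "\<delta>i * \<theta> w w' \<in> F" using skew_to_F[OF e_\<theta> \<theta>_skew] by blast

lemma \<kappa>_cnj: "x \<in> F \<Longrightarrow> \<kappa> x * cnj (\<kappa> x) = 1"
  using \<kappa>_norm[of x] by (simp add: cmod_sq[symmetric])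

lemma \<kappa>_diff: assumes "x \<in> F" "y \<in> F" shows "\<kappa> (x - y) = \<kappa> x * cnj (\<kappa> y)"
proof -
  have "\<kappa> x = \<kappa> (x - y) * \<kappa> y" using \<kappa>_add[OF F_add[OF assms(1) F_uminus[OF assms(2)]] assms(2)] by simp
  then show ?thesis using \<kappa>_cnj[OF assms(2)] by (simp add: mult.assoc)
qed

lemma \<theta>_diff: assumes "w \<in> W" shows "\<theta> w w' - \<theta> w' w = ip w' w - ip w w'"
proof -
  have "\<theta> w w' - \<theta> w' w = (b + s b) * ip w' w - (b + s b) * ip w w'"
    by (simp add: \<theta>_def algebra_simps)
  then show ?thesis using ip_e[OF assms] by (simp add: tr_b)
qed

text \<open>The commutator pairing of the Heisenberg group, composed with the central character.\<close>
definition pairing :: "(nat \<Rightarrow> 'a) \<Rightarrow> (nat \<Rightarrow> 'a) \<Rightarrow> complex" where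
  "pairing v w = \<kappa> (s0 * (\<delta>i * (ip w v - ip v w)))"

lemma T_conj:
  assumes v: "v \<in> W" and w: "w \<in> W" shows "adj (T w) * T v * T w = sc (pairing v w) (T v)"
proof -
  let ?a = "\<kappa> (s0 * (\<delta>i * \<theta> v w))" and ?b = "\<kappa> (s0 * (\<delta>i * \<theta> w v))"
  have F: "s0 * (\<delta>i * \<theta> v w) \<in> F" "s0 * (\<delta>i * \<theta> w v) \<in> F" using F_mult[OF s0(1) \<delta>\<theta>_F] by auto
  have "s0 * (\<delta>i * (ip w v - ip v w)) = s0 * (\<delta>i * \<theta> v w) - s0 * (\<delta>i * \<theta> w v)"
    using \<theta>_diff[OF v, of w] by (simp add: right_diff_distrib[symmetric])
  then have lam: "pairing v w = ?a * cnj ?b" by (simp add: pairing_def \<kappa>_diff[OF F])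
  have "T v * T w = sc ?a (T (w + v))" using T_mult[OF v w] by (simp add: add.commute)
  also have "\<dots> = sc (?a * cnj ?b) (T w * T v)"
    using T_mult[OF w v] \<kappa>_cnj[OF F(2)] by (simp add: mult.assoc mult.commute[of "cnj _"])
  finally have "adj (T w) * (T v * T w) = sc (pairing v w) ((adj (T w) * T w) * T v)"
    by (simp add: lam mult.assoc)
  then show ?thesis by (simp add: T_unit[OF w] P0_T[OF v] mult.assoc)
qed

text \<open>Nondegeneracy of the form that sends \<open>c\<close>, \<open>z\<close> to \<kappa> of
  \<open>s0\<close> times the trace of \<open>\<delta>i * c * z\<close>. It makes both the
  commutator pairing on \<open>W\<close> and its restrictions to pairs of lines perfect.\<close>

lemma trace_form:
  assumes "e * z = z" "z \<noteq> 0" shows "\<exists>c. e * c = c \<and> \<kappa> (s0 * (\<delta>i * c * z + s (\<delta>i * c * z))) \<noteq> 1"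
proof -
  obtain c0 where c0: "c0 \<in> F" "c0 * s0 = e" using F_inverse[OF s0] by blast
  let ?z = "s0 * \<delta>i * z"
  have "?z \<noteq> 0"
  proof
    assume "?z = 0"
    then have "(c0 * s0) * (\<delta> * \<delta>i) * z = 0" by (simp only: mult_ac mult_zero_right) (metis mult.assoc mult.commute mult_zero_right)
    then show False using c0(2) assms by simp
  qed
  moreover have "e * ?z = ?z" using s0(1) by (simp add: in_F mult.assoc[symmetric])
  ultimately obtain c where c: "e * c = c" "\<kappa> (c * ?z + s (c * ?z)) \<noteq> 1" using \<kappa>_trace_nontriv by blast
  moreover have "c * ?z + s (c * ?z) = s0 * (\<delta>i * c * z + s (\<delta>i * c * z))"
    using s0(1) by (simp add: in_F s_mult algebra_simps)
  ultimately show ?thesis by auto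
qed

lemma pairing_trace: "pairing v w = \<kappa> (s0 * (\<delta>i * ip w v + s (\<delta>i * ip w v)))"
  using ip_sym[of v w] by (simp add: pairing_def s_mult algebra_simps)

lemma pairing_nontriv: assumes "v \<in> W" "v \<noteq> 0" shows "\<exists>w\<in>W. pairing v w \<noteq> 1"
proof -
  obtain i where i: "v i \<noteq> 0" using assms(2) by (auto simp: fun_eq_iff)
  then have ij: "j + 2 \<le> i" "i < n" using V_out[OF assms(1), of i] by force+
  obtain c where c: "e * c = c" "\<kappa> (s0 * (\<delta>i * c * v i + s (\<delta>i * c * v i))) \<noteq> 1"
    using trace_form[OF V_e[OF assms(1)] i] by blast
  have "ip (sm (s c) (bv i)) v = c * v i" using ip_bv(1)[OF ij(2), of v] V_e[OF assms(1)] by simp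
  then have "pairing v (sm (s c) (bv i)) \<noteq> 1" using c(2) by (simp add: pairing_trace mult.assoc)
  then show ?thesis using V_sm[OF V_bv[OF ij]] by blast
qed

lemma pairing_sum: assumes "v \<in> W" "v \<noteq> 0" shows "(\<Sum>w\<in>W. pairing v w) = 0"
proof -
  obtain w0 where w0: "w0 \<in> W" "pairing v w0 \<noteq> 1" using pairing_nontriv[OF assms] by blast
  have tF: "s0 * (\<delta>i * ip w v + s (\<delta>i * ip w v)) \<in> F" for w
    by (intro F_mult s0 trace_F) (simp add: mult.assoc[symmetric])
  have "pairing v (w + w') = pairing v w * pairing v w'" for w w'
    unfolding pairing_trace \<kappa>_add[OF tF tF, symmetric] by (simp add: s_add algebra_simps)
  then show ?thesis using w0 sgrp_V[of "j+2" n] jn by (intro char_sum_zero[of W _ w0]) auto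
qed

text \<open>Conjugation by a suitable \<open>T w\<close> multiplies \<open>T v\<close> by a scalar
  different from 1 and preserves the trace.\<close>

lemma tr_T: assumes v: "v \<in> W" "v \<noteq> 0" shows "tr (T v) = 0"
proof -
  obtain w where w: "w \<in> W" "pairing v w \<noteq> 1" using pairing_nontriv[OF v] by blast
  have "pairing v w * tr (T v) = tr (adj (T w) * T v * T w)" by (simp add: T_conj[OF v(1) w(1)])
  also have "\<dots> = tr (T w * adj (T w) * T v)" by (subst tr_commute) (simp add: mult.assoc)
  finally show ?thesis using w(2) by (simp add: T_unit[OF w(1)] P0_T[OF v(1)])
qed

abbreviation "SP \<equiv> cspan (T ` W)"

lemma T_SP: "w \<in> W \<Longrightarrow> T w \<in> SP" by (auto intro: cspan_base)

lemma SP_mult: "x \<in> SP \<Longrightarrow> y \<in> SP \<Longrightarrow> x * y \<in> SP"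
proof (rule cspan_mult)
  fix x y assume "x \<in> T ` W" "y \<in> T ` W"
  then obtain w w' where w: "w \<in> W" "x = T w" "w' \<in> W" "y = T w'" by blast
  then show "x * y \<in> SP" using cspan_sc[OF T_SP[OF V_add[OF w(1,3)]]] by (simp only: T_mult)
qed

lemma adj_T_SP: assumes w: "w \<in> W" shows "adj (T w) \<in> SP"
proof -
  have w': "- w \<in> W" by (rule V_uminus[OF w])
  let ?c = "\<kappa> (s0 * (\<delta>i * \<theta> w (- w)))"
  have "adj (T w) * (T w * T (- w)) = sc ?c (adj (T w) * P0)" by (simp add: T_mult[OF w w'] T_0)
  moreover have "adj (T w) * (T w * T (- w)) = T (- w)"
    by (simp add: mult.assoc[symmetric] T_unit[OF w] P0_T[OF w'])
  moreover have "adj (T w) * P0 = adj (T w)" using P0_T(1)[OF w] P0_facts(2) by (metis adj_mult)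
  ultimately have "sc (cnj ?c) (T (- w)) = sc (?c * cnj ?c) (adj (T w))" by (simp add: mult.commute)
  then show ?thesis using \<kappa>_cnj[OF F_mult[OF s0(1) \<delta>\<theta>_F]] T_SP[OF w'] by (metis cspan_sc sc_simps(4))
qed

lemma card_W: "card W = q ^ (2 * (n - j - 2))" using card_V(2)[of "j+2" n] jn by simp

lemma fin_W: "finite W" using card_V(1)[of "j+2" n] jn by simp

text \<open>Conjugation by \<open>T w\<close> multiplies \<open>T v\<close> by a character value in
  \<open>w\<close>; the sum over \<open>w\<close> kills every \<open>T v\<close> with
  \<open>v \<noteq> 0\<close> and leaves \<open>T 0 = P0\<close>. On the span of the
  \<open>T w\<close> this average is thus the expectation onto scalars, which replaces
  irreducibility of the Heisenberg representation.\<close>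

lemma T_expect:
  assumes "M \<in> SP" "P0 \<noteq> 0"
  shows "(\<Sum>w\<in>W. adj (T w) * M * T w) = sc (of_nat (card W) * tr M / tr P0) P0 \<and> M * P0 = M"
  using assms(1)
proof (induction rule: cspan.induct)
  case (cspan_base M)
  have tr0: "tr P0 \<noteq> 0" using proj_tr[OF P0_facts(5)] nsq_eq_0[of P0] assms(2) by auto
  obtain v where v: "v \<in> W" "M = T v" using cspan_base by blast
  have "(\<Sum>w\<in>W. adj (T w) * M * T w) = sc (\<Sum>w\<in>W. pairing v w) (T v)"
    by (simp add: v T_conj sum_sc)
  then show ?case
  proof (cases "v = 0")
    case True
    have "(\<Sum>w\<in>W. adj (T w) * M * T w) = (\<Sum>w\<in>W. sc 1 P0)"
    proof (rule sum.cong)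
      fix w assume w: "w \<in> W"
      have "adj (T w) * P0 * T w = adj (T w) * T w" using P0_T(1)[OF w] by (simp add: mult.assoc)
      then show "adj (T w) * M * T w = sc 1 P0" using v True T_unit(1)[OF w] by (simp add: T_0)
    qed simp
    then show ?thesis using tr0 v True P0_T(2)[OF v(1)] unfolding sum_sc by (simp add: T_0)
  next
    case False
    then show ?thesis
      using \<open>_ = sc (\<Sum>w\<in>W. pairing v w) (T v)\<close> tr_T[OF v(1) False] pairing_sum[OF v(1) False] v P0_T(2)[OF v(1)] by simp
  qed
next
  case cspan_0 then show ?case by simp
next
  case (cspan_add x y)
  then show ?case by (simp add: distrib_left distrib_right sum.distrib add_divide_distrib sc_add)
next
  case (cspan_sc x c)
  have "(\<Sum>w\<in>W. adj (T w) * sc c x * T w) = sc c (\<Sum>w\<in>W. adj (T w) * x * T w)" by (simp add: sc_sum)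
  then show ?case using cspan_sc by (simp add: mult_ac)
qed

lemma h_P0: assumes "h \<in> N (j + 2)" shows "\<pi> h * P0 = P0 * \<pi> h"
  by (rule Ps_commute[OF u_facts(2,3) Nj2[OF assms] fix_u[OF assms] s0(1)])

text \<open>Compute \<open>\<Sum> tr (T w)\<^sup>* M (T w) M\<^sup>*\<close> for \<open>M = \<pi> h * P0\<close> in two ways.\<close>
lemma weil_norm:
  assumes h: "h \<in> N (j + 2)" and M: "\<pi> h * P0 \<in> SP" and nz: "P0 \<noteq> 0"
  shows "(cmod (tr (\<pi> h * P0)))\<^sup>2 * real (card W) = (nsq P0)\<^sup>2 * real (card {w \<in> W. act h w = w})"
proof -
  let ?M = "\<pi> h * P0"
  have P0n: "tr P0 = of_real (nsq P0)" "nsq P0 \<noteq> 0"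
    using proj_tr[OF P0_facts(5)] nsq_eq_0 nz by auto
  have adjM: "adj ?M = P0 * \<pi> (- h)" using srep_uminus[OF rep Nj2[OF h]] P0_facts(2) by simp
  have mh: "- h \<in> N (j + 2)" by (rule N_uminus[OF h])
  have MT: "?M * T w * adj ?M = T (act h w)" if w: "w \<in> W" for w
  proof -
    have "?M * T w * adj ?M = \<pi> h * (P0 * T w * P0) * \<pi> (- h)" by (simp only: adjM mult.assoc)
    also have "\<dots> = \<pi> h * \<pi> (sig u w) * (P0 * \<pi> (- h))" using P0_T[OF w] by (simp add: T_def mult.assoc)
    also have "\<dots> = (\<pi> h * \<pi> (sig u w) * \<pi> (- h)) * P0" by (simp only: h_P0[OF mh, symmetric] mult.assoc)
    also have "\<dots> = \<pi> (h + sig u w - h) * P0"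
      by (simp only: conj_add_srep[OF rep sgrp_N Nj2[OF h] sig_N[OF w]])
    finally show ?thesis using sig_conj[OF h w] by (simp add: T_def)
  qed
  \<comment> \<open>The \<open>T w\<close> are orthogonal for the Hilbert-Schmidt product, because
    \<open>adj (T w) * T v\<close> is a scalar multiple of \<open>T (v - w)\<close>. This is what
    turns one of the two evaluations into a count of fixed vectors.\<close>
  have trT: "tr (adj (T w) * T v) = (if v = w then tr P0 else 0)" if "v \<in> W" "w \<in> W" for v w
  proof (cases "v = w")
    case True then show ?thesis using T_unit(1)[OF that(2)] by simp
  next
    case False
    have d: "v - w \<in> W" by (rule V_diff[OF that])
    let ?c = "\<kappa> (s0 * (\<delta>i * \<theta> w (v - w)))"
    have "T w * T (v - w) = sc ?c (T v)" using T_mult[OF that(2) d] by simp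
    then have "adj (T w) * (T w * T (v - w)) = sc ?c (adj (T w) * T v)" by simp
    then have "T (v - w) = sc ?c (adj (T w) * T v)"
      by (simp add: mult.assoc[symmetric] T_unit[OF that(2)] P0_T[OF d])
    then have "0 = ?c * tr (adj (T w) * T v)" using tr_T[OF d] False by (metis right_minus_eq tr_simps(3))
    moreover have "?c \<noteq> 0" using \<kappa>_norm[OF F_mult[OF s0(1) \<delta>\<theta>_F]] by (metis norm_zero zero_neq_one)
    ultimately show ?thesis using False by simp
  qed
  have "(\<Sum>w\<in>W. tr (adj (T w) * ?M * T w * adj ?M)) = (\<Sum>w\<in>W. tr (adj (T w) * T (act h w)))"
    using MT by (intro sum.cong refl) (simp add: mult.assoc)
  also have "\<dots> = (\<Sum>w\<in>W. if act h w = w then tr P0 else 0)"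
    using trT[OF act_N[OF h]] by (intro sum.cong refl) auto
  also have "\<dots> = of_nat (card {w \<in> W. act h w = w}) * tr P0"
    using fin_W by (simp add: sum.If_cases Int_def)
  finally have 1: "(\<Sum>w\<in>W. tr (adj (T w) * ?M * T w * adj ?M)) = of_nat (card {w \<in> W. act h w = w}) * tr P0" .
  have "(\<Sum>w\<in>W. tr (adj (T w) * ?M * T w * adj ?M)) = tr ((\<Sum>w\<in>W. adj (T w) * ?M * T w) * adj ?M)"
    by (simp add: sum_distrib_right)
  also have "\<dots> = of_nat (card W) * tr ?M / tr P0 * tr (P0 * adj ?M)"
    using T_expect[OF M nz] by simp
  also have "P0 * adj ?M = adj ?M" by (simp only: adjM P0_P0)
  also have "of_nat (card W) * tr ?M / tr P0 * tr (adj ?M) = of_nat (card W) * of_real ((cmod (tr ?M))\<^sup>2) / tr P0"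
    by (simp add: cmod_sq del: adj_mult)
  finally have "of_nat (card W) * of_real ((cmod (tr ?M))\<^sup>2) / tr P0 = of_nat (card {w \<in> W. act h w = w}) * tr P0"
    using 1 by simp
  then have "complex_of_real (real (card W) * (cmod (tr ?M))\<^sup>2) = of_real (real (card {w \<in> W. act h w = w}) * (nsq P0)\<^sup>2)"
    using P0n by (simp add: field_simps power2_eq_square)
  then have "real (card W) * (cmod (tr ?M))\<^sup>2 = real (card {w \<in> W. act h w = w}) * (nsq P0)\<^sup>2"
    by (simp only: of_real_eq_iff)
  then show ?thesis by (simp add: mult.commute)
qed

end


lemma sc_diff_left: "sc (c - d) X = sc c X - sc d X"
  by (rule cmx_eqI) (simp add: left_diff_distrib)

lemma (in hring) s_1 [simp]: "s 1 = 1"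
  using s_mult[of 1 "s 1"] by simp

text \<open>In a totally isotropic plane the rank-one term of a transvection expands into two
  diagonal terms and a cross term, and the cross term is a root element. Transvections conjugated by
  Heisenberg elements are evaluated in this form.\<close>

lemma (in hgeom) tv_lin:
  assumes u: "ip u u = 0" and v: "ip v v = 0" and uv: "ip u v = 0" and a: "s a = - a"
  shows "tv (sm x1 u + sm x2 v) a
    = tv u (a * (x1 * s x1)) + (tv v (a * (x2 * s x2)) + Eg u (sm (a * s x1 * x2) v) 0)"
proof (rule sym_eqI)
  fix x
  have vu: "ip v u = 0" using uv by (rule ip_0_sym)
  have sk: "s (a * (y * s y)) = - (a * (y * s y))" for y by (simp add: s_mult a mult.commute)
  have adm: "adm u (sm (a * s x1 * x2) v) 0" using u v uv by (simp add: adm_def)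
  have z: "ip (sm x1 u + sm x2 v) (sm x1 u + sm x2 v) = 0" using u v uv vu by simp
  show "act (tv (sm x1 u + sm x2 v) a) x
    = act (tv u (a * (x1 * s x1)) + (tv v (a * (x2 * s x2)) + Eg u (sm (a * s x1 * x2) v) 0)) x"
    using u v uv vu
    by (simp add: act_tv[OF z a] act_tv[OF _ sk] act_Eg[OF adm]) (simp add: fun_eq_iff s_mult a algebra_simps)
qed

section \<open>Fixed vectors of isotropic lines, and transvections inside the Heisenberg
  algebra\<close>

context heis
begin

lemma sig_iso: "w \<in> W \<Longrightarrow> ip w w = 0 \<Longrightarrow> sig u w = Eg u w 0"
  by (simp add: sig_def)

lemma sig_uminus_iso:
  assumes "w \<in> W" "ip w w = 0" shows "- sig u w = sig u (- w)"
proof -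
  have "sig u w + sig u (- w) = 0"
    using sig_add[OF assms(1) V_uminus[OF assms(1)]] assms(2) tv_0[OF u_facts(3)] by (simp add: sig_0 \<theta>_def)
  then show ?thesis by (rule minus_unique)
qed

lemma sig_conj_sig:
  assumes x: "x \<in> W" and y: "y \<in> W"
  shows "sig u x + sig u y - sig u x = sig u y + tv u (\<theta> x y - \<theta> y x)"
proof -
  let ?d = "\<theta> x y - \<theta> y x"
  have sk: "s ?d = - ?d" using \<theta>_skew[of x y] \<theta>_skew[of y x] by (simp add: s_diff)
  have "sig u x + tv u ?d - sig u x = tv u ?d"
    using conj_tv(1)[OF N_U[OF sig_N[OF x]] u_facts(3) sk] by (simp add: act_sig_u[OF x])
  then have "- sig u x + (sig u x + tv u ?d - sig u x) = - sig u x + tv u ?d" by (simp only:)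
  then have c: "tv u ?d - sig u x = - sig u x + tv u ?d"
    by (simp only: diff_conv_add_uminus add.assoc minus_add_cancel)
  have "tv u (\<theta> x y) = tv u (\<theta> y x) + tv u ?d" using tv_add[OF u_facts(3) \<theta>_skew sk] by simp
  then have "sig u x + sig u y = sig u (y + x) + tv u (\<theta> y x) + tv u ?d"
    using sig_add[OF x y] by (simp add: add.assoc add.commute[of x y])
  also have "\<dots> = sig u y + sig u x + tv u ?d" by (simp only: sig_add[OF y x])
  finally have "sig u x + sig u y - sig u x = sig u y + sig u x + (tv u ?d - sig u x)"
    by (simp add: diff_conv_add_uminus add.assoc del: add_uminus_conv_diff)
  then show ?thesis unfolding c by (simp add: add.assoc)
qed

text \<open>For isotropic \<open>v\<close>, the projection to the vectors in the range of
  \<open>P\<close> fixed by the root elements along the line of \<open>v\<close>: one step towards a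
  polarisation of the Heisenberg group.\<close>

definition Q :: "(nat \<Rightarrow> 'a) \<Rightarrow> 'i cmx \<Rightarrow> 'i cmx" where
  "Q v P = spr A (\<lambda>\<beta>. \<pi> (sig u (sm \<beta> v)) * P) (\<lambda>_. 1)"

context
  fixes P :: "'i cmx" and v w0 :: "nat \<Rightarrow> 'a"
  assumes P: "proj P" "P0 * P = P" and v: "v \<in> W" "ip v v = 0" and w0: "w0 \<in> W" "ip w0 v = e"
    and comm: "\<And>c. \<pi> (sig u (sm c v)) * P = P * \<pi> (sig u (sm c v))"
      "\<And>c. \<pi> (sig u (sm c w0)) * P = P * \<pi> (sig u (sm c w0))"
begin

lemma zero_P: "\<pi> 0 * P = P" using P(2) P0_facts(3) by (metis mult.assoc)

lemma spec_Q: "spectral A (\<lambda>\<beta>. \<pi> (sig u (sm \<beta> v)) * P) (\<lambda>_. 1)"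
proof
  show "sgrp A" by (rule sgrp_A)
  have PP: "P * P = P" "adj P = P" using P(1) by (auto simp: proj_def)
  have "\<pi> (sig u (sm (c + d) v)) * P = \<pi> (sig u (sm c v)) * P * (\<pi> (sig u (sm d v)) * P)" for c d
  proof -
    have th: "\<theta> (sm c v) (sm d v) = 0" using v(2) by (simp add: \<theta>_def)
    have "\<pi> (sig u (sm c v)) * P * (\<pi> (sig u (sm d v)) * P) = \<pi> (sig u (sm c v)) * (P * \<pi> (sig u (sm d v))) * P"
      by (simp only: mult.assoc)
    also have "\<dots> = \<pi> (sig u (sm c v)) * (\<pi> (sig u (sm d v)) * (P * P))" by (simp only: comm(1)[symmetric] mult.assoc)
    also have "\<dots> = \<pi> (sig u (sm c v + sm d v)) * P"
      using sig_mult_gen[OF V_sm[OF v(1)] V_sm[OF v(1)] P(2), of c d] by (simp only: th PP mult_zero_right \<kappa>_0 sc_simps)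
    finally show ?thesis by (simp only: sm_add_left)
  qed
  moreover have "\<pi> (sig u (sm (- c) v)) * P = adj (\<pi> (sig u (sm c v)) * P)" for c
  proof -
    have "sig u (sm (- c) v) = - sig u (sm c v)"
      using sig_uminus_iso[OF V_sm[OF v(1)], of c] v(2) by (simp add: sm_minus_left)
    then have "\<pi> (sig u (sm (- c) v)) = adj (\<pi> (sig u (sm c v)))"
      using srep_uminus[OF rep sig_N[OF V_sm[OF v(1)]]] by simp
    then show ?thesis using comm(1)[of "- c"] PP by simp
  qed
  ultimately show "srep A (\<lambda>\<beta>. \<pi> (sig u (sm \<beta> v)) * P)" by (simp add: srep_def)
qed simp_all

lemma Q_proj: "proj (Q v P)"
  unfolding Q_def by (rule spectral.proj_spr[OF spec_Q])

lemma P_Q: "P * Q v P = Q v P"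
  using spectral.spr_0(1)[OF spec_Q] by (simp add: Q_def sig_0 zero_P)

lemma P0_Q: "P0 * Q v P = Q v P" using P_Q P(2) by (metis mult.assoc)

lemma sig_Q: assumes "e * \<beta> = \<beta>" shows "\<pi> (sig u (sm \<beta> v)) * Q v P = Q v P"
  using spectral.spr_left[OF spec_Q, of \<beta>] assms P_Q by (simp add: Q_def[symmetric] in_A mult.assoc)

lemma Q_commute:
  assumes "\<And>\<beta>. M * (\<pi> (sig u (sm \<beta> v)) * P) = \<pi> (sig u (sm \<beta> v)) * P * M" shows "M * Q v P = Q v P * M"
  unfolding Q_def by (rule spectral.spr_commute[OF spec_Q]) (rule assms)

text \<open>Conjugation by \<open>sig u (sm c w0)\<close> multiplies
  \<open>sig u (sm \<beta> v)\<close> by a character value that pairs \<open>c\<close> and \<beta>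
  perfectly, because \<open>ip w0 v = e\<close>. The conjugates of \<open>Q v P\<close> are
  therefore the projections to all characters of the line of \<open>v\<close>, and these add up to
  \<open>P\<close>.\<close>

lemma Q_decomp: "P = (\<Sum>c\<in>A. \<pi> (sig u (sm c w0)) * Q v P * \<pi> (- sig u (sm c w0)))"
proof -
  define h where "h \<beta> c = \<kappa> (s0 * (\<delta>i * c * s \<beta> + s (\<delta>i * c * s \<beta>)))" for \<beta> c
  have conj: "\<pi> (sig u (sm c w0)) * (\<pi> (sig u (sm \<beta> v)) * P) * \<pi> (- sig u (sm c w0)) = sc (h \<beta> c) (\<pi> (sig u (sm \<beta> v)) * P)" for c \<beta>
  proof -
    let ?x = "sm c w0" and ?y = "sm \<beta> v"
    have xy: "?x \<in> W" "?y \<in> W" using v w0 V_sm by auto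
    let ?d = "\<theta> ?x ?y - \<theta> ?y ?x"
    have vw: "ip v w0 = e" using ip_sym[of v w0] w0(2) by simp
    have ds: "?d = c * s \<beta> * e - s (c * s \<beta> * e)"
      using \<theta>_diff[OF xy(1), of ?y] vw w0(2) by (simp add: s_mult mult_ac)
    have sk: "s ?d = - ?d" using \<theta>_skew[of ?x ?y] \<theta>_skew[of ?y ?x] by (simp add: s_diff)
    have ed: "e * ?d = ?d" using e_\<theta> by (simp add: right_diff_distrib)
    have "\<delta>i * e = \<delta>i" using e_\<delta>i by (simp add: mult.commute)
    moreover have "\<delta>i * ?d = (\<delta>i * e) * c * s \<beta> + s ((\<delta>i * e) * c * s \<beta>)"
      unfolding ds by (simp add: s_mult algebra_simps)
    ultimately have dd: "\<delta>i * ?d = \<delta>i * c * s \<beta> + s (\<delta>i * c * s \<beta>)" by (simp only:)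
    have Pm: "P * \<pi> (- sig u ?x) = \<pi> (- sig u ?x) * P"
      using arg_cong[OF comm(2)[of c], of adj] P(1) srep_uminus[OF rep sig_N[OF xy(1)]] by (simp add: proj_def)
    have tvN: "tv u ?d \<in> N j" by (rule N_tv[OF u_facts(2,3) ed sk])
    have "\<pi> (sig u ?x) * (\<pi> (sig u ?y) * P) * \<pi> (- sig u ?x) = \<pi> (sig u ?x) * \<pi> (sig u ?y) * \<pi> (- sig u ?x) * P"
      by (simp only: mult.assoc Pm)
    also have "\<dots> = \<pi> (sig u ?y) * (\<pi> (tv u ?d) * P0 * P)"
      using conj_add_srep[OF rep sgrp_N sig_N[OF xy(1)] sig_N[OF xy(2)]] sig_conj_sig[OF xy]
        srep_add[OF rep sig_N[OF xy(2)] tvN] P(2) by (simp add: mult.assoc)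
    also have "\<dots> = sc (\<kappa> (s0 * (\<delta>i * ?d))) (\<pi> (sig u ?y) * P)" by (simp only: tvP[OF ed sk] sc_simps P)
    finally show ?thesis by (simp only: dd h_def)
  qed
  have hsum: "(\<Sum>c\<in>A. h \<beta> c) = (if \<beta> = 0 then of_nat (card A) else 0)" if b: "\<beta> \<in> A" for \<beta>
  proof (cases "\<beta> = 0")
    case False
    have es: "e * s \<beta> = s \<beta>" using b e_s by (simp add: in_A)
    obtain c where c: "e * c = c" "h \<beta> c \<noteq> 1" using trace_form[OF es] False by (auto simp: h_def)
    have tF: "s0 * (\<delta>i * c * s \<beta> + s (\<delta>i * c * s \<beta>)) \<in> F" for c
      by (intro F_mult s0 trace_F) (simp add: mult.assoc[symmetric])
    have "h \<beta> (x + y) = h \<beta> x * h \<beta> y" for x y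
      unfolding h_def \<kappa>_add[OF tF tF, symmetric] by (simp add: s_add algebra_simps)
    then show ?thesis using False c by (simp add: char_sum_zero[OF sgrp_A, of _ c] in_A)
  qed (simp add: h_def)
  have "(\<Sum>c\<in>A. \<pi> (sig u (sm c w0)) * Q v P * \<pi> (- sig u (sm c w0)))
    = (\<Sum>c\<in>A. sc (1 / of_nat (card A)) (\<Sum>\<beta>\<in>A. sc (h \<beta> c) (\<pi> (sig u (sm \<beta> v)) * P)))"
    by (simp add: Q_def spr_def sum_distrib_left sum_distrib_right conj del: add_2_eq_Suc')
  also have "\<dots> = sc (1 / of_nat (card A)) (\<Sum>\<beta>\<in>A. \<Sum>c\<in>A. sc (h \<beta> c) (\<pi> (sig u (sm \<beta> v)) * P))"
    unfolding sc_sum[symmetric] by (subst sum.swap) simp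
  also have "(\<Sum>\<beta>\<in>A. \<Sum>c\<in>A. sc (h \<beta> c) (\<pi> (sig u (sm \<beta> v)) * P)) = (\<Sum>\<beta>\<in>A. if \<beta> = 0 then sc (of_nat (card A)) P else 0)"
    unfolding sum_sc by (intro sum.cong refl) (simp add: hsum sig_0 zero_P)
  also have "\<dots> = sc (of_nat (card A)) P" using sgrpD(2)[OF sgrp_A] by simp
  finally have "(\<Sum>c\<in>A. \<pi> (sig u (sm c w0)) * Q v P * \<pi> (- sig u (sm c w0)))
    = sc (1 / of_nat (card A)) (sc (of_nat (card A)) P)" .
  moreover have "sc (1 / of_nat (card A)) (sc (of_nat (card A)) P) = P"
    using sgrpD(2,5)[OF sgrp_A] by auto
  ultimately show ?thesis by (simp only:)
qed

lemma tr_Q: "tr P = of_nat (q\<^sup>2) * tr (Q v P)"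
proof -
  have z: "\<pi> 0 * Q v P = Q v P" using P_Q zero_P by (metis mult.assoc)
  have "tr P = (\<Sum>c\<in>A. tr (\<pi> (sig u (sm c w0)) * Q v P * \<pi> (- sig u (sm c w0))))"
    by (subst Q_decomp) simp
  also have "\<dots> = (\<Sum>c\<in>A. tr (Q v P))"
    by (intro sum.cong refl tr_conj[OF rep sgrp_N sig_N[OF V_sm[OF w0(1)]] z])
  finally show ?thesis by (simp add: card_A')
qed

end

text \<open>
  If the transvections with axis \<open>v\<close> act on the range of \<open>P'\<close> by a character \<open>y \<noteq> 0\<close>, there is an
  isotropic \<open>z = u + \<zeta> v\<close> whose transvections act trivially on it, although the root group
  of \<open>z\<close> does not.
\<close>
lemma tv_fixes_Q:
  assumes stop: "\<And>w a. w \<in> W \<Longrightarrow> adm u w a \<Longrightarrow> e * a = a \<Longrightarrow> \<pi> (Eg u w a) * PZ \<pi> u = PZ \<pi> u"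
    and v: "v \<in> W" "ip v v = 0" and P': "P0 * P' = P'" "\<And>\<beta>. e * \<beta> = \<beta> \<Longrightarrow> \<pi> (sig u (sm \<beta> v)) * P' = P'"
    and a: "e * a = a" "s a = - a"
  shows "\<pi> (tv v a) * P' = P'"
proof -
  have vj: "v \<in> V j n" using V_mono[OF v(1)] by simp
  have uv: "ip u v = 0" "ip v u = 0" using u_perp[OF v(1)] by auto
  have R0: "Ps \<pi> v y * P' = 0" if y: "y \<in> F" "y \<noteq> 0" for y
  proof -
    define R where "R = Ps \<pi> v y * P'"
    obtain c where c: "c \<in> F" "c * y = e" using F_inverse[OF y] by blast
    have "e * (- (s0 * c)) = - (s0 * c)" "s (- (s0 * c)) = - (s0 * c)"
      using F_uminus[OF F_mult[OF s0(1) c(1)]] by (auto simp: in_F)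
    \<comment> \<open>The norm of \<zeta> is \<open>- s0 / y\<close>, so that the transvections with
      axis \<open>u + \<zeta> v\<close> act on \<open>R\<close> by values of \<kappa> at multiples
      of \<open>s0 + y * (\<zeta> * s \<zeta>) = 0\<close>.\<close>
    then obtain \<zeta> where z0: "e * \<zeta> = \<zeta>" "\<zeta> * s \<zeta> = - (s0 * c)" using norm_onto by blast
    have "y * (s0 * c) = (c * y) * s0" by (simp only: mult_ac)
    then have Ny: "s0 + y * (\<zeta> * s \<zeta>) = 0" unfolding z0(2) using c(2) s0(1) by (simp add: in_F)
    have adm0: "adm u (sm \<beta> v) 0" for \<beta> using v(2) uv u_facts(3) by (simp add: adm_def)
    have sig0: "sig u (sm \<beta> v) = Eg u (sm \<beta> v) 0" for \<beta> using sig_iso[OF V_sm[OF v(1)]] v(2) by simp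
    have "\<zeta> \<noteq> 0"
    proof
      assume "\<zeta> = 0" then show False using Ny s0(2) by simp
    qed
    have R_v: "\<pi> (tv v (\<delta> * t)) * R = sc (\<kappa> (y * t)) R" if "t \<in> F" for t
      using Ps_left(1)[OF vj v(2) y(1) that] by (simp add: R_def mult.assoc[symmetric])
    have R_sig: "\<pi> (sig u (sm \<beta> v)) * R = R" if b: "e * \<beta> = \<beta>" for \<beta>
    proof -
      have "act (sig u (sm \<beta> v)) v = v" using uv v(2) by (simp add: sig0 act_Eg[OF adm0])
      then have "\<pi> (sig u (sm \<beta> v)) * Ps \<pi> v y = Ps \<pi> v y * \<pi> (sig u (sm \<beta> v))"
        by (rule Ps_commute[OF vj v(2) sig_N[OF V_sm[OF v(1)]] _ y(1)])
      then have "\<pi> (sig u (sm \<beta> v)) * R = Ps \<pi> v y * (\<pi> (sig u (sm \<beta> v)) * P')" by (simp add: R_def mult.assoc[symmetric])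
      then show ?thesis using P'(2)[OF b] by (simp add: R_def)
    qed
    have R_u: "\<pi> (tv u (\<delta> * t)) * R = sc (\<kappa> (s0 * t)) R" if t: "t \<in> F" for t
    proof -
      have "act (tv u (\<delta> * t)) v = v" using uv skew_F[OF t] by (simp add: act_tv[OF u_facts(3)])
      then have "\<pi> (tv u (\<delta> * t)) * Ps \<pi> v y = Ps \<pi> v y * \<pi> (tv u (\<delta> * t))"
        by (rule Ps_commute[OF vj v(2) tv_F_N[OF u_facts(2,3) t] _ y(1)])
      then have "\<pi> (tv u (\<delta> * t)) * R = Ps \<pi> v y * (\<pi> (tv u (\<delta> * t)) * P0 * P')"
        using P'(1) by (simp add: R_def mult.assoc[symmetric]) (simp add: mult.assoc)
      then show ?thesis by (simp add: Ps_left(1)[OF u_facts(2,3) s0(1) t] P'(1) R_def)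
    qed
    define z where "z = u + sm \<zeta> v"
    have zV: "z \<in> V j n" unfolding z_def by (intro V_add V_sm vj u_facts)
    have zz: "ip z z = 0" using uv v(2) u_facts(3) by (simp add: z_def)
    have R_z: "\<pi> (tv z (\<delta> * t)) * R = R" if t: "t \<in> F" for t
    proof -
      have sk: "s (\<delta> * t) = - (\<delta> * t)" "e * (\<delta> * t) = \<delta> * t" using skew_F[OF t] by auto
      let ?Nz = "\<zeta> * s \<zeta>"
      have NF: "?Nz * t \<in> F" using z0(2) F_mult[OF F_uminus[OF F_mult[OF s0(1) c(1)]] t] by simp
      have "tv z (\<delta> * t) = tv u (\<delta> * t) + (tv v (\<delta> * (?Nz * t)) + sig u (sm (\<delta> * t * \<zeta>) v))"
        using tv_lin[OF u_facts(3) v(2) uv(1) sk(1), of 1 \<zeta>] by (simp add: z_def sig0 mult_ac)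
      then have "\<pi> (tv z (\<delta> * t)) * R = \<pi> (tv u (\<delta> * t)) * (\<pi> (tv v (\<delta> * (?Nz * t))) * (\<pi> (sig u (sm (\<delta> * t * \<zeta>) v)) * R))"
        using srep_add[OF rep] tv_F_N[OF u_facts(2,3) t] tv_F_N[OF vj v(2) NF] sig_N[OF V_sm[OF v(1)]] N_add
        by (simp add: mult.assoc)
      also have "\<dots> = sc (\<kappa> (y * (?Nz * t)) * \<kappa> (s0 * t)) R"
        using R_sig[of "\<delta> * t * \<zeta>"] R_v[OF NF] R_u[OF t] sk(2) by (simp add: mult.assoc[symmetric])
      also have "\<kappa> (y * (?Nz * t)) * \<kappa> (s0 * t) = \<kappa> ((s0 + y * ?Nz) * t)"
        using \<kappa>_add[OF F_mult[OF s0(1) t] F_mult[OF y(1) NF]] by (simp add: algebra_simps)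
      finally show ?thesis using Ny by simp
    qed
    have PZR: "PZ \<pi> z * R = R"
    proof -
      have "(\<Sum>t\<in>F. \<pi> (tv z (\<delta> * t)) * R) = sc (of_nat (card F)) R"
        using R_z by (simp add: sum_sc[of "\<lambda>_. 1" R F, simplified])
      then show ?thesis using sgrpD(5)[OF sgrp_F] F_0 by (auto simp: Ps_def spr_def sum_distrib_right)
    qed
    \<comment> \<open>This element of \<open>N j\<close> carries \<open>u\<close> to
      \<open>z\<close> and fixes the line of \<open>v\<close>. It transports the assumption
      \<open>stop\<close> from \<open>u\<close> to \<open>z\<close>, and since
      \<open>PZ \<pi> z\<close> fixes \<open>R\<close>, the root elements of \<open>z\<close> along
      \<open>v\<close> fix \<open>R\<close> too.\<close>
    define g where "g = Eg (u1 j) (sm \<zeta> v) 0"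
    have u1v: "ip (u1 j) v = 0" "ip v (u1 j) = 0"
      using ip_disjoint[OF u_facts(4) v(1)] ip_disjoint[OF v(1) u_facts(4)] by auto
    have gN: "g \<in> N j" unfolding g_def
      by (rule cross_N[OF u_facts(5) V_sm[OF vj] u_facts(6)]) (simp_all add: v(2) u1v)
    have admg: "adm (u1 j) (sm \<zeta> v) 0" by (simp add: adm_def v(2) u1v u_facts(6))
    have gu: "act g u = z" using u_facts(7) uv z0(1) by (simp add: g_def act_Eg[OF admg] z_def)
    have gv: "act g (sm \<beta> v) = sm \<beta> v" for \<beta> using u1v v(2) by (simp add: g_def act_Eg[OF admg])
    have R_E: "\<pi> (Eg z (sm \<beta> v) 0) * R = R" if b: "e * \<beta> = \<beta>" for \<beta>
    proof -
      have bW: "sm \<beta> v \<in> W" by (rule V_sm[OF v(1)])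
      have adm: "adm u (sm \<beta> v) 0" using v(2) uv u_facts(3) by (simp add: adm_def)
      have EN: "Eg u (sm \<beta> v) 0 \<in> N j" using sig_N[OF bW] sig_iso[OF bW] v(2) by simp
      have "g + Eg u (sm \<beta> v) 0 - g = Eg z (sm \<beta> v) 0" using conj_Eg(2)[OF N_U[OF gN] adm] gu gv by simp
      then have 1: "\<pi> g * \<pi> (Eg u (sm \<beta> v) 0) * \<pi> (- g) = \<pi> (Eg z (sm \<beta> v) 0)"
        using conj_add_srep[OF rep sgrp_N gN EN] by simp
      have "\<pi> (Eg z (sm \<beta> v) 0) * PZ \<pi> z = \<pi> g * (\<pi> (Eg u (sm \<beta> v) 0) * ((\<pi> (- g) * \<pi> g) * PZ \<pi> u)) * \<pi> (- g)"
        unfolding 1[symmetric] Ps_conj[OF u_facts(2,3) gN, of 0, unfolded gu, symmetric] by (simp only: mult.assoc)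
      also have "\<dots> = \<pi> g * PZ \<pi> u * \<pi> (- g)"
        using \<pi>_inv(1)[OF gN] Ps_0(1)[OF u_facts(2,3) F_0] stop[OF bW adm] by (simp add: mult.assoc)
      also have "\<dots> = PZ \<pi> z" using Ps_conj[OF u_facts(2,3) gN] gu by simp
      finally have "\<pi> (Eg z (sm \<beta> v) 0) * (PZ \<pi> z * R) = PZ \<pi> z * R" by (simp only: mult.assoc[symmetric])
      then show ?thesis by (simp only: PZR)
    qed
    \<comment> \<open>The same root element is the product of one with axis \<open>u\<close>, which
      fixes \<open>R\<close>, and a transvection with axis \<open>v\<close>, which acts on
      \<open>R\<close> by a value of \<kappa>. Some \<beta> makes this value different from 1, and
      \<open>R = 0\<close> follows.\<close>
    have R_scal: "sc (\<kappa> (y * (\<beta> * (\<delta>i * s \<zeta>) + s (\<beta> * (\<delta>i * s \<zeta>))))) R = R" if b: "e * \<beta> = \<beta>" for \<beta>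
    proof -
      let ?a = "\<beta> * s \<zeta> - s \<beta> * \<zeta>"
      have ska: "s ?a = - ?a" "e * ?a = ?a" using b z0(1) e_s by (simp_all add: s_diff s_mult right_diff_distrib mult.assoc[symmetric])
      have t: "\<delta>i * ?a \<in> F" "\<delta> * (\<delta>i * ?a) = ?a" using skew_to_F[OF ska(2,1)] by auto
      have adm1: "adm z (sm \<beta> v) 0" using zz uv v(2) by (simp add: adm_def z_def)
      have adm2: "adm u (sm \<beta> v) 0" using v(2) uv u_facts(3) by (simp add: adm_def)
      have "Eg z (sm \<beta> v) 0 = sig u (sm \<beta> v) + tv v ?a"
      proof (rule sym_eqI)
        fix x
        have "act (Eg z (sm \<beta> v) 0) x = x + sm (ip z x) (sm \<beta> v) - sm (ip (sm \<beta> v) x) z + sm (0 * ip z x) z"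
          by (rule act_Eg[OF adm1])
        then show "act (Eg z (sm \<beta> v) 0) x = act (sig u (sm \<beta> v) + tv v ?a) x"
          using uv v(2) by (simp add: sig0 act_Eg[OF adm2] act_tv[OF v(2) ska(1)] z_def)
            (simp add: fun_eq_iff algebra_simps)
      qed
      then have "\<pi> (Eg z (sm \<beta> v) 0) * R = \<pi> (sig u (sm \<beta> v)) * (\<pi> (tv v (\<delta> * (\<delta>i * ?a))) * R)"
        using srep_add[OF rep sig_N[OF V_sm[OF v(1)]] N_tv[OF vj v(2) ska(2,1)]] t(2) by (simp add: mult.assoc)
      also have "\<dots> = sc (\<kappa> (y * (\<delta>i * ?a))) R" using R_v[OF t(1)] R_sig[OF b] by simp
      also have "\<delta>i * ?a = \<beta> * (\<delta>i * s \<zeta>) + s (\<beta> * (\<delta>i * s \<zeta>))" by (simp add: s_mult algebra_simps)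
      finally have "\<pi> (Eg z (sm \<beta> v) 0) * R = sc (\<kappa> (y * (\<beta> * (\<delta>i * s \<zeta>) + s (\<beta> * (\<delta>i * s \<zeta>))))) R" .
      then show ?thesis using R_E[OF b] by (rule trans[OF sym])
    qed
    let ?w = "y * \<delta>i * s \<zeta>"
    have "?w \<noteq> 0"
    proof
      assume "?w = 0"
      then have "(c * y) * (\<delta> * \<delta>i) * s \<zeta> = 0" by (metis mult.assoc mult.commute mult_zero_right)
      then show False using c(2) e_s[OF z0(1)] \<open>\<zeta> \<noteq> 0\<close> by simp
    qed
    moreover have "e * ?w = ?w" using y(1) by (simp add: in_F mult.assoc[symmetric])
    ultimately obtain \<beta> where b: "e * \<beta> = \<beta>" "\<kappa> (\<beta> * ?w + s (\<beta> * ?w)) \<noteq> 1" using \<kappa>_trace_nontriv by blast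
    have "\<beta> * ?w + s (\<beta> * ?w) = y * (\<beta> * (\<delta>i * s \<zeta>) + s (\<beta> * (\<delta>i * s \<zeta>)))"
      using y(1) by (simp add: in_F s_mult algebra_simps)
    then have "sc (\<kappa> (\<beta> * ?w + s (\<beta> * ?w)) - 1) R = 0" using R_scal[OF b(1)] by (simp add: sc_diff_left)
    then show ?thesis using b(2) by (simp add: sc_eq_0 R_def)
  qed
  have "P' = \<pi> 0 * P'" using P'(1) P0_facts(3) by (metis mult.assoc)
  also have "\<dots> = (\<Sum>y\<in>F. Ps \<pi> v y * P')" unfolding Ps_complete[OF vj v(2), symmetric] by (rule sum_distrib_right)
  also have "\<dots> = (\<Sum>y\<in>F. if y = 0 then PZ \<pi> v * P' else 0)" using R0 by (intro sum.cong refl) simp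
  also have "\<dots> = PZ \<pi> v * P'" by simp
  finally have eq: "P' = PZ \<pi> v * P'" .
  have "\<pi> (tv v a) * P' = \<pi> (tv v a) * PZ \<pi> v * P'" by (subst (1) eq) (simp add: mult.assoc)
  also have "\<dots> = P'" unfolding PZ_left(1)[OF vj v(2) a] using eq by (rule sym)
  finally show ?thesis .
qed

end


text \<open>The complement of \<open>P\<close> contributes the sum of a positive definite function,
  which is nonnegative. A lower bound found on a subrepresentation therefore persists for the
  representation containing it.\<close>

lemma sum_subrep:
  assumes "srep H \<pi>" "sgrp H" "gram H f" "proj P" "\<pi> 0 * P = P"
    and comm: "\<And>h. h \<in> H \<Longrightarrow> \<pi> h * P = P * \<pi> h"
  shows "Re (\<Sum>h\<in>H. f h * cnj (tr (\<pi> h))) \<ge> Re (\<Sum>h\<in>H. f h * cnj (tr (\<pi> h * P)))"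
proof -
  note z = srep_0[OF assms(1,2)]
  let ?P = "\<pi> 0 - P"
  have "proj ?P" by (rule proj_diff[OF z(1) assms(4,5)])
  moreover have "\<pi> h * ?P = ?P * \<pi> h" if "h \<in> H" for h
    using comm[OF that] z(2,3)[OF that] by (simp add: algebra_simps)
  ultimately have "srep H (\<lambda>h. \<pi> h * ?P)" by (intro srep_mult_proj[OF assms(1)])
  then have "gram H (\<lambda>h. f h * cnj (tr (\<pi> h * ?P)))"
    by (rule gram_mult[OF assms(3) gram_cnj[OF gram_tr[OF _ assms(2)]]])
  then have nonneg: "Re (\<Sum>h\<in>H. f h * cnj (tr (\<pi> h * ?P))) \<ge> 0" by (rule gram_sum_nonneg[OF _ assms(2)])
  have eq: "f h * cnj (tr (\<pi> h)) = f h * cnj (tr (\<pi> h * P)) + f h * cnj (tr (\<pi> h * ?P))" if "h \<in> H" for h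
    using z(3)[OF that] by (simp add: right_diff_distrib algebra_simps)
  have "(\<Sum>h\<in>H. f h * cnj (tr (\<pi> h)))
    = (\<Sum>h\<in>H. f h * cnj (tr (\<pi> h * P))) + (\<Sum>h\<in>H. f h * cnj (tr (\<pi> h * ?P)))"
    by (subst sum.distrib[symmetric], rule sum.cong[OF refl], rule eq)
  then show ?thesis using nonneg by simp
qed

context heis
begin

context
  assumes stop: "\<And>w a. w \<in> W \<Longrightarrow> adm u w a \<Longrightarrow> e * a = a \<Longrightarrow> \<pi> (Eg u w a) * PZ \<pi> u = PZ \<pi> u"
begin

text \<open>The range of \<open>P0\<close> is spanned by conjugates of \<open>P'\<close>, the part
  fixed by the root line of \<open>v\<close>. On each conjugate the transvection is a scalar:
  conjugated back, its axis becomes \<open>\<gamma> u + v\<close>, and it factors into a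
  transvection with axis \<open>u\<close>, which is scalar, and two factors fixing
  \<open>P'\<close>. As the conjugates lie in the span of the \<open>T w\<close>, so does the
  transvection.\<close>

lemma tv_SP:
  assumes v: "v \<in> W" "ip v v = 0" and a: "e * a = a" "s a = - a"
  shows "\<pi> (tv v a) * P0 \<in> SP"
proof (cases "prim v")
  case False
  have "tv v a = 0" by (rule tv_trivial_or_prim[OF v False a(2)])
  then show ?thesis using T_SP[of 0] by (simp add: T_0 P0_facts)
next
  case True
  obtain g where g: "g \<in> N (j + 2)" "act g v = u1 (j + 2)"
    using move_isotropic[of "j + 2" v] v True jn by auto
  \<comment> \<open>A partner with \<open>ip w0 v = e\<close> exists because \<open>v\<close> is
    conjugate to one vector of a hyperbolic pair; \<open>w0\<close> is the preimage of the
    other.\<close>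
  define w0 where "w0 = act (- g) (u0 (j + 2))"
  have uW: "u0 (j + 2) \<in> W" "ip (u0 (j + 2)) (u1 (j + 2)) = e"
    using u0_facts[of "j + 2"] jn by auto
  have w0: "w0 \<in> W" unfolding w0_def by (rule act_N[OF N_uminus[OF g(1)] uW(1)])
  have "ip w0 v = ip (act (- g) (u0 (j + 2))) (act (- g) (act g v))" by (simp add: w0_def)
  also have "\<dots> = e" using UD(3)[OF N_U[OF N_uminus[OF g(1)]]] g(2) uW(2) by simp
  finally have w0v: "ip w0 v = e" .
  have comm: "\<pi> (sig u (sm c v)) * P0 = P0 * \<pi> (sig u (sm c v))" "\<pi> (sig u (sm c w0)) * P0 = P0 * \<pi> (sig u (sm c w0))" for c
    using sig_P0 V_sm v(1) w0 by blast+
  note ctx = P0_facts(5,1) v w0 w0v comm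
  define P' where "P' = Q v P0"
  have P'0: "P0 * P' = P'" unfolding P'_def by (rule P0_Q[OF ctx])
  have P'sig: "\<pi> (sig u (sm \<beta> v)) * P' = P'" if "e * \<beta> = \<beta>" for \<beta>
    unfolding P'_def by (rule sig_Q[OF ctx that])
  have P'tv: "\<pi> (tv v a) * P' = P'" by (rule tv_fixes_Q[OF stop v P'0 P'sig a])
  have P'SP: "P' \<in> SP"
    unfolding P'_def Q_def spr_def
    by (intro cspan_sc cspan_sum) (use T_SP[OF V_sm[OF v(1)]] in \<open>simp add: T_def\<close>)
  define X where "X c = sig u (sm c w0)" for c
  have XN: "X c \<in> N j" for c unfolding X_def by (rule sig_N[OF V_sm[OF w0]])
  have uv: "ip u v = 0" "ip v u = 0" using u_perp[OF v(1)] by auto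
  have step: "\<exists>k. \<pi> (tv v a) * (\<pi> (X c) * P' * \<pi> (- X c)) = sc k (\<pi> (X c) * P' * \<pi> (- X c))" for c
  proof -
    define x where "x = sm c w0"
    let ?\<gamma> = "ip x v"
    have xW: "x \<in> W" unfolding x_def by (rule V_sm[OF w0])
    have Xx: "X c = Eg u x (- (b * ip x x))" by (simp add: X_def x_def sig_def)
    have tvN: "tv v a \<in> N j" using N_tv[OF V_mono[OF v(1)] v(2) a] by simp
    have "act (X c) (sm ?\<gamma> u + sm 1 v) = v"
      using uv u_facts(3) u_perp[OF xW] by (simp add: Xx act_Eg[OF sig_adm[OF xW]])
    then have "act (- X c) v = sm ?\<gamma> u + sm 1 v" by (metis act_uminus_cancel(2))
    then have "- X c + tv v a + X c = tv (sm ?\<gamma> u + sm 1 v) a"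
      using conj_tv(1)[OF N_U[OF N_uminus[OF XN[of c]]] v(2) a(2)] by simp
    also have "\<dots> = tv u (a * (?\<gamma> * s ?\<gamma>)) + (tv v a + sig u (sm (a * s ?\<gamma>) v))"
      using tv_lin[OF u_facts(3) v(2) uv(1) a(2), of ?\<gamma> 1] sig_iso[OF V_sm[OF v(1)]] v(2) by simp
    finally have conj: "- X c + tv v a + X c = tv u (a * (?\<gamma> * s ?\<gamma>)) + (tv v a + sig u (sm (a * s ?\<gamma>) v))" .
    have sk: "s (a * (?\<gamma> * s ?\<gamma>)) = - (a * (?\<gamma> * s ?\<gamma>))" "e * (a * (?\<gamma> * s ?\<gamma>)) = a * (?\<gamma> * s ?\<gamma>)"
      using a by (simp_all add: s_mult mult.assoc[symmetric])
    have tuN: "tv u (a * (?\<gamma> * s ?\<gamma>)) \<in> N j" by (rule N_tv[OF u_facts(2,3) sk(2,1)])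
    have sgN: "sig u (sm (a * s ?\<gamma>) v) \<in> N j" by (rule sig_N[OF V_sm[OF v(1)]])
    let ?k = "\<kappa> (s0 * (\<delta>i * (a * (?\<gamma> * s ?\<gamma>))))"
    have eb: "e * (a * s ?\<gamma>) = a * s ?\<gamma>" using a(1) by (simp only: mult.assoc[symmetric])
    have "\<pi> (- X c + tv v a + X c) * P' = \<pi> (tv u (a * (?\<gamma> * s ?\<gamma>))) * (\<pi> (tv v a) * (\<pi> (sig u (sm (a * s ?\<gamma>) v)) * P'))"
      unfolding conj using srep_add[OF rep tuN N_add[OF tvN sgN]] srep_add[OF rep tvN sgN] by (simp only: mult.assoc)
    also have "\<dots> = \<pi> (tv u (a * (?\<gamma> * s ?\<gamma>))) * P0 * P'" by (simp only: P'sig[OF eb] P'tv mult.assoc P'0)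
    also have "\<dots> = sc ?k P'" by (simp only: tvP[OF sk(2,1)] sc_simps P'0)
    finally have *: "\<pi> (- X c + tv v a + X c) * P' = sc ?k P'" .
    have "X c + (- X c + tv v a + X c) = tv v a + X c" by (simp only: add.assoc add_minus_cancel)
    then have "\<pi> (tv v a) * \<pi> (X c) = \<pi> (X c) * \<pi> (- X c + tv v a + X c)"
      using srep_add[OF rep XN[of c], of "- X c + tv v a + X c"] srep_add[OF rep tvN XN[of c]] N_add N_uminus XN tvN by simp
    then have "\<pi> (tv v a) * (\<pi> (X c) * P' * \<pi> (- X c)) = \<pi> (X c) * (\<pi> (- X c + tv v a + X c) * P') * \<pi> (- X c)"
      by (metis mult.assoc)
    then show ?thesis unfolding * by (intro exI[of _ ?k]) simp
  qed
  then obtain k where k: "\<And>c. \<pi> (tv v a) * (\<pi> (X c) * P' * \<pi> (- X c)) = sc (k c) (\<pi> (X c) * P' * \<pi> (- X c))" by metis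
  have inSP: "\<pi> (X c) * P' * \<pi> (- X c) \<in> SP" for c
  proof -
    have xW: "sm c w0 \<in> W" by (rule V_sm[OF w0])
    have P'r: "P' * P0 = P'"
    proof -
      have a1: "adj P' = P'" using Q_proj[OF ctx] by (simp add: P'_def proj_def)
      have "P' * P0 = adj (P0 * P')" using a1 P0_facts(2) by simp
      then show ?thesis by (simp only: P'0 a1)
    qed
    have "T (sm c w0) * P' * adj (T (sm c w0)) = \<pi> (X c) * (P0 * P') * (P0 * \<pi> (- X c))"
      by (simp only: adj_T[OF xW] sig_P0'[OF xW]) (simp only: T_def X_def mult.assoc)
    also have "\<dots> = \<pi> (X c) * (P' * P0) * \<pi> (- X c)" by (simp only: P'0 mult.assoc)
    finally show ?thesis using SP_mult[OF SP_mult[OF T_SP[OF xW] P'SP] adj_T_SP[OF xW]] P'r by simp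
  qed
  have "P0 = (\<Sum>c\<in>A. \<pi> (X c) * P' * \<pi> (- X c))" unfolding P'_def X_def by (rule Q_decomp[OF ctx])
  then have "\<pi> (tv v a) * P0 = \<pi> (tv v a) * (\<Sum>c\<in>A. \<pi> (X c) * P' * \<pi> (- X c))" by (rule arg_cong)
  then have "\<pi> (tv v a) * P0 = (\<Sum>c\<in>A. \<pi> (tv v a) * (\<pi> (X c) * P' * \<pi> (- X c)))"
    by (simp only: sum_distrib_left)
  also have "\<dots> = (\<Sum>c\<in>A. sc (k c) (\<pi> (X c) * P' * \<pi> (- X c)))" by (simp only: k)
  also have "\<dots> \<in> SP" by (intro cspan_sum cspan_sc inSP)
  finally show ?thesis .
qed

text \<open>Provides the hypothesis of \<open>weil_norm\<close> on all of \<open>N (j + 2)\<close>: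
  there the group acts on the range of \<open>P0\<close> inside the Heisenberg algebra, hence as a
  multiple of a Weil representation.\<close>

lemma N_SP: "h \<in> N (j + 2) \<Longrightarrow> \<pi> h * P0 \<in> SP"
proof (induction rule: N.induct)
  case N_zero show ?case using T_SP[of 0] by (simp add: T_0 P0_facts)
next
  case (N_step z a g)
  have tvN: "tv z a \<in> N j" by (rule Nj2[OF N_tv[OF N_step(1-4)]])
  have "\<pi> (tv z a + g) * P0 = \<pi> (tv z a) * (\<pi> g * P0)"
    using srep_add[OF rep tvN Nj2[OF N_step(5)]] by (simp add: mult.assoc)
  also have "\<pi> g * P0 = P0 * (\<pi> g * P0)" by (simp only: h_P0[OF N_step(5)] P0_P0)
  also have "\<pi> (tv z a) * (P0 * (\<pi> g * P0)) = (\<pi> (tv z a) * P0) * (\<pi> g * P0)" by (simp only: mult.assoc)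
  finally show ?case using SP_mult[OF tv_SP[OF N_step(1-4)] N_step(6)] by simp
qed

text \<open>Each hyperbolic plane of \<open>W\<close> lowers the trace by the exact factor
  \<open>q\<^sup>2\<close>, by passing to the vectors fixed by one isotropic line. The new
  projection still commutes with the root elements orthogonal to the planes already treated, so the
  step can be repeated.\<close>

lemma isotropic_reduction:
  assumes "j + 2 + 2 * k \<le> n"
  shows "\<exists>P. proj P \<and> P0 * P = P \<and> (\<forall>w\<in>V (j + 2 + 2 * k) n. \<pi> (sig u w) * P = P * \<pi> (sig u w))
    \<and> tr P0 = of_nat (q ^ (2 * k)) * tr P"
  using assms
proof (induction k)
  case 0 show ?case using P0_facts sig_P0 by (intro exI[of _ P0]) auto
next
  case (Suc k)
  let ?m = "j + 2 + 2 * k"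
  have m: "?m + 2 \<le> n" using Suc.prems by simp
  obtain P where P: "proj P" "P0 * P = P" "\<And>w. w \<in> V ?m n \<Longrightarrow> \<pi> (sig u w) * P = P * \<pi> (sig u w)"
    "tr P0 = of_nat (q ^ (2 * k)) * tr P" using Suc.IH m by auto
  define v where "v = u0 ?m"
  define w0 where "w0 = u1 ?m"
  have vm: "v \<in> V ?m (?m + 2)" "v \<in> V ?m n" "w0 \<in> V ?m n" "ip v v = 0" "ip w0 v = e"
    using u0_facts[OF m] by (auto simp: v_def w0_def)
  have vW: "v \<in> W" "w0 \<in> W" using vm V_mono[of _ ?m n "j+2" n] by auto
  note ctx = P(1,2) vW(1) vm(4) vW(2) vm(5) P(3)[OF V_sm[OF vm(2)]] P(3)[OF V_sm[OF vm(3)]]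
  have "\<pi> (sig u w) * Q v P = Q v P * \<pi> (sig u w)" if w: "w \<in> V (?m + 2) n" for w
  proof (rule Q_commute[OF ctx])
    fix \<beta>
    let ?y = "sm \<beta> v"
    have wm: "w \<in> V ?m n" "w \<in> W" using V_mono[OF w] by auto
    have yW: "?y \<in> W" by (rule V_sm[OF vW(1)])
    have "ip w v = 0" "ip v w = 0" using ip_disjoint[OF w vm(1)] ip_disjoint[OF vm(1) w] by auto
    then have th: "\<theta> w ?y = 0" "\<theta> ?y w = 0" by (simp_all add: \<theta>_def)
    have "sig u w + sig u ?y = sig u ?y + sig u w"
      using sig_add[OF wm(2) yW] sig_add[OF yW wm(2)] th by (simp add: add.commute)
    then have c: "\<pi> (sig u w) * \<pi> (sig u ?y) = \<pi> (sig u ?y) * \<pi> (sig u w)"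
      using srep_add[OF rep sig_N[OF wm(2)] sig_N[OF yW]] srep_add[OF rep sig_N[OF yW] sig_N[OF wm(2)]] by simp
    have "\<pi> (sig u w) * (\<pi> (sig u ?y) * P) = \<pi> (sig u ?y) * (\<pi> (sig u w) * P)" by (simp only: mult.assoc[symmetric] c)
    then show "\<pi> (sig u w) * (\<pi> (sig u ?y) * P) = \<pi> (sig u ?y) * P * \<pi> (sig u w)"
      by (simp only: P(3)[OF wm(1)] mult.assoc)
  qed
  moreover have "tr P0 = of_nat (q ^ (2 * Suc k)) * tr (Q v P)"
    using P(4) tr_Q[OF ctx] by (simp add: power2_eq_square)
  moreover have idx: "j + 2 + 2 * Suc k = ?m + 2" by simp
  ultimately show ?case
    unfolding idx using Q_proj[OF ctx] P0_Q[OF ctx] by blast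
qed

lemma heis_degree:
  assumes "P0 \<noteq> 0" shows "nsq P0 \<ge> real q ^ (n - j - 3)" "nsq P0 \<le> nsq (\<pi> 0)"
proof -
  \<comment> \<open>The number of disjoint coordinate planes in \<open>W\<close>. When
    \<open>n - j\<close> is odd one coordinate is left over and the bound loses a factor
    \<open>q\<close>.\<close>
  let ?k = "(n - j - 2) div 2"
  obtain P :: "'i cmx" where P: "proj P" "tr P0 = of_nat (q ^ (2 * ?k)) * tr P"
  proof -
    have "2 * ?k \<le> n - j - 2" by simp
    then have "j + 2 + 2 * ?k \<le> n" using jn by linarith
    from isotropic_reduction[OF this] show ?thesis using that by blast
  qed
  have eq: "nsq P0 = real (q ^ (2 * ?k)) * nsq P"
  proof -
    have "complex_of_real (nsq P0) = of_real (real (q ^ (2 * ?k)) * nsq P)"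
      using P(2) proj_tr[OF P(1)] proj_tr[OF P0_facts(5)] by simp
    then show ?thesis by (simp only: of_real_eq_iff)
  qed
  have "P \<noteq> 0"
  proof
    assume "P = 0"
    then have "nsq P0 = 0" using eq by (simp add: nsq_def)
    then show False using nsq_eq_0 assms by blast
  qed
  then have "nsq P \<ge> 1" by (rule proj_nsq_ge_1[OF P(1)])
  then have "real (q ^ (2 * ?k)) * 1 \<le> nsq P0" unfolding eq by (intro mult_left_mono) auto
  moreover have "real q ^ (n - j - 3) \<le> real q ^ (2 * ?k)"
    using q_ge_2 by (intro power_increasing) auto
  ultimately show "nsq P0 \<ge> real q ^ (n - j - 3)" by simp
  have *: "proj (\<pi> 0 - P0)" by (rule proj_diff[OF srep_0(1)[OF rep sgrp_N] P0_facts(5,3)])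
  have "complex_of_real (nsq (\<pi> 0 - P0)) = of_real (nsq (\<pi> 0) - nsq P0)"
    using proj_tr[OF *] proj_tr[OF srep_0(1)[OF rep sgrp_N]] proj_tr[OF P0_facts(5)] by simp
  then have "nsq (\<pi> 0 - P0) = nsq (\<pi> 0) - nsq P0" by (simp only: of_real_eq_iff)
  then show "nsq P0 \<le> nsq (\<pi> 0)" using nsq_nonneg[of "\<pi> 0 - P0"] by simp
qed

text \<open>\<open>r\<close> is the multiplicity, in the range of \<open>P0\<close>, of a Heisenberg
  representation of dimension \<open>q ^ (n - j - 2)\<close>. Dividing the trace by \<open>r\<close>
  leaves a positive definite function with the absolute value of a Weil character. Its inner product
  with that trace is \<open>r\<close> times a sum of numbers of fixed vectors, each at least 1, and
  \<open>r \<ge> 1 / q\<close> by \<open>heis_degree\<close>.\<close>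

lemma heis_result:
  assumes nz: "P0 \<noteq> 0"
  shows "\<exists>f. gram (N (j + 2)) f \<and> (\<forall>h\<in>N (j + 2). (cmod (f h))\<^sup>2 = real (card {w \<in> W. act h w = w}))
    \<and> Re (\<Sum>h\<in>N (j + 2). f h * cnj (tr (\<pi> h))) \<ge> real (card (N (j + 2))) / real q"
proof -
  let ?H = "N (j + 2)"
  define r where "r = nsq P0 / real q ^ (n - j - 2)"
  have q: "real q > 0" using q_ge_2 by simp
  have "real q ^ (n - j - 2) = real q * real q ^ (n - j - 3)"
  proof -
    have "n - j - 2 = Suc (n - j - 3)" using jn by simp
    then show ?thesis by (simp only: power_Suc)
  qed
  then have "real q ^ (n - j - 2) / real q \<le> nsq P0" using heis_degree(1)[OF nz] q by simp
  then have r1: "r \<ge> 1 / real q" using q by (simp add: r_def field_simps)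
  then have r: "r > 0" using q by (smt (verit) divide_pos_pos)
  define \<psi> where "\<psi> h = tr (\<pi> h * P0)" for h
  define f where "f h = of_real (1 / r) * \<psi> h" for h
  have rep': "srep ?H \<pi>" using srep_subset[OF rep] Nj2 by blast
  have "srep ?H (\<lambda>h. \<pi> h * P0)" by (rule srep_mult_proj[OF rep' P0_facts(5) h_P0])
  then have g\<psi>: "gram ?H \<psi>" unfolding \<psi>_def by (rule gram_tr[OF _ sgrp_N])
  have gf: "gram ?H f" unfolding f_def by (rule gram_scale[OF _ g\<psi>]) (use r in simp)
  have f2: "(cmod (f h))\<^sup>2 = real (card {w \<in> W. act h w = w})" if h: "h \<in> ?H" for h
  proof -
    have "real (card W) = (real q ^ (n - j - 2))\<^sup>2" unfolding card_W by (simp add: power_mult[symmetric] mult.commute)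
    then have "(cmod (\<psi> h))\<^sup>2 = r\<^sup>2 * real (card {w \<in> W. act h w = w})"
      using weil_norm[OF h N_SP[OF h] nz] q by (simp add: \<psi>_def r_def power_divide field_simps)
    then show ?thesis using r by (simp add: f_def norm_mult power_mult_distrib norm_divide power_divide)
  qed
  have "Re (f h * cnj (\<psi> h)) \<ge> 1 / real q" if h: "h \<in> ?H" for h
  proof -
    have "\<psi> h = of_real r * f h" using r by (simp add: f_def)
    then have "f h * cnj (\<psi> h) = of_real (r * (cmod (f h))\<^sup>2)" by (simp add: cmod_sq)
    then have "Re (f h * cnj (\<psi> h)) = r * real (card {w \<in> W. act h w = w})" using f2[OF h] by simp
    moreover have "card {w \<in> W. act h w = w} > 0"
      using fin_W U_lin(1)[OF N_U[OF h]] by (auto simp: card_gt_0_iff intro!: exI[of _ 0])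
    then have "r * 1 \<le> r * real (card {w \<in> W. act h w = w})" using r by (intro mult_left_mono) auto
    ultimately show ?thesis using r1 by simp
  qed
  then have "(\<Sum>h\<in>?H. 1 / real q) \<le> (\<Sum>h\<in>?H. Re (f h * cnj (\<psi> h)))" by (rule sum_mono)
  then have "real (card ?H) / real q \<le> Re (\<Sum>h\<in>?H. f h * cnj (\<psi> h))" by simp
  also have "\<dots> \<le> Re (\<Sum>h\<in>?H. f h * cnj (tr (\<pi> h)))"
    unfolding \<psi>_def by (rule sum_subrep[OF rep' sgrp_N gf P0_facts(5,3) h_P0])
  finally show ?thesis using gf f2 by blast
qed

end

end

section \<open>Fixed vectors, the three cases for a representation, and the descent\<close>

context hgeom
begin

definition fixn :: "(nat \<Rightarrow> 'a) sym \<Rightarrow> nat" where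
  "fixn g = card {x \<in> V 0 n. act g x = x}"

lemma fixn_ge_1: "g \<in> U 0 \<Longrightarrow> fixn g \<ge> 1"
  using card_V(1)[of 0 n] U_lin(1)[of g 0] by (auto simp: fixn_def Suc_le_eq card_gt_0_iff intro!: exI[of _ 0])

end

context hrep
begin

text \<open>The cases are read off from the Heisenberg group of \<open>u\<close>. A nonzero label
  \<open>x\<close> with \<open>PX x \<noteq> 0\<close> leads to \<open>alpha\<close>. Otherwise the
  characters of the transvections with axis \<open>u\<close> decide: if only the trivial one occurs
  the result is \<open>triv\<close>, and any other leads to \<open>beta\<close>.\<close>

lemma dichotomy:
  assumes nz: "\<pi> 0 \<noteq> 0"
  obtains
    (alpha) P where "proj P" "P \<noteq> 0" "\<pi> 0 * P = P" "P * \<pi> 0 = P" "\<And>h. h \<in> N (j + 4) \<Longrightarrow> \<pi> h * P = P * \<pi> h"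
      "nsq P * real q ^ (n - j - 4) \<le> nsq (\<pi> 0)"
  | (triv) "\<And>g. g \<in> N j \<Longrightarrow> \<pi> g = \<pi> 0"
  | (beta) f where "gram (N (j + 2)) f" "\<And>h. h \<in> N (j + 2) \<Longrightarrow> cmod (f h) \<le> real (fixn h)"
      "Re (\<Sum>h\<in>N (j + 2). f h * cnj (tr (\<pi> h))) \<ge> real (card (N (j + 2))) / real q"
      "nsq (\<pi> 0) \<ge> real q ^ (n - j - 3)"
proof (cases "\<exists>x. x \<in> V (j + 2) n \<and> x \<noteq> 0 \<and> PX x \<noteq> 0")
  case True
  then show ?thesis using Px_bound alpha by blast
next
  case False
  then have stop: "\<pi> (Eg u w a) * PZ \<pi> u = PZ \<pi> u" if "w \<in> V (j + 2) n" "adm u w a" "e * a = a" for w a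
    using stop_Eg[OF _ that] by blast
  show ?thesis
  proof (cases "\<exists>s0\<in>F. s0 \<noteq> 0 \<and> Ps \<pi> u s0 \<noteq> 0")
    case False
    have "\<pi> 0 = (\<Sum>y\<in>F. if y = 0 then PZ \<pi> u else 0)"
      unfolding Ps_complete[OF u_facts(2,3), symmetric] using False by (intro sum.cong) auto
    then have "PZ \<pi> u = \<pi> 0" by simp
    then show ?thesis using trivial_case triv by blast
  next
    case True
    then obtain s0 where s0: "s0 \<in> F" "s0 \<noteq> 0" "Ps \<pi> u s0 \<noteq> 0" by blast
    interpret h: heis s e q \<alpha> b \<delta> \<delta>i n \<kappa> j \<pi> s0 by unfold_locales (use s0 in auto)
    obtain f where f: "gram (N (j + 2)) f" "\<And>h. h \<in> N (j + 2) \<Longrightarrow> (cmod (f h))\<^sup>2 = real (card {w \<in> V (j + 2) n. act h w = w})"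
      "Re (\<Sum>h\<in>N (j + 2). f h * cnj (tr (\<pi> h))) \<ge> real (card (N (j + 2))) / real q"
      using h.heis_result[OF stop s0(3)] by blast
    have "cmod (f h) \<le> real (fixn h)" if h: "h \<in> N (j + 2)" for h
    proof -
      have "card {w \<in> V (j + 2) n. act h w = w} \<le> fixn h"
        unfolding fixn_def
      proof (rule card_mono)
        show "finite {x \<in> V 0 n. act h x = x}" using card_V(1)[of 0 n] by simp
        show "{w \<in> V (j + 2) n. act h w = w} \<subseteq> {x \<in> V 0 n. act h x = x}"
          using V_mono[of _ "j + 2" n 0 n] by blast
      qed
      \<comment> \<open>As \<open>fixn h \<ge> 1\<close>, a bound on the square also bounds the
        absolute value; the loss of a square root does no harm to the moments.\<close>
      then have 1: "(cmod (f h))\<^sup>2 \<le> real (fixn h)" using f(2)[OF h] by simp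
      show ?thesis
      proof (cases "cmod (f h) \<le> 1")
        case True
        moreover have "1 \<le> real (fixn h)" using fixn_ge_1[OF N_U0[OF h]] by simp
        ultimately show ?thesis by linarith
      next
        case False
        then have "cmod (f h) * 1 \<le> cmod (f h) * cmod (f h)" by (intro mult_left_mono) auto
        then show ?thesis using 1 by (simp add: power2_eq_square)
      qed
    qed
    moreover have "nsq (\<pi> 0) \<ge> real q ^ (n - j - 3)" by (rule order_trans[OF h.heis_degree[OF stop s0(3)]])
    ultimately show ?thesis using beta f by blast
  qed
qed

end

context hchar
begin

lemma large_degree:
  fixes \<pi> :: "(nat \<Rightarrow> 'a) sym \<Rightarrow> 'i cmx"
  assumes "srep (N 0) \<pi>" "7 \<le> n" "\<pi> 0 \<noteq> 0" "g \<in> N 0" "\<pi> g \<noteq> \<pi> 0"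
  shows "nsq (\<pi> 0) \<ge> real q ^ (n - 4)"
proof -
  interpret hrep s e q \<alpha> b \<delta> \<delta>i n \<kappa> 0 \<pi> by unfold_locales (use assms in auto)
  from assms(3) show ?thesis
  proof (cases rule: dichotomy)
    case (alpha P)
    have "1 * real q ^ (n - 4) \<le> nsq P * real q ^ (n - 4)"
      using proj_nsq_ge_1[OF alpha(1,2)] by (intro mult_right_mono) auto
    then show ?thesis using alpha(6) by simp
  next
    case triv then show ?thesis using assms(4,5) by blast
  next
    case (beta f)
    have "real q ^ (n - 4) \<le> real q ^ (n - 3)" using q_ge_2 by (intro power_increasing) auto
    then show ?thesis using beta(4) by simp
  qed
qed

text \<open>Every \<open>alpha\<close> step passes to a subrepresentation of
  \<open>N (j + 4)\<close> whose degree is smaller by a factor of at least \<open>q ^ m\<close>, so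
  after \<open>k\<close> steps the degree would drop below 1. \<open>sum_subrep\<close> carries the
  lower bound back to the original representation.\<close>

lemma small_degree:
  fixes \<pi> :: "(nat \<Rightarrow> 'a) sym \<Rightarrow> 'i cmx"
  assumes "srep (N j) \<pi>" "\<pi> 0 \<noteq> 0" "nsq (\<pi> 0) < real q ^ (k * m)" "j + 4 * k + m + 7 \<le> n"
  shows "\<exists>j' f. j \<le> j' \<and> j' \<le> j + 4 * k + 2 \<and> gram (N j') f \<and> (\<forall>h\<in>N j'. cmod (f h) \<le> real (fixn h))
    \<and> Re (\<Sum>h\<in>N j'. f h * cnj (tr (\<pi> h))) \<ge> real (card (N j')) / real q"
  using assms
proof (induction k arbitrary: j \<pi>)
  case 0
  then show ?case using proj_nsq_ge_1[OF srep_0(1)[OF 0(1) sgrp_N] 0(2)] by simp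
next
  case (Suc k)
  interpret hrep s e q \<alpha> b \<delta> \<delta>i n \<kappa> j \<pi> by unfold_locales (use Suc.prems in auto)
  have q0: "real q > 0" using q_ge_2 by simp
  from Suc.prems(2) show ?case
  proof (cases rule: dichotomy)
    case (alpha P)
    have sub: "N (j + 4) \<subseteq> N j" by (rule N_mono) simp
    have rep4: "srep (N (j + 4)) (\<lambda>h. \<pi> h * P)"
      by (rule srep_mult_proj[OF srep_subset[OF rep sub] alpha(1,5)])
    have "nsq P * real q ^ m \<le> nsq P * real q ^ (n - j - 4)"
      using Suc.prems(4) q_ge_2 nsq_nonneg by (intro mult_left_mono power_increasing) auto
    then have "nsq P * real q ^ m < real q ^ (k * m) * real q ^ m"
      using alpha(6) Suc.prems(3) by (simp add: power_add algebra_simps)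
    then have "nsq (\<pi> 0 * P) < real q ^ (k * m)" using q0 alpha(3) by simp
    then obtain j' f where f: "j' \<le> j + 4 + 4 * k + 2" "gram (N j') f" "\<forall>h\<in>N j'. cmod (f h) \<le> real (fixn h)"
      "Re (\<Sum>h\<in>N j'. f h * cnj (tr (\<pi> h * P))) \<ge> real (card (N j')) / real q" "j + 4 \<le> j'"
      using Suc.IH[OF rep4] alpha(2,3) Suc.prems(4) by (auto simp: algebra_simps)
    have sub': "N j' \<subseteq> N (j + 4)" by (rule N_mono[OF f(5)])
    have "Re (\<Sum>h\<in>N j'. f h * cnj (tr (\<pi> h))) \<ge> Re (\<Sum>h\<in>N j'. f h * cnj (tr (\<pi> h * P)))"
      by (rule sum_subrep[OF srep_subset[OF rep] sgrp_N f(2) alpha(1,3)]) (use sub sub' alpha(5) in auto)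
    then show ?thesis using f by (intro exI[of _ j'] exI[of _ f]) auto
  next
    case triv
    let ?f = "\<lambda>_. of_real 1 :: complex"
    have "(\<Sum>h\<in>N j. ?f h * cnj (tr (\<pi> h))) = of_real (real (card (N j)) * nsq (\<pi> 0))"
      using triv proj_tr[OF srep_0(1)[OF rep sgrp_N]] by simp
    moreover have "real (card (N j)) / real q \<le> real (card (N j)) * nsq (\<pi> 0)"
    proof -
      have "1 / real q \<le> 1" using q_ge_2 by simp
      also have "\<dots> \<le> nsq (\<pi> 0)" by (rule proj_nsq_ge_1[OF srep_0(1)[OF rep sgrp_N] Suc.prems(2)])
      finally have "real (card (N j)) * (1 / real q) \<le> real (card (N j)) * nsq (\<pi> 0)" by (intro mult_left_mono) auto
      then show ?thesis by simp
    qed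
    moreover have "gram (N j) ?f" by (rule gram_const) simp
    moreover have "cmod (?f h) \<le> real (fixn h)" if "h \<in> N j" for h using fixn_ge_1[OF N_U0[OF that]] by simp
    ultimately show ?thesis by (intro exI[of _ j] exI[of _ ?f]) auto
  next
    case (beta f)
    then show ?thesis by (intro exI[of _ "j + 2"] exI[of _ f]) auto
  qed
qed

end


section \<open>Moments of irreducible characters\<close>

lemma gram_uminus:
  assumes "gram H \<phi>" "sgrp H" "h \<in> H" shows "\<phi> (- h) = cnj (\<phi> h)"
proof -
  obtain I a where I: "finite (I::nat set)"
    "\<And>x y. x \<in> H \<Longrightarrow> y \<in> H \<Longrightarrow> \<phi> (- x + y) = (\<Sum>i\<in>I. cnj (a i x) * a i y)"
    using gramE[OF assms(1)] by blast
  show ?thesis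
    using I(2)[OF assms(3) sgrpD(2)[OF assms(2)]] I(2)[OF sgrpD(2)[OF assms(2)] assms(3)]
    by (simp add: mult.commute)
qed

lemma gram_sum_real:
  assumes "gram H \<phi>" "sgrp H" shows "\<exists>r\<ge>0. (\<Sum>h\<in>H. \<phi> h) = of_real r"
proof -
  have "cnj (\<Sum>h\<in>H. \<phi> h) = (\<Sum>h\<in>H. \<phi> (- h))" using gram_uminus[OF assms] by simp
  also have "\<dots> = (\<Sum>h\<in>H. \<phi> h)" by (rule sgrp_translate(3)[OF assms(2) sgrpD(2)[OF assms(2)]])
  finally have "(\<Sum>h\<in>H. \<phi> h) \<in> \<real>" using Reals_cnj_iff by blast
  then show ?thesis using gram_sum_nonneg[OF assms] by (metis of_real_Re)
qed

text \<open>Cauchy-Schwarz for the Gram vectors of \<open>0\<close> and \<open>h\<close>, which both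
  have squared length \<open>\<phi> 0\<close>.\<close>

lemma gram_bound:
  assumes "gram H \<phi>" "sgrp H" "h \<in> H" shows "cmod (\<phi> h) \<le> Re (\<phi> 0)"
proof -
  obtain I a where I: "finite (I::nat set)"
    "\<And>x y. x \<in> H \<Longrightarrow> y \<in> H \<Longrightarrow> \<phi> (- x + y) = (\<Sum>i\<in>I. cnj (a i x) * a i y)"
    using gramE[OF assms(1)] by blast
  have sq: "Re (\<phi> 0) = (\<Sum>i\<in>I. (cmod (a i x))\<^sup>2)" if "x \<in> H" for x
  proof -
    have "\<phi> 0 = (\<Sum>i\<in>I. of_real ((cmod (a i x))\<^sup>2))"
      using I(2)[OF that that] by (simp add: cmod_sq mult.commute)
    then show ?thesis by simp
  qed
  note z = sgrpD(2)[OF assms(2)]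
  have "cmod (\<phi> h) \<le> (\<Sum>i\<in>I. cmod (a i 0) * cmod (a i h))"
    using I(2)[OF z assms(3)] by (simp add: norm_sum[THEN order_trans] norm_mult sum_norm_le)
  then have "(cmod (\<phi> h))\<^sup>2 \<le> (\<Sum>i\<in>I. cmod (a i 0) * cmod (a i h))\<^sup>2" by (simp add: power_mono)
  also have "\<dots> \<le> (\<Sum>i\<in>I. (cmod (a i 0))\<^sup>2) * (\<Sum>i\<in>I. (cmod (a i h))\<^sup>2)" by (rule Cauchy_Schwarz_sum)
  also have "\<dots> = (Re (\<phi> 0))\<^sup>2" using sq[OF z] sq[OF assms(3)] by (simp add: power2_eq_square)
  finally have "(cmod (\<phi> h))\<^sup>2 \<le> (Re (\<phi> 0))\<^sup>2" .
  moreover have "Re (\<phi> 0) \<ge> 0" unfolding sq[OF z] by (simp add: sum_nonneg)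
  ultimately show ?thesis by (rule power2_le_imp_le)
qed

section \<open>Induction of positive definite functions\<close>

definition ind :: "'g::group_add set \<Rightarrow> 'g set \<Rightarrow> ('g \<Rightarrow> complex) \<Rightarrow> 'g \<Rightarrow> complex" where
  "ind G H f g = of_real (1 / real (card H)) * (\<Sum>x\<in>G. if - x + g + x \<in> H then f (- x + g + x) else 0)"

lemma ind_class:
  assumes "sgrp G" "x \<in> G" shows "ind G H f (x + g - x) = ind G H f g"
proof -
  let ?k = "\<lambda>y. if y \<in> H then f y else 0"
  have eq: "- y + (x + g - x) + y = - (- x + y) + g + (- x + y)" for y
    by (simp only: minus_add minus_minus diff_conv_add_uminus add.assoc)
  have "(\<Sum>y\<in>G. ?k (- y + (x + g - x) + y)) = (\<Sum>y\<in>G. ?k (- (- x + y) + g + (- x + y)))"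
    by (simp only: eq)
  also have "\<dots> = (\<Sum>y\<in>G. ?k (- y + g + y))" by (rule sgrp_translate(1)[OF assms(1) sgrpD(4)[OF assms]])
  finally show ?thesis by (simp add: ind_def)
qed

text \<open>The extension of \<open>f\<close> by zero is positive definite on \<open>G\<close>: its
  Gram vectors are those of \<open>f\<close>, translated to the cosets \<open>t + H\<close> and
  averaged over \<open>t\<close>. The induced function is a sum of conjugates of this
  extension.\<close>

lemma gram_ind:
  assumes G: "sgrp G" and H: "sgrp H" "H \<subseteq> G" and f: "gram H f" shows "gram G (ind G H f)"
proof -
  obtain I a where I: "finite (I::nat set)"
    "\<And>x y. x \<in> H \<Longrightarrow> y \<in> H \<Longrightarrow> f (- x + y) = (\<Sum>i\<in>I. cnj (a i x) * a i y)"
    using gramE[OF f] by blast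
  define r where "r = 1 / real (card H)"
  define b where "b i t y = (if - t + y \<in> H then a i (- t + y) else 0)" for i t y
  define k where "k y = (if y \<in> H then f y else 0)" for y
  have r: "r \<ge> 0" by (simp add: r_def)
  have kb: "k (- x + y) = of_real r * (\<Sum>t\<in>G. \<Sum>i\<in>I. cnj (b i t x) * b i t y)" if xy: "x \<in> G" "y \<in> G" for x y
  proof -
    have t: "(\<Sum>i\<in>I. cnj (b i t x) * b i t y) = (if - t + x \<in> H then k (- x + y) else 0)" for t
    proof (cases "- t + x \<in> H")
      case True
      have "- t + y = (- t + x) + (- x + y)" "- x + y = - (- t + x) + (- t + y)"
        by (simp_all add: minus_add add.assoc del: add_uminus_conv_diff)
      then have iff: "- t + y \<in> H \<longleftrightarrow> - x + y \<in> H" using True sgrpD(3,4)[OF H(1)] by metis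
      show ?thesis
      proof (cases "- t + y \<in> H")
        case ty: True
        have "f (- x + y) = (\<Sum>i\<in>I. cnj (a i (- t + x)) * a i (- t + y))"
          using I(2)[OF True ty] \<open>- x + y = - (- t + x) + (- t + y)\<close> by simp
        then show ?thesis using True ty iff by (simp add: b_def k_def)
      qed (use True iff in \<open>simp add: b_def k_def\<close>)
    qed (simp add: b_def)
    \<comment> \<open>For given \<open>x\<close> exactly \<open>card H\<close> elements
      \<open>t\<close> satisfy the coset condition, which cancels the factor
      \<open>r\<close>.\<close>
    have "card {t \<in> G. - t + x \<in> H} = card H"
    proof (rule bij_betw_same_card[of "\<lambda>t. - t + x"], rule bij_betw_byWitness[where f' = "\<lambda>h. x + - h"])
      show "\<forall>t\<in>{t \<in> G. - t + x \<in> H}. x + - (- t + x) = t"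
        by (simp add: minus_add add.assoc[symmetric] del: add_uminus_conv_diff)
      show "\<forall>h\<in>H. - (x + - h) + x = h" by (simp add: minus_add add.assoc del: add_uminus_conv_diff)
      have "x + - h \<in> G" if "h \<in> H" for h using that H(2) sgrpD(3,4)[OF G] xy by blast
      moreover have "- (x + - h) + x = h" for h by (simp add: minus_add add.assoc del: add_uminus_conv_diff)
      ultimately show "(\<lambda>h. x + - h) ` H \<subseteq> {t \<in> G. - t + x \<in> H}" by auto
    qed auto
    then have "(\<Sum>t\<in>G. if - t + x \<in> H then k (- x + y) else 0) = of_nat (card H) * k (- x + y)"
      using sgrpD(1)[OF G] by (simp add: sum.If_cases Int_def)
    then show ?thesis using t sgrpD(5)[OF H(1)] by (simp add: r_def)
  qed
  show ?thesis
  proof (rule gramI[of "G \<times> G \<times> I" G _ "\<lambda>(x, t, i) y. of_real r * b i t (y + x)"])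
    show "finite (G \<times> G \<times> I)" using sgrpD(1)[OF G] I(1) by simp
    fix y z assume yz: "y \<in> G" "z \<in> G"
    have eq: "- x + (- y + z) + x = - (y + x) + (z + x)" for x
      by (simp add: minus_add add.assoc del: add_uminus_conv_diff)
    have "ind G H f (- y + z) = of_real r * (\<Sum>x\<in>G. k (- (y + x) + (z + x)))"
      by (simp only: ind_def r_def k_def eq[symmetric])
    also have "(\<Sum>x\<in>G. k (- (y + x) + (z + x))) = (\<Sum>x\<in>G. of_real r * (\<Sum>t\<in>G. \<Sum>i\<in>I. cnj (b i t (y + x)) * b i t (z + x)))"
      by (intro sum.cong refl kb sgrpD(3)[OF G] yz)
    also have "of_real r * \<dots> = (\<Sum>x\<in>G. \<Sum>t\<in>G. \<Sum>i\<in>I. cnj (of_real r * b i t (y + x)) * (of_real r * b i t (z + x)))"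
      by (simp add: sum_distrib_left mult_ac)
    also have "\<dots> = (\<Sum>p\<in>G \<times> G \<times> I. cnj ((\<lambda>(x, t, i) y. of_real r * b i t (y + x)) p y) * (\<lambda>(x, t, i) y. of_real r * b i t (y + x)) p z)"
      by (simp add: sum.cartesian_product')
    finally show "ind G H f (- y + z) = (\<Sum>p\<in>G \<times> G \<times> I. cnj ((\<lambda>(x, t, i) y. of_real r * b i t (y + x)) p y) * (\<lambda>(x, t, i) y. of_real r * b i t (y + x)) p z)" .
  qed
qed

text \<open>For irreducible \<open>\<pi>\<close>, \<open>conv\<close> is Schur's lemma applied to the sum of the \<open>F w * \<pi> (- w)\<close>.\<close>
locale irrchar =
  fixes G :: "'g::group_add set" and \<pi> :: "'g \<Rightarrow> 'i cmx" and \<chi> :: "'g \<Rightarrow> complex"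
  assumes G: "sgrp G" and rep: "srep G \<pi>" and \<chi>: "g \<in> G \<Longrightarrow> \<chi> g = tr (\<pi> g)" and nz: "\<pi> 0 \<noteq> 0"
    and conv: "(\<And>x w. x \<in> G \<Longrightarrow> w \<in> G \<Longrightarrow> F (x + w - x) = F w) \<Longrightarrow> g \<in> G \<Longrightarrow>
      (\<Sum>w\<in>G. F w * \<chi> (- w + g)) * \<chi> 0 = (\<Sum>w\<in>G. F w * \<chi> (- w)) * \<chi> g"
    and norm: "(\<Sum>w\<in>G. \<chi> w * \<chi> (- w)) = of_nat (card G)"
    and abelian: "(\<And>x y. x \<in> G \<Longrightarrow> y \<in> G \<Longrightarrow> \<pi> (x + y) = \<pi> (y + x)) \<Longrightarrow> \<chi> 0 = 1"
begin

abbreviation "d \<equiv> nsq (\<pi> 0)"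

lemma \<chi>0: "\<chi> 0 = of_real d" using \<chi>[OF sgrpD(2)[OF G]] proj_tr[OF srep_0(1)[OF rep G]] by simp

lemma d_ge_1: "d \<ge> 1" by (rule proj_nsq_ge_1[OF srep_0(1)[OF rep G] nz])

lemma gram_\<chi>: "gram G \<chi>" by (rule gram_cong[OF gram_tr[OF rep G] G]) (simp add: \<chi>)

lemma \<chi>_commute: "x \<in> G \<Longrightarrow> y \<in> G \<Longrightarrow> \<chi> (x + y) = \<chi> (y + x)"
  using sgrpD(3)[OF G] srep_add[OF rep] tr_commute[of "\<pi> x" "\<pi> y"] by (simp add: \<chi>)

lemma \<chi>_class: assumes "x \<in> G" "w \<in> G" shows "\<chi> (x + w - x) = \<chi> w"
proof -
  have "\<chi> (x + w + - x) = \<chi> (- x + (x + w))" using assms sgrpD(3,4)[OF G] by (intro \<chi>_commute) auto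
  then show ?thesis by (simp add: minus_add_cancel)
qed

context
  fixes F :: "'g \<Rightarrow> complex" and c :: real
  assumes F: "gram G F" "\<And>x w. x \<in> G \<Longrightarrow> w \<in> G \<Longrightarrow> F (x + w - x) = F w"
    and c: "(\<Sum>w\<in>G. F w * cnj (\<chi> w)) = of_real (c * real (card G))"
begin

lemma conv_left:
  assumes "x \<in> G" "y \<in> G"
  shows "(\<Sum>z\<in>G. F (- x + z) * \<chi> (- z + y)) = of_real (c * real (card G) / d) * \<chi> (- x + y)"
proof -
  have g: "- x + y \<in> G" using assms sgrpD(3,4)[OF G] by blast
  have "(\<Sum>z\<in>G. F (- x + z) * \<chi> (- z + y)) = (\<Sum>z\<in>G. F (- x + z) * \<chi> (- (- x + z) + (- x + y)))"
    by (simp add: minus_add add.assoc del: add_uminus_conv_diff)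
  also have "\<dots> = (\<Sum>w\<in>G. F w * \<chi> (- w + (- x + y)))" by (rule sgrp_translate(1)[OF G sgrpD(4)[OF G assms(1)]])
  finally have "(\<Sum>z\<in>G. F (- x + z) * \<chi> (- z + y)) * of_real d = (\<Sum>w\<in>G. F w * \<chi> (- w)) * \<chi> (- x + y)"
    using conv[of F, OF F(2) g] by (simp add: \<chi>0)
  also have "(\<Sum>w\<in>G. F w * \<chi> (- w)) = of_real (c * real (card G))"
    unfolding c[symmetric] using gram_uminus[OF gram_\<chi> G] by simp
  finally show ?thesis using d_ge_1 by (simp add: field_simps)
qed

lemma conv_right:
  assumes "x \<in> G" "y \<in> G"
  shows "(\<Sum>z\<in>G. \<chi> (- x + z) * F (- z + y)) = of_real (c * real (card G) / d) * \<chi> (- x + y)"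
proof -
  have "\<chi> (- x + z) * F (- z + y) = cnj (F (- y + z) * \<chi> (- z + x))" if z: "z \<in> G" for z
    using gram_uminus[OF gram_\<chi> G, of "- z + x"] gram_uminus[OF F(1) G, of "- y + z"] z assms sgrpD(3,4)[OF G]
    by (simp add: minus_add del: add_uminus_conv_diff)
  then have "(\<Sum>z\<in>G. \<chi> (- x + z) * F (- z + y)) = cnj (\<Sum>z\<in>G. F (- y + z) * \<chi> (- z + x))" by simp
  also have "\<dots> = of_real (c * real (card G) / d) * cnj (\<chi> (- y + x))" unfolding conv_left[OF assms(2,1)] by simp
  also have "cnj (\<chi> (- y + x)) = \<chi> (- x + y)"
    using gram_uminus[OF gram_\<chi> G, of "- y + x"] assms sgrpD(3,4)[OF G] by (simp add: minus_add del: add_uminus_conv_diff)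
  finally show ?thesis .
qed

text \<open>Convolution with \<open>d / |G| * \<chi>\<close> is an orthogonal projection commuting with convolution by \<open>F\<close>.\<close>
lemma gram_component:
  assumes conv_\<chi>: "\<And>x y. x \<in> G \<Longrightarrow> y \<in> G \<Longrightarrow> (\<Sum>z\<in>G. \<chi> (- x + z) * \<chi> (- z + y)) = of_real (real (card G) / d) * \<chi> (- x + y)"
  shows "gram G (\<lambda>g. F g - of_real c * \<chi> g)"
proof -
  obtain I a where I: "finite (I::nat set)"
    "\<And>x y. x \<in> G \<Longrightarrow> y \<in> G \<Longrightarrow> F (- x + y) = (\<Sum>i\<in>I. cnj (a i x) * a i y)"
    using gramE[OF F(1)] by blast
  define r where "r = complex_of_real (d / real (card G))"
  have rC: "r * of_real (c * real (card G) / d) = of_real c" "r * of_real (real (card G) / d) = 1" "cnj r = r"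
  proof -
    have "d / real (card G) * (c * real (card G) / d) = c" "d / real (card G) * (real (card G) / d) = 1"
      using d_ge_1 sgrpD(5)[OF G] by auto
    then show "r * of_real (c * real (card G) / d) = of_real c" "r * of_real (real (card G) / d) = 1"
      unfolding r_def by (simp_all only: of_real_mult[symmetric] of_real_1)
  qed (simp add: r_def)
  define p where "p i y = (\<Sum>z\<in>G. a i z * \<chi> (- z + y))" for i y
  have cnj_p: "cnj (p i x) = (\<Sum>z\<in>G. cnj (a i z) * \<chi> (- x + z))" if "x \<in> G" for i x
  proof -
    have "cnj (\<chi> (- z + x)) = \<chi> (- x + z)" if "z \<in> G" for z
      using gram_uminus[OF gram_\<chi> G, of "- z + x"] that \<open>x \<in> G\<close> sgrpD(3,4)[OF G] by (simp add: minus_add del: add_uminus_conv_diff)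
    then show ?thesis by (simp add: p_def)
  qed
  show ?thesis
  proof (rule gramI[OF I(1), of G _ "\<lambda>i y. a i y - r * p i y"])
    fix x y assume xy: "x \<in> G" "y \<in> G"
    let ?g = "- x + y"
    have t1: "(\<Sum>i\<in>I. cnj (a i x) * p i y') = (\<Sum>z\<in>G. F (- x + z) * \<chi> (- z + y'))" if "x \<in> G" for x y'
    proof -
      have "(\<Sum>i\<in>I. cnj (a i x) * p i y') = (\<Sum>i\<in>I. \<Sum>z\<in>G. cnj (a i x) * a i z * \<chi> (- z + y'))"
        by (simp add: p_def sum_distrib_left mult.assoc)
      also have "\<dots> = (\<Sum>z\<in>G. \<Sum>i\<in>I. cnj (a i x) * a i z * \<chi> (- z + y'))" by (rule sum.swap)
      also have "\<dots> = (\<Sum>z\<in>G. F (- x + z) * \<chi> (- z + y'))" by (intro sum.cong refl) (simp add: I(2) that sum_distrib_right)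
      finally show ?thesis .
    qed
    have t2: "(\<Sum>i\<in>I. cnj (p i x) * a i y) = (\<Sum>z\<in>G. \<chi> (- x + z) * F (- z + y))"
    proof -
      have "(\<Sum>i\<in>I. cnj (p i x) * a i y) = (\<Sum>i\<in>I. \<Sum>z\<in>G. \<chi> (- x + z) * (cnj (a i z) * a i y))"
        by (simp add: cnj_p[OF xy(1)] sum_distrib_right sum_distrib_left mult_ac)
      also have "\<dots> = (\<Sum>z\<in>G. \<Sum>i\<in>I. \<chi> (- x + z) * (cnj (a i z) * a i y))" by (rule sum.swap)
      also have "\<dots> = (\<Sum>z\<in>G. \<chi> (- x + z) * F (- z + y))" by (intro sum.cong refl) (simp add: I(2) xy sum_distrib_left)
      finally show ?thesis .
    qed
    have t3: "(\<Sum>i\<in>I. cnj (p i x) * p i y) = of_real (c * real (card G) / d) * (of_real (real (card G) / d) * \<chi> ?g)"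
    proof -
      have "(\<Sum>i\<in>I. cnj (p i x) * p i y) = (\<Sum>i\<in>I. \<Sum>z\<in>G. \<chi> (- x + z) * (cnj (a i z) * p i y))"
        by (simp add: cnj_p[OF xy(1)] sum_distrib_right sum_distrib_left mult_ac)
      also have "\<dots> = (\<Sum>z\<in>G. \<Sum>i\<in>I. \<chi> (- x + z) * (cnj (a i z) * p i y))" by (rule sum.swap)
      also have "\<dots> = (\<Sum>z\<in>G. \<chi> (- x + z) * (of_real (c * real (card G) / d) * \<chi> (- z + y)))"
        by (intro sum.cong refl) (simp add: t1 conv_left xy flip: sum_distrib_left)
      also have "\<dots> = of_real (c * real (card G) / d) * (\<Sum>z\<in>G. \<chi> (- x + z) * \<chi> (- z + y))"
        by (simp add: sum_distrib_left mult_ac)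
      finally show ?thesis by (simp only: conv_\<chi>[OF xy])
    qed
    have "(\<Sum>i\<in>I. cnj (a i x - r * p i x) * (a i y - r * p i y))
      = (\<Sum>i\<in>I. cnj (a i x) * a i y) - r * (\<Sum>i\<in>I. cnj (a i x) * p i y) - r * (\<Sum>i\<in>I. cnj (p i x) * a i y)
        + r * (r * (\<Sum>i\<in>I. cnj (p i x) * p i y))"
      by (simp add: rC(3) sum.distrib sum_subtractf sum_distrib_left algebra_simps)
    also have "\<dots> = F ?g - r * of_real (c * real (card G) / d) * \<chi> ?g - r * of_real (c * real (card G) / d) * \<chi> ?g
      + r * of_real (c * real (card G) / d) * (r * of_real (real (card G) / d)) * \<chi> ?g"
      unfolding t1[OF xy(1)] t2 t3 conv_left[OF xy] conv_right[OF xy] I(2)[OF xy] by (simp only: mult_ac)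
    also have "\<dots> = F ?g - of_real c * \<chi> ?g" unfolding rC by simp
    finally show "F ?g - of_real c * \<chi> ?g = (\<Sum>i\<in>I. cnj (a i x - r * p i x) * (a i y - r * p i y))" ..
  qed
qed

end

lemma conv_\<chi>:
  assumes "x \<in> G" "y \<in> G"
  shows "(\<Sum>z\<in>G. \<chi> (- x + z) * \<chi> (- z + y)) = of_real (real (card G) / d) * \<chi> (- x + y)"
proof -
  have "(\<Sum>w\<in>G. \<chi> w * cnj (\<chi> w)) = of_real (1 * real (card G))"
    using norm gram_uminus[OF gram_\<chi> G] by simp
  from conv_left[OF gram_\<chi> \<chi>_class this assms] show ?thesis by simp
qed

text \<open>Frobenius reciprocity, carried out as an interchange of sums over conjugates, turns the
  inner product on \<open>H\<close> into one on \<open>G\<close>. It is real because it is the sum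
  of a positive definite function. A multiple of \<chi> by at least \<open>c0\<close> then splits
  off the induced function by \<open>gram_component\<close>, and \<open>gram_moment\<close> compares
  the moments.\<close>

lemma moment_le_induced:
  assumes H: "sgrp H" "H \<subseteq> G" and f: "gram H f"
    and c0: "0 \<le> c0" "Re (\<Sum>h\<in>H. f h * cnj (\<chi> h)) \<ge> c0 * real (card H)"
  shows "c0 ^ (2 * k) * (\<Sum>g\<in>G. cmod (\<chi> g) ^ (2 * k)) \<le> (\<Sum>g\<in>G. cmod (ind G H f g) ^ (2 * k))"
proof -
  let ?F = "ind G H f"
  have gF: "gram G ?F" by (rule gram_ind[OF G H f])
  have cF: "?F (x + w - x) = ?F w" if "x \<in> G" for x w by (rule ind_class[OF G that])
  have conjH: "(\<Sum>g\<in>G. if - x + g + x \<in> H then f (- x + g + x) * cnj (\<chi> g) else 0) = (\<Sum>h\<in>H. f h * cnj (\<chi> h))"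
    if x: "x \<in> G" for x
  proof -
    have "(\<Sum>g\<in>G. if - x + g + x \<in> H then f (- x + g + x) * cnj (\<chi> g) else 0)
      = (\<Sum>g\<in>{g \<in> G. - x + g + x \<in> H}. f (- x + g + x) * cnj (\<chi> g))"
      using sgrpD(1)[OF G] by (simp add: sum.inter_filter)
    also have "\<dots> = (\<Sum>h\<in>H. f h * cnj (\<chi> h))"
    proof (rule sum.reindex_bij_witness[of _ "\<lambda>h. x + h + - x" "\<lambda>g. - x + g + x"])
      fix g assume g: "g \<in> {g \<in> G. - x + g + x \<in> H}"
      show "x + (- x + g + x) + - x = g" by (simp add: add.assoc)
      show "- x + g + x \<in> H" using g by simp
      have "\<chi> (- x + g + x) = \<chi> g" using \<chi>_class[OF sgrpD(4)[OF G x], of g] g by simp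
      then show "f (- x + g + x) * cnj (\<chi> (- x + g + x)) = f (- x + g + x) * cnj (\<chi> g)" by simp
    next
      fix h assume h: "h \<in> H"
      show *: "- x + (x + h + - x) + x = h" by (simp add: add.assoc)
      have "x + h + - x \<in> G" using sgrpD(3)[OF G sgrpD(3)[OF G x] sgrpD(4)[OF G x]] h H(2) by blast
      then show "x + h + - x \<in> {g \<in> G. - x + g + x \<in> H}" using h by (simp only: mem_Collect_eq *)
    qed
    finally show ?thesis .
  qed
  have "(\<Sum>g\<in>G. ?F g * cnj (\<chi> g)) = of_real (1 / real (card H)) * (\<Sum>g\<in>G. \<Sum>x\<in>G. if - x + g + x \<in> H then f (- x + g + x) * cnj (\<chi> g) else 0)"
    by (simp add: ind_def sum_distrib_left sum_distrib_right if_distrib[of "\<lambda>z. z * _"] if_distrib[of "\<lambda>z. _ * z"] mult.assoc cong: if_cong)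
  also have "\<dots> = of_real (1 / real (card H)) * (\<Sum>x\<in>G. \<Sum>h\<in>H. f h * cnj (\<chi> h))"
    by (subst sum.swap) (simp add: conjH)
  finally have S: "(\<Sum>g\<in>G. ?F g * cnj (\<chi> g)) = of_real (real (card G) / real (card H)) * (\<Sum>h\<in>H. f h * cnj (\<chi> h))" by simp
  obtain r where r: "(\<Sum>h\<in>H. f h * cnj (\<chi> h)) = of_real r"
    using gram_sum_real[OF gram_mult[OF f gram_cnj[OF gram_subset[OF gram_\<chi> H(2)]]] H(1)] by blast
  define c where "c = r / real (card H)"
  have cc: "c \<ge> c0" using c0(2) sgrpD(5)[OF H(1)] by (simp add: r c_def field_simps)
  have "(\<Sum>g\<in>G. ?F g * cnj (\<chi> g)) = of_real (c * real (card G))" by (simp add: S r c_def)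
  from gram_component[OF gF cF this conv_\<chi>] have "gram G (\<lambda>g. ?F g - of_real c * \<chi> g)" by simp
  from gram_moment[OF G gF gram_scale[OF _ gram_\<chi>] this] cc c0
  have "(\<Sum>g\<in>G. cmod (of_real c * \<chi> g) ^ (2 * k)) \<le> (\<Sum>g\<in>G. cmod (?F g) ^ (2 * k))" by simp
  moreover have "(\<Sum>g\<in>G. cmod (of_real c * \<chi> g) ^ (2 * k)) = c ^ (2 * k) * (\<Sum>g\<in>G. cmod (\<chi> g) ^ (2 * k))"
    using cc c0 by (simp add: norm_mult power_mult_distrib sum_distrib_left)
  moreover have "c0 ^ (2 * k) * (\<Sum>g\<in>G. cmod (\<chi> g) ^ (2 * k)) \<le> c ^ (2 * k) * (\<Sum>g\<in>G. cmod (\<chi> g) ^ (2 * k))"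
    using cc c0(1) by (intro mult_right_mono power_mono sum_nonneg) auto
  ultimately show ?thesis by simp
qed

text \<open>The absolute value at \<open>g\<close> is attained on the whole conjugacy class. The
  count runs through the map \<open>x \<mapsto> x + g - x\<close>, each fibre of which has at most
  as many elements as the centraliser.\<close>

lemma class_moment:
  assumes g: "g \<in> G"
  shows "real (card G) * cmod (\<chi> g) ^ k \<le> real (card {x \<in> G. x + g = g + x}) * (\<Sum>x\<in>G. cmod (\<chi> x) ^ k)"
proof -
  let ?C = "{x \<in> G. x + g = g + x}"
  have fin: "finite G" by (rule sgrpD(1)[OF G])
  have fibre: "card {x \<in> G. x + g - x = y} \<le> card ?C" for y
  proof (cases "{x \<in> G. x + g - x = y} = {}")
    case False
    then obtain x0 where x0: "x0 \<in> G" "x0 + g - x0 = y" by blast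
    show ?thesis
    proof (rule card_inj_on_le[of "\<lambda>x. - x0 + x"])
      show "inj_on (\<lambda>x. - x0 + x) {x \<in> G. x + g - x = y}" by (rule inj_onI) simp
      show "(\<lambda>x. - x0 + x) ` {x \<in> G. x + g - x = y} \<subseteq> ?C"
      proof clarify
        fix x assume x: "x \<in> G" "y = x + g - x"
        have "x0 + g = y + x0" "x + g = y + x" using x0(2) x(2) by (metis diff_add_cancel)+
        then have "x0 + (- x0 + x + g) = x0 + (g + (- x0 + x))" by (metis add.assoc add_minus_cancel)
        then show "- x0 + x \<in> G \<and> - x0 + x + g = g + (- x0 + x)"
          using x0(1) x(1) sgrpD(3,4)[OF G] by (metis add_left_cancel)
      qed
    qed (use fin in simp)
  next
    case True
    show ?thesis by (simp only: True card.empty le0)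
  qed
  have "real (card G) * cmod (\<chi> g) ^ k = (\<Sum>x\<in>G. cmod (\<chi> (x + g - x)) ^ k)" using \<chi>_class g by simp
  also have "\<dots> = (\<Sum>y\<in>G. \<Sum>x\<in>{x \<in> G. x + g - x = y}. cmod (\<chi> (x + g - x)) ^ k)"
  proof (rule sum.group[symmetric, OF fin fin])
    show "(\<lambda>x. x + g - x) ` G \<subseteq> G"
      using g sgrpD(3,4)[OF G] by (auto simp: diff_conv_add_uminus simp del: add_uminus_conv_diff)
  qed
  also have "\<dots> = (\<Sum>y\<in>G. real (card {x \<in> G. x + g - x = y}) * cmod (\<chi> y) ^ k)" by (intro sum.cong refl) simp
  also have "\<dots> \<le> (\<Sum>y\<in>G. real (card ?C) * cmod (\<chi> y) ^ k)"
    using fibre by (intro sum_mono mult_right_mono) auto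
  finally show ?thesis by (simp add: sum_distrib_left)
qed

end


section \<open>The character bound for groups between the transvection group and the isometry group\<close>

context hgeom
begin

text \<open>\<open>N m\<close> is transitive on the vectors of norm \<open>e\<close> in
  \<open>V m n\<close>, so the image of the next basis vector can be moved back to that vector. This
  continues as long as \<open>m + 5 \<le> n\<close>.\<close>

lemma U_to_N:
  assumes "g \<in> U j" "j \<le> m" "m + 5 \<le> n" shows "\<exists>p\<in>N j. p + g \<in> U m"
  using assms(2,3)
proof (induction m rule: dec_induct)
  case base show ?case using assms(1) N.N_zero by (intro bexI[of _ 0]) auto
next
  case (step m)
  then obtain p where p: "p \<in> N j" "p + g \<in> U m" by auto
  have "bv m \<in> V m n" using step by (intro V_bv) auto
  then have y: "act (p + g) (bv m) \<in> V m n" by (rule U_Vj[OF p(2)])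
  have "ip (act (p + g) (bv m)) (act (p + g) (bv m)) = e"
    unfolding UD(3)[OF p(2)] using step by (simp add: ip_bv_bv)
  then obtain h where h: "h \<in> N m" "act h (act (p + g) (bv m)) = bv m"
    using move_norm_1[OF _ y] step by auto
  have "h + (p + g) \<in> U m" by (rule U_add[OF N_U[OF h(1)] p(2)])
  then have "h + (p + g) \<in> U (Suc m)" using h(2) by (auto simp: U_def less_Suc_eq)
  moreover have "h + p \<in> N j" using N_add[OF _ p(1)] h(1) N_mono[of j m] step by auto
  ultimately show ?case by (intro bexI[of _ "h + p"]) (auto simp: add.assoc)
qed

text \<open>By \<open>U_to_N\<close> every element is a product of one in \<open>N j\<close> and one
  in \<open>U (n - 5)\<close>, and the latter group has at most \<open>q ^ (2 * 5\<^sup>2)\<close>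
  elements.\<close>

lemma card_U_N:
  assumes "j + 5 \<le> n" shows "card (U j) \<le> q ^ 50 * card (N j)"
proof -
  let ?m = "n - 5"
  have m: "j \<le> ?m" "?m + 5 \<le> n" using assms by auto
  have "\<forall>g\<in>U j. \<exists>p. p \<in> N j \<and> p + g \<in> U ?m" using U_to_N[OF _ m] by blast
  then obtain p where p: "\<And>g. g \<in> U j \<Longrightarrow> p g \<in> N j \<and> p g + g \<in> U ?m" by metis
  have "card (U j) \<le> card (N j \<times> U ?m)"
  proof (rule card_inj_on_le[of "\<lambda>g. (p g, p g + g)"])
    show "inj_on (\<lambda>g. (p g, p g + g)) (U j)" by (rule inj_onI) auto
    show "(\<lambda>g. (p g, p g + g)) ` U j \<subseteq> N j \<times> U ?m" using p by auto
    show "finite (N j \<times> U ?m)" using sgrpD(1)[OF sgrp_N] card_U(1)[of ?m] by auto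
  qed
  also have "\<dots> \<le> card (N j) * q ^ 50"
    using card_U(2)[of ?m] assms by (simp add: card_cartesian_product)
  finally show ?thesis by (simp add: mult.commute)
qed

definition modN :: "(nat \<Rightarrow> 'a) sym \<Rightarrow> (nat \<Rightarrow> 'a) sym \<Rightarrow> bool" where
  "modN x y \<longleftrightarrow> (\<exists>c\<in>N 0. x = c + y)"

lemma modN_sym: "modN x y \<Longrightarrow> modN y x"
  unfolding modN_def using N_uminus by (metis minus_add_cancel)

lemma modN_trans: "modN x y \<Longrightarrow> modN y z \<Longrightarrow> modN x z"
  unfolding modN_def using N_add by (metis add.assoc)

lemma modN_add:
  assumes "x' \<in> U 0" "modN x x'" "modN y y'" shows "modN (x + y) (x' + y')"
proof -
  obtain c d where cd: "c \<in> N 0" "x = c + x'" "d \<in> N 0" "y = d + y'" using assms by (auto simp: modN_def)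
  have "x + y = (c + (x' + d - x')) + (x' + y')"
    by (simp add: cd diff_conv_add_uminus add.assoc del: add_uminus_conv_diff)
  then show ?thesis unfolding modN_def using N_add[OF cd(1) N_conj[OF assms(1) cd(3)]] by blast
qed

text \<open>
  Modulo \<open>N 0\<close>, any two elements can be moved to subgroups acting on orthogonal coordinate subspaces.
\<close>
lemma commute_mod_N:
  assumes n: "10 \<le> n" and g: "g \<in> U 0" "h \<in> U 0" shows "modN (g + h) (h + g)"
proof -
  let ?m = "n - 5"
  have m: "0 \<le> ?m" "?m + 5 \<le> n" "5 \<le> ?m" using n by auto
  have mod: "\<exists>g1. g1 \<in> U ?m \<and> modN g g1" if gU: "g \<in> U 0" for g
  proof -
    obtain p where p: "p \<in> N 0" "p + g \<in> U ?m" using U_to_N[OF gU m(1,2)] by blast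
    have "g = - p + (p + g)" by (simp add: add.assoc[symmetric])
    then show ?thesis using p N_uminus unfolding modN_def by blast
  qed
  obtain g1 h1 where g1: "g1 \<in> U ?m" "modN g g1" and h1: "h1 \<in> U ?m" "modN h h1" using mod g by blast
  have U0: "g1 \<in> U 0" "h1 \<in> U 0" using g1 h1 U_mono[of 0 ?m] by auto
  \<comment> \<open>The last five basis vectors are moved to the first five. The condition
    \<open>n \<ge> 10\<close> keeps the two blocks disjoint and leaves the space required by
    \<open>witt\<close>.\<close>
  have "\<exists>p\<in>N 0. \<forall>r<5. act p (bv (?m + r)) = bv r"
    by (rule witt) (use n in \<open>auto intro: V_bv simp: ip_bv_bv\<close>)
  then obtain p where p: "p \<in> N 0" "\<And>r. r < 5 \<Longrightarrow> act p (bv (?m + r)) = bv r" by blast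
  define k where "k = p + g1 - p"
  note pU = N_U[OF p(1)]
  have kU: "k \<in> U 0"
    unfolding k_def diff_conv_add_uminus by (intro U_add U_uminus pU U0)
  \<comment> \<open>Conjugation by \<open>p\<close> in the normal subgroup \<open>N 0\<close> does
    not change the class modulo \<open>N 0\<close>.\<close>
  have "g1 = (- p + (k + p - k)) + k"
    by (simp add: k_def diff_conv_add_uminus add.assoc minus_add del: add_uminus_conv_diff)
  then have "modN g1 k" unfolding modN_def using N_add[OF N_uminus[OF p(1)] N_conj[OF kU p(1)]] by blast
  then have gk: "modN g k" using modN_trans g1(2) by blast
  have kfix: "act k x = x" if x: "x \<in> V 5 n" for x
  proof -
    let ?y = "act (- p) x"
    have y: "?y \<in> V 0 n" using act_N[OF N_uminus[OF p(1)] V_mono[OF x]] by simp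
    have "?y i = 0" if "\<not> i < ?m" for i
    proof (cases "i < n")
      case True
      define r where "r = i - ?m"
      have r: "r < 5" "i = ?m + r" using that True n by (auto simp: r_def)
      have "ip (bv i) ?y = ip (act p (bv i)) (act p ?y)" by (rule UD(3)[OF pU, symmetric])
      also have "\<dots> = ip (bv r) x" using p(2)[OF r(1)] r(2) by simp
      also have "\<dots> = 0" using V_out[OF x, of r] r n by (simp add: ip_bv)
      finally show ?thesis using True V_e[OF y] by (simp add: ip_bv)
    qed (use V_out[OF y] in auto)
    then have "?y \<in> V 0 ?m" using y by (auto simp: V_def)
    then have "act g1 ?y = ?y" by (rule U_fix[OF g1(1)])
    then show ?thesis by (simp add: k_def)
  qed
  have kV: "act k x \<in> V 0 5" if x: "x \<in> V 0 5" for x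
  proof -
    have kx: "act k x \<in> V 0 n" using U_V[OF kU V_mono[OF x]] n by simp
    have "act k x i = 0" if "\<not> i < 5" for i
    proof (cases "i < n")
      case True
      have "ip (bv i) (act k x) = ip (act k (bv i)) (act k x)" using kfix[OF V_bv] that True by simp
      also have "\<dots> = 0" unfolding UD(3)[OF kU] using V_out[OF x, of i] that True by (simp add: ip_bv)
      finally show ?thesis using True V_e[OF kx] by (simp add: ip_bv)
    qed (use V_out[OF kx] in auto)
    then show ?thesis using kx by (auto simp: V_def)
  qed
  have hfix: "act h1 x = x" if "x \<in> V 0 5" for x using U_fix[OF h1(1) V_mono[OF that]] n by simp
  have h5: "h1 \<in> U 5" using h1(1) U_mono[OF m(3)] by blast
  have "k + h1 = h1 + k"
  proof (rule U_eqI[OF U_add[OF kU U0(2)] U_add[OF U0(2) kU]])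
    fix i assume i: "i < n"
    show "act (k + h1) (bv i) = act (h1 + k) (bv i)"
    proof (cases "i < 5")
      case True
      then have b: "bv i \<in> V 0 5" by (intro V_bv) auto
      show ?thesis using hfix[OF b] hfix[OF kV[OF b]] by simp
    next
      case False
      then have b: "bv i \<in> V 5 n" using i by (intro V_bv) auto
      show ?thesis using kfix[OF b] kfix[OF U_Vj[OF h5 b]] by simp
    qed
  qed
  then have "modN (g + h) (h1 + k)" using modN_add[OF kU gk h1(2)] by simp
  moreover have "modN (h + g) (h1 + k)" by (rule modN_add[OF U0(2) h1(2) gk])
  ultimately show ?thesis using modN_trans modN_sym by blast
qed

lemma fixn_conj: assumes "g \<in> U 0" "x \<in> U 0" shows "fixn (- x + g + x) = fixn g"
  unfolding fixn_def
proof (rule bij_betw_same_card[of "act x"], rule bij_betw_byWitness[where f' = "act (- x)"])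
  have 1: "act g (act x y) = act x y \<longleftrightarrow> act (- x + g + x) y = y" for y by (simp) (metis act_uminus_cancel)
  show "act x ` {y \<in> V 0 n. act (- x + g + x) y = y} \<subseteq> {y \<in> V 0 n. act g y = y}" using 1 U_V[OF assms(2)] by auto
  have "act (- x + g + x) (act (- x) y) = act (- x) y" if "act g y = y" for y using that by simp
  then show "act (- x) ` {y \<in> V 0 n. act g y = y} \<subseteq> {y \<in> V 0 n. act (- x + g + x) y = y}"
    using U_V[OF U_uminus[OF assms(2)]] by auto
qed auto

text \<open>If \<open>- x + g + x\<close> fixes the first \<open>j\<close> basis vectors, then
  \<open>g\<close> fixes their images under \<open>x\<close>. There are at most
  \<open>fixn g ^ j\<close> such families of images, and the \<open>x\<close> with a given family
  lie in one coset of \<open>U j\<close>.\<close>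

lemma card_conj_into_N:
  assumes G: "sgrp G" "G \<subseteq> U 0" and j: "j + 5 \<le> n"
  shows "card {x \<in> G. - x + g + x \<in> N j} \<le> fixn g ^ j * (q ^ 50 * card (N j))"
proof -
  let ?X = "{x \<in> G. - x + g + x \<in> N j}"
  let ?Fix = "{x \<in> V 0 n. act g x = x}"
  let ?T = "{..<j} \<rightarrow>\<^sub>E ?Fix"
  let ?\<phi> = "\<lambda>x. restrict (\<lambda>i. act x (bv i)) {..<j}"
  have finT: "finite ?T" using card_V(1)[of 0 n] by (intro finite_PiE) auto
  have into: "?\<phi> x \<in> ?T" if x: "x \<in> ?X" for x
  proof -
    have "act g (act x (bv i)) = act x (bv i)" if "i < j" for i
    proof -
      have "act (- x + g + x) (bv i) = bv i" using x UD(6)[OF N_U] that by blast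
      then show ?thesis by (simp) (metis act_uminus_cancel(1))
    qed
    moreover have "act x (bv i) \<in> V 0 n" if "i < j" for i using U_V[of x "bv i"] x G(2) V_bv[of 0 i n] that j by auto
    ultimately show ?thesis by auto
  qed
  have fibre: "card {x \<in> ?X. ?\<phi> x = t} \<le> card (U j)" for t
  proof (cases "{x \<in> ?X. ?\<phi> x = t} = {}")
    case False
    then obtain x0 where x0: "x0 \<in> ?X" "?\<phi> x0 = t" by blast
    show ?thesis
    proof (rule card_inj_on_le[of "\<lambda>x. - x0 + x"])
      show "inj_on (\<lambda>x. - x0 + x) {x \<in> ?X. ?\<phi> x = t}" by (rule inj_onI) simp
      show "finite (U j)" using card_U(1)[of j] j by simp
      show "(\<lambda>x. - x0 + x) ` {x \<in> ?X. ?\<phi> x = t} \<subseteq> U j"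
      proof
        fix y assume "y \<in> (\<lambda>x. - x0 + x) ` {x \<in> ?X. ?\<phi> x = t}"
        then obtain x where x: "x \<in> G" "?\<phi> x = t" "y = - x0 + x" by blast
        have "act (- x0 + x) (bv i) = bv i" if "i < j" for i
          using fun_cong[OF x(2), of i] fun_cong[OF x0(2), of i] that by simp (metis act_uminus_cancel(2))
        moreover have "- x0 + x \<in> U 0" using x x0 G sgrpD(3,4)[OF G(1)] by blast
        ultimately show "y \<in> U j" unfolding x(3) by (auto simp: U_def)
      qed
    qed
  next
    case True
    show ?thesis by (simp only: True card.empty le0)
  qed
  have finX: "finite ?X" using sgrpD(1)[OF G(1)] by simp
  have "card ?X \<le> card (\<Union>t\<in>?T. {x \<in> ?X. ?\<phi> x = t})"
  proof (rule card_mono)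
    show "finite (\<Union>t\<in>?T. {x \<in> ?X. ?\<phi> x = t})" by (rule finite_subset[OF _ finX]) blast
    show "?X \<subseteq> (\<Union>t\<in>?T. {x \<in> ?X. ?\<phi> x = t})" using into by blast
  qed
  also have "\<dots> \<le> (\<Sum>t\<in>?T. card {x \<in> ?X. ?\<phi> x = t})" by (rule card_UN_le[OF finT])
  also have "\<dots> \<le> (\<Sum>t\<in>?T. card (U j))" by (rule sum_mono) (rule fibre)
  also have "\<dots> = fixn g ^ j * card (U j)" by (simp add: card_PiE fixn_def)
  also have "\<dots> \<le> fixn g ^ j * (q ^ 50 * card (N j))" by (intro mult_le_mono2 card_U_N j)
  finally show ?thesis .
qed

lemma ind_bound:
  assumes G: "sgrp G" "G \<subseteq> U 0" and j: "j + 5 \<le> n" and g: "g \<in> G"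
    and f: "\<And>h. h \<in> N j \<Longrightarrow> cmod (f h) \<le> real (fixn h)"
  shows "cmod (ind G (N j) f g) \<le> real q ^ 50 * real (fixn g) ^ (j + 1)"
proof -
  let ?X = "{x \<in> G. - x + g + x \<in> N j}"
  have fin: "finite G" by (rule sgrpD(1)[OF G(1)])
  have cN: "real (card (N j)) > 0" using sgrpD(5)[OF sgrp_N] by simp
  have "cmod (\<Sum>x\<in>G. if - x + g + x \<in> N j then f (- x + g + x) else 0) = cmod (\<Sum>x\<in>?X. f (- x + g + x))"
    using fin by (simp add: sum.inter_filter)
  also have "\<dots> \<le> (\<Sum>x\<in>?X. real (fixn g))"
  proof (rule sum_norm_le)
    fix x assume x: "x \<in> ?X"
    then have "fixn (- x + g + x) = fixn g" using g G(2) by (intro fixn_conj) auto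
    then show "cmod (f (- x + g + x)) \<le> real (fixn g)" using f[of "- x + g + x"] x by simp
  qed
  also have "\<dots> = real (card ?X) * real (fixn g)" by simp
  also have "\<dots> \<le> real (fixn g ^ j * (q ^ 50 * card (N j))) * real (fixn g)"
    by (intro mult_right_mono of_nat_mono card_conj_into_N G j) simp
  finally have "cmod (\<Sum>x\<in>G. if - x + g + x \<in> N j then f (- x + g + x) else 0)
    \<le> real (card (N j)) * (real q ^ 50 * real (fixn g) ^ (j + 1))" by (simp add: mult_ac)
  then show ?thesis using cN by (simp add: ind_def norm_mult norm_divide field_simps)
qed

text \<open>Two new coordinates are spent on each vector: only its part beyond the coordinates
  already occupied has to be moved, and this is done by an element acting trivially on the occupied
  ones.\<close>

lemma move_list:
  assumes "2 * length xs + 3 \<le> n" "set xs \<subseteq> V 0 n"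
  shows "\<exists>h\<in>N 0. \<forall>x\<in>set xs. act h x \<in> V 0 (2 * length xs)"
  using assms
proof (induction xs rule: rev_induct)
  case Nil show ?case using N.N_zero by auto
next
  case (snoc x xs)
  let ?l = "2 * length xs"
  obtain h where h: "h \<in> N 0" "\<forall>x\<in>set xs. act h x \<in> V 0 ?l" using snoc by auto
  define y where "y = act h x"
  define y1 where "y1 = (\<lambda>i. if ?l \<le> i then y i else 0)"
  have y: "y \<in> V 0 n" unfolding y_def using act_N[OF h(1)] snoc.prems by simp
  have y1: "y1 \<in> V ?l n" using y by (auto simp: y1_def V_def)
  have y0: "y - y1 \<in> V 0 ?l" using y by (auto simp: y1_def V_def)
  obtain g where g: "g \<in> N ?l" "act g y1 \<in> V ?l (?l + 2)" using move2[OF _ y1] snoc.prems by auto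
  note gU = N_U[OF g(1)]
  have "act g ((y - y1) + y1) = (y - y1) + act g y1" by (simp only: UD(1)[OF gU] U_fix[OF gU y0])
  then have eq: "act g y = (y - y1) + act g y1" by simp
  have "act g y \<in> V 0 (?l + 2)" unfolding eq using V_mono[OF y0] V_mono[OF g(2)] by (intro V_add) auto
  moreover have "act g (act h z) \<in> V 0 (?l + 2)" if "z \<in> set xs" for z
    using U_fix[OF gU] h(2) that V_mono by fastforce
  ultimately show ?case
    using N_add[OF _ h(1)] N_mono[of 0 ?l] g(1) by (intro bexI[of _ "g + h"]) (auto simp: y_def)
qed

text \<open>\<open>fixn g ^ M\<close> counts the \<open>M\<close>-tuples fixed by \<open>g\<close>.
  Orbits are not counted directly: the stabiliser of a tuple is compared with the set of
  \<open>g\<close> that send some tuple \<open>t\<close> over the first \<open>2 * M\<close>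
  coordinates to it. For a fixed \<open>t\<close> these sets are disjoint subsets of
  \<open>G\<close>, and there are \<open>q ^ (4 * M\<^sup>2)\<close> tuples
  \<open>t\<close>.\<close>

lemma fixn_moment:
  assumes G: "sgrp G" "G \<subseteq> U 0" "N 0 \<subseteq> G" and M: "2 * M + 5 \<le> n"
  shows "(\<Sum>g\<in>G. real (fixn g) ^ M) \<le> real (card G) * real q ^ (4 * M\<^sup>2)"
proof -
  let ?X = "{xs. set xs \<subseteq> V 0 n \<and> length xs = M}"
  let ?T = "{xs. set xs \<subseteq> V 0 (2 * M) \<and> length xs = M}"
  have fin: "finite G" by (rule sgrpD(1)[OF G(1)])
  have finX: "finite ?X" and finT: "finite ?T"
    using card_V(1) by (auto intro!: finite_lists_length_eq)
  have fixM: "fixn g ^ M = card {xs \<in> ?X. map (act g) xs = xs}" for g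
  proof -
    have "{xs \<in> ?X. map (act g) xs = xs} = {xs. set xs \<subseteq> {x \<in> V 0 n. act g x = x} \<and> length xs = M}"
    proof -
      have "map (act g) xs = xs \<longleftrightarrow> (\<forall>x\<in>set xs. act g x = x)" for xs by (induction xs) auto
      then show ?thesis by blast
    qed
    then show ?thesis using card_V(1)[of 0 n] by (simp add: card_lists_length_eq fixn_def)
  qed
  have swap: "(\<Sum>g\<in>G. card {xs \<in> ?X. map (act g) xs = xs}) = (\<Sum>xs\<in>?X. card {g \<in> G. map (act g) xs = xs})"
  proof -
    have "(\<Sum>g\<in>G. card {xs \<in> ?X. map (act g) xs = xs}) = (\<Sum>g\<in>G. \<Sum>xs\<in>?X. if map (act g) xs = xs then 1 else 0)"
      using finX by (simp add: sum.If_cases Int_def)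
    also have "\<dots> = (\<Sum>xs\<in>?X. \<Sum>g\<in>G. if map (act g) xs = xs then 1 else 0)" by (rule sum.swap)
    finally show ?thesis using fin by (simp add: sum.If_cases Int_def)
  qed
  have stab: "card {g \<in> G. map (act g) xs = xs} \<le> (\<Sum>t\<in>?T. card {g \<in> G. map (act g) t = xs})" if xs: "xs \<in> ?X" for xs
  proof -
    obtain h where h: "h \<in> N 0" "\<forall>x\<in>set xs. act h x \<in> V 0 (2 * M)" using move_list[of xs] xs M by auto
    let ?t = "map (act h) xs"
    have t: "?t \<in> ?T" using h(2) xs by auto
    have "card {g \<in> G. map (act g) xs = xs} \<le> card {g \<in> G. map (act g) ?t = xs}"
    proof (rule card_inj_on_le[of "\<lambda>g. g + - h"])
      show "inj_on (\<lambda>g. g + - h) {g \<in> G. map (act g) xs = xs}" by (rule inj_onI) (simp only: add_right_cancel)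
      show "(\<lambda>g. g + - h) ` {g \<in> G. map (act g) xs = xs} \<subseteq> {g \<in> G. map (act g) ?t = xs}"
      proof clarify
        fix g assume g: "g \<in> G" "map (act g) xs = xs"
        have "g + - h \<in> G" using sgrpD(3)[OF G(1) g(1)] sgrpD(4)[OF G(1)] h(1) G(3) by blast
        moreover have "map (act (g + - h)) ?t = xs" using g(2) by (simp add: comp_def)
        ultimately show "g + - h \<in> G \<and> map (act (g + - h)) ?t = xs" by blast
      qed
    qed (use fin in simp)
    also have "\<dots> \<le> (\<Sum>t\<in>?T. card {g \<in> G. map (act g) t = xs})" by (rule member_le_sum[OF t _ finT]) simp
    finally show ?thesis .
  qed
  have "(\<Sum>g\<in>G. fixn g ^ M) \<le> (\<Sum>xs\<in>?X. \<Sum>t\<in>?T. card {g \<in> G. map (act g) t = xs})"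
    unfolding fixM swap by (rule sum_mono) (rule stab)
  also have "\<dots> = (\<Sum>t\<in>?T. \<Sum>xs\<in>?X. card {g \<in> G. map (act g) t = xs})" by (rule sum.swap)
  also have "\<dots> \<le> (\<Sum>t\<in>?T. card G)"
  proof (rule sum_mono)
    fix t
    have "(\<Sum>xs\<in>?X. card {g \<in> G. map (act g) t = xs}) = card (\<Union>xs\<in>?X. {g \<in> G. map (act g) t = xs})"
      by (rule card_UN_disjoint[symmetric]) (use fin finX in auto)
    also have "\<dots> \<le> card G" by (rule card_mono[OF fin]) auto
    finally show "(\<Sum>xs\<in>?X. card {g \<in> G. map (act g) t = xs}) \<le> card G" .
  qed
  also have "\<dots> = (q ^ (2 * (2 * M))) ^ M * card G"
    using card_V[of 0 "2 * M"] by (simp add: card_lists_length_eq)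
  also have "(q ^ (2 * (2 * M))) ^ M = q ^ (4 * M\<^sup>2)" by (simp add: power_mult[symmetric] power2_eq_square mult.assoc)
  finally have "real (\<Sum>g\<in>G. fixn g ^ M) \<le> real (q ^ (4 * M\<^sup>2) * card G)" by (rule of_nat_mono)
  then show ?thesis by (simp add: mult.commute)
qed

end

section \<open>Moments and pointwise bounds for irreducible characters\<close>

context hchar
begin

text \<open>The descent ends at some \<open>j \<le> 4 * k0 + 2\<close>, so the induced function is
  at most \<open>q ^ 50\<close> times the power \<open>4 * k0 + 3\<close> of the number of fixed
  vectors. Raised to the power \<open>2 * k\<close> this contributes \<open>100 * k\<close> to the
  exponent, the lower bound \<open>1 / q\<close> contributes \<open>2 * k\<close>, and
  \<open>fixn_moment\<close> contributes the rest.\<close>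

lemma low_degree_moment:
  assumes irr: "irrchar G \<pi> \<chi>" and GU: "N 0 \<subseteq> G" "G \<subseteq> U 0"
    and deg: "nsq (\<pi> 0) < real q ^ (k0 * m)" and n: "4 * k0 + m + 7 \<le> n" "2 * (2 * k * (4 * k0 + 3)) + 5 \<le> n"
  shows "(\<Sum>g\<in>G. cmod (\<chi> g) ^ (2 * k)) \<le> real (card G) * real q ^ (102 * k + 4 * (2 * k * (4 * k0 + 3))\<^sup>2)"
proof -
  interpret irrchar G \<pi> \<chi> by (rule irr)
  let ?J = "4 * k0 + 3" and ?q = "real q"
  have q: "?q \<ge> 1" "?q > 0" using q_ge_2 by auto
  obtain j f where j: "j \<le> 4 * k0 + 2" and f: "gram (N j) f" "\<And>h. h \<in> N j \<Longrightarrow> cmod (f h) \<le> real (fixn h)"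
    "Re (\<Sum>h\<in>N j. f h * cnj (tr (\<pi> h))) \<ge> real (card (N j)) / ?q"
    using small_degree[OF srep_subset[OF rep GU(1)] nz deg] n(1) by auto
  have NG: "N j \<subseteq> G" using N_mono[of 0 j] GU(1) by auto
  have jn: "j + 5 \<le> n" using j n(1) by linarith
  have "(\<Sum>h\<in>N j. f h * cnj (tr (\<pi> h))) = (\<Sum>h\<in>N j. f h * cnj (\<chi> h))"
    by (rule sum.cong) (use NG \<chi> in auto)
  then have c: "Re (\<Sum>h\<in>N j. f h * cnj (\<chi> h)) \<ge> 1 / ?q * real (card (N j))" using f(3) by simp
  have "(1 / ?q) ^ (2 * k) * (\<Sum>g\<in>G. cmod (\<chi> g) ^ (2 * k)) \<le> (\<Sum>g\<in>G. cmod (ind G (N j) f g) ^ (2 * k))"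
    by (rule moment_le_induced[OF sgrp_N NG f(1) _ c]) (use q in simp)
  also have "\<dots> \<le> (\<Sum>g\<in>G. ?q ^ (100 * k) * real (fixn g) ^ (2 * k * ?J))"
  proof (rule sum_mono)
    fix g assume g: "g \<in> G"
    have one: "1 \<le> real (fixn g)" using fixn_ge_1[of g] g GU(2) by auto
    have "cmod (ind G (N j) f g) \<le> ?q ^ 50 * real (fixn g) ^ (j + 1)" by (rule ind_bound[OF G GU(2) jn g f(2)])
    also have "\<dots> \<le> ?q ^ 50 * real (fixn g) ^ ?J" using one j by (intro mult_left_mono power_increasing) auto
    finally have "cmod (ind G (N j) f g) ^ (2 * k) \<le> (?q ^ 50 * real (fixn g) ^ ?J) ^ (2 * k)" by (intro power_mono) auto
    also have "\<dots> = ?q ^ (100 * k) * real (fixn g) ^ (2 * k * ?J)"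
      by (simp add: power_mult_distrib power_mult[symmetric] mult_ac)
    finally show "cmod (ind G (N j) f g) ^ (2 * k) \<le> ?q ^ (100 * k) * real (fixn g) ^ (2 * k * ?J)" .
  qed
  also have "\<dots> = ?q ^ (100 * k) * (\<Sum>g\<in>G. real (fixn g) ^ (2 * k * ?J))" by (rule sum_distrib_left[symmetric])
  also have "\<dots> \<le> ?q ^ (100 * k) * (real (card G) * ?q ^ (4 * (2 * k * ?J)\<^sup>2))"
    by (intro mult_left_mono fixn_moment G GU n(2)) (use q in simp)
  finally have "?q ^ (2 * k) * ((1 / ?q) ^ (2 * k) * (\<Sum>g\<in>G. cmod (\<chi> g) ^ (2 * k)))
    \<le> ?q ^ (2 * k) * (?q ^ (100 * k) * (real (card G) * ?q ^ (4 * (2 * k * ?J)\<^sup>2)))"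
    using q by (intro mult_left_mono) auto
  moreover have "?q ^ (2 * k) * ((1 / ?q) ^ (2 * k) * S) = S" for S
    using q by (simp add: power_one_over)
  moreover have "?q ^ (2 * k) * (?q ^ (100 * k) * (real (card G) * ?q ^ (4 * (2 * k * ?J)\<^sup>2)))
    = real (card G) * ?q ^ (102 * k + 4 * (2 * k * ?J)\<^sup>2)"
  proof -
    have "102 * k = 2 * k + 100 * k" by simp
    then show ?thesis by (simp only: power_add mult_ac)
  qed
  ultimately show ?thesis by simp
qed

text \<open>If \<open>N 0\<close> acts trivially, \<open>commute_mod_N\<close> makes the
  representing matrices commute, which forces degree 1. Otherwise \<open>large_degree\<close>
  applies.\<close>

lemma linear_or_large:
  assumes irr: "irrchar G \<pi> \<chi>" and GU: "N 0 \<subseteq> G" "G \<subseteq> U 0" and n: "10 \<le> n"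
  shows "nsq (\<pi> 0) = 1 \<or> nsq (\<pi> 0) \<ge> real q ^ (n - 4)"
proof (cases "\<exists>g\<in>N 0. \<pi> g \<noteq> \<pi> 0")
  case True
  interpret irrchar G \<pi> \<chi> by (rule irr)
  show ?thesis using True large_degree[OF srep_subset[OF rep GU(1)] _ nz] n by auto
next
  case False
  interpret irrchar G \<pi> \<chi> by (rule irr)
  have "\<pi> (x + y) = \<pi> (y + x)" if xy: "x \<in> G" "y \<in> G" for x y
  proof -
    obtain c where c: "c \<in> N 0" "x + y = c + (y + x)"
      using commute_mod_N[OF n, of x y] xy GU(2) by (auto simp: modN_def)
    have yx: "y + x \<in> G" using sgrpD(3)[OF G] xy by blast
    have "\<pi> (x + y) = \<pi> c * \<pi> (y + x)" unfolding c(2) by (rule srep_add[OF rep _ yx]) (use c GU in blast)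
    then show ?thesis using False c(1) srep_0(2)[OF rep G yx] by simp
  qed
  then have "\<chi> 0 = 1" by (rule abelian)
  then show ?thesis using \<chi>0 by simp
qed

text \<open>\<open>M\<close> is the exponent of \<open>low_degree_moment\<close> for
  \<open>k = K + 1\<close> and \<open>k0 = 3 * K\<close>. The term \<open>M * 2 ^ m\<close> absorbs
  the moment constant; the others supply the coordinates needed by the descent and by
  \<open>fixn_moment\<close>.\<close>

definition bound_n :: "nat \<Rightarrow> nat \<Rightarrow> nat" where
  "bound_n K m = (let M = 102 * (K + 1) + 4 * (2 * (K + 1) * (4 * (3 * K) + 3))\<^sup>2
     in M * 2 ^ m + M + 24 * K + 30)"

text \<open>From degree \<open>q ^ (K n)\<close> on, the second moment is enough, since
  \<open>2 K / 2 ^ m \<ge> C\<close>. Below it the moment of order \<open>2 (K + 1)\<close> is used: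
  there \<open>(C n + M) 2 ^ m \<le> n (K + 1)\<close>, and the degree is at least
  \<open>q ^ (n - 4)\<close> with \<open>2 (n - 4) \<ge> n\<close>.\<close>

theorem character_bound:
  assumes irr: "irrchar G \<pi> \<chi>" and GU: "N 0 \<subseteq> G" "G \<subseteq> U 0" and g: "g \<in> G"
    and C: "C \<ge> 1" and K: "real K \<ge> C * 2 ^ m" and n: "n \<ge> bound_n K m"
    and cent: "real (card {x \<in> G. x + g = g + x}) \<le> real q powr (C * real n)"
  shows "cmod (\<chi> g) \<le> cmod (\<chi> 0) powr (1 / 2 ^ m)"
proof -
  interpret irrchar G \<pi> \<chi> by (rule irr)
  let ?q = "real q" and ?k = "K + 1" and ?l = "3 * K" and ?d = "nsq (\<pi> 0)"
  define M where "M = 102 * ?k + 4 * (2 * ?k * (4 * ?l + 3))\<^sup>2"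
  have nM: "n \<ge> M * 2 ^ m + M + 24 * K + 30" using n unfolding bound_n_def Let_def M_def .
  have q: "?q > 1" "?q > 0" using q_ge_2 by auto
  have d0: "cmod (\<chi> 0) = ?d" using \<chi>0 d_ge_1 by simp
  have K1: "K \<ge> 1"
  proof -
    have "1 * 1 \<le> C * 2 ^ m" by (intro mult_mono) (use C in auto)
    then show ?thesis using K by linarith
  qed
  have cG: "real (card G) > 0" using sgrpD(5)[OF G] by simp
  consider "?d = 1" | "?d \<ge> ?q powr (real K * real n)"
    | "?d \<ge> ?q ^ (n - 4)" "?d < ?q powr (real K * real n)"
    using linear_or_large[OF irr GU] nM by linarith
  then show ?thesis
  proof cases
    case 1
    have "cmod (\<chi> g) \<le> Re (\<chi> 0)" by (rule gram_bound[OF gram_\<chi> G g])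
    then show ?thesis using 1 \<chi>0 d0 by simp
  next
    case 2
    have "(\<Sum>x\<in>G. cmod (\<chi> x) ^ 2) = real (card G)"
    proof -
      have "(\<Sum>w\<in>G. \<chi> w * \<chi> (- w)) = of_real (\<Sum>x\<in>G. cmod (\<chi> x) ^ 2)"
        using gram_uminus[OF gram_\<chi> G] by (simp add: cmod_sq)
      then have "complex_of_real (\<Sum>x\<in>G. cmod (\<chi> x) ^ 2) = of_real (real (card G))" using norm by simp
      then show ?thesis by (simp only: of_real_eq_iff)
    qed
    then have "real (card G) * cmod (\<chi> g) ^ 2 \<le> real (card G) * ?q powr (C * real n)"
      using class_moment[OF g, of 2] mult_right_mono[OF cent, of "real (card G)"] by (simp add: mult.commute)
    then have 1: "cmod (\<chi> g) ^ 2 \<le> ?q powr (C * real n)" using cG by simp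
    have "C \<le> real K * 2 / 2 ^ m" using K C by (simp add: field_simps) 
    from mult_right_mono[OF this, of "real n"] have "C * real n \<le> real K * real n * (2 / 2 ^ m)" by (simp add: mult_ac)
    then have "?q powr (C * real n) \<le> ?q powr (real K * real n * (2 / 2 ^ m))"
      using q by (intro powr_mono) auto
    also have "\<dots> = (?q powr (real K * real n)) powr (2 / 2 ^ m)" by (simp add: powr_powr)
    also have "\<dots> \<le> ?d powr (2 / 2 ^ m)" by (rule powr_mono2) (use 2 in auto)
    also have "\<dots> = (?d powr (1 / 2 ^ m)) ^ 2" using d_ge_1 by (simp add: power2_eq_square powr_add[symmetric])
    finally have "?q powr (C * real n) \<le> (?d powr (1 / 2 ^ m)) ^ 2" .
    with 1 have "cmod (\<chi> g) ^ 2 \<le> (?d powr (1 / 2 ^ m)) ^ 2" by (rule order_trans)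
    then show ?thesis unfolding d0 by (rule power2_le_imp_le) simp
  next
    case 3
    \<comment> \<open>Each descent gains \<open>n div 2\<close> in the exponent, which leaves the
      other half of the coordinates for the descents themselves. Since
      \<open>n \<le> 3 * (n div 2)\<close>, the bound \<open>q ^ (K n)\<close> is exhausted by
      \<open>3 * K\<close> of them.\<close>
    let ?m0 = "n div 2"
    have "2 * ?m0 + 1 \<ge> n" by simp
    then have "2 * real ?m0 + 1 \<ge> real n" by linarith
    then have "real n \<le> 3 * real ?m0" using nM by linarith
    then have "real K * real n \<le> real (?l * ?m0)" using mult_left_mono[of "real n" "3 * real ?m0" "real K"] by simp
    then have "?q powr (real K * real n) \<le> ?q powr real (?l * ?m0)" using q by (intro powr_mono) auto
    then have deg: "?d < ?q ^ (?l * ?m0)" using 3(2) q by (simp only: powr_realpow)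
    have Mbig: "2 * (2 * ?k * (4 * ?l + 3)) \<le> M"
    proof -
      have "a \<le> a\<^sup>2" for a :: nat by (simp add: power2_eq_square)
      from this[of "2 * ?k * (4 * ?l + 3)"] show ?thesis unfolding M_def by linarith
    qed
    have "(\<Sum>x\<in>G. cmod (\<chi> x) ^ (2 * ?k)) \<le> real (card G) * ?q ^ M"
      unfolding M_def by (rule low_degree_moment[OF irr GU deg]) (use nM Mbig in linarith)+
    then have "real (card G) * cmod (\<chi> g) ^ (2 * ?k) \<le> ?q powr (C * real n) * (real (card G) * ?q ^ M)"
      using class_moment[OF g, of "2 * ?k"] cent by (meson mult_mono of_nat_0_le_iff order_trans powr_ge_zero sum_nonneg zero_le_power norm_ge_zero)
    then have "cmod (\<chi> g) ^ (2 * ?k) \<le> ?q powr (C * real n) * ?q ^ M" using cG by (simp add: mult.left_commute)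
    also have "\<dots> = ?q powr (C * real n + real M)" using q by (simp add: powr_add powr_realpow)
    also have "\<dots> \<le> ?q powr (real (n - 4) * (real (2 * ?k) / 2 ^ m))"
    proof (intro powr_mono)
      have "2 * real (n - 4) \<ge> real n" using nM by simp
      then have "real n * real ?k \<le> 2 * real (n - 4) * real ?k" by (rule mult_right_mono) simp
      then have a: "real n * real ?k \<le> real (n - 4) * real (2 * ?k)" by (simp add: algebra_simps)
      have "C * 2 ^ m * real n \<le> real K * real n" by (rule mult_right_mono[OF K]) simp
      moreover have "real M * 2 ^ m \<le> real n"
      proof -
        have "M * 2 ^ m \<le> n" using nM by linarith
        then have "real (M * 2 ^ m) \<le> real n" by (simp only: of_nat_le_iff)
        then show ?thesis by simp
      qed
      ultimately have "(C * real n + real M) * 2 ^ m \<le> real n * real ?k" by (simp add: algebra_simps)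
      then have "(C * real n + real M) * 2 ^ m \<le> real (n - 4) * real (2 * ?k)" using a by linarith
      then show "C * real n + real M \<le> real (n - 4) * (real (2 * ?k) / 2 ^ m)" by (simp add: field_simps)
    qed (use q in simp)
    also have "\<dots> = (?q ^ (n - 4)) powr (real (2 * ?k) / 2 ^ m)" using q by (simp only: powr_realpow[symmetric] powr_powr)
    also have "\<dots> \<le> ?d powr (real (2 * ?k) / 2 ^ m)" by (rule powr_mono2) (use 3 q in auto)
    also have "\<dots> = (?d powr (1 / 2 ^ m)) ^ (2 * ?k)"
    proof -
      have "0 < ?d powr (1 / 2 ^ m)" using d_ge_1 by simp
      then have "(?d powr (1 / 2 ^ m)) ^ (2 * ?k) = (?d powr (1 / 2 ^ m)) powr real (2 * ?k)"
        by (rule powr_realpow[symmetric])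
      then show ?thesis by (simp only: powr_powr times_divide_eq_left mult_1)
    qed
    finally have "cmod (\<chi> g) ^ (2 * ?k) \<le> (?d powr (1 / 2 ^ m)) ^ (2 * ?k)" .
    moreover have "2 * ?k = Suc (2 * K + 1)" by simp
    ultimately have "cmod (\<chi> g) ^ Suc (2 * K + 1) \<le> (?d powr (1 / 2 ^ m)) ^ Suc (2 * K + 1)" by (simp only:)
    then show ?thesis unfolding d0 by (rule power_le_imp_le_base) simp
  qed
qed

end


section \<open>Unitarisation of complex matrix representations\<close>

definition cm :: "nat \<Rightarrow> complex mat \<Rightarrow> nat cmx" where
  "cm d M = Abs_cmx (\<lambda>i j. if i < d \<and> j < d then M $$ (i, j) else 0)"

lemma ent_cm [simp]: "ent (cm d M) i j = (if i < d \<and> j < d then M $$ (i, j) else 0)"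
  unfolding cm_def by (subst ent_Abs[of "{..<d}"]) (auto split: if_splits)

lemma supp_cm: "supp (cm d M) \<subseteq> {..<d}" by (auto simp: supp_def split: if_splits)

lemma cm_mult:
  assumes "M \<in> carrier_mat d d" "M' \<in> carrier_mat d d" shows "cm d (M * M') = cm d M * cm d M'"
  by (rule cmx_eqI) (use assms in \<open>auto simp: ent_mult[OF _ disjI1[OF supp_cm]] scalar_prod_def lessThan_atLeast0\<close>)

lemma cm_inj:
  assumes "M \<in> carrier_mat d d" "M' \<in> carrier_mat d d" "cm d M = cm d M'" shows "M = M'"
proof (rule eq_matI)
  fix i j assume "i < dim_row M'" "j < dim_col M'"
  then show "M $$ (i, j) = M' $$ (i, j)" using arg_cong[OF assms(3), of "\<lambda>X. ent X i j"] assms(1,2) by simp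
qed (use assms in auto)

definition mc :: "nat \<Rightarrow> nat cmx \<Rightarrow> complex mat" where
  "mc d X = mat d d (\<lambda>(i, j). ent X i j)"

lemma mc_carrier [simp]: "mc d X \<in> carrier_mat d d" by (simp add: mc_def)

lemma cm_one_mult: "cm d (1\<^sub>m d) * X = X \<longleftrightarrow> (\<forall>i j. d \<le> i \<longrightarrow> ent X i j = 0)"
  "X * cm d (1\<^sub>m d) = X \<longleftrightarrow> (\<forall>i j. d \<le> j \<longrightarrow> ent X i j = 0)"
proof -
  have 1: "ent (cm d (1\<^sub>m d) * X) i j = (if i < d then ent X i j else 0)" for i j
  proof -
    have "ent (cm d (1\<^sub>m d) * X) i j = (\<Sum>k<d. if k = i then (if i < d then ent X i j else 0) else 0)"
      unfolding ent_mult[OF finite_lessThan disjI1[OF supp_cm]] by (intro sum.cong refl) auto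
    then show ?thesis by simp
  qed
  have 2: "ent (X * cm d (1\<^sub>m d)) i j = (if j < d then ent X i j else 0)" for i j
  proof -
    have "ent (X * cm d (1\<^sub>m d)) i j = (\<Sum>k<d. if k = j then (if j < d then ent X i j else 0) else 0)"
      unfolding ent_mult[OF finite_lessThan disjI2[OF supp_cm]] by (intro sum.cong refl) auto
    then show ?thesis by simp
  qed
  show "cm d (1\<^sub>m d) * X = X \<longleftrightarrow> (\<forall>i j. d \<le> i \<longrightarrow> ent X i j = 0)"
    using 1 by (metis cmx_eqI linorder_not_less)
  show "X * cm d (1\<^sub>m d) = X \<longleftrightarrow> (\<forall>i j. d \<le> j \<longrightarrow> ent X i j = 0)"
    using 2 by (metis cmx_eqI linorder_not_less)
qed

lemma cm_mc:
  assumes "cm d (1\<^sub>m d) * X = X" "X * cm d (1\<^sub>m d) = X" shows "cm d (mc d X) = X"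
  by (rule cmx_eqI) (use assms in \<open>auto simp: mc_def cm_one_mult\<close>)

locale matrep =
  fixes G :: "'g::group_add set" and r :: "'g \<Rightarrow> complex mat" and d :: nat
  assumes G: "sgrp G" and carr: "x \<in> G \<Longrightarrow> r x \<in> carrier_mat d d" and r0: "r 0 = 1\<^sub>m d"
    and radd: "x \<in> G \<Longrightarrow> y \<in> G \<Longrightarrow> r (x + y) = r x * r y" and d: "d > 0"
    and irr: "W \<subseteq> carrier_vec d \<Longrightarrow> 0\<^sub>v d \<in> W \<Longrightarrow> (\<And>u w. u \<in> W \<Longrightarrow> w \<in> W \<Longrightarrow> u + w \<in> W) \<Longrightarrow>
      (\<And>c u. u \<in> W \<Longrightarrow> c \<cdot>\<^sub>v u \<in> W) \<Longrightarrow> (\<And>g u. g \<in> G \<Longrightarrow> u \<in> W \<Longrightarrow> r g *\<^sub>v u \<in> W) \<Longrightarrow>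
      W = {0\<^sub>v d} \<or> W = carrier_vec d"
begin

definition R :: "'g \<Rightarrow> nat cmx" where "R x = cm d (r x)"
abbreviation "I \<equiv> R 0"

lemma R_add: "x \<in> G \<Longrightarrow> y \<in> G \<Longrightarrow> R (x + y) = R x * R y"
  by (simp add: R_def radd carr cm_mult)

lemma I_def': "I = cm d (1\<^sub>m d)" by (simp add: R_def r0)

lemma R_I: "x \<in> G \<Longrightarrow> I * R x = R x" "x \<in> G \<Longrightarrow> R x * I = R x"
  using R_add[of 0 x] R_add[of x 0] sgrpD(2)[OF G] by auto

lemma R_inv: "x \<in> G \<Longrightarrow> R x * R (- x) = I" "x \<in> G \<Longrightarrow> R (- x) * R x = I"
  using R_add[of x "- x"] R_add[of "- x" x] sgrpD(4)[OF G] by auto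

lemma I_proj: "I * I = I" "adj I = I"
  using R_I(1)[OF sgrpD(2)[OF G]] by (auto simp: I_def' intro!: cmx_eqI)

lemma tr_R: "x \<in> G \<Longrightarrow> tr (R x) = mtrace (r x)"
  using carr[of x] by (subst tr_eq[OF _ supp_cm[of d "r x"], folded R_def]) (auto simp: R_def mtrace_def)

lemma tr_I: "tr I = of_nat d" using tr_R[OF sgrpD(2)[OF G]] by (simp add: r0 mtrace_def)

text \<open>Over the complex numbers \<open>X\<close> has an eigenvalue, and its eigenspace is
  invariant under the representation.\<close>

lemma schur:
  assumes X: "I * X = X" "X * I = X" and comm: "\<And>g. g \<in> G \<Longrightarrow> X * R g = R g * X"
  shows "\<exists>c. X = sc c I"
proof -
  define M where "M = mc d X"
  have M: "M \<in> carrier_mat d d" by (simp add: M_def)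
  have XM: "cm d M = X" unfolding M_def by (rule cm_mc) (use X in \<open>simp_all add: I_def'\<close>)
  have Mg: "M * r g = r g * M" if "g \<in> G" for g
    by (rule cm_inj[of _ d]) (use M carr[OF that] comm[OF that] in \<open>simp_all add: cm_mult XM R_def\<close>)
  obtain c where "c \<in> spectrum M" using spectrum_non_empty[OF M] d by auto
  then obtain v where v: "v \<in> carrier_vec d" "v \<noteq> 0\<^sub>v d" "M *\<^sub>v v = c \<cdot>\<^sub>v v"
    using M by (auto simp: spectrum_def eigenvalue_def eigenvector_def)
  define W where "W = {v \<in> carrier_vec d. M *\<^sub>v v = c \<cdot>\<^sub>v v}"
  have "W = {0\<^sub>v d} \<or> W = carrier_vec d"
  proof (rule irr)
    show "0\<^sub>v d \<in> W" using M by (auto simp: W_def intro!: eq_vecI)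
    fix u w assume "u \<in> W" "w \<in> W"
    then show "u + w \<in> W" using M by (auto simp: W_def mult_add_distrib_mat_vec[OF M] smult_add_distrib_vec[of _ d])
  next
    fix k u assume "u \<in> W"
    then show "k \<cdot>\<^sub>v u \<in> W" using M by (auto simp: W_def mult_mat_vec[OF M] smult_smult_assoc mult.commute)
  next
    fix g u assume g: "g \<in> G" and u: "u \<in> W"
    have uc: "u \<in> carrier_vec d" "M *\<^sub>v u = c \<cdot>\<^sub>v u" using u by (auto simp: W_def)
    have "M *\<^sub>v (r g *\<^sub>v u) = (M * r g) *\<^sub>v u" by (rule assoc_mult_mat_vec[OF M carr[OF g] uc(1), symmetric])
    also have "\<dots> = r g *\<^sub>v (M *\<^sub>v u)" unfolding Mg[OF g] by (rule assoc_mult_mat_vec[OF carr[OF g] M uc(1)])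
    also have "\<dots> = c \<cdot>\<^sub>v (r g *\<^sub>v u)" unfolding uc(2) by (rule mult_mat_vec[OF carr[OF g] uc(1)])
    finally show "r g *\<^sub>v u \<in> W" using carr[OF g] uc(1) by (simp add: W_def)
  qed (auto simp: W_def)
  then have all: "u \<in> carrier_vec d \<Longrightarrow> M *\<^sub>v u = c \<cdot>\<^sub>v u" for u using v by (auto simp: W_def)
  have "M $$ (i, j) = (if i = j then c else 0)" if ij: "i < d" "j < d" for i j
  proof -
    have "(M *\<^sub>v unit_vec d j) $ i = (c \<cdot>\<^sub>v unit_vec d j) $ i" using all by simp
    moreover have "(M *\<^sub>v unit_vec d j) $ i = M $$ (i, j)" using M ij by (simp add: scalar_prod_right_unit)
    ultimately show ?thesis using ij by (cases "i = j") (auto simp: unit_vec_def)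
  qed
  then have "X = sc c I" unfolding XM[symmetric] I_def' by (intro cmx_eqI) auto
  then show ?thesis ..
qed

definition H :: "nat cmx" where "H = (\<Sum>x\<in>G. adj (R x) * R x)"

lemma H_facts: "I * H = H" "H * I = H" "adj H = H"
proof -
  show *: "H * I = H" by (simp add: H_def sum_distrib_right mult.assoc R_I)
  show a: "adj H = H" by (simp add: H_def adj_sum)
  show "I * H = H" using arg_cong[OF *, of adj] a I_proj by simp
qed

lemma H_inv: assumes g: "g \<in> G" shows "adj (R g) * H * R g = H"
proof -
  have "adj (R g) * H * R g = (\<Sum>x\<in>G. adj (R x * R g) * (R x * R g))"
    by (simp add: H_def sum_distrib_left sum_distrib_right mult.assoc)
  also have "\<dots> = (\<Sum>x\<in>G. adj (R (x + g)) * R (x + g))" using g by (intro sum.cong refl) (simp add: R_add)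
  also have "\<dots> = H" unfolding H_def by (rule sgrp_translate(2)[OF G g])
  finally show ?thesis .
qed

text \<open>The quadratic form of \<open>H\<close> is the sum of the squared norms of the
  \<open>R x * w\<close>. On a kernel vector all of these vanish, in particular the one for the
  identity, so \<open>H\<close> is nonsingular.\<close>

lemma H_inverse: "\<exists>B. H * B = I \<and> B * H = I \<and> B * I = B \<and> I * B = B"
proof -
  have HM: "cm d (mc d H) = H" using H_facts by (intro cm_mc) (simp_all add: I_def')
  have "det (mc d H) \<noteq> 0"
  proof
    assume "det (mc d H) = 0"
    then obtain v where v: "v \<in> carrier_vec d" "v \<noteq> 0\<^sub>v d" "mc d H *\<^sub>v v = 0\<^sub>v d"
      using det_0_iff_vec_prod_zero[OF mc_carrier] by blast
    \<comment> \<open>The vector is stored as a matrix with the single column 0, so that squared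
      norms are available as \<open>nsq\<close>.\<close>
    define w where "w = Abs_cmx (\<lambda>i j. if i < d \<and> j = 0 then v $ i else 0)"
    have ew: "ent w i j = (if i < d \<and> j = 0 then v $ i else 0)" for i j
      unfolding w_def by (subst ent_Abs[of "insert 0 {..<d}"]) (auto split: if_splits)
    have suppH: "supp H \<subseteq> {..<d}" using supp_cm[of d "mc d H"] by (simp only: HM)
    have Hw: "ent (H * w) i j = (\<Sum>k<d. ent H i k * ent w k j)" for i j
      by (rule ent_mult[OF finite_lessThan disjI1[OF suppH]])
    have Iw: "I * w = w" using ew by (simp add: I_def' cm_one_mult)
    have "ent (H * w) i j = 0" for i j
    proof (cases "i < d \<and> j = 0")
      case True
      have "ent (H * w) i j = (\<Sum>k<d. ent H i k * v $ k)"
        unfolding Hw using True by (intro sum.cong refl) (auto simp: ew)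
      also have "\<dots> = (mc d H *\<^sub>v v) $ i" using True v(1) by (simp add: mc_def scalar_prod_def lessThan_atLeast0)
      finally show ?thesis using v(3) True by simp
    next
      case False
      show ?thesis
      proof (cases "i < d")
        case True
        then show ?thesis unfolding Hw using False by (intro sum.neutral) (auto simp: ew)
      next
        case False
        then have "ent H i k = 0" for k using suppH ent_nonzero(1)[of H i k] by auto
        then show ?thesis unfolding Hw by simp
      qed
    qed
    then have "H * w = 0" by (intro cmx_eqI) simp
    then have "0 = tr (adj w * (H * w))" by simp
    also have "\<dots> = (\<Sum>x\<in>G. tr (adj (R x * w) * (R x * w)))"
      by (simp add: H_def sum_distrib_left sum_distrib_right mult.assoc)
    also have "\<dots> = of_real (\<Sum>x\<in>G. nsq (R x * w))" by (simp only: tr_adj_mult of_real_sum)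
    finally have "(\<Sum>x\<in>G. nsq (R x * w)) = 0" by (metis of_real_eq_0_iff)
    then have "nsq (I * w) = 0"
      using sum_nonneg_eq_0_iff[OF sgrpD(1)[OF G], of "\<lambda>x. nsq (R x * w)"] nsq_nonneg sgrpD(2)[OF G] by blast
    then have "w = 0" using nsq_eq_0 Iw by metis
    then have "v = 0\<^sub>v d" using ew v(1) by (intro eq_vecI) (auto, metis ent_zero)
    then show False using v(2) by simp
  qed
  then have "mc d H \<in> Units (ring_mat TYPE(complex) d ())" by (rule det_non_zero_imp_unit[OF mc_carrier])
  then obtain B where B: "B \<in> carrier_mat d d" "B * mc d H = 1\<^sub>m d" "mc d H * B = 1\<^sub>m d"
    by (auto simp: Units_def ring_mat_def)
  have "H * cm d B = I" "cm d B * H = I"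
    using cm_mult[OF mc_carrier B(1), of H] cm_mult[OF B(1) mc_carrier, of H] B by (simp_all add: HM I_def')
  moreover have "cm d B * I = cm d B" "I * cm d B = cm d B"
    using cm_one_mult by (auto simp: I_def')
  ultimately show ?thesis by blast
qed

definition B :: "nat cmx" where "B = (SOME B. H * B = I \<and> B * H = I \<and> B * I = B \<and> I * B = B)"

lemma B_facts: "H * B = I" "B * H = I" "B * I = B" "I * B = B"
  using someI_ex[OF H_inverse] unfolding B_def by blast+

lemma B_adj: "adj B = B"
proof -
  have "adj B * H = I" using arg_cong[OF B_facts(1), of adj] H_facts I_proj by simp
  then have "adj B * (H * B) = I * B" by (simp add: mult.assoc[symmetric])
  moreover have "adj B * I = adj B" using arg_cong[OF B_facts(4), of adj] I_proj by simp
  ultimately show ?thesis using B_facts by simp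
qed

lemma B_R: assumes g: "g \<in> G" shows "B * adj (R g) = R (- g) * B"
proof -
  have "adj (R g) * H * (R g * R (- g)) = H * R (- g)" using H_inv[OF g] by (simp add: mult.assoc[symmetric])
  then have "adj (R g) * H = H * R (- g)" using R_inv[OF g] H_facts by (simp add: mult.assoc)
  then have "B * (adj (R g) * H) * B = B * (H * R (- g)) * B" by simp
  then have "B * adj (R g) * (H * B) = (B * H) * R (- g) * B" by (simp only: mult.assoc)
  moreover have "adj (R g) * I = adj (R g)" using arg_cong[OF R_I(1)[OF g], of adj] I_proj by simp
  ultimately show ?thesis using B_facts R_I(1)[OF sgrpD(4)[OF G g]] by (simp add: mult.assoc)
qed

text \<open>
  With the invariant form \<open>H\<close> and its inverse \<open>B\<close>, the block matrix \<open>S R(g) B S\<^sup>*\<close>, where \<open>S\<close> is the stack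
  of all \<open>R x\<close>, is a \<open>*\<close>-representation equivalent to \<open>R\<close>; no square root of \<open>H\<close> is needed.
\<close>
definition K :: "'g \<Rightarrow> 'g \<Rightarrow> 'g \<Rightarrow> nat cmx" where "K g x y = R x * R g * B * adj (R y)"

definition \<pi> :: "'g \<Rightarrow> ('g \<times> nat) cmx" where
  "\<pi> g = Abs_cmx (\<lambda>p p'. if fst p \<in> G \<and> fst p' \<in> G then ent (K g (fst p) (fst p')) (snd p) (snd p') else 0)"

lemma supp_K: "supp (K g x y) \<subseteq> {..<d}" if "x \<in> G" "y \<in> G"
proof -
  have "I * K g x y = K g x y" "K g x y * I = K g x y"
    using R_I[OF that(1)] arg_cong[OF R_I(1)[OF that(2)], of adj] I_proj by (simp_all add: K_def mult.assoc[symmetric]) (simp add: mult.assoc)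
  then have "\<forall>i j. d \<le> i \<longrightarrow> ent (K g x y) i j = 0" "\<forall>i j. d \<le> j \<longrightarrow> ent (K g x y) i j = 0"
    unfolding I_def' cm_one_mult by blast+
  then show ?thesis unfolding supp_def by (force simp: not_less[symmetric])
qed

lemma ent_\<pi>: "ent (\<pi> g) p p' = (if fst p \<in> G \<and> fst p' \<in> G then ent (K g (fst p) (fst p')) (snd p) (snd p') else 0)"
  unfolding \<pi>_def
proof (subst ent_Abs[of "G \<times> {..<d}"])
  show "finite (G \<times> {..<d})" using sgrpD(1)[OF G] by simp
  fix p p' :: "'g \<times> nat" assume *: "(if fst p \<in> G \<and> fst p' \<in> G then ent (K g (fst p) (fst p')) (snd p) (snd p') else 0) \<noteq> 0"
  then have "fst p \<in> G" "fst p' \<in> G" "ent (K g (fst p) (fst p')) (snd p) (snd p') \<noteq> 0" by (auto split: if_splits)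
  then show "p \<in> G \<times> {..<d} \<and> p' \<in> G \<times> {..<d}"
    using subsetD[OF supp_K[of "fst p" "fst p'" g] ent_nonzero(1)] subsetD[OF supp_K[of "fst p" "fst p'" g] ent_nonzero(2)]
    by (auto simp: mem_Times_iff)
qed simp

lemma supp_\<pi>: "supp (\<pi> g) \<subseteq> G \<times> {..<d}"
proof
  fix p assume "p \<in> supp (\<pi> g)"
  then obtain p' where "ent (\<pi> g) p p' \<noteq> 0 \<or> ent (\<pi> g) p' p \<noteq> 0" by (auto simp: supp_def)
  then show "p \<in> G \<times> {..<d}"
    using subsetD[OF supp_K[of "fst p" "fst p'" g] ent_nonzero(1)] subsetD[OF supp_K[of "fst p'" "fst p" g] ent_nonzero(2)]
    by (auto simp: ent_\<pi> mem_Times_iff split: if_splits)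
qed

lemma fin_GD: "finite (G \<times> {..<d})" using sgrpD(1)[OF G] by simp

lemma \<pi>_mult: assumes "g \<in> G" "h \<in> G" shows "\<pi> (g + h) = \<pi> g * \<pi> h"
proof (rule cmx_eqI)
  fix p p' :: "'g \<times> nat"
  obtain x i y j where p: "p = (x, i)" "p' = (y, j)" by (metis surj_pair)
  have "ent (\<pi> g * \<pi> h) p p' = (\<Sum>z\<in>G. \<Sum>k<d. ent (\<pi> g) p (z, k) * ent (\<pi> h) (z, k) p')"
    by (subst ent_mult[OF fin_GD disjI1[OF supp_\<pi>]]) (simp add: sum.cartesian_product')
  also have "\<dots> = ent (\<pi> (g + h)) p p'"
  proof (cases "x \<in> G \<and> y \<in> G")
    case True
    have "(\<Sum>z\<in>G. \<Sum>k<d. ent (\<pi> g) p (z, k) * ent (\<pi> h) (z, k) p') = (\<Sum>z\<in>G. ent (K g x z * K h z y) i j)"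
    proof (rule sum.cong)
      fix z assume z: "z \<in> G"
      have "ent (K g x z * K h z y) i j = (\<Sum>k<d. ent (K g x z) i k * ent (K h z y) k j)"
        by (rule ent_mult) (use supp_K[of x z g] True z in auto)
      then show "(\<Sum>k<d. ent (\<pi> g) p (z, k) * ent (\<pi> h) (z, k) p') = ent (K g x z * K h z y) i j"
        using True z by (simp add: ent_\<pi> p)
    qed simp
    also have "\<dots> = ent (R x * R g * (B * H) * R h * B * adj (R y)) i j"
      by (simp add: K_def H_def sum_distrib_left sum_distrib_right mult.assoc)
    also have "R x * R g * (B * H) * R h * B * adj (R y) = K (g + h) x y"
      using R_I(1)[OF assms(2)] R_add[OF assms] by (simp add: B_facts K_def mult.assoc)
    finally show ?thesis using True by (simp add: ent_\<pi> p)
  qed (auto simp: ent_\<pi> p)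
  finally show "ent (\<pi> (g + h)) p p' = ent (\<pi> g * \<pi> h) p p'" ..
qed

lemma \<pi>_adj: assumes g: "g \<in> G" shows "\<pi> (- g) = adj (\<pi> g)"
proof (rule cmx_eqI)
  fix p p' :: "'g \<times> nat"
  have "adj (K g x y) = K (- g) y x" for x y
    using B_R[OF g] by (simp add: K_def B_adj mult.assoc)
  then have "cnj (ent (K g x y) i j) = ent (K (- g) y x) j i" for x y i j by (metis ent_adj)
  then show "ent (\<pi> (- g)) p p' = ent (adj (\<pi> g)) p p'" by (simp add: ent_\<pi>)
qed

lemma srep_\<pi>: "srep G \<pi>" using \<pi>_mult \<pi>_adj by (simp add: srep_def)

lemma tr_\<pi>: assumes g: "g \<in> G" shows "tr (\<pi> g) = tr (R g)"
proof -
  have "tr (\<pi> g) = (\<Sum>x\<in>G. \<Sum>i<d. ent (\<pi> g) (x, i) (x, i))"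
    by (subst tr_eq[OF fin_GD supp_\<pi>]) (simp add: sum.cartesian_product')
  also have "\<dots> = (\<Sum>x\<in>G. tr (K g x x))"
    by (intro sum.cong refl, subst tr_eq[OF _ supp_K]) (auto simp: ent_\<pi>)
  also have "\<dots> = (\<Sum>x\<in>G. tr (R g * B * (adj (R x) * R x)))"
  proof (rule sum.cong)
    fix x
    have "tr (R x * (R g * B * adj (R x))) = tr (R g * B * adj (R x) * R x)" by (rule tr_commute)
    then show "tr (K g x x) = tr (R g * B * (adj (R x) * R x))" by (simp add: K_def mult.assoc)
  qed simp
  also have "\<dots> = tr (R g * (B * H))" by (simp add: H_def sum_distrib_left mult.assoc)
  finally show ?thesis using R_I(2)[OF g] by (simp add: B_facts)
qed

text \<open>The row of blocks at the identity already determines \<open>R\<close>, because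
  \<open>B * H = I\<close>. In this way commutation relations are carried from \<open>\<pi>\<close>
  back to the given representation.\<close>

lemma R_from_\<pi>: assumes "g \<in> G" shows "ent (R g) i j = (\<Sum>y\<in>G. \<Sum>k<d. ent (\<pi> g) (0, i) (y, k) * ent (R y) k j)"
proof -
  note z = sgrpD(2)[OF G]
  have "(\<Sum>y\<in>G. \<Sum>k<d. ent (\<pi> g) (0, i) (y, k) * ent (R y) k j) = (\<Sum>y\<in>G. ent (K g 0 y * R y) i j)"
    using z by (intro sum.cong refl, subst ent_mult[OF _ disjI1[OF supp_K]]) (auto simp: ent_\<pi>)
  also have "\<dots> = ent (I * R g * (B * H)) i j" by (simp add: K_def H_def sum_distrib_left mult.assoc)
  finally show ?thesis using R_I[OF assms] by (simp add: B_facts)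
qed

text \<open>The convolution identity is Schur's lemma for the operator built from a class function,
  and the norm relation is Schur orthogonality through averages of matrix units. If the values
  commute, each of them is scalar by Schur's lemma, so every line is invariant and irreducibility
  leaves only degree 1.\<close>

lemma irrchar: "irrchar G \<pi> (\<lambda>g. tr (R g))"
proof
  show "sgrp G" by (rule G)
  show "srep G \<pi>" by (rule srep_\<pi>)
  show "tr (R g) = tr (\<pi> g)" if "g \<in> G" for g using tr_\<pi>[OF that] ..
  show "\<pi> 0 \<noteq> 0" using tr_\<pi>[OF sgrpD(2)[OF G]] tr_I d by auto
next
  fix F :: "'g \<Rightarrow> complex" and g
  assume F: "\<And>x w. x \<in> G \<Longrightarrow> w \<in> G \<Longrightarrow> F (x + w - x) = F w" and g: "g \<in> G"
  define X where "X = (\<Sum>w\<in>G. sc (F w) (R (- w)))"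
  have IX: "I * X = X" "X * I = X" using R_I sgrpD(4)[OF G] by (simp_all add: X_def sum_distrib_left sum_distrib_right)
  have comm: "X * R h = R h * X" if h: "h \<in> G" for h
  proof -
    have "R h * X = (\<Sum>w\<in>G. sc (F w) (R (h + - w)))" using h sgrpD(4)[OF G] by (simp add: X_def sum_distrib_left R_add[symmetric])
    also have "\<dots> = (\<Sum>w\<in>G. sc (F (h + w - h)) (R (- (h + w - h) + h)))"
      using F[OF h] by (intro sum.cong refl) (simp add: minus_diff_eq diff_conv_add_uminus minus_add add.assoc del: add_uminus_conv_diff)
    also have "\<dots> = (\<Sum>w\<in>G. sc (F w) (R (- w + h)))"
      by (rule sum.reindex_bij_witness[of _ "\<lambda>w. - h + w + h" "\<lambda>w. h + w - h"])
        (use h sgrpD(3,4)[OF G] in \<open>auto simp: diff_conv_add_uminus add.assoc simp del: add_uminus_conv_diff\<close>)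
    also have "\<dots> = X * R h" using h sgrpD(4)[OF G] by (simp add: X_def sum_distrib_right R_add)
    finally show ?thesis ..
  qed
  obtain c where c: "X = sc c I" using schur[OF IX comm] by blast
  have *: "(\<Sum>w\<in>G. F w * tr (R (- w + g))) = c * tr (R g)" if g: "g \<in> G" for g
  proof -
    have "(\<Sum>w\<in>G. F w * tr (R (- w + g))) = tr (X * R g)"
      using g sgrpD(4)[OF G] by (simp add: X_def sum_distrib_right R_add)
    then show ?thesis using c R_I(1)[OF g] by simp
  qed
  from *[OF g] *[OF sgrpD(2)[OF G]]
  show "(\<Sum>w\<in>G. F w * tr (R (- w + g))) * tr I = (\<Sum>w\<in>G. F w * tr (R (- w))) * tr (R g)" by simp
next
  define E where "E a b = Abs_cmx (\<lambda>i j. if i = a \<and> j = b then 1 else 0)" for a b :: nat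
  have eE: "ent (E a b) i j = (if i = a \<and> j = b then 1 else 0)" for a b i j
    unfolding E_def by (subst ent_Abs[of "{a, b}"]) (auto split: if_splits)
  have RER: "ent (R g * E a b * R h) i j = ent (R g) i a * ent (R h) b j" if "a < d" "b < d" for g h a b i j
  proof -
    have "ent (R g * E a b) i k = (if k = b then ent (R g) i a else 0)" for k
    proof -
      have "ent (R g * E a b) i k = (\<Sum>l<d. if l = a then (if k = b then ent (R g) i a else 0) else 0)"
        unfolding R_def by (subst ent_mult[OF finite_lessThan disjI1[OF supp_cm]], intro sum.cong refl) (auto simp: eE)
      then show ?thesis using that by simp
    qed
    moreover have "ent (R g * E a b * R h) i j = (\<Sum>k<d. ent (R g * E a b) i k * ent (R h) k j)"
      by (rule ent_mult) (use supp_cm[of d "r h"] in \<open>auto simp: R_def\<close>)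
    ultimately have "ent (R g * E a b * R h) i j = (\<Sum>k<d. (if k = b then ent (R g) i a else 0) * ent (R h) k j)" by simp
    also have "\<dots> = (\<Sum>k<d. if k = b then ent (R g) i a * ent (R h) b j else 0)" by (intro sum.cong refl) simp
    finally have "ent (R g * E a b * R h) i j = \<dots>" .
    then show ?thesis using that by simp
  qed
  \<comment> \<open>The average of a conjugated matrix unit is scalar by Schur's lemma, and
    comparing traces determines the scalar.\<close>
  have avg: "(\<Sum>g\<in>G. R g * E a b * R (- g)) = sc (if a = b then of_nat (card G) / of_nat d else 0) I"
    if ab: "a < d" "b < d" for a b
  proof -
    define X where "X = (\<Sum>g\<in>G. R g * E a b * R (- g))"
    have IX: "I * X = X" "X * I = X"
      using R_I sgrpD(4)[OF G] by (simp_all add: X_def sum_distrib_left sum_distrib_right mult.assoc) (simp add: mult.assoc[symmetric] R_I)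
    have comm: "X * R h = R h * X" if h: "h \<in> G" for h
    proof -
      have "R h * X = (\<Sum>g\<in>G. R (h + g) * E a b * R (- g))"
        using h by (simp add: X_def sum_distrib_left R_add mult.assoc)
      also have "\<dots> = (\<Sum>g\<in>G. R (h + g) * E a b * R (- (h + g) + h))"
        by (simp add: minus_add add.assoc del: add_uminus_conv_diff)
      also have "\<dots> = (\<Sum>g\<in>G. R g * E a b * R (- g + h))" by (rule sgrp_translate(1)[OF G h])
      also have "\<dots> = X * R h" using h sgrpD(4)[OF G] by (simp add: X_def sum_distrib_right R_add mult.assoc)
      finally show ?thesis ..
    qed
    obtain c where c: "X = sc c I" using schur[OF IX comm] by blast
    have trE: "tr (R g * E a b * R (- g)) = (if a = b then 1 else 0)" if g: "g \<in> G" for g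
    proof -
      have "tr (R g * E a b * R (- g)) = tr (R (- g) * (R g * E a b))" by (rule tr_commute)
      also have "\<dots> = tr (I * E a b)" using R_inv(2)[OF g] by (simp add: mult.assoc[symmetric])
      also have "I * E a b = E a b" using ab by (simp add: I_def' cm_one_mult eE)
      also have "tr (E a b) = (\<Sum>i\<in>{a, b}. ent (E a b) i i)"
        by (rule tr_eq) (auto simp: supp_def eE split: if_splits)
      finally show ?thesis by (simp add: eE)
    qed
    have "of_nat (card G) * (if a = b then 1 else 0) = tr X" by (simp add: X_def trE)
    then have "c = (if a = b then of_nat (card G) / of_nat d else 0)" using d by (auto simp: c tr_I field_simps)
    then show ?thesis using c by (simp add: X_def)
  qed
  have trR: "tr (R g) = (\<Sum>a<d. ent (R g) a a)" for g unfolding R_def by (rule tr_eq) (use supp_cm in auto)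
  have "(\<Sum>g\<in>G. tr (R g) * tr (R (- g))) = (\<Sum>g\<in>G. \<Sum>a<d. \<Sum>b<d. ent (R g * E a b * R (- g)) a b)"
    unfolding trR sum_product by (intro sum.cong refl) (simp add: RER)
  also have "\<dots> = (\<Sum>a<d. \<Sum>g\<in>G. \<Sum>b<d. ent (R g * E a b * R (- g)) a b)" by (rule sum.swap)
  also have "\<dots> = (\<Sum>a<d. \<Sum>b<d. \<Sum>g\<in>G. ent (R g * E a b * R (- g)) a b)"
    by (intro sum.cong refl) (rule sum.swap)
  also have "\<dots> = (\<Sum>a<d. \<Sum>b<d. if b = a then of_nat (card G) / of_nat d else 0)"
  proof (intro sum.cong refl)
    fix a b assume "a \<in> {..<d}" "b \<in> {..<d}"
    then have "(\<Sum>g\<in>G. ent (R g * E a b * R (- g)) a b) = ent (sc (if a = b then of_nat (card G) / of_nat d else 0) I) a b"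
      using avg[of a b] by (simp only: ent_sum[symmetric] lessThan_iff)
    then show "(\<Sum>g\<in>G. ent (R g * E a b * R (- g)) a b) = (if b = a then of_nat (card G) / of_nat d else 0)"
      using \<open>a \<in> {..<d}\<close> by (auto simp: I_def')
  qed
  finally show "(\<Sum>g\<in>G. tr (R g) * tr (R (- g))) = of_nat (card G)" using d by simp
next
  assume ab: "\<And>x y. x \<in> G \<Longrightarrow> y \<in> G \<Longrightarrow> \<pi> (x + y) = \<pi> (y + x)"
  have comm: "R x * R y = R y * R x" if "x \<in> G" "y \<in> G" for x y
  proof -
    have m: "x + y \<in> G" "y + x \<in> G" using that sgrpD(3)[OF G] by auto
    have "R (x + y) = R (y + x)"
      by (rule cmx_eqI) (simp only: R_from_\<pi>[OF m(1)] R_from_\<pi>[OF m(2)] ab[OF that])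
    then show ?thesis using R_add that by simp
  qed
  have scal: "\<exists>c. R g = sc c I" if g: "g \<in> G" for g
    by (rule schur) (use R_I[OF g] comm[OF g] in auto)
  define W :: "complex vec set" where "W = {c \<cdot>\<^sub>v unit_vec d 0 | c. True}"
  have "W = {0\<^sub>v d} \<or> W = carrier_vec d"
  proof (rule irr)
    show "0\<^sub>v d \<in> W" by (auto simp: W_def intro!: exI[of _ 0])
    fix u w assume "u \<in> W" "w \<in> W"
    then show "u + w \<in> W" unfolding W_def by clarify (metis add_smult_distrib_vec)
  next
    fix c u assume "u \<in> W" then show "c \<cdot>\<^sub>v u \<in> W" unfolding W_def by clarify (metis smult_smult_assoc)
  next
    fix g u assume g: "g \<in> G" and u: "u \<in> W"
    obtain c where c: "R g = sc c I" using scal[OF g] by blast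
    have "r g = c \<cdot>\<^sub>m 1\<^sub>m d"
      by (rule cm_inj[OF carr[OF g]]) (use c in \<open>auto simp: R_def[symmetric] I_def' intro!: cmx_eqI\<close>)
    moreover obtain k where k: "u = k \<cdot>\<^sub>v unit_vec d 0" using u by (auto simp: W_def)
    ultimately have "r g *\<^sub>v u = (c * k) \<cdot>\<^sub>v unit_vec d 0"
      by (intro eq_vecI) (auto simp: scalar_prod_def if_distrib cong: if_cong)
    then show "r g *\<^sub>v u \<in> W" by (auto simp: W_def)
  qed (auto simp: W_def)
  moreover have "unit_vec d 0 \<in> W" unfolding W_def by (auto intro!: exI[of _ 1])
  moreover have "unit_vec d 0 \<noteq> (0\<^sub>v d :: complex vec)" using d by (metis index_unit_vec(1) index_zero_vec(1) zero_neq_one)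
  ultimately have W: "W = carrier_vec d" by auto
  have "d = 1"
  proof (rule ccontr)
    assume "d \<noteq> 1"
    then have d1: "1 < d" using d by simp
    have "unit_vec d 1 \<in> W" using W by simp
    then obtain c where "unit_vec d 1 = c \<cdot>\<^sub>v (unit_vec d 0 :: complex vec)" by (auto simp: W_def)
    then have "(unit_vec d 1 :: complex vec) $ 1 = (c \<cdot>\<^sub>v unit_vec d 0) $ 1" by simp
    then show False using d1 by simp
  qed
  then show "tr I = 1" unfolding tr_I by simp
qed

end


section \<open>A type containing all finite fields\<close>

definition two_ring :: "nat ring" where
  "two_ring = \<lparr>carrier = {0, 1}, mult = (*), one = 1, zero = 0, add = (\<lambda>x y. (x + y) mod 2)\<rparr>"

lemma cring_two_ring: "cring two_ring"
proof (rule cringI)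
  show "abelian_group two_ring"
    by (rule abelian_groupI) (auto simp: two_ring_def)
  show "comm_monoid two_ring"
    by (rule comm_monoidI) (auto simp: two_ring_def)
qed (auto simp: two_ring_def)

text \<open>The Boolean gives two copies of each ring; in the linear case they become the two
  components of F_q x F_q.\<close>

definition comp_ring :: "nat ring \<times> bool \<Rightarrow> nat ring" where
  "comp_ring i = (if cring (fst i) then fst i else two_ring)"

lemma cring_comp_ring: "cring (comp_ring i)" by (simp add: comp_ring_def cring_two_ring)

lemma comp_ring_swap: "comp_ring (R, \<not> c) = comp_ring (R, c)" by (simp add: comp_ring_def)

interpretation CR: cring "comp_ring i" for i by (rule cring_comp_ring)

text \<open>
  The class \<open>comm_ring_1\<close> needs a single type for the rings attached to all finite fields \<open>R\<close>: it is
  a product with two factors for each commutative ring on \<open>nat\<close> (for all other records the factor is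
  the field with two elements).
\<close>
typedef uring = "{f. \<forall>i. f i \<in> carrier (comp_ring i)}"
  morphisms cp Abs_uring
  by (rule exI[of _ "\<lambda>i. \<zero>\<^bsub>comp_ring i\<^esub>"]) simp

setup_lifting type_definition_uring

lemma cp_closed [simp]: "cp x i \<in> carrier (comp_ring i)" using cp[of x] by blast

lemma uring_eqI: "(\<And>i. cp x i = cp y i) \<Longrightarrow> x = y" by (metis cp_inject ext)

instantiation uring :: comm_ring_1
begin
lift_definition zero_uring :: uring is "\<lambda>i. \<zero>\<^bsub>comp_ring i\<^esub>" by simp
lift_definition one_uring :: uring is "\<lambda>i. \<one>\<^bsub>comp_ring i\<^esub>" by simp
lift_definition plus_uring :: "uring \<Rightarrow> uring \<Rightarrow> uring" is "\<lambda>f g i. f i \<oplus>\<^bsub>comp_ring i\<^esub> g i" by simp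
lift_definition times_uring :: "uring \<Rightarrow> uring \<Rightarrow> uring" is "\<lambda>f g i. f i \<otimes>\<^bsub>comp_ring i\<^esub> g i" by simp
lift_definition uminus_uring :: "uring \<Rightarrow> uring" is "\<lambda>f i. \<ominus>\<^bsub>comp_ring i\<^esub> f i" by simp
definition minus_uring :: "uring \<Rightarrow> uring \<Rightarrow> uring" where "minus_uring a b = a + - b"

lemma cp_simps [simp]: "cp 0 i = \<zero>\<^bsub>comp_ring i\<^esub>" "cp 1 i = \<one>\<^bsub>comp_ring i\<^esub>"
  "cp (x + y) i = cp x i \<oplus>\<^bsub>comp_ring i\<^esub> cp y i" "cp (x * y) i = cp x i \<otimes>\<^bsub>comp_ring i\<^esub> cp y i"
  "cp (- x) i = \<ominus>\<^bsub>comp_ring i\<^esub> cp x i"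
  by (transfer; simp)+

instance
proof
  have "cp (0 :: uring) (two_ring, True) \<noteq> cp 1 (two_ring, True)"
    by (simp add: comp_ring_def cring_two_ring) (simp add: two_ring_def)
  then show "(0 :: uring) \<noteq> 1" by metis
qed (auto intro!: uring_eqI simp: CR.a_ac CR.m_ac CR.l_distr CR.r_distr CR.l_neg CR.r_neg minus_uring_def)
end

lemma cp_pow [simp]: "cp (x ^ k) i = cp x i [^]\<^bsub>comp_ring i\<^esub> k"
  by (induction k) (simp_all add: CR.m_comm)

lemma cp_sum: "cp (\<Sum>k\<in>S. f k) i = (\<Oplus>\<^bsub>comp_ring i\<^esub>k\<in>S. cp (f k) i)"
  by (induction S rule: infinite_finite_induct) (simp_all add: CR.finsum_infinite)

lemma cp_prod: "cp (\<Prod>k\<in>S. f k) i = (\<Otimes>\<^bsub>comp_ring i\<^esub>k\<in>S. cp (f k) i)"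
  by (induction S rule: infinite_finite_induct) (simp_all add: CR.finprod_infinite)

lemma cp_of_nat: "cp (of_nat k) i = [k] \<cdot>\<^bsub>comp_ring i\<^esub> \<one>\<^bsub>comp_ring i\<^esub>"
  by (induction k) (simp_all add: CR.a_comm)

section \<open>Finite fields as rings with idempotent identity\<close>

lemma finite_field_generator:
  fixes R (structure)
  assumes R: "field R" "finite (carrier R)"
  shows "\<exists>a\<in>carrier R. a \<noteq> \<zero> \<and> (\<forall>x\<in>carrier R. x \<noteq> \<zero> \<longrightarrow> (\<exists>k::nat. x = a [^] k)) \<and>
    (\<forall>k::nat. a [^] k = \<one> \<longleftrightarrow> (card (carrier R) - 1) dvd k)"
proof -
  interpret field R by fact
  interpret M: group "mult_of R" by (rule field_mult_group)
  note [simp] = mult_of_simps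
  obtain a where a: "a \<in> carrier R" "a \<noteq> \<zero>" and gen: "carrier R - {\<zero>} = {a [^] i | i::nat. i \<in> UNIV}"
    using finite_field_mult_group_has_gen[OF R(2)] by auto
  have am: "a \<in> carrier (mult_of R)" using a by simp
  have fin: "finite (carrier (mult_of R))" using R(2) by simp
  have "M.ord a = card (carrier R) - 1"
  proof -
    have "generate (mult_of R) {a} = {a [^] k | k. k \<in> (UNIV :: nat set)}"
      using M.generate_pow_nat[of a] am fin M.ord_ge_1[OF fin am] by auto
    then have "generate (mult_of R) {a} = carrier R - {\<zero>}" using gen by simp
    then show ?thesis using M.generate_pow_card[OF am] a R(2) by (simp add: card_Diff_singleton)
  qed
  then have od: "a [^] k = \<one> \<longleftrightarrow> (card (carrier R) - 1) dvd k" for k :: nat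
    using M.pow_eq_id[OF am, of k] by simp
  have pw: "\<exists>k::nat. x = a [^] k" if "x \<in> carrier R" "x \<noteq> \<zero>" for x
  proof -
    have "x \<in> {a [^] i | i::nat. i \<in> UNIV}" unfolding gen[symmetric] using that by simp
    then show ?thesis by blast
  qed
  show ?thesis by (intro bexI[OF _ a(1)] conjI ballI impI allI) (fact a(2) pw od)+
qed

text \<open>Sylow's theorem yields an additive subgroup of order \<open>l\<close>, hence some
  nonzero \<open>x\<close> annihilated by \<open>l\<close>. In the absence of zero divisors the
  \<open>l\<close>-fold multiple of the identity vanishes.\<close>

lemma finite_field_prime:
  fixes R (structure)
  assumes R: "field R" "finite (carrier R)" and l: "prime l" "l dvd card (carrier R)"
  shows "[l] \<cdot> \<one> = \<zero>"
proof -
  interpret field R by fact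
  obtain m where m: "card (carrier R) = l ^ 1 * m" using l(2) by (auto elim: dvdE)
  have "\<exists>H. subgroup H (add_monoid R) \<and> card H = l ^ 1"
    by (rule sylow_thm[of l "add_monoid R" 1 m, OF l(1) add.is_group]) (use m R(2) in \<open>simp_all add: Coset.order_def\<close>)
  then obtain H where H: "subgroup H (add_monoid R)" "card H = l" by auto
  have Hc: "H \<subseteq> carrier R" and z: "\<zero> \<in> H" using subgroup.subset[OF H(1)] subgroup.one_closed[OF H(1)] by auto
  have "H \<noteq> {\<zero>}" using H(2) prime_gt_1_nat[OF l(1)] by auto
  then obtain x where x: "x \<in> H" "x \<noteq> \<zero>" using z by blast
  have xc: "x \<in> carrier R" using x Hc by auto
  interpret H: group "add_monoid R\<lparr>carrier := H\<rparr>" by (rule add.subgroup_imp_group[OF H(1)])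
  have "x [^]\<^bsub>add_monoid R\<lparr>carrier := H\<rparr>\<^esub> Coset.order (add_monoid R\<lparr>carrier := H\<rparr>) = \<one>\<^bsub>add_monoid R\<lparr>carrier := H\<rparr>\<^esub>"
    by (rule H.pow_order_eq_1) (use x in simp)
  then have "x [^]\<^bsub>add_monoid R\<lparr>carrier := H\<rparr>\<^esub> l = \<zero>" using H(2) by (simp add: Coset.order_def)
  then have "[l] \<cdot> x = \<zero>" by (simp add: add_pow_def nat_pow_def)
  then have "([l] \<cdot> \<one>) \<otimes> x = \<zero>" using add_pow_ldistr[of \<one> x l] xc by simp
  then show ?thesis using integral x xc by auto
qed


section \<open>Fields of square order inside a commutative ring, and their Frobenius
  involution\<close>

locale idem_field =
  fixes E a :: "'a::comm_ring_1" and q :: nat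
  assumes E: "E * E = E" "E \<noteq> 0" and cA: "card {x. E * x = x} = q\<^sup>2" and q1: "q \<ge> 2"
    and a: "E * a = a" "a \<noteq> 0" and gen: "E * x = x \<Longrightarrow> x \<noteq> 0 \<Longrightarrow> \<exists>k. x = a ^ k * E"
    and ord: "a ^ k * E = E \<longleftrightarrow> (q\<^sup>2 - 1) dvd k"
    and char: "prime l \<Longrightarrow> l dvd q \<Longrightarrow> of_nat l * E = 0"
begin

lemma q_gt0: "q\<^sup>2 - 1 > 0" "q > 0" using q1 by (auto intro: le_less_trans[OF _ power_strict_mono[of 1 q 2]] simp: )

lemma EE [simp]: "E * E = E" "E * (E * x) = E * x"
  using E(1) by (simp_all add: mult.assoc[symmetric])

lemma powE: "a ^ j * E * (a ^ k * E) = a ^ (j + k) * E"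
  by (simp add: power_add mult_ac)

lemma E_powE: "E * (a ^ k * E) = a ^ k * E" by (simp add: mult_ac)

lemma powE_period: "a ^ k * E \<noteq> 0"
proof
  assume *: "a ^ k * E = 0"
  have "a ^ ((q\<^sup>2 - 1) * k) * E = E" by (simp add: ord)
  moreover have "(q\<^sup>2 - 1) * k = k + (q\<^sup>2 - 2) * k" using q_gt0 by (cases "q\<^sup>2 - 1") (auto simp: numeral_2_eq_2)
  ultimately have "E = a ^ ((q\<^sup>2 - 2) * k) * (a ^ k * E)" by (simp add: power_add mult_ac)
  then show False using * E(2) by simp
qed

lemma integral: assumes "E * x = x" "E * y = y" "x * y = 0" shows "x = 0 \<or> y = 0"
proof (rule ccontr)
  assume "\<not> (x = 0 \<or> y = 0)"
  then obtain j k where "x = a ^ j * E" "y = a ^ k * E" using gen assms by meson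
  then show False using powE powE_period assms(3) by simp
qed

lemma powE_eq: "a ^ j * E = a ^ k * E \<longleftrightarrow> [j = k] (mod (q\<^sup>2 - 1))"
proof -
  have *: "a ^ j * E = a ^ (j + i) * E \<longleftrightarrow> [j = j + i] (mod (q\<^sup>2 - 1))" for i j
  proof
    assume "a ^ j * E = a ^ (j + i) * E"
    then have "a ^ j * E * (a ^ i * E - E) = 0" using powE[of j i] powE[of j 0] by (simp add: right_diff_distrib)
    then have "a ^ i * E - E = 0"
      using integral[of "a ^ j * E" "a ^ i * E - E"] powE_period[of j] E_powE[of i] E_powE[of j] E(1)
      by (auto simp: right_diff_distrib)
    then show "[j = j + i] (mod (q\<^sup>2 - 1))" by (auto simp: ord cong_add_lcancel_0_nat cong_0_iff cong_sym_eq[of j])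
  next
    assume "[j = j + i] (mod (q\<^sup>2 - 1))"
    then have "a ^ i * E = E" by (auto simp: ord cong_add_lcancel_0_nat cong_0_iff cong_sym_eq[of j])
    then show "a ^ j * E = a ^ (j + i) * E" using powE[of j i] powE[of j 0] by simp
  qed
  show ?thesis
  proof (cases "j \<le> k")
    case True then show ?thesis using *[of j "k - j"] by simp
  next
    case False then show ?thesis using *[of k "j - k"] by (simp add: cong_sym_eq eq_commute)
  qed
qed

lemma pow_q2: assumes "E * x = x" shows "x ^ q\<^sup>2 = x"
proof (cases "x = 0")
  case False
  then obtain k where k: "x = a ^ k * E" using gen assms by blast
  have Ep: "E ^ j = E" if "j > 0" for j using that
  proof (induction j)
    case (Suc j) then show ?case using E(1) by (cases "j = 0") auto
  qed simp
  have "x ^ q\<^sup>2 = a ^ (k * q\<^sup>2) * E" using q_gt0 by (simp add: k power_mult_distrib power_mult Ep)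
  also have "\<dots> = a ^ k * E"
  proof -
    have "k * q\<^sup>2 = k + k * (q\<^sup>2 - 1)" using q_gt0 by (cases "q\<^sup>2") auto
    then show ?thesis unfolding powE_eq by (simp add: cong_def)
  qed
  finally show ?thesis using k by simp
qed (use q_gt0 in \<open>simp add: power_0_left\<close>)

lemma E_mult: "E * x = x \<Longrightarrow> E * (x * y) = x * y" by (simp add: mult.assoc[symmetric])

lemma E_pow: "E * x = x \<Longrightarrow> k > 0 \<Longrightarrow> E * x ^ k = x ^ k"
  by (cases k) (auto simp: mult.assoc[symmetric])

lemma inverse: assumes "E * x = x" "x \<noteq> 0" shows "\<exists>y. E * y = y \<and> y * x = E"
proof -
  obtain k where k: "x = a ^ k * E" using gen assms by blast
  have "a ^ ((q\<^sup>2 - 2) * k) * E * x = a ^ ((q\<^sup>2 - 2) * k + k) * E" by (simp only: k powE)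
  also have "(q\<^sup>2 - 2) * k + k = (q\<^sup>2 - 1) * k" using q_gt0 by (cases "q\<^sup>2 - 1") (auto simp: numeral_2_eq_2)
  also have "a ^ ((q\<^sup>2 - 1) * k) * E = E" by (simp add: ord)
  finally show ?thesis using E_powE[of "(q\<^sup>2 - 2) * k"] by (intro exI[of _ "a ^ ((q\<^sup>2 - 2) * k) * E"] conjI)
qed

lemma prime_frob:
  assumes "E * x = x" "E * y = y" "prime l" "l dvd q" shows "(x + y) ^ l = x ^ l + y ^ l"
proof -
  have l0: "l > 0" using assms(3) by (rule prime_gt_0_nat)
  have mid: "of_nat (l choose k) * x ^ k * y ^ (l - k) = 0" if "k \<in> {0<..<l}" for k
  proof -
    have "l dvd (l choose k)" using that assms(3) by (intro dvd_choose_prime) auto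
    then obtain c where c: "l choose k = l * c" by (auto elim: dvdE)
    have "of_nat (l choose k) * E = of_nat c * (of_nat l * E)" by (simp add: c mult_ac)
    then have "of_nat (l choose k) * E = 0" using char[OF assms(3,4)] by simp
    moreover have Ex: "E * x ^ k = x ^ k" using that E_pow[OF assms(1)] by simp
    have "of_nat (l choose k) * x ^ k = of_nat (l choose k) * E * x ^ k" by (simp only: mult.assoc Ex)
    ultimately show ?thesis by simp
  qed
  have "(x + y) ^ l = (\<Sum>k\<le>l. of_nat (l choose k) * x ^ k * y ^ (l - k))" by (rule binomial_ring)
  also have "{..l} = insert 0 (insert l {0<..<l})" using l0 by auto
  also have "(\<Sum>k\<in>insert 0 (insert l {0<..<l}). of_nat (l choose k) * x ^ k * y ^ (l - k)) = x ^ l + y ^ l"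
    using l0 mid by (simp add: add.commute)
  finally show ?thesis .
qed

text \<open>Raising to a prime divisor of \<open>q\<close> is additive by the binomial theorem, and
  a general divisor is peeled off one prime factor at a time. The case \<open>c = q\<close> is the
  additivity of the Frobenius map.\<close>

lemma pow_dvd_add:
  assumes "c dvd q" "E * x = x" "E * y = y" shows "(x + y) ^ c = x ^ c + y ^ c"
  using assms
proof (induction c arbitrary: x y rule: less_induct)
  case (less c)
  show ?case
  proof (cases "c = 1")
    case False
    then obtain l where l: "prime l" "l dvd c" using prime_factor_nat by blast
    then obtain c' where c: "c = l * c'" by (auto elim: dvdE)
    have c0: "c > 0" using less.prems(1) q_gt0 by (cases c) auto
    have l0: "l > 0" using l(1) by (rule prime_gt_0_nat)
    have "(x + y) ^ l = x ^ l + y ^ l"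
      by (rule prime_frob[OF less.prems(2,3) l(1)]) (rule dvd_trans[OF l(2) less.prems(1)])
    then have "(x + y) ^ c = (x ^ l + y ^ l) ^ c'" by (simp only: c power_mult)
    also have "\<dots> = (x ^ l) ^ c' + (y ^ l) ^ c'"
    proof (rule less.IH)
      show "c' < c" using c c0 prime_gt_1_nat[OF l(1)] by simp
      show "c' dvd q" by (rule dvd_mult_right[of l]) (use c less.prems(1) in simp)
    qed (use E_pow l0 less.prems in auto)
    finally show ?thesis by (simp add: c power_mult)
  qed simp
qed

text \<open>The power map on the summand of \<open>E\<close>, extended by the identity on the
  complementary summand, so that the involution is defined on the whole ring.\<close>

definition frob :: "'a \<Rightarrow> 'a" where "frob x = (E * x) ^ q + (x - E * x)"

lemma E_Ex: "E * (E * x) = E * x" using E(1) by (simp add: mult.assoc[symmetric])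

lemma frob_A: "E * x = x \<Longrightarrow> frob x = x ^ q" by (simp add: frob_def)

lemma E_frob: "E * frob x = (E * x) ^ q"
  using E_pow[OF E_Ex q_gt0(2)] E_Ex by (simp add: frob_def distrib_left right_diff_distrib)

lemma E_frobA: "E * x = x \<Longrightarrow> E * frob x = frob x"
  unfolding E_frob by (simp add: frob_A)

lemma frob_add: "frob (x + y) = frob x + frob y"
  using pow_dvd_add[OF dvd_refl E_Ex E_Ex, of x y] by (simp add: frob_def distrib_left algebra_simps)

lemma pow_E_diff: "(E * u) ^ q * (v - E * v) = 0"
proof -
  have *: "E * X * w = X * (E * w)" for X w by (simp only: mult_ac)
  have "(E * u) ^ q * (v - E * v) = E * (E * u) ^ q * (v - E * v)"
    by (simp only: E_pow[OF E_Ex q_gt0(2)])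
  also have "\<dots> = (E * u) ^ q * (E * (v - E * v))" by (rule *)
  also have "E * (v - E * v) = 0" by (simp add: right_diff_distrib)
  finally show ?thesis by simp
qed

lemma frob_mult: "frob (x * y) = frob x * frob y"
proof -
  have 1: "E * x * (E * y) = E * (x * y)"
  proof -
    have "E * x * (E * y) = E * (E * (x * y))" by (simp only: mult_ac)
    then show ?thesis by simp
  qed
  have g: "(x - X) * (y - Y) = x * y - x * Y - X * y + X * Y" for X Y by (simp add: algebra_simps)
  have g': "(P + X) * (Q + Y) = P * Q + P * Y + Q * X + X * Y" for P Q X Y :: 'a by (simp add: algebra_simps)
  have 2: "x * (E * y) = E * (x * y)" "E * x * y = E * (x * y)" by (simp_all only: mult_ac)
  have 3: "(x - E * x) * (y - E * y) = x * y - E * (x * y)" unfolding g 1 2 by simp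
  have "frob x * frob y = (E * x) ^ q * (E * y) ^ q + (x * y - E * (x * y))"
    unfolding frob_def g' 3 pow_E_diff by simp
  also have "(E * x) ^ q * (E * y) ^ q = (E * (x * y)) ^ q"
    unfolding 1[symmetric] by (rule power_mult_distrib[symmetric])
  finally show ?thesis by (simp only: frob_def)
qed

lemma frob_conj: "frob (frob x) = x"
proof -
  have "(E * frob x) ^ q = E * x" by (simp add: E_frob power_mult[symmetric] power2_eq_square[symmetric] pow_q2 E_Ex)
  moreover have "frob x - E * frob x = x - E * x" by (simp add: E_frob) (simp add: frob_def)
  ultimately show ?thesis unfolding frob_def[of "frob x"] by simp
qed

lemma E_pow_E: "k > 0 \<Longrightarrow> E ^ k = E"
proof (induction k)
  case (Suc k) then show ?case by (cases "k = 0") auto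
qed simp

lemma frob_E: "frob E = E" using E(1) q_gt0 by (simp add: frob_A E_pow_E)

lemma q2_eq: "q\<^sup>2 - 1 = (q + 1) * (q - 1)"
  using q1 by (cases q) (auto simp: power2_eq_square algebra_simps)

text \<open>In exponents the condition is that \<open>k * (q - 1)\<close> is divisible by
  \<open>q\<^sup>2 - 1 = (q + 1) * (q - 1)\<close>.\<close>

lemma fixed_iff: "frob (a ^ k * E) = a ^ k * E \<longleftrightarrow> (q + 1) dvd k"
proof -
  have "frob (a ^ k * E) = a ^ (k * q) * E"
    using q_gt0 by (simp add: frob_A E_powE power_mult_distrib power_mult E_pow_E)
  then have "frob (a ^ k * E) = a ^ k * E \<longleftrightarrow> [k * q = k] (mod (q\<^sup>2 - 1))" by (simp add: powE_eq)
  also have "k * q = k + k * (q - 1)" using q1 by (cases q) auto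
  also have "[k + k * (q - 1) = k] (mod (q\<^sup>2 - 1)) \<longleftrightarrow> (q + 1) * (q - 1) dvd k * (q - 1)"
    unfolding q2_eq[symmetric] by (simp add: cong_add_lcancel_0_nat cong_0_iff)
  also have "\<dots> \<longleftrightarrow> (q + 1) dvd k" using q1 by (subst (1 2) mult.commute[of _ "q - 1"], subst nat_mult_dvd_cancel_disj) auto
  finally show ?thesis .
qed

lemma fixed_gen:
  assumes x: "E * x = x" "frob x = x" "x \<noteq> 0" shows "\<exists>j<q - 1. x = a ^ ((q + 1) * j) * E"
proof -
  obtain k where k: "x = a ^ k * E" using gen[OF x(1,3)] ..
  define i where "i = k mod (q\<^sup>2 - 1)"
  have "a ^ k * E = a ^ i * E" unfolding powE_eq i_def by (simp only: cong_def mod_mod_trivial)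
  then have ki: "x = a ^ i * E" using k by simp
  have "(q + 1) dvd i" using x(2) unfolding ki fixed_iff .
  then obtain j where j: "i = (q + 1) * j" by (rule dvdE)
  have "i < q\<^sup>2 - 1" unfolding i_def using q_gt0(1) by (rule mod_less_divisor)
  then have "(q + 1) * j < (q + 1) * (q - 1)" unfolding q2_eq j .
  then have "j < q - 1" by (simp only: mult_less_cancel1)
  then show ?thesis using ki unfolding j by (intro exI[of _ j] conjI)
qed

lemma fixed_inj:
  assumes "i < q - 1" "j < q - 1" "a ^ ((q + 1) * i) * E = a ^ ((q + 1) * j) * E" shows "i = j"
proof -
  have "(q + 1) * i < (q + 1) * (q - 1)" "(q + 1) * j < (q + 1) * (q - 1)"
    using assms(1,2) by (simp_all only: mult_less_cancel1) simp_all
  then have "(q + 1) * i = (q + 1) * j" using assms(3) unfolding powE_eq q2_eq cong_def by (simp only: mod_less)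
  then show "i = j" by (rule nat_mult_eq_cancel1[THEN iffD1, rotated]) simp
qed

lemma fixed_powE: "frob (a ^ ((q + 1) * i) * E) = a ^ ((q + 1) * i) * E"
  unfolding fixed_iff by (rule dvd_triv_left)

lemma frob_0: "frob 0 = 0"
  using q_gt0 by (simp add: frob_def power_0_left)

lemma card_fixed: "card {x. E * x = x \<and> frob x = x} = q"
proof -
  define g where g: "g = (\<lambda>i. a ^ ((q + 1) * i) * E)"
  have sub: "x \<in> insert 0 (g ` {..<q - 1})" if x: "E * x = x" "frob x = x" for x
  proof (cases "x = 0")
    case False
    obtain j where "j < q - 1" "x = g j" using fixed_gen[OF x False] unfolding g by blast
    then show ?thesis by blast
  qed simp
  have mem: "E * g i = g i" "frob (g i) = g i" for i unfolding g by (rule E_powE fixed_powE)+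
  have "{x. E * x = x \<and> frob x = x} = insert 0 (g ` {..<q - 1})"
  proof (intro equalityI subsetI)
    fix x assume "x \<in> insert 0 (g ` {..<q - 1})"
    then consider "x = 0" | i where "x = g i" by blast
    then show "x \<in> {x. E * x = x \<and> frob x = x}"
    proof cases
      case 2 then show ?thesis using mem[of i] by simp
    qed (simp add: frob_0)
  qed (use sub in blast)
  moreover have "inj_on g {..<q - 1}"
    by (rule inj_onI) (rule fixed_inj, simp_all only: lessThan_iff g)
  moreover have "0 \<notin> g ` {..<q - 1}"
  proof
    assume "0 \<in> g ` {..<q - 1}"
    then obtain i where "0 = g i" by (rule imageE)
    then have "g i = 0" by (rule sym)
    then show False unfolding g using powE_period by blast
  qed
  ultimately have "card {x. E * x = x \<and> frob x = x} = Suc (q - 1)"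
    by (simp only: card_insert_disjoint card_image finite_imageI finite_lessThan card_lessThan not_False_eq_True)
  then show ?thesis using q1 by simp
qed

lemma norm_onto: assumes "E * y = y" "frob y = y" shows "\<exists>z. E * z = z \<and> z * frob z = y"
proof (cases "y = 0")
  case True then show ?thesis by (intro exI[of _ 0]) simp
next
  case False
  then obtain k where k: "y = a ^ k * E" using gen assms by blast
  then obtain j where j: "k = (q + 1) * j" using fixed_iff assms(2) by (auto elim: dvdE)
  have "a ^ j * E * frob (a ^ j * E) = a ^ j * E * (a ^ (j * q) * E)"
    using q_gt0 by (simp add: frob_A E_powE power_mult_distrib power_mult E_pow_E)
  also have "\<dots> = y" unfolding powE k j by (simp add: algebra_simps)
  finally show ?thesis using E_powE by blast
qed

lemma frob_uminus: "frob (- x) = - frob x"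
  using frob_add[of x "- x"] frob_add[of 0 0] by (simp add: eq_neg_iff_add_eq_0 add.commute)

lemma not_fixed: "\<exists>x. E * x = x \<and> frob x \<noteq> x"
proof (rule ccontr)
  assume "\<not> ?thesis"
  then have "{x. E * x = x \<and> frob x = x} = {x. E * x = x}" by auto
  then have "q = q\<^sup>2" using card_fixed cA by simp
  then show False using q1 by (simp add: power2_eq_square)
qed

text \<open>If the trace vanished, \<open>frob\<close> would be negation; since it fixes
  \<open>E\<close> this gives \<open>E = - E\<close>, so \<open>frob\<close> would be the identity,
  which \<open>not_fixed\<close> excludes. A nonzero trace value is normalised to \<open>E\<close>
  by its inverse, which \<open>frob\<close> fixes.\<close>

lemma trace_onto: assumes z: "E * z = z" "z \<noteq> 0" shows "\<exists>c. E * c = c \<and> c * z + frob (c * z) = E"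
proof -
  have "\<exists>x. E * x = x \<and> x + frob x \<noteq> 0"
  proof (rule ccontr)
    assume "\<not> ?thesis"
    then have *: "frob x = - x" if "E * x = x" for x using that by (simp add: eq_neg_iff_add_eq_0 add.commute)
    obtain x where x: "E * x = x" "frob x \<noteq> x" using not_fixed by blast
    have "E = - E" using *[OF E(1)] unfolding frob_E .
    then have "E * x = - E * x" by (rule arg_cong[of _ _ "\<lambda>t. t * x"])
    then have "x = - x" using x(1) by simp
    then show False using *[OF x(1)] x(2) by simp
  qed
  then obtain x where x: "E * x = x" "x + frob x \<noteq> 0" by blast
  have Et: "E * (x + frob x) = x + frob x" unfolding distrib_left E_frobA[OF x(1)] x(1) ..
  obtain t where t: "E * t = t" "t * (x + frob x) = E" using inverse[OF Et x(2)] by blast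
  obtain w where w: "E * w = w" "w * z = E" using inverse[OF z] by blast
  have "frob t * (x + frob x) = E"
    using arg_cong[OF t(2), of frob] unfolding frob_mult frob_add frob_conj frob_E by (simp only: add.commute)
  then have t1: "(frob t - t) * (x + frob x) = 0" using t(2) by (simp only: left_diff_distrib diff_self)
  have t2: "E * (frob t - t) = frob t - t" unfolding right_diff_distrib E_frobA[OF t(1)] t(1) ..
  have ct: "frob t = t" using integral[OF t2 Et t1] x(2) by simp
  have "t * x * w * z = t * (x * (w * z))" by (simp only: mult.assoc)
  also have "\<dots> = t * x" unfolding w(2) mult.commute[of x E] x(1) ..
  finally have "t * x * w * z + frob (t * x * w * z) = t * x + frob t * frob x" by (simp only: frob_mult)
  also have "\<dots> = E" using t(2) unfolding ct distrib_left .
  finally have "t * x * w * z + frob (t * x * w * z) = E" .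
  then show ?thesis using E_mult[OF E_mult[OF t(1), of x], of w] by blast
qed

text \<open>\<alpha> comes from surjectivity of the norm, \<open>b\<close> from surjectivity of the
  trace, and \<delta> is the difference between an element that is not fixed and its
  conjugate.\<close>

lemma hring_exists: "\<exists>\<alpha> b \<delta> \<delta>i. hring frob E q \<alpha> b \<delta> \<delta>i"
proof -
  have mE: "E * - E = - E" "frob (- E) = - E" by (simp_all only: frob_uminus frob_E mult_minus_right EE)
  obtain \<alpha> where \<alpha>: "E * \<alpha> = \<alpha>" "\<alpha> * frob \<alpha> = - E" using norm_onto[OF mE] by blast
  obtain b where b: "E * b = b" "b * E + frob (b * E) = E" using trace_onto[OF E] by blast
  have b2: "b + frob b = E" using b(2) unfolding mult.commute[of b E] b(1) .
  obtain x where x: "E * x = x" "frob x \<noteq> x" using not_fixed by blast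
  define \<delta> where "\<delta> = x - frob x"
  have "frob \<delta> = frob x + - frob (frob x)" unfolding \<delta>_def diff_conv_add_uminus frob_add frob_uminus ..
  then have \<delta>: "E * \<delta> = \<delta>" "frob \<delta> = - \<delta>" "\<delta> \<noteq> 0"
    using x(2) by (simp_all add: \<delta>_def right_diff_distrib E_frobA[OF x(1)] x(1) frob_conj)
  obtain \<delta>i where \<delta>i: "E * \<delta>i = \<delta>i" "\<delta>i * \<delta> = E" using inverse[OF \<delta>(1,3)] by blast
  have \<delta>\<delta>: "\<delta> * \<delta>i = E" using \<delta>i(2) by (simp only: mult.commute)
  have "hring frob E q \<alpha> b \<delta> \<delta>i"
  proof
    show "frob (x + y) = frob x + frob y" "frob (x * y) = frob x * frob y" "frob (frob x) = x" for x y
      by (fact frob_add frob_mult frob_conj)+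
    show "\<exists>z. E * z = z \<and> z * frob z = y" if "E * y = y" "frob y = y" for y by (rule norm_onto[OF that])
    show "frob E = E" "E * E = E" "E \<noteq> 0" "E * \<alpha> = \<alpha>" "\<alpha> * frob \<alpha> = - E" "E * b = b" "b + frob b = E"
      "E * \<delta> = \<delta>" "E * \<delta>i = \<delta>i" "\<delta> * \<delta>i = E" "frob \<delta> = - \<delta>" "card {x. E * x = x} = q\<^sup>2" "q \<ge> 2"
      "card {x. E * x = x \<and> frob x = x} = q"
      by (fact frob_E E \<alpha> b b2 \<delta> \<delta>i \<delta>\<delta> cA q1 card_fixed)+
    show "\<exists>c. E * c = c \<and> c * z + frob (c * z) = E" if "E * z = z" "z \<noteq> 0" for z by (rule trace_onto[OF that])
    show "(\<exists>c. E * c = c \<and> y = c * d) \<or> (\<exists>p. E * p = p \<and> p * p = p \<and> p * d = 0 \<and> p * y \<noteq> 0)"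
      if hd: "E * d = d" and hy: "E * y = y" for d y
    proof (cases "d = 0")
      case True
      show ?thesis
      proof (cases "y = 0")
        case True then show ?thesis by (intro disjI1 exI[of _ 0]) simp
      next
        case False then show ?thesis using \<open>d = 0\<close> hy by (intro disjI2 exI[of _ E]) simp
      qed
    next
      case False
      then obtain c where c: "E * c = c" "c * d = E" using inverse[OF hd] by blast
      have "y = y * c * d" unfolding mult.assoc c(2) mult.commute[of y E] hy ..
      then show ?thesis using E_mult[OF hy, of c] by (intro disjI1 exI[of _ "y * c"] conjI)
    qed
    show "p * frob p = 0" if hp: "E * p = p" "p * p = p" "p \<noteq> E" for p
    proof -
      have 1: "p * (p - E) = 0" by (simp only: right_diff_distrib hp mult.commute[of p E] diff_self)
      have 2: "E * (p - E) = p - E" by (simp only: right_diff_distrib hp EE)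
      have "p = 0" using integral[OF hp(1) 2 1] hp(3) by simp
      then show ?thesis by simp
    qed
  qed
  then show ?thesis by (intro exI)
qed

end


section \<open>The rings of the linear and unitary groups\<close>

lift_definition swp :: "uring \<Rightarrow> uring" is "\<lambda>f i. f (fst i, \<not> snd i)"
  by (metis comp_ring_def fst_conv)

lemma cp_swp [simp]: "cp (swp x) (R, c) = cp x (R, \<not> c)" by transfer simp

text \<open>The element with components \<open>u\<close> and \<open>v\<close> at the two copies of
  \<open>R\<close> and zero at all other indices. In the unitary case only the first copy carries
  the field, with identity \<open>pr R \<one> \<zero>\<close>.\<close>

definition pr :: "nat ring \<Rightarrow> nat \<Rightarrow> nat \<Rightarrow> uring" where
  "pr R u v = Abs_uring (\<lambda>i. if i = (R, True) then u else if i = (R, False) then v else \<zero>\<^bsub>comp_ring i\<^esub>)"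

locale nat_field = field R for R :: "nat ring" (structure)
begin

lemma comp_ring_R [simp]: "comp_ring (R, c) = R"
  using is_cring by (simp add: comp_ring_def)

abbreviation "prj x \<equiv> cp x (R, True)"
abbreviation "prj' x \<equiv> cp x (R, False)"

lemma prj_closed [simp]: "prj x \<in> carrier R" "prj' x \<in> carrier R"
  using cp_closed[of x "(R, True)"] cp_closed[of x "(R, False)"] by simp_all

lemma prj_simps [simp]: "prj 0 = \<zero>" "prj 1 = \<one>" "prj (x + y) = prj x \<oplus> prj y" "prj (x * y) = prj x \<otimes> prj y"
  "prj (- x) = \<ominus> prj x" "prj (x ^ k) = prj x [^] k"
  "prj' 0 = \<zero>" "prj' 1 = \<one>" "prj' (x + y) = prj' x \<oplus> prj' y" "prj' (x * y) = prj' x \<otimes> prj' y"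
  "prj' (- x) = \<ominus> prj' x" "prj' (x ^ k) = prj' x [^] k" "prj (swp x) = prj' x" "prj' (swp x) = prj x"
  by simp_all

lemma prj_sum: "prj (\<Sum>k\<in>S. f k) = (\<Oplus>k\<in>S. prj (f k))" "prj' (\<Sum>k\<in>S. f k) = (\<Oplus>k\<in>S. prj' (f k))"
  by (simp_all add: cp_sum)

lemma cp_pr:
  assumes "u \<in> carrier R" "v \<in> carrier R"
  shows "cp (pr R u v) i = (if i = (R, True) then u else if i = (R, False) then v else \<zero>\<^bsub>comp_ring i\<^esub>)"
  unfolding pr_def using assms by (subst Abs_uring_inverse) (auto simp: CR.zero_closed)

lemma prj_pr [simp]:
  assumes "u \<in> carrier R" "v \<in> carrier R" shows "prj (pr R u v) = u" "prj' (pr R u v) = v"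
  by (simp_all add: cp_pr assms)

lemma pr_mult: "u \<in> carrier R \<Longrightarrow> v \<in> carrier R \<Longrightarrow> pr R u v * x = pr R (u \<otimes> prj x) (v \<otimes> prj' x)"
  by (rule uring_eqI) (simp add: cp_pr)

lemma pr_add: "u \<in> carrier R \<Longrightarrow> v \<in> carrier R \<Longrightarrow> u' \<in> carrier R \<Longrightarrow> v' \<in> carrier R \<Longrightarrow>
    pr R u v + pr R u' v' = pr R (u \<oplus> u') (v \<oplus> v')"
  and pr_uminus: "u \<in> carrier R \<Longrightarrow> v \<in> carrier R \<Longrightarrow> - pr R u v = pr R (\<ominus> u) (\<ominus> v)"
  and pr_zero: "pr R \<zero> \<zero> = 0"
  by (auto intro!: uring_eqI simp: cp_pr CR.minus_zero)

lemma swp_pr: assumes "u \<in> carrier R" "v \<in> carrier R" shows "swp (pr R u v) = pr R v u"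
proof (rule uring_eqI)
  fix i show "cp (swp (pr R u v)) i = cp (pr R v u) i"
    using assms by (cases i) (auto simp: cp_pr comp_ring_swap)
qed

lemma pr_inj: "u \<in> carrier R \<Longrightarrow> v \<in> carrier R \<Longrightarrow> u' \<in> carrier R \<Longrightarrow> v' \<in> carrier R \<Longrightarrow>
    pr R u v = pr R u' v' \<longleftrightarrow> u = u' \<and> v = v'"
  by (metis prj_pr)

lemmas pr_ops = pr_add pr_uminus pr_zero swp_pr pr_inj

lemma prj_eqI:
  assumes "pr R \<one> \<one> * x = x" "pr R \<one> \<one> * y = y" "prj x = prj y" "prj' x = prj' y" shows "x = y"
  using assms by (metis pr_mult one_closed)

lemma pr10: "pr R \<one> \<zero> * x = x \<longleftrightarrow> x = pr R (prj x) \<zero>" and pr11: "pr R \<one> \<one> * x = x \<longleftrightarrow> x = pr R (prj x) (prj' x)"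
  by (auto simp: pr_mult)

lemma A_U: "{x. pr R \<one> \<zero> * x = x} = (\<lambda>u. pr R u \<zero>) ` carrier R"
proof
  show "{x. pr R \<one> \<zero> * x = x} \<subseteq> (\<lambda>u. pr R u \<zero>) ` carrier R"
    unfolding pr10 using prj_closed by blast
qed (auto simp: pr_mult)

lemma A_L: "{x. pr R \<one> \<one> * x = x} = (\<lambda>(u, v). pr R u v) ` (carrier R \<times> carrier R)"
proof
  show "{x. pr R \<one> \<one> * x = x} \<subseteq> (\<lambda>(u, v). pr R u v) ` (carrier R \<times> carrier R)"
  proof
    fix x assume "x \<in> {x. pr R \<one> \<one> * x = x}"
    then have "x = (\<lambda>(u, v). pr R u v) (prj x, prj' x)" by (simp add: pr11)
    then show "x \<in> (\<lambda>(u, v). pr R u v) ` (carrier R \<times> carrier R)" using prj_closed by blast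
  qed
qed (auto simp: pr_mult)

lemma idem_field_U:
  assumes fin: "finite (carrier R)" and q: "card (carrier R) = q\<^sup>2"
  shows "\<exists>a. idem_field (pr R \<one> \<zero>) a q"
proof -
  obtain a where a: "a \<in> carrier R" "a \<noteq> \<zero>" and gen: "\<And>x. x \<in> carrier R \<Longrightarrow> x \<noteq> \<zero> \<Longrightarrow> \<exists>k::nat. x = a [^] k"
    and ord: "\<And>k::nat. a [^] k = \<one> \<longleftrightarrow> (card (carrier R) - 1) dvd k"
    using finite_field_generator[OF field_axioms fin] by blast
  have pw: "pr R a \<zero> ^ k * pr R \<one> \<zero> = pr R (a [^] k) \<zero>" for k :: nat
    using a(1) by (subst mult.commute) (simp add: pr_mult)
  have inj: "pr R u \<zero> = pr R u' \<zero> \<longleftrightarrow> u = u'" if "u \<in> carrier R" "u' \<in> carrier R" for u u'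
    using that by (simp add: pr_ops)
  have z: "pr R \<zero> \<zero> = 0" by (simp add: pr_ops)
  have "idem_field (pr R \<one> \<zero>) (pr R a \<zero>) q"
  proof
    show "pr R \<one> \<zero> \<noteq> 0" "pr R a \<zero> \<noteq> 0" using inj[of _ \<zero>] a z by auto
    have "inj_on (\<lambda>u. pr R u \<zero>) (carrier R)" by (rule inj_onI) (simp add: inj)
    then show "card {x. pr R \<one> \<zero> * x = x} = q\<^sup>2" unfolding A_U by (simp add: card_image q)
    have "card {\<zero>, \<one>} \<le> card (carrier R)" by (rule card_mono) (use fin in auto)
    then have "2 \<le> q\<^sup>2" using q by simp
    then show "q \<ge> 2" by (cases q; cases "q - 1") (auto simp: power2_eq_square)
    show "\<exists>k. x = pr R a \<zero> ^ k * pr R \<one> \<zero>" if x: "pr R \<one> \<zero> * x = x" "x \<noteq> 0" for x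
    proof -
      have x': "x = pr R (prj x) \<zero>" using x pr10 by simp
      then have "prj x \<noteq> \<zero>" using x(2) z by metis
      then obtain k :: nat where "prj x = a [^] k" using gen prj_closed by blast
      then show ?thesis using x' pw by metis
    qed
    show "pr R a \<zero> ^ k * pr R \<one> \<zero> = pr R \<one> \<zero> \<longleftrightarrow> (q\<^sup>2 - 1) dvd k" for k
      unfolding pw using inj[of "a [^] k" \<one>] a ord[of k] q by simp
    show "of_nat l * pr R \<one> \<zero> = 0" if l: "prime l" "l dvd q" for l
    proof -
      have "l dvd card (carrier R)" using l(2) q by (simp add: power2_eq_square)
      then have "[l] \<cdot> \<one> = \<zero>" by (rule finite_field_prime[OF field_axioms fin l(1)])
      then show ?thesis by (subst mult.commute) (simp add: pr_mult cp_of_nat z)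
    qed
  qed (use a in \<open>simp_all add: pr_mult\<close>)
  then show ?thesis ..
qed

text \<open>For the coordinate swap, \<open>(1, -1)\<close> has norm \<open>(-1, -1)\<close>, is
  skew and squares to the identity, so it serves as \<alpha>, as \<delta> and as the inverse of
  \<delta>; \<open>(1, 0)\<close> has trace \<open>(1, 1)\<close>. The proper nonzero idempotents
  \<open>(1, 0)\<close> and \<open>(0, 1)\<close> are interchanged by the swap, hence multiply to
  zero.\<close>

lemma hring_L:
  assumes fin: "finite (carrier R)" and q: "card (carrier R) = q"
  shows "hring swp (pr R \<one> \<one>) q (pr R \<one> (\<ominus> \<one>)) (pr R \<one> \<zero>) (pr R \<one> (\<ominus> \<one>)) (pr R \<one> (\<ominus> \<one>))"
proof
  have *: "\<exists>u v. u \<in> carrier R \<and> v \<in> carrier R \<and> x = pr R u v" if "pr R \<one> \<one> * x = x" for x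
    using that pr11 prj_closed by metis
  have inj: "pr R u v = pr R u' v' \<longleftrightarrow> u = u' \<and> v = v'"
    if "u \<in> carrier R" "u' \<in> carrier R" "v \<in> carrier R" "v' \<in> carrier R" for u u' v v'
    using that by (simp add: pr_ops)
  have z: "0 = pr R \<zero> \<zero>" by (simp add: pr_ops)
  show "swp (x + y) = swp x + swp y" "swp (x * y) = swp x * swp y" "swp (swp x) = x" for x y
    by (transfer, auto simp: fun_eq_iff comp_ring_swap)+
  show "pr R \<one> \<one> \<noteq> 0" unfolding z by (subst inj) auto
  show "\<exists>c. pr R \<one> \<one> * c = c \<and> c * z + swp (c * z) = pr R \<one> \<one>"
    if hz: "pr R \<one> \<one> * z = z" "z \<noteq> 0" for z
  proof -
    obtain u v where uv: "u \<in> carrier R" "v \<in> carrier R" "z = pr R u v" using *[OF hz(1)] by blast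
    have "u \<noteq> \<zero> \<or> v \<noteq> \<zero>" using uv(3) hz(2) z by auto
    then show ?thesis
    proof
      assume "u \<noteq> \<zero>"
      then have "u \<in> Units R" using uv field_Units by simp
      then have "pr R (inv u) \<zero> * z + swp (pr R (inv u) \<zero> * z) = pr R \<one> \<one>" "inv u \<in> carrier R"
        using uv by (simp_all add: pr_mult pr_ops)
      then show ?thesis by (intro exI[of _ "pr R (inv u) \<zero>"]) (simp add: pr_mult)
    next
      assume "v \<noteq> \<zero>"
      then have "v \<in> Units R" using uv field_Units by simp
      then have "pr R \<zero> (inv v) * z + swp (pr R \<zero> (inv v) * z) = pr R \<one> \<one>" "inv v \<in> carrier R"
        using uv by (simp_all add: pr_mult pr_ops)
      then show ?thesis by (intro exI[of _ "pr R \<zero> (inv v)"]) (simp add: pr_mult)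
    qed
  qed
  show "(\<exists>c. pr R \<one> \<one> * c = c \<and> y = c * d) \<or> (\<exists>p. pr R \<one> \<one> * p = p \<and> p * p = p \<and> p * d = 0 \<and> p * y \<noteq> 0)"
    if hd: "pr R \<one> \<one> * d = d" and hy: "pr R \<one> \<one> * y = y" for d y
  proof -
    obtain u v where uv: "u \<in> carrier R" "v \<in> carrier R" "d = pr R u v" using *[OF hd] by blast
    obtain u' v' where uv': "u' \<in> carrier R" "v' \<in> carrier R" "y = pr R u' v'" using *[OF hy] by blast
    \<comment> \<open>Divisibility can fail only in a component where \<open>d\<close> vanishes and
      \<open>y\<close> does not; the idempotent of that component is then the witness.\<close>
    consider "u = \<zero>" "u' \<noteq> \<zero>" | "v = \<zero>" "v' \<noteq> \<zero>" | "u = \<zero> \<Longrightarrow> u' = \<zero>" "v = \<zero> \<Longrightarrow> v' = \<zero>" by blast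
    then show ?thesis
    proof cases
      case 1
      then have "pr R \<one> \<zero> * d = 0" "pr R \<one> \<zero> * y \<noteq> 0" using uv uv' by (simp_all add: pr_mult z inj)
      then show ?thesis by (intro disjI2 exI[of _ "pr R \<one> \<zero>"]) (simp add: pr_mult)
    next
      case 2
      then have "pr R \<zero> \<one> * d = 0" "pr R \<zero> \<one> * y \<noteq> 0" using uv uv' by (simp_all add: pr_mult z inj)
      then show ?thesis by (intro disjI2 exI[of _ "pr R \<zero> \<one>"]) (simp add: pr_mult)
    next
      case 3
      have quot: "\<exists>c\<in>carrier R. w' = c \<otimes> w" if "w \<in> carrier R" "w' \<in> carrier R" "w = \<zero> \<Longrightarrow> w' = \<zero>" for w w'
      proof (cases "w = \<zero>")
        case True then show ?thesis using that by (intro bexI[of _ \<zero>]) auto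
      next
        case False
        then have "w \<in> Units R" using that field_Units by simp
        then show ?thesis using that by (intro bexI[of _ "w' \<otimes> inv w"]) (auto simp: m_assoc)
      qed
      obtain c c' where c: "c \<in> carrier R" "u' = c \<otimes> u" "c' \<in> carrier R" "v' = c' \<otimes> v"
        using quot[OF uv(1) uv'(1) 3(1)] quot[OF uv(2) uv'(2) 3(2)] by blast
      then show ?thesis using uv uv' by (intro disjI1 exI[of _ "pr R c c'"]) (simp add: pr_mult)
    qed
  qed
  show "p * swp p = 0" if p: "pr R \<one> \<one> * p = p" "p * p = p" "p \<noteq> pr R \<one> \<one>" for p
  proof -
    obtain u v where uv: "u \<in> carrier R" "v \<in> carrier R" "p = pr R u v" using *[OF p(1)] by blast
    have idem: "w = \<zero> \<or> w = \<one>" if "w \<in> carrier R" "w \<otimes> w = w" for w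
      using that by (metis m_lcancel r_one one_closed)
    have "u \<otimes> u = u" "v \<otimes> v = v" using p(2) uv by (simp_all add: pr_mult inj)
    then have "u = \<zero> \<or> v = \<zero>" using idem uv p(3) by blast
    then show ?thesis using uv by (auto simp: pr_mult pr_ops)
  qed
  show "\<exists>w. pr R \<one> \<one> * w = w \<and> w * swp w = y" if y: "pr R \<one> \<one> * y = y" "swp y = y" for y
  proof -
    obtain u v where uv: "u \<in> carrier R" "v \<in> carrier R" "y = pr R u v" using *[OF y(1)] by blast
    have "swp (pr R u v) = pr R u v" using y(2) unfolding uv(3) .
    then have "u = v" unfolding swp_pr[OF uv(1,2)] inj[OF uv(2,1,1,2)] ..
    then show ?thesis using uv by (intro exI[of _ "pr R u \<one>"]) (simp add: pr_mult pr_ops)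
  qed
  have "inj_on (\<lambda>(u, v). pr R u v) (carrier R \<times> carrier R)" by (rule inj_onI) (auto simp: inj)
  then show "card {x. pr R \<one> \<one> * x = x} = q\<^sup>2"
    unfolding A_L by (simp add: card_image card_cartesian_product q power2_eq_square)
  have "card {\<zero>, \<one>} \<le> card (carrier R)" by (rule card_mono) (use fin in auto)
  then show "q \<ge> 2" using q by simp
  have "{x. pr R \<one> \<one> * x = x \<and> swp x = x} = (\<lambda>u. pr R u u) ` carrier R"
  proof
    show "{x. pr R \<one> \<one> * x = x \<and> swp x = x} \<subseteq> (\<lambda>u. pr R u u) ` carrier R"
    proof
      fix x assume "x \<in> {x. pr R \<one> \<one> * x = x \<and> swp x = x}"
      then have x: "pr R \<one> \<one> * x = x" "swp x = x" by auto
      obtain u v where uv: "u \<in> carrier R" "v \<in> carrier R" "x = pr R u v" using *[OF x(1)] by blast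
      have "swp (pr R u v) = pr R u v" using x(2) unfolding uv(3) .
    then have "u = v" unfolding swp_pr[OF uv(1,2)] inj[OF uv(2,1,1,2)] ..
      then show "x \<in> (\<lambda>u. pr R u u) ` carrier R" using uv by simp
    qed
  qed (auto simp: pr_mult pr_ops)
  moreover have "inj_on (\<lambda>u. pr R u u) (carrier R)" by (rule inj_onI) (simp add: inj)
  ultimately show "card {x. pr R \<one> \<one> * x = x \<and> swp x = x} = q" by (simp add: card_image q)
qed (simp_all add: pr_mult pr_ops l_minus r_minus)

subsection \<open>Matrices over the field\<close>

text \<open>Entries are lifted to the ring type, where matrix identities reduce to manipulations of
  ordinary finite sums; \<open>lf_inject\<close> pulls them back.\<close>

definition lf :: "(nat \<Rightarrow> nat \<Rightarrow> nat) \<Rightarrow> nat \<Rightarrow> nat \<Rightarrow> uring" where "lf A i j = pr R (A i j) \<zero>"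

lemma fmatsD: "A \<in> fmats R n \<Longrightarrow> A i j \<in> carrier R" "A \<in> fmats R n \<Longrightarrow> \<not> (i < n \<and> j < n) \<Longrightarrow> A i j = \<zero>"
  by (auto simp: fmats_def)

lemma fmat_mul_prj:
  assumes "\<And>i j. A i j \<in> carrier R" "\<And>i j. B i j \<in> carrier R" "i < n" "j < n"
  shows "fmat_mul R n A B i j = prj (\<Sum>k<n. lf A i k * lf B k j)"
  using assms by (simp add: fmat_mul_def prj_sum lf_def)

lemma fmat_mul_fmats:
  assumes "A \<in> fmats R n" "B \<in> fmats R n" shows "fmat_mul R n A B \<in> fmats R n"
  using assms by (auto simp: fmats_def fmat_mul_def intro!: finsum_closed)

lemma lf_mul:
  assumes "A \<in> fmats R n" "B \<in> fmats R n"
  shows "lf (fmat_mul R n A B) i j = (\<Sum>k<n. lf A i k * lf B k j)"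
proof -
  have e: "pr R \<one> \<zero> * lf A i k = lf A i k" for k using fmatsD[OF assms(1)] by (simp add: lf_def pr_mult)
  then have "pr R \<one> \<zero> * (\<Sum>k<n. lf A i k * lf B k j) = (\<Sum>k<n. lf A i k * lf B k j)"
    by (simp add: sum_distrib_left mult.assoc[symmetric])
  then have *: "(\<Sum>k<n. lf A i k * lf B k j) = pr R (prj (\<Sum>k<n. lf A i k * lf B k j)) \<zero>" by (simp only: pr10)
  show ?thesis
  proof (cases "i < n \<and> j < n")
    case True
    then show ?thesis using fmatsD[OF assms(1)] fmatsD[OF assms(2)] by (subst *, subst lf_def) (simp add: fmat_mul_prj)
  next
    case False
    then have "lf A i k * lf B k j = 0" for k
      using fmatsD(2)[OF assms(1), of i k] fmatsD(2)[OF assms(2), of k j] by (auto simp: lf_def pr_zero)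
    then show ?thesis using False by (auto simp: lf_def fmat_mul_def pr_zero)
  qed
qed

lemma lf_inject: "A \<in> fmats R n \<Longrightarrow> B \<in> fmats R n \<Longrightarrow> lf A = lf B \<Longrightarrow> A = B"
proof (intro ext)
  fix i j assume A: "A \<in> fmats R n" "B \<in> fmats R n" and "lf A = lf B"
  then have "lf A i j = lf B i j" by simp
  then show "A i j = B i j" using fmatsD(1)[OF A(1)] fmatsD(1)[OF A(2)] by (simp add: lf_def pr_inj)
qed

lemma fmat_assoc:
  assumes "A \<in> fmats R n" "B \<in> fmats R n" "C \<in> fmats R n"
  shows "fmat_mul R n (fmat_mul R n A B) C = fmat_mul R n A (fmat_mul R n B C)"
proof (rule lf_inject[of _ n])
  show "lf (fmat_mul R n (fmat_mul R n A B) C) = lf (fmat_mul R n A (fmat_mul R n B C))"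
  proof (intro ext)
    fix i j
    have "(\<Sum>k<n. (\<Sum>l<n. lf A i l * lf B l k) * lf C k j) = (\<Sum>k<n. \<Sum>l<n. lf A i l * (lf B l k * lf C k j))"
      by (simp add: sum_distrib_right mult.assoc)
    also have "\<dots> = (\<Sum>l<n. \<Sum>k<n. lf A i l * (lf B l k * lf C k j))" by (rule sum.swap)
    finally show "lf (fmat_mul R n (fmat_mul R n A B) C) i j = lf (fmat_mul R n A (fmat_mul R n B C)) i j"
      using assms by (simp add: lf_mul fmat_mul_fmats sum_distrib_left)
  qed
qed (use assms fmat_mul_fmats in auto)

lemma fmat_one_fmats: "fmat_one R n \<in> fmats R n" by (auto simp: fmats_def fmat_one_def)

lemma fmat_one_mul:
  assumes A: "A \<in> fmats R n" shows "fmat_mul R n (fmat_one R n) A = A" "fmat_mul R n A (fmat_one R n) = A"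
proof -
  have e: "pr R \<one> \<zero> * lf A i j = lf A i j" for i j using fmatsD[OF A] by (simp add: lf_def pr_mult)
  have z: "lf A i j = 0" if "\<not> (i < n \<and> j < n)" for i j using fmatsD(2)[OF A that] by (simp add: lf_def pr_ops)
  have o: "lf (fmat_one R n) i j = (if i = j \<and> i < n then pr R \<one> \<zero> else 0)" for i j
    by (auto simp: lf_def fmat_one_def pr_ops)
  have e': "lf A i j * pr R \<one> \<zero> = lf A i j" for i j using e[of i j] by (simp only: mult.commute)
  show "fmat_mul R n (fmat_one R n) A = A"
  proof (rule lf_inject[OF fmat_mul_fmats[OF fmat_one_fmats A] A], intro ext)
    fix i j
    have "lf (fmat_mul R n (fmat_one R n) A) i j = (\<Sum>k<n. if k = i then lf A i j else 0)"
      unfolding lf_mul[OF fmat_one_fmats A] by (intro sum.cong refl) (auto simp: o e)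
    then show "lf (fmat_mul R n (fmat_one R n) A) i j = lf A i j" using z by simp
  qed
  show "fmat_mul R n A (fmat_one R n) = A"
  proof (rule lf_inject[OF fmat_mul_fmats[OF A fmat_one_fmats] A], intro ext)
    fix i j
    have "lf (fmat_mul R n A (fmat_one R n)) i j = (\<Sum>k<n. if k = j then lf A i j else 0)"
      unfolding lf_mul[OF A fmat_one_fmats] by (intro sum.cong refl) (auto simp: o e')
    then show "lf (fmat_mul R n A (fmat_one R n)) i j = lf A i j" using z by simp
  qed
qed

lemma fmat_inverse_unique:
  assumes "A \<in> fmats R n" "B \<in> fmats R n" "C \<in> fmats R n"
    "fmat_mul R n B A = fmat_one R n" "fmat_mul R n A C = fmat_one R n"
  shows "B = C"
  using fmat_assoc[OF assms(2,1,3)] fmat_one_mul[OF assms(2)] fmat_one_mul[OF assms(3)] assms(4,5) by simp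

end


section \<open>Matrices of isometries\<close>

context hgeom
begin

definition mtx :: "(nat \<Rightarrow> 'a) sym \<Rightarrow> nat \<Rightarrow> nat \<Rightarrow> 'a" where
  "mtx g i j = (if i < n \<and> j < n then act g (bv j) i else 0)"

text \<open>Unitary matrices with respect to \<open>s\<close>, with both one-sided relations as part
  of the definition; they are the image of \<open>mtx\<close> on \<open>U 0\<close>.\<close>

definition unm :: "(nat \<Rightarrow> nat \<Rightarrow> 'a) set" where
  "unm = {M. (\<forall>i j. e * M i j = M i j) \<and> (\<forall>i j. \<not> (i < n \<and> j < n) \<longrightarrow> M i j = 0) \<and>
    (\<forall>i<n. \<forall>j<n. (\<Sum>k<n. s (M k i) * M k j) = (if i = j then e else 0)) \<and>
    (\<forall>i<n. \<forall>j<n. (\<Sum>k<n. M i k * s (M j k)) = (if i = j then e else 0))}"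

lemma unmD:
  assumes "M \<in> unm"
  shows "e * M i j = M i j" "\<not> (i < n \<and> j < n) \<Longrightarrow> M i j = 0"
    "i < n \<Longrightarrow> j < n \<Longrightarrow> (\<Sum>k<n. s (M k i) * M k j) = (if i = j then e else 0)"
    "i < n \<Longrightarrow> j < n \<Longrightarrow> (\<Sum>k<n. M i k * s (M j k)) = (if i = j then e else 0)"
  using assms unfolding unm_def by blast+

lemma ip_bv_left: "i < n \<Longrightarrow> ip (bv i) x = e * x i"
proof -
  assume i: "i < n"
  have "ip (bv i) x = (\<Sum>k<n. if k = i then e * x i else 0)"
    unfolding ip_def bv_def by (intro sum.cong refl) auto
  then show ?thesis using i by simp
qed

lemma act_bv: assumes "g \<in> U 0" "k < n" shows "e * act g (bv k) i = act g (bv k) i" "n \<le> i \<Longrightarrow> act g (bv k) i = 0"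
proof -
  have "bv k \<in> V 0 n" using assms(2) by (auto simp: V_def bv_def)
  then have "act g (bv k) \<in> V 0 n" by (rule U_V[OF assms(1)])
  then show "e * act g (bv k) i = act g (bv k) i" "n \<le> i \<Longrightarrow> act g (bv k) i = 0" unfolding V_def by auto
qed

lemma e_mtx: "g \<in> U 0 \<Longrightarrow> e * mtx g i j = mtx g i j"
  by (simp add: mtx_def act_bv)

lemma act_expand:
  assumes g: "g \<in> U 0" and x: "x \<in> V 0 n" and i: "i < n"
  shows "act g x i = (\<Sum>k<n. mtx g i k * x k)"
  using x
proof (induction rule: V_induct)
  case zero
  have "act g 0 i = (\<Sum>k<n. mtx g i k * (0 :: nat \<Rightarrow> 'a) k)" using U_lin(1)[OF g] by simp
  then show ?case .
next
  case (add x y)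
  then have "act g (x + y) i = (\<Sum>k<n. mtx g i k * (x + y) k)"
    using UD(1)[OF g] by (simp add: distrib_left sum.distrib)
  then show ?case .
next
  case (bv c j)
  then have j: "j < n" by simp
  have "(\<Sum>k<n. mtx g i k * sm c (bv j) k) = (\<Sum>k<n. if k = j then c * (e * act g (bv j) i) else 0)"
    by (intro sum.cong refl) (simp add: bv_def mtx_def i mult_ac)
  then have "act g (sm c (bv j)) i = (\<Sum>k<n. mtx g i k * sm c (bv j) k)"
    using UD(2)[OF g] j act_bv(1)[OF g j] by simp
  then show ?case .
qed

lemma mtx_add:
  assumes g: "g \<in> U 0" and h: "h \<in> U 0" and ij: "i < n" "j < n"
  shows "mtx (g + h) i j = (\<Sum>k<n. mtx g i k * mtx h k j)"
proof -
  have "bv j \<in> V 0 n" using ij by (auto simp: V_def bv_def)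
  then have "act h (bv j) \<in> V 0 n" by (rule U_V[OF h])
  then have "act g (act h (bv j)) i = (\<Sum>k<n. mtx g i k * act h (bv j) k)" by (rule act_expand[OF g _ ij(1)])
  then show ?thesis using ij by (simp add: mtx_def)
qed

lemma mtx_zero: "mtx 0 i j = (if i = j \<and> i < n then e else 0)"
  by (auto simp: mtx_def bv_def)

lemma mtx_uminus:
  assumes g: "g \<in> U 0" shows "mtx (- g) i j = s (mtx g j i)"
proof (cases "i < n \<and> j < n")
  case True
  have "ip (bv i) (act (- g) (bv j)) = ip (act g (bv i)) (bv j)"
    using UD(3)[OF g, of "bv i" "act (- g) (bv j)"] by simp
  also have "\<dots> = s (ip (bv j) (act g (bv i)))" by (rule ip_sym)
  finally show ?thesis
    using True act_bv(1)[OF g] act_bv(1)[OF U_uminus[OF g]] by (simp add: ip_bv_left mtx_def)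
qed (auto simp: mtx_def)

lemma mtx_unm: assumes g: "g \<in> U 0" shows "mtx g \<in> unm"
proof -
  have "(\<Sum>k<n. s (mtx g k i) * mtx g k j) = (if i = j then e else 0)" if "i < n" "j < n" for i j
    using mtx_add[OF U_uminus[OF g] g that] that by (simp add: mtx_uminus[OF g] mtx_zero)
  moreover have "(\<Sum>k<n. mtx g i k * s (mtx g j k)) = (if i = j then e else 0)" if "i < n" "j < n" for i j
    using mtx_add[OF g U_uminus[OF g] that] that by (simp add: mtx_uminus[OF g] mtx_zero)
  ultimately show ?thesis unfolding unm_def using e_mtx[OF g] by (auto simp: mtx_def)
qed

lemma mtx_inj: assumes "g \<in> U 0" "h \<in> U 0" "mtx g = mtx h" shows "g = h"
proof (rule U_eqI[OF assms(1,2)], rule ext)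
  fix k i assume k: "k < n"
  show "act g (bv k) i = act h (bv k) i"
  proof (cases "i < n")
    case True then show ?thesis using fun_cong[OF fun_cong[OF assms(3), of i], of k] k by (simp add: mtx_def)
  next
    case False then show ?thesis using act_bv(2)[OF assms(1) k, of i] act_bv(2)[OF assms(2) k, of i] by simp
  qed
qed

text \<open>The matrix acts on the \<open>e\<close>-part of the first \<open>n\<close> coordinates,
  while the complementary part \<open>x i - e * x i\<close> and all further coordinates are kept, as
  membership in \<open>U\<close> demands.\<close>

definition mact :: "(nat \<Rightarrow> nat \<Rightarrow> 'a) \<Rightarrow> (nat \<Rightarrow> 'a) \<Rightarrow> nat \<Rightarrow> 'a" where
  "mact M x = (\<lambda>i. if i < n then x i - e * x i + (\<Sum>k<n. M i k * x k) else x i)"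

lemma mact_mact:
  assumes "\<And>i k. e * M i k = M i k" "\<And>i k. e * M' i k = M' i k"
    and "\<And>i l. i < n \<Longrightarrow> l < n \<Longrightarrow> (\<Sum>k<n. M i k * M' k l) = (if i = l then e else 0)"
  shows "mact M (mact M' x) = x"
proof
  fix i
  show "mact M (mact M' x) i = x i"
  proof (cases "i < n")
    case i: True
    have Me: "M i k * (y - e * y) = 0" for k y
    proof -
      have "M i k * (y - e * y) = M i k * y - (e * M i k) * y" by (simp only: right_diff_distrib mult_ac)
      then show ?thesis by (simp only: assms(1) diff_self)
    qed
    have "(\<Sum>k<n. M i k * mact M' x k) = (\<Sum>k<n. M i k * (\<Sum>l<n. M' k l * x l))"
      by (intro sum.cong refl) (simp add: mact_def distrib_left Me)
    also have "\<dots> = (\<Sum>k<n. \<Sum>l<n. (M i k * M' k l) * x l)" by (simp only: sum_distrib_left mult.assoc)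
    also have "\<dots> = (\<Sum>l<n. \<Sum>k<n. (M i k * M' k l) * x l)" by (rule sum.swap)
    also have "\<dots> = (\<Sum>l<n. if l = i then e * x i else 0)"
      by (intro sum.cong refl) (simp add: sum_distrib_right[symmetric] assms(3)[OF i])
    also have "\<dots> = e * x i" using i by simp
    finally have S: "(\<Sum>k<n. M i k * mact M' x k) = e * x i" .
    have "e * (\<Sum>k<n. M' i k * x k) = (\<Sum>k<n. M' i k * x k)"
      by (simp only: sum_distrib_left mult.assoc[symmetric] assms(2))
    then have "e * mact M' x i = (\<Sum>k<n. M' i k * x k)"
      using i by (simp add: mact_def distrib_left right_diff_distrib mult.assoc[symmetric])
    then have "mact M' x i - e * mact M' x i = x i - e * x i" using i by (simp add: mact_def)
    then show ?thesis using i S unfolding mact_def[of M] by simp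
  qed (simp add: mact_def)
qed

lemma mtx_surj: assumes M: "M \<in> unm" shows "\<exists>g\<in>U 0. mtx g = M"
proof -
  note D = unmD[OF M]
  define M' where "M' = (\<lambda>i j. s (M j i))"
  have eM': "e * M' i j = M' i j" for i j unfolding M'_def by (rule e_s[OF D(1)])
  have 1: "mact M (mact M' x) = x" for x
    by (rule mact_mact[OF D(1) eM']) (simp only: M'_def D(4))
  have 2: "mact M' (mact M x) = x" for x
    by (rule mact_mact[OF eM' D(1)]) (simp only: M'_def D(3))
  have "bij (mact M)" by (rule o_bij[of "mact M'"]) (simp_all add: fun_eq_iff 1 2)
  define g where "g = Abs_sym (mact M)"
  have ag: "act g = mact M" unfolding g_def by (rule act_Abs) fact
  have p1: "mact M (x + y) = mact M x + mact M y" for x y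
    by (rule ext) (simp add: mact_def distrib_left sum.distrib algebra_simps)
  have p2: "mact M (sm c x) = sm c (mact M x)" for c x
    by (rule ext) (simp add: mact_def sum_distrib_left distrib_left right_diff_distrib mult_ac)
  have p3: "ip (mact M x) (mact M y) = ip x y" for x y
  proof -
    define X where "X = (\<lambda>i. \<Sum>k<n. M i k * x k)"
    define Y where "Y = (\<lambda>i. \<Sum>k<n. M i k * y k)"
    have eX: "e * X i = X i" "e * Y i = Y i" for i
      unfolding X_def Y_def by (simp_all only: sum_distrib_left mult.assoc[symmetric] D(1))
    have esX: "e * s (X i) = s (X i)" for i by (rule e_s[OF eX(1)])
    have t: "(u - e * u + P) * (w - e * w + Q) = u * w - e * (u * w) + P * Q"
      if "e * P = P" "e * Q = Q" for u w P Q
    proof -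
      have a: "(u - e * u) * Q = 0"
      proof -
        have "(u - e * u) * Q = u * Q - u * (e * Q)" by (simp add: algebra_simps)
        then show ?thesis by (simp only: that diff_self)
      qed
      have b: "P * (w - e * w) = 0"
      proof -
        have "P * (w - e * w) = P * w - (e * P) * w" by (simp only: right_diff_distrib mult_ac)
        then show ?thesis by (simp only: that diff_self)
      qed
      have ee: "e * u * (e * w) = e * (u * w)"
      proof -
        have "e * u * (e * w) = (e * e) * (u * w)" by (simp only: mult_ac)
        then show ?thesis by (simp only: e_e)
      qed
      have c: "(u - e * u) * (w - e * w) = u * w - e * (u * w)"
      proof -
        have "(u - e * u) * (w - e * w) = u * w - e * u * w - u * (e * w) + e * u * (e * w)" by (simp add: algebra_simps)
        moreover have "e * u * w = e * (u * w)" "u * (e * w) = e * (u * w)" by (simp_all only: mult_ac)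
        ultimately show ?thesis by (simp only: ee) simp
      qed
      have "(u - e * u + P) * (w - e * w + Q) = (u - e * u) * (w - e * w) + (u - e * u) * Q + P * (w - e * w) + P * Q"
        by (simp only: distrib_left distrib_right add_ac)
      then show ?thesis by (simp only: a b c add_0_right)
    qed
    have "ip (mact M x) (mact M y) = (\<Sum>i<n. s (x i) * y i - e * (s (x i) * y i) + s (X i) * Y i)"
      unfolding ip_def
    proof (intro sum.cong refl)
      fix i assume "i \<in> {..<n}"
      then have m: "mact M x i = x i - e * x i + X i" "mact M y i = y i - e * y i + Y i" by (simp_all add: mact_def X_def Y_def)
      have "s (mact M x i) = s (x i) - e * s (x i) + s (X i)" unfolding m by (simp only: s_add s_diff s_mult s_e)
      then show "s (mact M x i) * mact M y i = s (x i) * y i - e * (s (x i) * y i) + s (X i) * Y i"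
        unfolding m(2) using t[OF esX eX(2)] by simp
    qed
    also have "\<dots> = (\<Sum>i<n. s (x i) * y i) - (\<Sum>i<n. e * (s (x i) * y i)) + (\<Sum>i<n. s (X i) * Y i)"
      by (simp only: sum.distrib sum_subtractf)
    also have "(\<Sum>i<n. s (X i) * Y i) = (\<Sum>i<n. e * (s (x i) * y i))"
    proof -
      have "(\<Sum>i<n. s (X i) * Y i) = (\<Sum>i<n. \<Sum>k<n. \<Sum>l<n. s (x k) * y l * (s (M i k) * M i l))"
        unfolding X_def Y_def s_sum sum_product by (intro sum.cong refl) (simp add: s_mult mult_ac)
      also have "\<dots> = (\<Sum>k<n. \<Sum>i<n. \<Sum>l<n. s (x k) * y l * (s (M i k) * M i l))" by (rule sum.swap)
      also have "\<dots> = (\<Sum>k<n. \<Sum>l<n. \<Sum>i<n. s (x k) * y l * (s (M i k) * M i l))"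
        by (rule sum.cong[OF refl]) (rule sum.swap)
      also have "\<dots> = (\<Sum>k<n. \<Sum>l<n. if l = k then e * (s (x k) * y k) else 0)"
      proof (intro sum.cong refl)
        fix k l assume "k \<in> {..<n}" "l \<in> {..<n}"
        then have "(\<Sum>i<n. s (x k) * y l * (s (M i k) * M i l)) = s (x k) * y l * (if k = l then e else 0)"
          using D(3)[of k l] by (simp only: sum_distrib_left[symmetric] lessThan_iff)
        then show "(\<Sum>i<n. s (x k) * y l * (s (M i k) * M i l)) = (if l = k then e * (s (x k) * y k) else 0)"
          by (cases "k = l") (simp_all add: mult_ac)
      qed
      finally show ?thesis by simp
    qed
    finally show ?thesis unfolding ip_def by simp
  qed
  have p4: "mact M x - x \<in> V 0 n" for x
  proof -
    have "e * (\<Sum>k<n. M i k * x k) = (\<Sum>k<n. M i k * x k)" for i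
      by (simp only: sum_distrib_left mult.assoc[symmetric] D(1))
    then show ?thesis by (auto simp: V_def mact_def distrib_left right_diff_distrib mult.assoc[symmetric])
  qed
  have p5: "mact M x = x" if x: "\<forall>i<n. e * x i = 0" for x
  proof
    fix i
    have "M i k * x k = 0" if "k < n" for k
    proof -
      have "M i k * x k = (e * M i k) * x k" by (simp only: D(1))
      also have "\<dots> = M i k * (e * x k)" by (simp only: mult_ac)
      finally show ?thesis using x that by simp
    qed
    then show "mact M x i = x i" using x by (simp add: mact_def)
  qed
  have "g \<in> U 0" unfolding U_def using p1 p2 p3 p4 p5 by (simp add: ag)
  moreover have "mtx g = M"
  proof (intro ext)
    fix i j
    show "mtx g i j = M i j"
    proof (cases "i < n \<and> j < n")
      case True
      have "(\<Sum>k<n. M i k * bv j k) = (\<Sum>k<n. if k = j then e * M i j else 0)"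
        by (intro sum.cong refl) (simp add: bv_def mult.commute)
      then have "(\<Sum>k<n. M i k * bv j k) = M i j" using True D(1) by simp
      then show ?thesis using True by (simp add: mtx_def ag mact_def bv_def)
    qed (auto simp: mtx_def D(2))
  qed
  ultimately show ?thesis by blast
qed

definition dt :: "(nat \<Rightarrow> 'a) sym \<Rightarrow> 'a" where "dt g = det (mat n n (\<lambda>(i, j). mtx g i j))"

lemma dt_add: assumes "g \<in> U 0" "h \<in> U 0" shows "dt (g + h) = dt g * dt h"
proof -
  have "mat n n (\<lambda>(i, j). mtx (g + h) i j) = mat n n (\<lambda>(i, j). mtx g i j) * mat n n (\<lambda>(i, j). mtx h i j)"
    by (rule eq_matI) (auto simp: mtx_add[OF assms] scalar_prod_def lessThan_atLeast0)
  then show ?thesis unfolding dt_def by (simp only: det_mult[of _ n] mat_carrier)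
qed

lemma dt_zero: "dt 0 = e ^ n"
proof -
  have "mat n n (\<lambda>(i, j). mtx 0 i j) = e \<cdot>\<^sub>m 1\<^sub>m n"
    by (rule eq_matI) (auto simp: mtx_zero)
  then show ?thesis by (simp add: dt_def)
qed

text \<open>For a fixed axis transvections add in their parameter, and the determinant is
  multiplicative. The factor \<open>e ^ n\<close> is the determinant of the identity isometry, whose
  matrix has diagonal entries \<open>e\<close> instead of 1.\<close>

lemma dt_tv_mult:
  assumes z: "z \<in> V 0 n" "ip z z = 0" and a: "s a = - a"
  shows "dt (tv z (of_nat k * a)) = dt (tv z a) ^ k * e ^ n"
proof (induction k)
  case 0 show ?case using z by (simp add: tv_0 dt_zero)
next
  case (Suc k)
  have sk: "s (of_nat k * a) = - (of_nat k * a)"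
  proof (induction k)
    case (Suc k)
    have "s (of_nat (Suc k) * a) = s a + s (of_nat k * a)" by (simp add: distrib_right s_add)
    also have "\<dots> = - a + - (of_nat k * a)" by (simp only: a Suc)
    finally show ?case by (simp add: distrib_right)
  qed simp
  have "tv z (of_nat (Suc k) * a) = tv z a + tv z (of_nat k * a)"
    using tv_add[OF z(2) a sk] by (simp add: distrib_right)
  then have "dt (tv z (of_nat (Suc k) * a)) = dt (tv z a) * dt (tv z (of_nat k * a))"
    using dt_add[OF tv_U[OF z a] tv_U[OF z sk]] by simp
  then show ?case by (simp only: Suc power_Suc mult.assoc)
qed

end


section \<open>The linear and unitary groups as isometry groups\<close>

lemma (in nat_field) pow_card:
  assumes fin: "finite (carrier R)" and x: "x \<in> carrier R" shows "x [^] card (carrier R) = x"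
proof (cases "x = \<zero>")
  case True
  have "card (carrier R) > 0" using fin x by (auto simp: card_gt_0_iff)
  then show ?thesis using True by (cases "card (carrier R)") auto
next
  case False
  interpret M: group "mult_of R" by (rule field_mult_group)
  have "x [^]\<^bsub>mult_of R\<^esub> Coset.order (mult_of R) = \<one>\<^bsub>mult_of R\<^esub>" by (rule M.pow_order_eq_1) (use x False in simp)
  then have "x [^] (card (carrier R) - 1) = \<one>" using fin by (simp add: Coset.order_def nat_pow_mult_of card_Diff_singleton)
  moreover have "card (carrier R) = Suc (card (carrier R) - 1)" using fin x by (metis Suc_pred' card_gt_0_iff empty_iff)
  ultimately show ?thesis using x by (metis l_one nat_pow_Suc)
qed

text \<open>The interface at which the linear and the unitary case merge: projecting to the first
  copy of \<open>R\<close> identifies the unitary matrices with \<open>GLeps\<close>. Injectivity is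
  a condition of its own because the projection forgets the second component, which in the linear
  case has to be recovered from the relations in \<open>unm\<close>.\<close>

locale matrix_model = nat_field R + hgeom s e q \<alpha> b \<delta> \<delta>i n
  for R :: "nat ring" (structure) and s :: "uring \<Rightarrow> uring" and e q \<alpha> b \<delta> \<delta>i n +
  fixes eps :: bool
  assumes fin: "finite (carrier R)" and card_R: "card (carrier R) = (if eps then q else q\<^sup>2)"
    and prj_e: "cp e (R, True) = \<one>"
    and fm_GLeps: "M \<in> unm \<Longrightarrow> (\<lambda>i j. cp (M i j) (R, True)) \<in> GLeps R n q eps"
    and fm_lift: "X \<in> GLeps R n q eps \<Longrightarrow> \<exists>M\<in>unm. \<forall>i j. cp (M i j) (R, True) = X i j"
    and fm_unm_inj: "M \<in> unm \<Longrightarrow> M' \<in> unm \<Longrightarrow> (\<And>i j. cp (M i j) (R, True) = cp (M' i j) (R, True)) \<Longrightarrow> M = M'"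
begin

definition fm :: "(nat \<Rightarrow> uring) sym \<Rightarrow> nat \<Rightarrow> nat \<Rightarrow> nat" where
  "fm g = (\<lambda>i j. prj (mtx g i j))"

lemma fm_mem: "g \<in> U 0 \<Longrightarrow> fm g \<in> GLeps R n q eps"
  unfolding fm_def by (rule fm_GLeps[OF mtx_unm])

lemma fm_add: assumes "g \<in> U 0" "h \<in> U 0" shows "fm (g + h) = fmat_mul R n (fm g) (fm h)"
proof (intro ext)
  fix i j
  show "fm (g + h) i j = fmat_mul R n (fm g) (fm h) i j"
  proof (cases "i < n \<and> j < n")
    case True
    then show ?thesis by (simp add: fm_def fmat_mul_def mtx_add[OF assms] prj_sum)
  qed (auto simp: fm_def fmat_mul_def mtx_def)
qed

lemma fm_zero: "fm 0 = fmat_one R n"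
  by (intro ext) (simp add: fm_def fmat_one_def mtx_zero prj_e)

lemma fm_surj: assumes "X \<in> GLeps R n q eps" shows "\<exists>g\<in>U 0. fm g = X"
proof -
  obtain M where M: "M \<in> unm" "\<And>i j. prj (M i j) = X i j" using fm_lift[OF assms] by blast
  obtain g where "g \<in> U 0" "mtx g = M" using mtx_surj[OF M(1)] by blast
  then show ?thesis using M(2) by (intro bexI[of _ g] ext) (simp_all add: fm_def)
qed

lemma fm_inj: assumes "g \<in> U 0" "h \<in> U 0" "fm g = fm h" shows "g = h"
proof (rule mtx_inj[OF assms(1,2)], rule fm_unm_inj[OF mtx_unm mtx_unm, OF assms(1,2)])
  fix i j show "prj (mtx g i j) = prj (mtx h i j)"
    using fun_cong[OF fun_cong[OF assms(3), of i], of j] by (simp add: fm_def)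
qed

lemma prj_dt: "prj (dt g) = fmat_det R n (fm g)"
proof -
  let ?P = "{p. p permutes {..<n}}"
  have "prj (dt g) = (\<Oplus>p\<in>?P. prj (signof p * (\<Prod>i<n. mtx g i (p i))))"
  proof -
    have "dt g = (\<Sum>p\<in>?P. signof p * (\<Prod>i<n. mat n n (\<lambda>(i, j). mtx g i j) $$ (i, p i)))"
      unfolding dt_def by (subst det_def'[of _ n]) (simp_all add: lessThan_atLeast0)
    also have "\<dots> = (\<Sum>p\<in>?P. signof p * (\<Prod>i<n. mtx g i (p i)))"
    proof (intro sum.cong refl, rule arg_cong[where f = "times _"], intro prod.cong refl)
      fix p i assume "p \<in> ?P" "i \<in> {..<n}"
      then have "i < n" "p i < n" using permutes_in_image[of p "{..<n}" i] by auto
      then show "mat n n (\<lambda>(i, j). mtx g i j) $$ (i, p i) = mtx g i (p i)" by simp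
    qed
    finally show ?thesis by (simp only: prj_sum)
  qed
  also have "\<dots> = fmat_det R n (fm g)"
    unfolding fmat_det_def
  proof (rule finsum_cong')
    fix p
    have "prj (\<Prod>i<n. mtx g i (p i)) = (\<Otimes>i\<in>{..<n}. fm g i (p i))"
      by (simp add: cp_prod fm_def)
    moreover have "(\<Otimes>i\<in>{..<n}. fm g i (p i)) \<in> carrier R" by (rule finprod_closed) (auto simp: fm_def)
    ultimately show "prj (signof p * (\<Prod>i<n. mtx g i (p i))) = (if evenperm p then \<Otimes>i\<in>{..<n}. fm g i (p i)
        else \<ominus> (\<Otimes>i\<in>{..<n}. fm g i (p i)))"
      by (simp add: sign_def l_minus)
  qed (auto simp: fm_def intro!: finprod_closed)
  finally show ?thesis .
qed

lemma prj_dt_add: "g \<in> U 0 \<Longrightarrow> h \<in> U 0 \<Longrightarrow> prj (dt (g + h)) = prj (dt g) \<otimes> prj (dt h)"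
  by (simp add: dt_add)

lemma prj_dt_zero: "prj (dt 0) = \<one>"
  by (simp add: dt_zero prj_e)

text \<open>Translation by \<open>e\<close> permutes the finite set \<open>F\<close>, so comparing
  the sums over \<open>F\<close> gives \<open>card F\<close> times \<open>e\<close> equal to
  zero.\<close>

lemma q_e: "of_nat q * e = 0"
proof -
  have "(\<Sum>x\<in>F. x + e) = (\<Sum>x\<in>F. x)"
    by (rule sum.reindex_bij_witness[of _ "\<lambda>x. x - e" "\<lambda>x. x + e"])
      (auto simp: in_F distrib_left right_diff_distrib s_add s_diff)
  then have "of_nat (card F) * e = 0" by (simp add: sum.distrib)
  then show ?thesis by (simp add: card_F')
qed

text \<open>The determinant of a transvection has order dividing \<open>q\<close>, while \<open>d ^ |R| = d\<close> in \<open>R\<close>.\<close>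
lemma prj_dt_tv:
  assumes z: "z \<in> V 0 n" "ip z z = 0" and a: "e * a = a" "s a = - a"
  shows "prj (dt (tv z a)) = \<one>"
proof -
  let ?d = "prj (dt (tv z a))"
  have "of_nat q * a = of_nat q * e * a" by (simp only: mult.assoc a(1))
  then have "of_nat q * a = 0" by (simp add: q_e)
  then have "dt (tv z 0) = dt (tv z a) ^ q * e ^ n" using dt_tv_mult[OF z a(2), of q] by simp
  then have "prj (dt 0) = ?d [^] q \<otimes> prj e [^] n" using tv_0[OF z(2)] by simp
  then have dq: "?d [^] q = \<one>" using prj_dt_zero by (simp add: prj_e)
  have "card (carrier R) = q * (if eps then 1 else q)" using card_R by (simp add: power2_eq_square)
  then have "?d [^] card (carrier R) = (?d [^] q) [^] (if eps then 1 else q)" by (simp add: nat_pow_pow)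
  then show ?thesis using pow_card[OF fin, of ?d] dq by simp
qed

lemma prj_dt_N: "g \<in> N 0 \<Longrightarrow> prj (dt g) = \<one>"
proof (induction rule: N.induct)
  case N_zero show ?case by (rule prj_dt_zero)
next
  case (N_step z a g)
  then show ?case using prj_dt_add[OF tv_U[of z 0 a] N_U0[of g]] prj_dt_tv[of z a] by simp
qed

lemma SL_iff: "g \<in> U 0 \<Longrightarrow> fm g \<in> SLeps R n q eps \<longleftrightarrow> prj (dt g) = \<one>"
  by (simp add: SLeps_def fm_mem prj_dt)

text \<open>Transvections have determinant one, so the preimages of both groups lie between
  \<open>N 0\<close> and \<open>U 0\<close>, which is the setting of
  \<open>character_bound\<close>.\<close>

lemma sgrp_preimage:
  assumes G: "G = GLeps R n q eps \<or> G = SLeps R n q eps"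
  defines "H \<equiv> {g \<in> U 0. fm g \<in> G}"
  shows "sgrp H" "N 0 \<subseteq> H"
proof -
  have "H = U 0 \<or> H = {g \<in> U 0. prj (dt g) = \<one>}"
    using G fm_mem SL_iff unfolding H_def by blast
  moreover have "finite (U 0)" by (rule card_U(1)) simp
  moreover have "prj (dt (- g)) = \<one>" if "g \<in> U 0" "prj (dt g) = \<one>" for g
    using prj_dt_add[OF that(1) U_uminus[OF that(1)]] that(2) prj_dt_zero by simp
  ultimately show "sgrp H" "N 0 \<subseteq> H"
    by (auto simp: sgrp_def U_zero U_add U_uminus prj_dt_add prj_dt_zero prj_dt_N N_U0)
qed

text \<open>The matrix representation is pulled back along \<open>fm\<close> to a group of
  isometries. It stays irreducible because \<open>fm\<close> maps onto \<open>G\<close>, and its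
  unitarisation satisfies \<open>irrchar\<close>.\<close>

theorem irr_char_bound:
  assumes G: "G = GLeps R n q eps \<or> G = SLeps R n q eps"
    and \<chi>: "irr_char (mat_group R n G) \<chi>" and g: "g \<in> G"
    and C: "C \<ge> 1" and K: "real K \<ge> C * 2 ^ m" and n: "n \<ge> hchar.bound_n K m"
    and cent: "real (card {x \<in> GLeps R n q eps. fmat_mul R n x g = fmat_mul R n g x}) \<le> real q powr (C * real n)"
  shows "cmod (\<chi> g) \<le> cmod (\<chi> (fmat_one R n)) powr (1 / 2 ^ m)"
proof -
  have eF: "e \<in> F" by (simp add: in_F)
  obtain \<kappa> where \<kappa>: "\<forall>x\<in>F. \<forall>y\<in>F. \<kappa> (x + y) = \<kappa> x * \<kappa> y" "\<forall>x\<in>F. cmod (\<kappa> x) = 1" "\<exists>x\<in>F. \<kappa> x \<noteq> 1"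
    using nontrivial_char[OF sgrp_F eF e_nz] by blast
  interpret hchar s e q \<alpha> b \<delta> \<delta>i n \<kappa>
    by unfold_locales (use \<kappa> in blast)+
  define H where "H = {g \<in> U 0. fm g \<in> G}"
  note H = sgrp_preimage[OF G, folded H_def]
  have HU: "H \<subseteq> U 0" by (auto simp: H_def)
  have GG: "G \<subseteq> GLeps R n q eps" using G by (auto simp: SLeps_def)
  obtain d \<rho> where rep: "is_rep (mat_group R n G) d \<rho>" and ir: "rep_irreducible (mat_group R n G) d \<rho>"
    and ch: "\<And>x. x \<in> G \<Longrightarrow> \<chi> x = mtrace (\<rho> x)"
    using \<chi> unfolding irr_char_def by (auto simp: mat_group_def)
  have HG: "fm x \<in> G" if "x \<in> H" for x using that by (simp add: H_def)
  have HS: "\<exists>x\<in>H. fm x = y" if y: "y \<in> G" for y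
  proof -
    have "y \<in> GLeps R n q eps" using y GG by blast
    from fm_surj[OF this] obtain x where "x \<in> U 0" "fm x = y" by blast
    then show ?thesis using y by (intro bexI[of _ x]) (simp_all add: H_def)
  qed
  interpret M: matrep H "\<lambda>x. \<rho> (fm x)" d
  proof
    show "sgrp H" by (rule H(1))
    show "\<rho> (fm x) \<in> carrier_mat d d" if "x \<in> H" for x
      using rep HG[OF that] by (simp add: is_rep_def mat_group_def)
    show "\<rho> (fm 0) = 1\<^sub>m d" using rep by (simp add: is_rep_def mat_group_def fm_zero)
    show "\<rho> (fm (x + y)) = \<rho> (fm x) * \<rho> (fm y)" if "x \<in> H" "y \<in> H" for x y
    proof -
      have "fm (x + y) = fmat_mul R n (fm x) (fm y)" by (rule fm_add) (use that HU in blast)+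
      then show ?thesis using rep HG[OF that(1)] HG[OF that(2)] by (simp add: is_rep_def mat_group_def)
    qed
    show "d > 0" using ir by (simp add: rep_irreducible_def)
    show "W = {0\<^sub>v d} \<or> W = carrier_vec d"
      if W: "W \<subseteq> carrier_vec d" "0\<^sub>v d \<in> W" "\<And>u w. u \<in> W \<Longrightarrow> w \<in> W \<Longrightarrow> u + w \<in> W"
        "\<And>c u. u \<in> W \<Longrightarrow> c \<cdot>\<^sub>v u \<in> W" "\<And>g u. g \<in> H \<Longrightarrow> u \<in> W \<Longrightarrow> \<rho> (fm g) *\<^sub>v u \<in> W" for W
    proof -
      have "\<rho> y *\<^sub>v u \<in> W" if "y \<in> G" "u \<in> W" for y u
        using HS[OF that(1)] W(5) that(2) by blast
      then show ?thesis
        using ir W unfolding rep_irreducible_def mat_group_def by simp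
    qed
  qed
  obtain x where x: "x \<in> H" "fm x = g" using HS[OF g] by blast
  have tr: "tr (M.R y) = \<chi> (fm y)" if "y \<in> H" for y
    using M.tr_R[OF that] ch[OF HG[OF that]] by simp
  \<comment> \<open>The centraliser within \<open>H\<close> embeds into the centraliser within the
    full group, which is the one bounded by \<open>cent\<close>.\<close>
  have "card {y \<in> H. y + x = x + y} \<le> card {A \<in> GLeps R n q eps. fmat_mul R n A g = fmat_mul R n g A}"
  proof (rule card_inj_on_le)
    show "inj_on fm {y \<in> H. y + x = x + y}" using fm_inj HU by (intro inj_onI) blast
    show "fm ` {y \<in> H. y + x = x + y} \<subseteq> {A \<in> GLeps R n q eps. fmat_mul R n A g = fmat_mul R n g A}"
    proof
      fix A assume "A \<in> fm ` {y \<in> H. y + x = x + y}"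
      then obtain y where y: "y \<in> H" "y + x = x + y" "A = fm y" by blast
      have yx: "y \<in> U 0" "x \<in> U 0" using y x HU by auto
      show "A \<in> {A \<in> GLeps R n q eps. fmat_mul R n A g = fmat_mul R n g A}"
        using fm_add[OF yx] fm_add[OF yx(2,1)] y(2,3) x(2) fm_mem[OF yx(1)] by simp
    qed
    have "GLeps R n q eps \<subseteq> fm ` U 0" using fm_surj by blast
    moreover have "finite (U 0)" by (rule card_U(1)) simp
    ultimately show "finite {A \<in> GLeps R n q eps. fmat_mul R n A g = fmat_mul R n g A}"
      by (auto intro: finite_subset)
  qed
  then have cent': "real (card {y \<in> H. y + x = x + y}) \<le> real q powr (C * real n)" using cent by linarith
  have "cmod (tr (M.R x)) \<le> cmod (tr (M.R 0)) powr (1 / 2 ^ m)"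
    by (rule character_bound[OF M.irrchar H(2) HU x(1) C K n cent'])
  then show ?thesis using tr[OF x(1)] tr[OF sgrpD(2)[OF H(1)]] x(2) fm_zero by simp
qed

end


section \<open>The unitary and the linear model\<close>

lemma (in nat_field) matrix_model_U:
  assumes fin: "finite (carrier R)" and q: "card (carrier R) = q\<^sup>2"
  shows "\<exists>s e \<alpha> b \<delta> \<delta>i. matrix_model R s e q \<alpha> b \<delta> \<delta>i n False"
proof -
  obtain a where "idem_field (pr R \<one> \<zero>) a q" using idem_field_U[OF fin q] by blast
  then interpret I: idem_field "pr R \<one> \<zero>" a q .
  obtain \<alpha> b \<delta> \<delta>i where h: "hring I.frob (pr R \<one> \<zero>) q \<alpha> b \<delta> \<delta>i" using I.hring_exists by (elim exE)
  interpret hgeom I.frob "pr R \<one> \<zero>" q \<alpha> b \<delta> \<delta>i n by (rule hgeom.intro[OF h])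
  have q0: "q > 0" using q_ge_2 by simp
  have frob_prj: "prj (I.frob x) = prj x [^] q" for x
  proof -
    have "prj (x - pr R \<one> \<zero> * x) = \<zero>"
      unfolding diff_conv_add_uminus by (simp add: r_neg del: add_uminus_conv_diff)
    then show ?thesis by (simp add: I.frob_def)
  qed
  have one: "prj (\<Sum>k<n. f k) = fmat_one R n i j"
    if "(\<Sum>k<n. f k) = (if i = j then pr R \<one> \<zero> else 0)" "i < n" "j < n" for i j and f :: "nat \<Rightarrow> uring"
    unfolding that(1) using that(2,3) by (simp add: fmat_one_def)
  have "matrix_model R I.frob (pr R \<one> \<zero>) q \<alpha> b \<delta> \<delta>i n False"
  proof
    show "finite (carrier R)" by (rule fin)
    show "card (carrier R) = (if False then q else q\<^sup>2)" using q by simp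
    show "prj (pr R \<one> \<zero>) = \<one>" by simp
    show "(\<lambda>i j. prj (M i j)) \<in> GLeps R n q False" if M: "M \<in> unm" for M
    proof -
      let ?A = "\<lambda>i j. prj (M i j)"
      have A: "?A \<in> fmats R n" using unmD(2)[OF M] by (auto simp: fmats_def)
      have C: "conj_tr R n q ?A = (\<lambda>i j. prj (I.frob (M j i)))"
        using unmD(2)[OF M] q0 by (intro ext) (auto simp: conj_tr_def frob_prj nat_pow_zero)
      have Cm: "conj_tr R n q ?A \<in> fmats R n"
        using A by (auto simp: conj_tr_def fmats_def)
      have 1: "fmat_mul R n (conj_tr R n q ?A) ?A = fmat_one R n"
      proof (intro ext)
        fix i j
        show "fmat_mul R n (conj_tr R n q ?A) ?A i j = fmat_one R n i j"
        proof (cases "i < n \<and> j < n")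
          case True
          have "fmat_mul R n (conj_tr R n q ?A) ?A i j = prj (\<Sum>k<n. I.frob (M k i) * M k j)"
            unfolding C using True by (simp add: fmat_mul_def prj_sum)
          then show ?thesis using one[OF unmD(3)[OF M]] True by simp
        qed (auto simp: fmat_mul_def fmat_one_def)
      qed
      have 2: "fmat_mul R n ?A (conj_tr R n q ?A) = fmat_one R n"
      proof (intro ext)
        fix i j
        show "fmat_mul R n ?A (conj_tr R n q ?A) i j = fmat_one R n i j"
        proof (cases "i < n \<and> j < n")
          case True
          have "fmat_mul R n ?A (conj_tr R n q ?A) i j = prj (\<Sum>k<n. M i k * I.frob (M j k))"
            unfolding C using True by (simp add: fmat_mul_def prj_sum)
          then show ?thesis using one[OF unmD(4)[OF M]] True by simp
        qed (auto simp: fmat_mul_def fmat_one_def)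
      qed
      show ?thesis using A Cm 1 2 unfolding GLeps_def GU_set_def GL_set_def by auto
    qed
    show "\<exists>M\<in>unm. \<forall>i j. prj (M i j) = A i j" if A: "A \<in> GLeps R n q False" for A
    proof -
      have A1: "A \<in> fmats R n" and CA: "fmat_mul R n (conj_tr R n q A) A = fmat_one R n"
        using A by (auto simp: GLeps_def GU_set_def GL_set_def)
      obtain B where B: "B \<in> fmats R n" "fmat_mul R n A B = fmat_one R n"
        using A by (auto simp: GLeps_def GU_set_def GL_set_def)
      have Cm: "conj_tr R n q A \<in> fmats R n" using A1 by (auto simp: conj_tr_def fmats_def)
      \<comment> \<open>\<open>GU_set\<close> states one relation between the matrix and its
        conjugate transpose; uniqueness of inverses supplies the other one demanded by
        \<open>unm\<close>.\<close>
      have AC: "fmat_mul R n A (conj_tr R n q A) = fmat_one R n"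
        using fmat_inverse_unique[OF A1 Cm B(1) CA B(2)] B(2) by simp
      note Ac = fmatsD(1)[OF A1]
      have s: "I.frob (lf A i j) = lf (conj_tr R n q A) j i" for i j
      proof -
        have e: "pr R \<one> \<zero> * lf A i j = lf A i j" using Ac by (simp add: lf_def pr_mult)
        have "pr R \<one> \<zero> * I.frob (lf A i j) = I.frob (lf A i j)" by (rule I.E_frobA[OF e])
        then have "I.frob (lf A i j) = pr R (prj (I.frob (lf A i j))) \<zero>" by (simp only: pr10)
        also have "prj (I.frob (lf A i j)) = conj_tr R n q A j i"
          using Ac fmatsD(2)[OF A1, of i j] q0 by (auto simp: frob_prj lf_def conj_tr_def nat_pow_zero)
        finally show ?thesis by (simp only: lf_def)
      qed
      have o: "lf (fmat_one R n) i j = (if i = j then pr R \<one> \<zero> else 0)" if "i < n" "j < n" for i j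
        using that by (auto simp: lf_def fmat_one_def pr_zero)
      have "lf A \<in> unm"
        unfolding unm_def mem_Collect_eq
      proof (intro conjI allI impI)
        fix i j
        show "pr R \<one> \<zero> * lf A i j = lf A i j" using Ac by (simp add: lf_def pr_mult)
        show "lf A i j = 0" if "\<not> (i < n \<and> j < n)" using fmatsD(2)[OF A1 that] by (simp add: lf_def pr_zero)
      next
        fix i j assume ij: "i < n" "j < n"
        show "(\<Sum>k<n. I.frob (lf A k i) * lf A k j) = (if i = j then pr R \<one> \<zero> else 0)"
          unfolding s lf_mul[OF Cm A1, symmetric] CA by (rule o[OF ij])
        show "(\<Sum>k<n. lf A i k * I.frob (lf A j k)) = (if i = j then pr R \<one> \<zero> else 0)"
          unfolding s lf_mul[OF A1 Cm, symmetric] AC by (rule o[OF ij])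
      qed
      then show ?thesis using Ac by (intro bexI[of _ "lf A"]) (simp_all add: lf_def)
    qed
    show "M = M'" if M: "M \<in> unm" "M' \<in> unm" and eq: "\<And>i j. prj (M i j) = prj (M' i j)" for M M'
    proof (intro ext)
      fix i j
      have "M i j = pr R (prj (M i j)) \<zero>" "M' i j = pr R (prj (M' i j)) \<zero>"
        using unmD(1)[OF M(1)] unmD(1)[OF M(2)] by (simp_all only: pr10)
      then show "M i j = M' i j" using eq[of i j] by (simp only:)
    qed
  qed
  then show ?thesis by (intro exI)
qed

text \<open>An invertible matrix is lifted by taking its inverse transpose as second component.
  Uniqueness of the inverse makes the lift unique.\<close>

lemma (in nat_field) matrix_model_L:
  assumes fin: "finite (carrier R)" and q: "card (carrier R) = q"
  shows "\<exists>s e \<alpha> b \<delta> \<delta>i. matrix_model R s e q \<alpha> b \<delta> \<delta>i n True"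
proof -
  interpret hgeom swp "pr R \<one> \<one>" q "pr R \<one> (\<ominus> \<one>)" "pr R \<one> \<zero>" "pr R \<one> (\<ominus> \<one>)" "pr R \<one> (\<ominus> \<one>)" n
    by (rule hgeom.intro[OF hring_L[OF fin q]])
  have eq1: "prj (\<Sum>k<n. f k) = fmat_one R n i j" "prj' (\<Sum>k<n. f k) = fmat_one R n j i"
    if "(\<Sum>k<n. f k) = (if i = j then pr R \<one> \<one> else 0)" "i < n" "j < n" for i j and f :: "nat \<Rightarrow> uring"
    unfolding that(1) using that(2,3) by (auto simp: fmat_one_def)
  have inv: "(\<lambda>i j. prj (M i j)) \<in> fmats R n" "(\<lambda>i j. prj' (M j i)) \<in> fmats R n"
    "fmat_mul R n (\<lambda>i j. prj' (M j i)) (\<lambda>i j. prj (M i j)) = fmat_one R n"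
    "fmat_mul R n (\<lambda>i j. prj (M i j)) (\<lambda>i j. prj' (M j i)) = fmat_one R n" if M: "M \<in> unm" for M
  proof -
    show "(\<lambda>i j. prj (M i j)) \<in> fmats R n" "(\<lambda>i j. prj' (M j i)) \<in> fmats R n"
      using unmD(2)[OF M] by (auto simp: fmats_def)
    show "fmat_mul R n (\<lambda>i j. prj' (M j i)) (\<lambda>i j. prj (M i j)) = fmat_one R n"
    proof (intro ext)
      fix i j
      show "fmat_mul R n (\<lambda>i j. prj' (M j i)) (\<lambda>i j. prj (M i j)) i j = fmat_one R n i j"
      proof (cases "i < n \<and> j < n")
        case True
        have "fmat_mul R n (\<lambda>i j. prj' (M j i)) (\<lambda>i j. prj (M i j)) i j = prj (\<Sum>k<n. swp (M k i) * M k j)"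
          using True by (simp add: fmat_mul_def prj_sum)
        then show ?thesis using eq1(1)[OF unmD(3)[OF M]] True by simp
      qed (auto simp: fmat_mul_def fmat_one_def)
    qed
    show "fmat_mul R n (\<lambda>i j. prj (M i j)) (\<lambda>i j. prj' (M j i)) = fmat_one R n"
    proof (intro ext)
      fix i j
      show "fmat_mul R n (\<lambda>i j. prj (M i j)) (\<lambda>i j. prj' (M j i)) i j = fmat_one R n i j"
      proof (cases "i < n \<and> j < n")
        case True
        have "fmat_mul R n (\<lambda>i j. prj (M i j)) (\<lambda>i j. prj' (M j i)) i j = prj (\<Sum>k<n. M i k * swp (M j k))"
          using True by (simp add: fmat_mul_def prj_sum)
        then show ?thesis using eq1(1)[OF unmD(4)[OF M]] True by simp
      qed (auto simp: fmat_mul_def fmat_one_def)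
    qed
  qed
  have "matrix_model R swp (pr R \<one> \<one>) q (pr R \<one> (\<ominus> \<one>)) (pr R \<one> \<zero>) (pr R \<one> (\<ominus> \<one>)) (pr R \<one> (\<ominus> \<one>)) n True"
  proof
    show "finite (carrier R)" by (rule fin)
    show "card (carrier R) = (if True then q else q\<^sup>2)" using q by simp
    show "prj (pr R \<one> \<one>) = \<one>" by simp
    show "(\<lambda>i j. prj (M i j)) \<in> GLeps R n q True" if M: "M \<in> unm" for M
      using inv[OF M] unfolding GLeps_def GL_set_def by auto
    show "\<exists>M\<in>unm. \<forall>i j. prj (M i j) = A i j" if A: "A \<in> GLeps R n q True" for A
    proof -
      obtain B where A1: "A \<in> fmats R n" and B: "B \<in> fmats R n"
        and AB: "fmat_mul R n A B = fmat_one R n" and BA: "fmat_mul R n B A = fmat_one R n"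
        using A by (auto simp: GLeps_def GL_set_def)
      note Ac = fmatsD(1)[OF A1] and Bc = fmatsD(1)[OF B]
      define M where "M = (\<lambda>i j. pr R (A i j) (B j i))"
      have M1: "prj (M i j) = A i j" "prj' (M i j) = B j i" for i j using Ac Bc by (simp_all add: M_def)
      have Me: "pr R \<one> \<one> * M i j = M i j" for i j using Ac Bc by (simp add: M_def pr_mult)
      have ent: "X = (if i = j then pr R \<one> \<one> else 0)"
        if "pr R \<one> \<one> * X = X" "prj X = fmat_one R n i j" "prj' X = fmat_one R n j i" "i < n" "j < n" for X i j
        by (rule prj_eqI) (use that in \<open>auto simp: fmat_one_def pr_mult pr_zero\<close>)
      have "M \<in> unm"
        unfolding unm_def mem_Collect_eq
      proof (intro conjI allI impI)
        fix i j
        show "pr R \<one> \<one> * M i j = M i j" by (rule Me)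
        show "M i j = 0" if "\<not> (i < n \<and> j < n)"
          using fmatsD(2)[OF A1 that] fmatsD(2)[OF B, of j i] that by (auto simp: M_def pr_zero)
      next
        fix i j assume ij: "i < n" "j < n"
        show "(\<Sum>k<n. swp (M k i) * M k j) = (if i = j then pr R \<one> \<one> else 0)"
        proof (rule ent[OF _ _ _ ij])
          have "pr R \<one> \<one> * (swp (M k i) * M k j) = swp (M k i) * M k j" for k
            by (subst mult.left_commute) (simp only: Me)
          then show "pr R \<one> \<one> * (\<Sum>k<n. swp (M k i) * M k j) = (\<Sum>k<n. swp (M k i) * M k j)"
            by (simp only: sum_distrib_left)
          show "prj (\<Sum>k<n. swp (M k i) * M k j) = fmat_one R n i j"
            unfolding BA[symmetric] using ij Ac Bc by (simp add: prj_sum M1 fmat_mul_def)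
          show "prj' (\<Sum>k<n. swp (M k i) * M k j) = fmat_one R n j i"
            unfolding BA[symmetric] using ij Ac Bc by (simp add: prj_sum M1 fmat_mul_def m_comm)
        qed
        show "(\<Sum>k<n. M i k * swp (M j k)) = (if i = j then pr R \<one> \<one> else 0)"
        proof (rule ent[OF _ _ _ ij])
          have "pr R \<one> \<one> * (M i k * swp (M j k)) = M i k * swp (M j k)" for k
            by (subst mult.assoc[symmetric]) (simp only: Me)
          then show "pr R \<one> \<one> * (\<Sum>k<n. M i k * swp (M j k)) = (\<Sum>k<n. M i k * swp (M j k))"
            by (simp only: sum_distrib_left)
          show "prj (\<Sum>k<n. M i k * swp (M j k)) = fmat_one R n i j"
            unfolding AB[symmetric] using ij Ac Bc by (simp add: prj_sum M1 fmat_mul_def)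
          show "prj' (\<Sum>k<n. M i k * swp (M j k)) = fmat_one R n j i"
            unfolding AB[symmetric] using ij Ac Bc by (simp add: prj_sum M1 fmat_mul_def m_comm)
        qed
      qed
      then show ?thesis using M1(1) by blast
    qed
    show "M = M'" if M: "M \<in> unm" "M' \<in> unm" and eq: "\<And>i j. prj (M i j) = prj (M' i j)" for M M'
    proof -
      have "(\<lambda>i j. prj' (M j i)) = (\<lambda>i j. prj' (M' j i))"
      proof (rule fmat_inverse_unique)
        show "fmat_mul R n (\<lambda>i j. prj (M i j)) (\<lambda>i j. prj' (M' j i)) = fmat_one R n"
          unfolding eq by (rule inv(4)[OF M(2)])
      qed (fact inv[OF M(1)] inv[OF M(2)])+
      then have eq': "prj' (M i j) = prj' (M' i j)" for i j
        using fun_cong[OF fun_cong[of _ _ j], of "\<lambda>i j. prj' (M j i)" "\<lambda>i j. prj' (M' j i)" i] by simp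
      show ?thesis by (intro ext) (rule prj_eqI[OF unmD(1)[OF M(1)] unmD(1)[OF M(2)] eq eq'])
    qed
  qed
  then show ?thesis by (intro exI)
qed

theorem theorem1p3:
  shows "\<exists>h :: real \<Rightarrow> nat \<Rightarrow> real. (\<forall>C m. C \<ge> 1 \<longrightarrow> h C m \<ge> 1) \<and>
    (\<forall>C m (q::nat) eps (R::nat ring) n G \<chi> g.
       C \<ge> 1 \<longrightarrow> field R \<longrightarrow> finite (carrier R) \<longrightarrow>
       card (carrier R) = (if eps then q else q ^ 2) \<longrightarrow>
       real n \<ge> h C m \<longrightarrow>
       (G = GLeps R n q eps \<or> G = SLeps R n q eps) \<longrightarrow>
       irr_char (mat_group R n G) \<chi> \<longrightarrow>
       g \<in> G \<longrightarrow>
       real (card {x \<in> GLeps R n q eps. fmat_mul R n x g = fmat_mul R n g x}) \<le> real q powr (C * real n) \<longrightarrow>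
       cmod (\<chi> g) \<le> cmod (\<chi> (fmat_one R n)) powr (1 / 2 ^ m))"
proof -
  \<comment> \<open>The integer \<open>K\<close> of the bound is \<open>C * 2 ^ m\<close> rounded
    up; the maximum with 1 keeps the values in the required range.\<close>
  define h where "h C m = max 1 (real (hchar.bound_n (nat \<lceil>C * 2 ^ m\<rceil>) m))" for C :: real and m :: nat
  have "cmod (\<chi> g) \<le> cmod (\<chi> (fmat_one R n)) powr (1 / 2 ^ m)"
    if C: "C \<ge> 1" and R: "field R" "finite (carrier R)" and q: "card (carrier R) = (if eps then q else q ^ 2)"
      and n: "real n \<ge> h C m" and G: "G = GLeps R n q eps \<or> G = SLeps R n q eps"
      and \<chi>: "irr_char (mat_group R n G) \<chi>" and g: "g \<in> G"
      and cent: "real (card {x \<in> GLeps R n q eps. fmat_mul R n x g = fmat_mul R n g x}) \<le> real q powr (C * real n)"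
    for C m and q :: nat and eps and R :: "nat ring" and n G \<chi> g
  proof -
    interpret F: nat_field R using R(1) by (rule nat_field.intro)
    have "\<exists>s e \<alpha> b \<delta> \<delta>i. matrix_model R s e q \<alpha> b \<delta> \<delta>i n eps"
      using F.matrix_model_U[OF R(2), of q n] F.matrix_model_L[OF R(2), of q n] q by (cases eps) simp_all
    then obtain s e \<alpha> b \<delta> \<delta>i where "matrix_model R s e q \<alpha> b \<delta> \<delta>i n eps" by (elim exE)
    then interpret matrix_model R s e q \<alpha> b \<delta> \<delta>i n eps .
    have K: "real (nat \<lceil>C * 2 ^ m\<rceil>) \<ge> C * 2 ^ m" by (rule real_nat_ceiling_ge)
    have "n \<ge> hchar.bound_n (nat \<lceil>C * 2 ^ m\<rceil>) m" using n by (simp add: h_def)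
    then show ?thesis by (rule irr_char_bound[OF G \<chi> g C K _ cent])
  qed
  then show ?thesis by (intro exI[of _ h]) (auto simp: h_def)
qed


end
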